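(* Let $M,A$ be weight sequences satisfying $(M.1)$ and $(M.2)'$, and let $E$ be a TMIB of class $[M]-[A]$ satisfying condition (G). For any $f\in\mathcal{S}'^{[M]}_{[A]}$ the following are equivalent: (i) $f*\varphi\in E'$ for every $\varphi\in\mathcal{S}^{[M]}_{[A]}$; (ii) $f\in\mathcal{D}'^{[M]}_{E'}$; (iii) there exist $f_\alpha\in E'$, $\alpha\in\mathbb{N}^d$, such that $f=\sum_{\alpha\in\mathbb{N}^d}f_\alpha^{(\alpha)}$ and $\sup_\alpha\ell^{|\alpha|}M_\alpha\|f_\alpha\|_{E'}<\infty$ for some $\ell>0$ (for every $\ell>0$).
   Context: A weight sequence is a sequence $M=(M_p)$ of positive reals with $(M_p/M_0)^{1/p}\to\infty$; $(M.1)$: $M_p^2\le M_{p-1}M_{p+1}$; $(M.2)'$: $M_{p+1}\le C_0H^pM_p$. $M_\alpha=M_{|\alpha|}$. Associated function $\omega_M(t)=\sup_p\log(t^pM_0/M_p)$, $\omega_M(0)=0$, radial on $\mathbb{R}^d$. $\mathcal{S}^{[M]}_{[A]}$ denotes the Gelfand–Shilov space of Beurling type $\mathcal{S}^{(M)}_{(A)}=\varprojlim_{\ell\to0^+}\mathcal{S}^{M,\ell}_{A,1/\ell}$ or Roumieu type $\mathcal{S}^{\{M\}}_{\{A\}}=\varinjlim_{\ell\to\infty}\mathcal{S}^{M,\ell}_{A,1/\ell}$, where $\mathcal{S}^{M,\ell}_{A,q}$ is the Banach space of smooth $\varphi$ with $\sup_{\alpha,x}|\varphi^{(\alpha)}(x)|e^{\omega_A(qx)}/(\ell^{|\alpha|}M_\alpha)<\infty$;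 $\mathcal{S}'^{[M]}_{[A]}$ its strong dual; statements in parentheses refer to Roumieu case. $T_xf(t)=f(t-x)$, $M_\xi f(t)=e^{2\pi i\xi\cdot t}f(t)$, extended by duality; for $f\in\mathcal{S}'^{[M]}_{[A]}$, $\langle f*\psi,\varphi\rangle=\langle f,\varphi*\check\psi\rangle$ with $\check\psi(t)=\psi(-t)$. TMIB of class $[M]-[A]$: Banach space $E$ with (a) continuous dense inclusions $\mathcal{S}^{[M]}_{[A]}\hookrightarrow E\hookrightarrow\mathcal{S}'^{[M]}_{[A]}$; (b) invariance under $T_x$, $M_\xi$; (c) there exist $q,C_{E,q}>0$ (for all $q>0$ some $C_{E,q}$) with $\|T_x\|_{L(E)}\le C_{E,q}e^{\omega_A(qx)}$, $\nu_E(\xi):=\|M_{-\xi}\|_{L(E)}\le C_{E,q}e^{\omega_M(q\xi)}$. The dual $E'$ is viewed inside $\mathcal{S}'^{[M]}_{[A]}$ by restriction. Condition (G): for every $q_0>0$ there is $q_1>0$ (for every $q_1>0$ there is $q_0>0$) and $C>0$ with $\nu_E(\xi)e^{\omega_M(q_0\xi)}\le Ce^{\omega_M(q_1\xi)}$. $\mathcal{D}^{M,\ell}_E$: Banach space of $f\in\mathcal{S}'^{[M]}_{[A]}$ with $f^{(\alpha)}\in E$ and $\sup_\alpha\|f^{(\alpha)}\|_E/(\ell^{|\alpha|}M_\alpha)<\infty$; $\mathcal{D}^{(M)}_E=\varprojlim_{\ell\to0^+}\mathcal{D}^{M,\ell}_E$, $\mathcal{D}^{\{M\}}_E=\varinjlim_{\ell\to\infty}\mathcal{D}^{M,\ell}_E$.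 $\mathcal{D}'^{[M]}_{E'}$ is the strong dual of $\mathcal{D}^{[M]}_E$, identified with a subspace of $\mathcal{S}'^{[M]}_{[A]}$ (as $\mathcal{S}^{[M]}_{[A]}$ is dense in $\mathcal{D}^{[M]}_E$). *)

theory Defs
  imports "HOL-Analysis.Analysis"
begin

text \<open>Test functions on R^d (d = CARD('n)) and ultradistributions, represented as
  functionals on test functions that vanish outside the Gelfand-Shilov space.
  The boolean b selects the case: b = True is the Beurling case (M),(A),
  b = False is the Roumieu case {M},{A}.\<close>

type_synonym 'n tfun = "real^'n \<Rightarrow> complex"
type_synonym 'n udist = "'n tfun \<Rightarrow> complex"

definition weight_seq :: "(nat \<Rightarrow> real) \<Rightarrow> bool" where
  "weight_seq M \<longleftrightarrow> (\<forall>p. 0 < M p) \<and>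
     filterlim (\<lambda>p. (M p / M 0) powr (1 / real p)) at_top sequentially"

definition cond_M1 :: "(nat \<Rightarrow> real) \<Rightarrow> bool" where
  "cond_M1 M \<longleftrightarrow> (\<forall>p\<ge>1. (M p)^2 \<le> M (p - 1) * M (p + 1))"

definition cond_M2' :: "(nat \<Rightarrow> real) \<Rightarrow> bool" where
  "cond_M2' M \<longleftrightarrow> (\<exists>C0 H. \<forall>p. M (Suc p) \<le> C0 * H ^ p * M p)"

definition assoc_fn :: "(nat \<Rightarrow> real) \<Rightarrow> real \<Rightarrow> real" where
  "assoc_fn M t = (if t = 0 then 0 else (SUP p. ln (t ^ p * M 0 / M p)))"

definition mlen :: "('n::finite \<Rightarrow> nat) \<Rightarrow> nat" where
  "mlen \<alpha> = (\<Sum>i\<in>UNIV. \<alpha> i)"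

definition pdir :: "'n::finite \<Rightarrow> 'n tfun \<Rightarrow> 'n tfun" where
  "pdir i f x = vector_derivative (\<lambda>t. f (x + t *\<^sub>R axis i 1)) (at 0)"

fun Dlist :: "'n::finite list \<Rightarrow> 'n tfun \<Rightarrow> 'n tfun" where
  "Dlist [] f = f"
| "Dlist (i # is) f = pdir i (Dlist is f)"

definition mi_list :: "('n::finite \<Rightarrow> nat) \<Rightarrow> 'n list" where
  "mi_list \<alpha> = (SOME is. \<forall>i. count_list is i = \<alpha> i)"

definition Dmi :: "('n::finite \<Rightarrow> nat) \<Rightarrow> 'n tfun \<Rightarrow> 'n tfun" where
  "Dmi \<alpha> f = Dlist (mi_list \<alpha>) f"

definition smooth_fn :: "'n::finite tfun \<Rightarrow> bool" where
  "smooth_fn f \<longleftrightarrow> (\<forall>is. continuous_on UNIV (Dlist is f) \<and>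
      (\<forall>i x. (\<lambda>t. Dlist is f (x + t *\<^sub>R axis i 1)) differentiable (at 0)))"

definition gs_sn :: "(nat \<Rightarrow> real) \<Rightarrow> (nat \<Rightarrow> real) \<Rightarrow> real \<Rightarrow> 'n::finite tfun \<Rightarrow> ereal" where
  "gs_sn M A l \<phi> = (SUP \<alpha>. SUP x. ereal (norm (Dmi \<alpha> \<phi> x) * exp (assoc_fn A (norm x / l))
                                   / (l ^ mlen \<alpha> * M (mlen \<alpha>))))"

definition bq :: "bool \<Rightarrow> (real \<Rightarrow> bool) \<Rightarrow> bool" where
  "bq b P \<longleftrightarrow> (if b then (\<exists>l>0. P l) else (\<forall>l>0. P l))"

definition GSsp :: "bool \<Rightarrow> (nat \<Rightarrow> real) \<Rightarrow> (nat \<Rightarrow> real) \<Rightarrow> 'n::finite tfun set" where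
  "GSsp b M A = {\<phi>. smooth_fn \<phi> \<and>
     (if b then (\<forall>l>0. gs_sn M A l \<phi> < \<infinity>) else (\<exists>l>0. gs_sn M A l \<phi> < \<infinity>))}"

definition lin_on :: "('a \<Rightarrow> complex) set \<Rightarrow> (('a \<Rightarrow> complex) \<Rightarrow> complex) \<Rightarrow> bool" where
  "lin_on S u \<longleftrightarrow> (\<forall>\<phi>\<in>S. \<forall>\<psi>\<in>S. \<forall>c. u (\<lambda>x. \<phi> x + \<psi> x) = u \<phi> + u \<psi> \<and>
                                 u (\<lambda>x. c * \<phi> x) = c * u \<phi>)"

definition restr :: "'a set \<Rightarrow> ('a \<Rightarrow> complex) \<Rightarrow> 'a \<Rightarrow> complex" where
  "restr S u = (\<lambda>\<phi>. if \<phi> \<in> S then u \<phi> else 0)"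

text \<open>The space S'^{[M]}_{[A]} of continuous linear functionals on S^{[M]}_{[A]}
  (Fr\'echet projective limit in the Beurling case, inductive limit in the Roumieu case).\<close>
definition GSdual :: "bool \<Rightarrow> (nat \<Rightarrow> real) \<Rightarrow> (nat \<Rightarrow> real) \<Rightarrow> 'n::finite udist set" where
  "GSdual b M A = {u. (\<forall>\<phi>. \<phi> \<notin> GSsp b M A \<longrightarrow> u \<phi> = 0) \<and> lin_on (GSsp b M A) u \<and>
      bq b (\<lambda>l. \<exists>C. \<forall>\<phi>\<in>GSsp b M A. gs_sn M A l \<phi> < \<infinity> \<longrightarrow>
                        norm (u \<phi>) \<le> C * real_of_ereal (gs_sn M A l \<phi>))}"

definition emb :: "bool \<Rightarrow> (nat \<Rightarrow> real) \<Rightarrow> (nat \<Rightarrow> real) \<Rightarrow> 'n::finite tfun \<Rightarrow> 'n udist" where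
  "emb b M A \<phi> = restr (GSsp b M A) (\<lambda>\<psi>. LINT x|lborel. \<phi> x * \<psi> x)"

definition Tr :: "bool \<Rightarrow> (nat \<Rightarrow> real) \<Rightarrow> (nat \<Rightarrow> real) \<Rightarrow> real^'n \<Rightarrow> 'n::finite udist \<Rightarrow> 'n udist" where
  "Tr b M A x f = restr (GSsp b M A) (\<lambda>\<phi>. f (\<lambda>t. \<phi> (t + x)))"

definition Md :: "bool \<Rightarrow> (nat \<Rightarrow> real) \<Rightarrow> (nat \<Rightarrow> real) \<Rightarrow> real^'n \<Rightarrow> 'n::finite udist \<Rightarrow> 'n udist" where
  "Md b M A \<xi> f = restr (GSsp b M A) (\<lambda>\<phi>. f (\<lambda>t. cis (2 * pi * (\<xi> \<bullet> t)) * \<phi> t))"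

text \<open>Convolution: <f * phi, psi> = <f, psi * check phi>.\<close>
definition conv :: "bool \<Rightarrow> (nat \<Rightarrow> real) \<Rightarrow> (nat \<Rightarrow> real) \<Rightarrow> 'n::finite udist \<Rightarrow> 'n tfun \<Rightarrow> 'n udist" where
  "conv b M A f \<phi> = restr (GSsp b M A) (\<lambda>\<psi>. f (\<lambda>x. LINT t|lborel. \<psi> t * \<phi> (t - x)))"

definition dder :: "bool \<Rightarrow> (nat \<Rightarrow> real) \<Rightarrow> (nat \<Rightarrow> real) \<Rightarrow> ('n::finite \<Rightarrow> nat) \<Rightarrow> 'n udist \<Rightarrow> 'n udist" where
  "dder b M A \<alpha> f = restr (GSsp b M A) (\<lambda>\<phi>. (-1) ^ mlen \<alpha> * f (Dmi \<alpha> \<phi>))"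

definition TMIB :: "bool \<Rightarrow> (nat \<Rightarrow> real) \<Rightarrow> (nat \<Rightarrow> real) \<Rightarrow> 'n::finite udist set \<Rightarrow> ('n udist \<Rightarrow> real) \<Rightarrow> bool" where
  "TMIB b M A E nE \<longleftrightarrow>
     \<comment> \<open>E is a complex vector subspace of S' with a complete norm\<close>
     E \<subseteq> GSdual b M A \<and> (\<lambda>_. 0) \<in> E \<and>
     (\<forall>f\<in>E. \<forall>g\<in>E. (\<lambda>\<phi>. f \<phi> + g \<phi>) \<in> E) \<and> (\<forall>f\<in>E. \<forall>c. (\<lambda>\<phi>. c * f \<phi>) \<in> E) \<and>
     (\<forall>f\<in>E. 0 \<le> nE f \<and> (nE f = 0 \<longrightarrow> f = (\<lambda>_. 0))) \<and>
     (\<forall>f\<in>E. \<forall>g\<in>E. nE (\<lambda>\<phi>. f \<phi> + g \<phi>) \<le> nE f + nE g) \<and>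
     (\<forall>f\<in>E. \<forall>c. nE (\<lambda>\<phi>. c * f \<phi>) = norm c * nE f) \<and>
     (\<forall>X. (\<forall>n. X n \<in> E) \<and> (\<forall>e>0. \<exists>N. \<forall>m\<ge>N. \<forall>n\<ge>N. nE (\<lambda>\<phi>. X m \<phi> - X n \<phi>) < e) \<longrightarrow>
          (\<exists>f\<in>E. (\<lambda>n. nE (\<lambda>\<phi>. X n \<phi> - f \<phi>)) \<longlonglongrightarrow> 0)) \<and>
     \<comment> \<open>(a): continuous dense inclusion of S into E\<close>
     (\<forall>\<phi>\<in>GSsp b M A. emb b M A \<phi> \<in> E) \<and>
     bq b (\<lambda>l. \<exists>C. \<forall>\<phi>\<in>GSsp b M A. gs_sn M A l \<phi> < \<infinity> \<longrightarrow>
                 nE (emb b M A \<phi>) \<le> C * real_of_ereal (gs_sn M A l \<phi>)) \<and>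
     (\<forall>f\<in>E. \<forall>e>0. \<exists>\<phi>\<in>GSsp b M A. nE (\<lambda>\<psi>. f \<psi> - emb b M A \<phi> \<psi>) < e) \<and>
     \<comment> \<open>(a): continuous inclusion of E into S' (equicontinuity of the unit ball)\<close>
     (\<forall>\<phi>\<in>GSsp b M A. \<exists>C. \<forall>f\<in>E. norm (f \<phi>) \<le> C * nE f) \<and>
     \<comment> \<open>(b): invariance\<close>
     (\<forall>x f. f \<in> E \<longrightarrow> Tr b M A x f \<in> E \<and> Md b M A x f \<in> E) \<and>
     \<comment> \<open>(c): operator norm bounds\<close>
     bq b (\<lambda>q. \<exists>C>0. \<forall>x f. f \<in> E \<longrightarrow>
             nE (Tr b M A x f) \<le> C * exp (assoc_fn A (q * norm x)) * nE f \<and>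
             nE (Md b M A (- x) f) \<le> C * exp (assoc_fn M (q * norm x)) * nE f)"

definition nuE :: "bool \<Rightarrow> (nat \<Rightarrow> real) \<Rightarrow> (nat \<Rightarrow> real) \<Rightarrow> 'n::finite udist set \<Rightarrow> ('n udist \<Rightarrow> real) \<Rightarrow> real^'n \<Rightarrow> real" where
  "nuE b M A E nE \<xi> = Sup {nE (Md b M A (- \<xi>) f) | f. f \<in> E \<and> nE f \<le> 1}"

definition condG :: "bool \<Rightarrow> (nat \<Rightarrow> real) \<Rightarrow> (nat \<Rightarrow> real) \<Rightarrow> 'n::finite udist set \<Rightarrow> ('n udist \<Rightarrow> real) \<Rightarrow> bool" where
  "condG b M A E nE \<longleftrightarrow>
    (let P = (\<lambda>q0 q1. \<exists>C. \<forall>\<xi>::real^'n. nuE b M A E nE \<xi> * exp (assoc_fn M (q0 * norm \<xi>))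
                                     \<le> C * exp (assoc_fn M (q1 * norm \<xi>)))
     in if b then (\<forall>q0>0. \<exists>q1>0. P q0 q1) else (\<forall>q1>0. \<exists>q0>0. P q0 q1))"

text \<open>E' viewed inside S' by restriction along the dense inclusion S -> E, with its dual norm.\<close>
definition Edual :: "bool \<Rightarrow> (nat \<Rightarrow> real) \<Rightarrow> (nat \<Rightarrow> real) \<Rightarrow> 'n::finite udist set \<Rightarrow> ('n udist \<Rightarrow> real) \<Rightarrow> 'n udist set" where
  "Edual b M A E nE = {g. \<exists>G. lin_on E G \<and> (\<exists>C. \<forall>f\<in>E. norm (G f) \<le> C * nE f) \<and>
                             g = restr (GSsp b M A) (\<lambda>\<phi>. G (emb b M A \<phi>))}"

definition Edual_norm :: "bool \<Rightarrow> (nat \<Rightarrow> real) \<Rightarrow> (nat \<Rightarrow> real) \<Rightarrow> ('n::finite udist \<Rightarrow> real) \<Rightarrow> 'n udist \<Rightarrow> real" where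
  "Edual_norm b M A nE g = Sup {norm (g \<phi>) | \<phi>. \<phi> \<in> GSsp b M A \<and> nE (emb b M A \<phi>) \<le> 1}"

definition DE_sn :: "bool \<Rightarrow> (nat \<Rightarrow> real) \<Rightarrow> (nat \<Rightarrow> real) \<Rightarrow> ('n::finite udist \<Rightarrow> real) \<Rightarrow> real \<Rightarrow> 'n udist \<Rightarrow> ereal" where
  "DE_sn b M A nE l f = (SUP \<alpha>. ereal (nE (dder b M A \<alpha> f) / (l ^ mlen \<alpha> * M (mlen \<alpha>))))"

definition DEstep :: "bool \<Rightarrow> (nat \<Rightarrow> real) \<Rightarrow> (nat \<Rightarrow> real) \<Rightarrow> 'n::finite udist set \<Rightarrow> ('n udist \<Rightarrow> real) \<Rightarrow> real \<Rightarrow> 'n udist set" where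
  "DEstep b M A E nE l = {f \<in> GSdual b M A. (\<forall>\<alpha>. dder b M A \<alpha> f \<in> E) \<and> DE_sn b M A nE l f < \<infinity>}"

definition DE :: "bool \<Rightarrow> (nat \<Rightarrow> real) \<Rightarrow> (nat \<Rightarrow> real) \<Rightarrow> 'n::finite udist set \<Rightarrow> ('n udist \<Rightarrow> real) \<Rightarrow> 'n udist set" where
  "DE b M A E nE = (if b then {f. \<forall>l>0. f \<in> DEstep b M A E nE l}
                         else {f. \<exists>l>0. f \<in> DEstep b M A E nE l})"

definition DEdual :: "bool \<Rightarrow> (nat \<Rightarrow> real) \<Rightarrow> (nat \<Rightarrow> real) \<Rightarrow> 'n::finite udist set \<Rightarrow> ('n udist \<Rightarrow> real) \<Rightarrow> 'n udist set" where
  "DEdual b M A E nE = {g \<in> GSdual b M A. \<exists>G. lin_on (DE b M A E nE) G \<and>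
      (if b then (\<exists>l>0. \<exists>C. \<forall>f\<in>DE b M A E nE.
                    norm (G f) \<le> C * real_of_ereal (DE_sn b M A nE l f))
            else (\<forall>l>0. \<exists>C. \<forall>f\<in>DEstep b M A E nE l.
                    norm (G f) \<le> C * real_of_ereal (DE_sn b M A nE l f))) \<and>
      (\<forall>\<phi>\<in>GSsp b M A. g \<phi> = G (emb b M A \<phi>))}"

end

(* (ii) ==> (i): f(Kop phi psi) = <f, psi convolved with a reflected test function>, and convolution
   with a fixed test function maps E continuously into D_E.

   (i) ==> (iii): A gliding hump argument makes the bounds |f(Kop eta psi)| <= C |psi|_E uniform over bounded
   sets of windows eta; applied to modulated windows this gives growth exp(omega_M(q xi)) in xi.
   Choose windows with (eta1 reflected) * eta2 equal to 1 at 0 and expand f by Fourier inversion,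
     f(phi) = INT f(Kop (mo xi eta1) (Kop (mo xi eta2) phi)) dxi.
   Choose c_p >= 0 with sum_i sum_p c_p |xi_i|^p dominating the growth in xi while c_p M_p L^p stays bounded.
   Dividing by this sum makes the integral convergent; its numerators are pure powers of xi_i, which
   integration by parts converts into pure derivatives of phi and of eta2. The former
   become the derivatives of f_alpha, the latter are absorbed by the ultradifferentiability of eta2.
   Only multi-indices on the coordinate axes are needed.

   (iii) ==> (ii): the pairing sum_alpha (-1)^|alpha| <f_alpha, h^(alpha)> converges for h in D_E. *)
theory Submission
  imports Defs "HOL-Probability.Probability"
begin

text \<open>The obstacle is the Roumieu case: the growth in \<xi> is at most C_q exp(omega_M(q
  |\<xi>|)) for every q > 0, with no control of C_q as q tends to 0, so no weight of that shape can
  be divided out. The coefficients c_p are therefore chosen diagonally: at each \<xi> their series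
  dominates, up to a constant, one of these bounds, although c_p M_p decays faster than every
  geometric sequence. (M.1) enters through M_j M_k \<le> M_0 M_(j+k), which splits one bound on
  c_(r+j) M_(r+j) between r derivatives of the test function and j derivatives of the window. (M.2)'
  pays for polynomial factors, hence for integrability in x and in \<xi>. Two windows are needed
  because eta1 stays next to f and carries the growth in \<xi>, while the derivatives need another
  factor to fall on. No topology is put on the test function space: all statements are bounds in
  single seminorms, integrals of test functions enter through Riemann sums that are uniform over all
  derivatives, and the gliding hump replaces a closed graph argument.\<close>

lemma norm_increment_le:
  fixes g :: "real \<Rightarrow> complex"
  assumes "0 \<le> h"
    and "\<And>s. 0 \<le> s \<Longrightarrow> s \<le> h \<Longrightarrow> (g has_vector_derivative g' s) (at s)"
    and "\<And>s. 0 \<le> s \<Longrightarrow> s \<le> h \<Longrightarrow> norm (g' s) \<le> B"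
  shows "norm (g h - g 0) \<le> B * h"
proof -
  have "norm (g h - g 0) \<le> B * norm (h - 0)"
  proof (rule differentiable_bound[where S="{0..h}" and f'="\<lambda>s u. u *\<^sub>R g' s"])
    show "convex {0..h}" by simp
    show "(g has_derivative (\<lambda>u. u *\<^sub>R g' s)) (at s within {0..h})" if "s \<in> {0..h}" for s
      using assms(2)[of s] that
      by (auto simp: has_vector_derivative_def intro: has_derivative_at_withinI)
    show "onorm (\<lambda>u. u *\<^sub>R g' s) \<le> B" if "s \<in> {0..h}" for s
    proof (rule onorm_le)
      show "norm (u *\<^sub>R g' s) \<le> B * norm u" for u
        using assms(3)[of s] that mult_left_mono[of "norm (g' s)" B "\<bar>u\<bar>"] by (simp add: mult.commute)
    qed
  qed (use assms(1) in auto)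
  then show ?thesis using assms(1) by simp
qed

section \<open>Iterated partial derivatives\<close>

lemma Dlist_append: "Dlist (is @ js) f = Dlist is (Dlist js f)"
  by (induction "is") auto

lemma smooth_fn_Dlist: "smooth_fn f \<Longrightarrow> smooth_fn (Dlist js f)"
  unfolding smooth_fn_def by (metis Dlist_append)

lemma smooth_fn_pdir: "smooth_fn f \<Longrightarrow> smooth_fn (pdir i f)"
  using smooth_fn_Dlist[of f "[i]"] by simp

lemma smooth_fn_continuous: "smooth_fn f \<Longrightarrow> continuous_on UNIV (Dlist is f)"
  unfolding smooth_fn_def by blast

lemma smooth_fn_continuous0: "smooth_fn f \<Longrightarrow> continuous_on UNIV f"
  using smooth_fn_continuous[of f "[]"] by simp

lemma smooth_fn_measurable: "smooth_fn f \<Longrightarrow> Dlist is f \<in> borel_measurable borel"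
  by (intro borel_measurable_continuous_onI smooth_fn_continuous)

lemma smooth_fn_has_vector_derivative0:
  assumes "smooth_fn f"
  shows "((\<lambda>t. Dlist is f (x + t *\<^sub>R axis i 1)) has_vector_derivative Dlist (i # is) f x) (at 0)"
  using assms unfolding smooth_fn_def
  by (auto simp: pdir_def vector_derivative_works[symmetric])

lemma has_vector_derivative_line_shift:
  fixes e x :: "'v::real_vector"
  assumes "\<And>x. ((\<lambda>t. g (x + t *\<^sub>R e)) has_vector_derivative g' x) (at 0)"
  shows "((\<lambda>t. g (x + t *\<^sub>R e)) has_vector_derivative g' (x + t *\<^sub>R e)) (at t)"
proof -
  have 1: "((\<lambda>s. s - t) has_vector_derivative 1) (at t)"
    by (auto intro!: derivative_eq_intros)
  have 2: "((\<lambda>u. g ((x + t *\<^sub>R e) + u *\<^sub>R e)) has_vector_derivative g' (x + t *\<^sub>R e)) (at (t - t))"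
    using assms[of "x + t *\<^sub>R e"] by simp
  have "(\<lambda>s. g (x + s *\<^sub>R e)) = (\<lambda>u. g ((x + t *\<^sub>R e) + u *\<^sub>R e)) \<circ> (\<lambda>s. s - t)"
    by (simp add: fun_eq_iff scaleR_diff_left)
  then show ?thesis using vector_diff_chain_at[OF 1 2] by simp
qed

lemma smooth_fn_has_vector_derivative:
  assumes "smooth_fn f"
  shows "((\<lambda>t. Dlist is f (x + t *\<^sub>R axis i 1)) has_vector_derivative
            Dlist (i # is) f (x + t *\<^sub>R axis i 1)) (at t)"
  by (rule has_vector_derivative_line_shift) (rule smooth_fn_has_vector_derivative0[OF assms])

text \<open>All closure properties of smooth functions are derived by guessing the family of all
  their derivatives.\<close>
lemma smooth_fnI:
  assumes "G [] = f" and "\<And>is. continuous_on UNIV (G is)"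
    and "\<And>is i x. ((\<lambda>t. G is (x + t *\<^sub>R axis i 1)) has_vector_derivative G (i # is) x) (at 0)"
  shows "smooth_fn f" and "Dlist is f = G is"
proof -
  have *: "Dlist is f = G is" for "is"
  proof (induction "is")
    case (Cons i "is")
    then show ?case by (auto simp: pdir_def vector_derivative_at[OF assms(3)])
  qed (simp add: assms(1))
  show "Dlist is f = G is" by (rule *)
  show "smooth_fn f" unfolding smooth_fn_def *
    using assms(2) differentiableI_vector[OF assms(3)] by blast
qed

text \<open>The mean value inequality twice: along direction i for \<open>u\<close>, whose
  derivative is itself an increment along direction j of the function \<open>w\<close>. The four
  values of f that occur are symmetric in i and j, which \<open>pdir_commute\<close>
  exploits.\<close>

lemma second_difference_bound:
  fixes f :: "(real^'n) \<Rightarrow> complex"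
  assumes sm: "smooth_fn f" and h: "0 \<le> h"
    and B: "\<And>s t. 0 \<le> s \<Longrightarrow> s \<le> h \<Longrightarrow> 0 \<le> t \<Longrightarrow> t \<le> h \<Longrightarrow>
         norm (Dlist [j, i] f (x + s *\<^sub>R axis i 1 + t *\<^sub>R axis j 1) - A) \<le> e"
  shows "norm (f (x + h *\<^sub>R axis i 1 + h *\<^sub>R axis j 1) - f (x + h *\<^sub>R axis i 1)
           - f (x + h *\<^sub>R axis j 1) + f x - (h * h) *\<^sub>R A) \<le> e * h * h"
proof -
  define u where "u s = f (x + s *\<^sub>R axis i 1 + h *\<^sub>R axis j 1) - f (x + s *\<^sub>R axis i 1) - s *\<^sub>R (h *\<^sub>R A)" for s
  define u' where "u' s = Dlist [i] f (x + s *\<^sub>R axis i 1 + h *\<^sub>R axis j 1) - Dlist [i] f (x + s *\<^sub>R axis i 1) - h *\<^sub>R A" for s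
  have "norm (u h - u 0) \<le> (e * h) * h"
  proof (rule norm_increment_le[OF h])
    fix s assume s: "0 \<le> s" "s \<le> h"
    have 1: "((\<lambda>s. f (x + s *\<^sub>R axis i 1 + h *\<^sub>R axis j 1)) has_vector_derivative
         Dlist [i] f (x + s *\<^sub>R axis i 1 + h *\<^sub>R axis j 1)) (at s)"
      using smooth_fn_has_vector_derivative[OF sm, of "[]" "x + h *\<^sub>R axis j 1" i s]
      by (simp add: algebra_simps)
    have 2: "((\<lambda>s. f (x + s *\<^sub>R axis i 1)) has_vector_derivative Dlist [i] f (x + s *\<^sub>R axis i 1)) (at s)"
      using smooth_fn_has_vector_derivative[OF sm, of "[]" x i s] by simp
    show "(u has_vector_derivative u' s) (at s)"
      unfolding u_def u'_def
      by (intro has_vector_derivative_diff 1 2) (auto intro!: derivative_eq_intros)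
    define w where "w t = Dlist [i] f (x + s *\<^sub>R axis i 1 + t *\<^sub>R axis j 1) - t *\<^sub>R A" for t
    have "norm (w h - w 0) \<le> e * h"
    proof (rule norm_increment_le[OF h])
      fix t assume t: "0 \<le> t" "t \<le> h"
      have 3: "((\<lambda>t. Dlist [i] f (x + s *\<^sub>R axis i 1 + t *\<^sub>R axis j 1)) has_vector_derivative
         Dlist [j, i] f (x + s *\<^sub>R axis i 1 + t *\<^sub>R axis j 1)) (at t)"
        using smooth_fn_has_vector_derivative[OF sm, of "[i]" "x + s *\<^sub>R axis i 1" j t] by simp
      show "(w has_vector_derivative (Dlist [j, i] f (x + s *\<^sub>R axis i 1 + t *\<^sub>R axis j 1) - A)) (at t)"
        unfolding w_def
        by (intro has_vector_derivative_diff 3) (auto intro!: derivative_eq_intros)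
    qed (use B s in auto)
    then show "norm (u' s) \<le> e * h" by (simp add: u'_def w_def algebra_simps)
  qed
  then show ?thesis by (simp add: u_def algebra_simps)
qed

text \<open>Symmetry is not built into \<open>smooth_fn\<close>, which asks only for continuous
  iterated one-dimensional derivatives. Divided by h^2, one and the same second difference
  approximates both mixed derivatives, so they coincide.\<close>

lemma pdir_commute:
  fixes f :: "(real^'n) \<Rightarrow> complex"
  assumes sm: "smooth_fn f"
  shows "pdir i (pdir j f) = pdir j (pdir i f)"
proof
  fix x
  define A where "A = Dlist [i, j] f x"
  define B where "B = Dlist [j, i] f x"
  have le: "norm (A - B) \<le> 2 * e" if e: "e > 0" for e
  proof -
    have near: "\<exists>d>0. \<forall>y. dist y x < d \<longrightarrow> norm (Dlist ks f y - Dlist ks f x) \<le> e" for ks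
    proof -
      have "isCont (Dlist ks f) x"
        using smooth_fn_continuous[OF sm, of ks] by (simp add: continuous_on_eq_continuous_at)
      then show ?thesis using e unfolding continuous_at_eps_delta dist_norm
        by (meson less_imp_le)
    qed
    obtain d1 where d1: "d1 > 0" "\<And>y. dist y x < d1 \<Longrightarrow> norm (Dlist [i,j] f y - A) \<le> e"
      using near[of "[i,j]"] unfolding A_def by blast
    obtain d2 where d2: "d2 > 0" "\<And>y. dist y x < d2 \<Longrightarrow> norm (Dlist [j,i] f y - B) \<le> e"
      using near[of "[j,i]"] unfolding B_def by blast
    \<comment> \<open>All points met lie within s + t \<le> 2 h of x, so a third of the smaller
      radius keeps them inside both neighbourhoods.\<close>
    define h where "h = min d1 d2 / 3"
    have h: "h > 0" using d1 d2 by (simp add: h_def)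
    have close: "dist (x + s *\<^sub>R axis a 1 + t *\<^sub>R axis b 1) x < min d1 d2"
      if "0 \<le> s" "s \<le> h" "0 \<le> t" "t \<le> h" for s t :: real and a b :: 'n
    proof -
      have "norm (s *\<^sub>R axis a 1 + t *\<^sub>R axis b 1 :: real^'n) \<le> s + t"
        by (rule order_trans[OF norm_triangle_ineq]) (use that in \<open>simp add: norm_axis_1\<close>)
      also have "\<dots> < min d1 d2" using that h by (simp add: h_def)
      finally show ?thesis by (simp add: dist_norm algebra_simps)
    qed
    have 1: "norm (f (x + h *\<^sub>R axis i 1 + h *\<^sub>R axis j 1) - f (x + h *\<^sub>R axis i 1)
           - f (x + h *\<^sub>R axis j 1) + f x - (h * h) *\<^sub>R B) \<le> e * h * h"
      using second_difference_bound[OF sm less_imp_le[OF h], of j i x B e] d2(2) close by force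
    have 2: "norm (f (x + h *\<^sub>R axis j 1 + h *\<^sub>R axis i 1) - f (x + h *\<^sub>R axis j 1)
           - f (x + h *\<^sub>R axis i 1) + f x - (h * h) *\<^sub>R A) \<le> e * h * h"
      using second_difference_bound[OF sm less_imp_le[OF h], of i j x A e] d1(2) close by force
    have eq: "f (x + h *\<^sub>R axis j 1 + h *\<^sub>R axis i 1) = f (x + h *\<^sub>R axis i 1 + h *\<^sub>R axis j 1)"
      by (simp add: algebra_simps)
    define D where "D = f (x + h *\<^sub>R axis i 1 + h *\<^sub>R axis j 1) - f (x + h *\<^sub>R axis i 1) - f (x + h *\<^sub>R axis j 1) + f x"
    have a: "norm (D - (h*h) *\<^sub>R B) \<le> e * h * h" using 1 by (simp add: D_def)
    have b: "norm (D - (h*h) *\<^sub>R A) \<le> e * h * h" using 2 unfolding eq D_def by (simp add: algebra_simps)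
    have "norm ((h*h) *\<^sub>R (A - B)) = norm ((D - (h*h) *\<^sub>R B) - (D - (h*h) *\<^sub>R A))"
      by (simp add: algebra_simps)
    also have "\<dots> \<le> e*h*h + e*h*h"
      by (rule order_trans[OF norm_triangle_ineq4 add_mono[OF a b]])
    finally have "\<bar>h*h\<bar> * norm (A - B) \<le> e*h*h + e*h*h" by (simp only: norm_scaleR)
    then have "(h*h) * norm (A - B) \<le> (h*h) * (2 * e)" by (simp add: algebra_simps)
    then show ?thesis using h by simp
  qed
  have "norm (A - B) \<le> 0"
    by (rule field_le_epsilon) (use le[of "_ / 2"] in simp)
  then show "pdir i (pdir j f) x = pdir j (pdir i f) x" by (simp add: A_def B_def)
qed

lemma Dlist_pdir_commute:
  assumes "smooth_fn f" shows "Dlist is (pdir i f) = pdir i (Dlist is f)"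
proof (induction "is")
  case (Cons j "is")
  then show ?case using pdir_commute[OF smooth_fn_Dlist[OF assms]] by simp
qed simp

lemma Dlist_Cons': "smooth_fn f \<Longrightarrow> Dlist (i # is) f = Dlist is (pdir i f)"
  by (simp add: Dlist_pdir_commute)

text \<open>\<open>Dmi\<close> goes through \<open>mi_list\<close>, an arbitrary list with the
  prescribed counts. This makes the choice harmless and allows lists of directions, which suit
  induction, in place of multi-indices.\<close>

lemma Dlist_mset_cong:
  assumes "smooth_fn f" "mset is = mset js" shows "Dlist is f = Dlist js f"
  using assms(2)
proof (induction "is" arbitrary: js)
  case (Cons i "is")
  then have "i \<in> set js" by (metis list.set_intros(1) set_mset_mset)
  then obtain js1 js2 where js: "js = js1 @ i # js2" by (meson split_list)
  then have "mset is = mset (js1 @ js2)" using Cons.prems by simp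
  from Cons.IH[OF this] have "Dlist is f = Dlist js1 (Dlist js2 f)" by (simp add: Dlist_append)
  then show ?case
    using Dlist_pdir_commute[OF smooth_fn_Dlist[OF assms(1), of js2], of js1 i]
    by (simp add: js Dlist_append)
qed simp

lemma count_list_mi_list: "count_list (mi_list \<alpha>) i = \<alpha> i"
proof -
  have "\<exists>is. \<forall>i. count_list is i = \<alpha> i"
  proof -
    have fin: "finite {i. 0 < \<alpha> i}" by simp
    obtain "is" where "mset is = Abs_multiset \<alpha>" by (metis ex_mset)
    then have "count (mset is) i = \<alpha> i" for i by (simp add: count_Abs_multiset[OF fin])
    then show ?thesis by (auto simp: count_mset count_list_eq_length_filter)
  qed
  then show ?thesis unfolding mi_list_def by (rule someI2_ex) simp
qed

lemma sum_count_list_UNIV: "(\<Sum>i\<in>UNIV. count_list is i) = length (is :: 'a::finite list)"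
  by (subst sum_count_set[symmetric, of _ UNIV]) auto

lemma length_mi_list [simp]: "length (mi_list \<alpha>) = mlen \<alpha>"
  unfolding mlen_def sum_count_list_UNIV[symmetric] by (simp add: count_list_mi_list)

lemma mset_eq_count_listI: "(\<And>i. count_list is i = count_list js i) \<Longrightarrow> mset is = mset js"
  by (rule multiset_eqI) (simp add: count_mset count_list_eq_length_filter)

lemma Dlist_eq_Dmi:
  assumes "smooth_fn f" shows "Dlist is f = Dmi (count_list is) f"
  unfolding Dmi_def by (rule Dlist_mset_cong[OF assms mset_eq_count_listI]) (simp add: count_list_mi_list)

lemma mlen_count_list: "mlen (count_list is) = length is"
  unfolding mlen_def by (rule sum_count_list_UNIV)

section \<open>Weight sequences and associated functions\<close>

text \<open>For t \<ge> 0 this is sup_p t^p A_0 / A_p; \<open>eo_ge\<close> and \<open>eo_le\<close>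
  are the two halves of that description, and most estimates of weights rest on them.\<close>

definition eo :: "(nat \<Rightarrow> real) \<Rightarrow> real \<Rightarrow> real" where
  "eo A t = exp (assoc_fn A t)"

lemma weight_seq_pos: "weight_seq A \<Longrightarrow> 0 < A p"
  by (simp add: weight_seq_def)

text \<open>Eventually A_p \<ge> A_0 (2 t + 1)^p, so the terms fall below 2^(-p) / A_0. Both the
  finiteness of omega_A and the convergence of the dominating power series come from here.\<close>

lemma weight_seq_summable:
  assumes A: "weight_seq A" and t: "0 \<le> t"
  shows "summable (\<lambda>p. t ^ p / A p)"
proof -
  note pos = weight_seq_pos[OF A]
  have "\<forall>\<^sub>F p in sequentially. 2 * t + 1 \<le> (A p / A 0) powr (1 / real p)"
    using A unfolding weight_seq_def filterlim_at_top by blast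
  then have "\<forall>\<^sub>F p in sequentially. norm (t ^ p / A p) \<le> (1/2) ^ p / A 0"
    using eventually_gt_at_top[of 0]
  proof eventually_elim
    case (elim p)
    have "(2 * t) ^ p \<le> (2 * t + 1) ^ p" using t by (intro power_mono) auto
    also have "\<dots> \<le> ((A p / A 0) powr (1 / real p)) ^ p"
      using elim t by (intro power_mono) auto
    also have "\<dots> = A p / A 0"
      using elim pos[of p] pos[of 0] by (simp add: powr_realpow[symmetric] powr_powr)
    finally have "2 ^ p * t ^ p * A 0 \<le> A p"
      using pos[of 0] by (simp add: field_simps power_mult_distrib)
    then show ?case using pos[of p] pos[of 0] t
      by (simp add: field_simps power_divide)
  qed
  moreover have "summable (\<lambda>p. (1/2::real) ^ p / A 0)"
    by (intro summable_divide summable_geometric) simp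
  ultimately show ?thesis by (rule summable_comparison_test_ev)
qed

text \<open>A supremum of reals is informative only for a bounded family; the bound is read off from
  the convergence of the series of t^p / A_p. For t = 0 only the term p = 0 is nonzero, and it
  equals 1.\<close>

lemma eo_ge:
  assumes A: "weight_seq A" and t: "0 \<le> t"
  shows "t ^ p * A 0 / A p \<le> eo A t"
proof (cases "t = 0")
  case True
  then show ?thesis using weight_seq_pos[OF A, of 0] weight_seq_pos[OF A, of p]
    by (cases p) (auto simp: eo_def assoc_fn_def)
next
  case False
  note pos = weight_seq_pos[OF A]
  have pt: "0 < t ^ p * A 0 / A p" for p using False t pos by simp
  have "Bseq (\<lambda>p. t ^ p / A p)"
    using weight_seq_summable[OF A t] by (meson Bseq_eq_bounded convergent_imp_Bseq convergent_def summable_LIMSEQ_zero)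
  then obtain B where B: "\<And>p. norm (t ^ p / A p) \<le> B" unfolding Bseq_def by blast
  have B': "t ^ p * A 0 / A p \<le> B * A 0" for p
    using B[of p] pos[of 0] pos[of p] t mult_right_mono[of "t ^ p / A p" B "A 0"] by simp
  have "ln (t ^ p * A 0 / A p) \<le> (SUP p. ln (t ^ p * A 0 / A p))"
  proof (rule cSUP_upper)
    show "bdd_above (range (\<lambda>p. ln (t ^ p * A 0 / A p)))"
      using B' pt by (intro bdd_aboveI[of _ "ln (B * A 0)"]) (smt (verit) imageE ln_le_cancel_iff)
  qed simp
  then have "exp (ln (t ^ p * A 0 / A p)) \<le> eo A t"
    using False unfolding eo_def assoc_fn_def by simp
  then show ?thesis using pt by (simp only: exp_ln)
qed

lemma eo_le:
  assumes A: "weight_seq A" and t: "0 \<le> t" and B: "\<And>p. t ^ p * A 0 / A p \<le> B"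
  shows "eo A t \<le> B"
proof -
  note pos = weight_seq_pos[OF A]
  have B1: "1 \<le> B" using B[of 0] pos[of 0] by simp
  show ?thesis
  proof (cases "t = 0")
    case True then show ?thesis using B1 by (simp add: eo_def assoc_fn_def)
  next
    case False
    have "(SUP p. ln (t ^ p * A 0 / A p)) \<le> ln B"
    proof (rule cSUP_least)
      show "ln (t ^ p * A 0 / A p) \<le> ln B" for p
        using B[of p] False t pos by (intro ln_mono) auto
    qed simp
    then have "eo A t \<le> exp (ln B)" using False by (simp add: eo_def assoc_fn_def)
    then show ?thesis using B1 by simp
  qed
qed

lemma eo_pos [simp]: "0 < eo A t" and eo_nonneg [simp]: "0 \<le> eo A t" and eo_nz [simp]: "eo A t \<noteq> 0"
  by (simp_all add: eo_def)

lemma eo_ge1: "weight_seq A \<Longrightarrow> 0 \<le> t \<Longrightarrow> 1 \<le> eo A t"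
  using eo_ge[of A t 0] weight_seq_pos[of A 0] by simp

lemma eo_mono:
  assumes A: "weight_seq A" and "0 \<le> s" "s \<le> t" shows "eo A s \<le> eo A t"
proof (rule eo_le[OF A])
  fix p
  have "s ^ p * A 0 / A p \<le> t ^ p * A 0 / A p"
    using assms weight_seq_pos[OF A] by (intro divide_right_mono mult_right_mono power_mono) (auto intro: less_imp_le)
  also have "\<dots> \<le> eo A t" using assms by (intro eo_ge) auto
  finally show "s ^ p * A 0 / A p \<le> eo A t" .
qed (use assms in auto)

text \<open>omega_A need not be subadditive. The inequality a + b \<le> 2 max a b gives this
  substitute, and doubling a parameter is harmless under either quantifier over parameters.\<close>

lemma eo_add:
  assumes A: "weight_seq A" and "0 \<le> a" "0 \<le> b"
  shows "eo A (a + b) \<le> eo A (2 * a) * eo A (2 * b)"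
proof (cases "a \<le> b")
  case True
  then have "eo A (a + b) \<le> 1 * eo A (2 * b)" using assms by (simp add: eo_mono)
  also have "\<dots> \<le> eo A (2 * a) * eo A (2 * b)" using eo_ge1[OF A, of "2 * a"] assms by (intro mult_right_mono) auto
  finally show ?thesis .
next
  case False
  then have "eo A (a + b) \<le> eo A (2 * a) * 1" using assms by (simp add: eo_mono)
  also have "\<dots> \<le> eo A (2 * a) * eo A (2 * b)" using eo_ge1[OF A, of "2 * b"] assms by (intro mult_left_mono) auto
  finally show ?thesis .
qed

lemma eo_norm_triangle:
  assumes A: "weight_seq A" and q: "0 \<le> q"
  shows "eo A (q * norm (x::'v::real_normed_vector)) \<le> eo A (2 * q * norm (x + y)) * eo A (2 * q * norm y)"
proof -
  have "eo A (q * norm x) \<le> eo A (q * norm (x + y) + q * norm y)"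
  proof (rule eo_mono[OF A])
    have "norm x \<le> norm (x + y) + norm y" using norm_triangle_ineq4[of "x + y" y] by simp
    then show "q * norm x \<le> q * norm (x + y) + q * norm y"
      using q mult_left_mono by (fastforce simp flip: distrib_left)
  qed (use q in auto)
  also have "\<dots> \<le> eo A (2 * (q * norm (x + y))) * eo A (2 * (q * norm y))"
    using q by (intro eo_add[OF A]) auto
  finally show ?thesis by (simp add: mult.assoc)
qed

section \<open>Absorbing polynomial factors by (M.2)'\<close>

lemma cond_M2'E:
  assumes "cond_M2' A" "weight_seq A"
  obtains C H where "1 \<le> C" "1 \<le> H" "\<And>p. A (Suc p) \<le> C * H ^ p * A p"
proof -
  obtain C H where CH: "\<And>p. A (Suc p) \<le> C * H ^ p * A p" using assms(1) unfolding cond_M2'_def by blast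
  show ?thesis
  proof (rule that[of "max 1 \<bar>C\<bar>" "max 1 \<bar>H\<bar>"])
    fix p
    have "C * H ^ p \<le> \<bar>C\<bar> * \<bar>H\<bar> ^ p" by (metis abs_ge_self abs_mult power_abs)
    also have "\<dots> \<le> max 1 \<bar>C\<bar> * max 1 \<bar>H\<bar> ^ p" by (intro mult_mono power_mono) auto
    finally have "C * H ^ p * A p \<le> max 1 \<bar>C\<bar> * max 1 \<bar>H\<bar> ^ p * A p"
      using weight_seq_pos[OF assms(2), of p] by (intro mult_right_mono) auto
    with CH[of p] show "A (Suc p) \<le> max 1 \<bar>C\<bar> * max 1 \<bar>H\<bar> ^ p * A p" by linarith
  qed auto
qed

text \<open>(M.2)' gives s^(p+1) / A_p \<le> C (H s)^(p+1) / A_(p+1): a factor s is paid for by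
  passing to the next index of the supremum.\<close>

lemma eo_absorb_linear:
  assumes A: "weight_seq A" "cond_M2' A"
  shows "\<exists>H\<ge>1. \<exists>C>0. \<forall>s\<ge>0. (1 + s) * eo A s \<le> C * eo A (H * s)"
proof -
  obtain C H where CH: "1 \<le> C" "1 \<le> H" "\<And>p. A (Suc p) \<le> C * H ^ p * A p"
    using cond_M2'E[OF A(2,1)] by blast
  note pos = weight_seq_pos[OF A(1)]
  have "(1 + s) * eo A s \<le> (1 + C) * eo A (H * s)" if s: "0 \<le> s" for s
  proof -
    have "s * eo A s \<le> C * eo A (H * s)"
    proof (cases "s = 0")
      case False
      have "eo A s \<le> C * eo A (H * s) / s"
      proof (rule eo_le[OF A(1) s])
        fix p
        have "s ^ p * A 0 / A p * s \<le> C * ((H * s) ^ Suc p * A 0 / A (Suc p))"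
        proof -
          have "A (Suc p) \<le> C * H ^ Suc p * A p"
          proof -
            have "C * H ^ p * A p \<le> C * H ^ Suc p * A p" using CH(1,2) pos[of p]
              by (intro mult_right_mono mult_left_mono power_increasing) auto
            with CH(3)[of p] show ?thesis by linarith
          qed
          then have "s ^ p * A 0 * s * A (Suc p) \<le> s ^ p * A 0 * s * (C * H ^ Suc p * A p)"
            using s pos[of 0] by (intro mult_left_mono) auto
          then show ?thesis using pos[of p] pos[of "Suc p"]
            by (simp add: field_simps power_mult_distrib)
        qed
        also have "\<dots> \<le> C * eo A (H * s)" using CH(1,2) s by (intro mult_left_mono eo_ge[OF A(1)]) auto
        finally show "s ^ p * A 0 / A p \<le> C * eo A (H * s) / s"
          using False s by (simp add: field_simps)
      qed
      then show ?thesis using False s by (simp add: field_simps)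
    qed (use CH in simp)
    moreover have "eo A s \<le> eo A (H * s)" using CH(2) s mult_right_mono[of 1 H s] by (intro eo_mono[OF A(1)]) auto
    ultimately show ?thesis by (simp add: algebra_simps)
  qed
  then show ?thesis using CH by (intro exI[of _ H] exI[of _ "1 + C"] conjI) auto
qed

text \<open>H is chosen before q and only C depends on q. The loss is thus a fixed dilation, which
  neither an existential nor a universal quantifier over q notices.\<close>

lemma eo_absorb_power:
  assumes A: "weight_seq A" "cond_M2' A"
  shows "\<exists>H\<ge>1. \<forall>q>0. \<exists>C>0. \<forall>t\<ge>0. (1 + t) ^ k * eo A (q * t) \<le> C * eo A (H * q * t)"
proof (induction k)
  case 0
  show ?case by (intro exI[of _ 1] conjI allI impI) (auto intro!: exI[of _ 1])
next
  case (Suc k)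
  then obtain H where H: "H \<ge> 1" "\<And>q. q > 0 \<Longrightarrow> \<exists>C>0. \<forall>t\<ge>0. (1 + t) ^ k * eo A (q * t) \<le> C * eo A (H * q * t)"
    by blast
  obtain H1 C1 where H1: "H1 \<ge> 1" "C1 > 0" "\<And>s. s \<ge> 0 \<Longrightarrow> (1 + s) * eo A s \<le> C1 * eo A (H1 * s)"
    using eo_absorb_linear[OF A] by blast
  show ?case
  proof (rule exI[of _ "H * H1"], intro conjI allI impI)
    show "1 \<le> H * H1" using H(1) H1(1) mult_mono[of 1 H 1 H1] by simp
    fix q :: real assume q: "q > 0"
    obtain C where C: "C > 0" "\<And>t. t \<ge> 0 \<Longrightarrow> (1 + t) ^ k * eo A (H1 * q * t) \<le> C * eo A (H * (H1 * q) * t)"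
      using H(2)[of "H1 * q"] q H1(1) by auto
    \<comment> \<open>Compares 1 + t with 1 + q t, so that the linear case applies with s = q
      t.\<close>
    define m where "m = max 1 (1 / q)"
    have m: "1 \<le> m" "1 \<le> m * q" using q by (auto simp: m_def max_def field_simps)
    show "\<exists>C>0. \<forall>t\<ge>0. (1 + t) ^ Suc k * eo A (q * t) \<le> C * eo A (H * H1 * q * t)"
    proof (intro exI[of _ "m * C1 * C"] conjI allI impI)
      fix t :: real assume t: "t \<ge> 0"
      have "1 + t \<le> m * (1 + q * t)" using m t mult_right_mono[of 1 "m * q" t] by (simp add: algebra_simps)
      then have "(1 + t) ^ Suc k * eo A (q * t) \<le> (1 + t) ^ k * (m * (1 + q * t)) * eo A (q * t)"
        using t by (simp add: mult_right_mono mult.commute)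
      also have "\<dots> = (1 + t) ^ k * m * ((1 + q * t) * eo A (q * t))" by simp
      also have "\<dots> \<le> (1 + t) ^ k * m * (C1 * eo A (H1 * (q * t)))"
        using t m q by (intro mult_left_mono H1(3)) auto
      also have "\<dots> = m * C1 * ((1 + t) ^ k * eo A (H1 * q * t))" by (simp add: mult_ac)
      also have "\<dots> \<le> m * C1 * (C * eo A (H * (H1 * q) * t))"
        using m H1 t by (intro mult_left_mono C) auto
      finally show "(1 + t) ^ Suc k * eo A (q * t) \<le> m * C1 * C * eo A (H * H1 * q * t)"
        by (simp add: mult_ac)
    qed (use m H1 C in auto)
  qed
qed

section \<open>Log-convexity and dominating power series\<close>

lemma cond_M1_supermult:
  assumes M: "weight_seq M" "cond_M1 M"
  shows "M j * M k \<le> M 0 * M (j + k)"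
proof -
  note pos = weight_seq_pos[OF M(1)]
  define r where "r p = M (Suc p) / M p" for p
  \<comment> \<open>This is (M.1) itself: the quotients of consecutive terms do not decrease. M j /
    M 0 is a product of the first j quotients, M (j + k) / M k of j later ones.\<close>
  have "r p \<le> r (Suc p)" for p
  proof -
    have "(M (Suc p))^2 \<le> M p * M (Suc (Suc p))"
      using M(2)[unfolded cond_M1_def, rule_format, of "Suc p"] by simp
    then show ?thesis using pos[of p] pos[of "Suc p"]
      by (simp add: r_def field_simps power2_eq_square)
  qed
  then have r: "r j \<le> r (j + k)" for j by (meson lift_Suc_mono_le le_add1)
  have Ms: "M (Suc p) = r p * M p" for p using pos[of p] by (simp add: r_def)
  have rp: "0 < r p" for p using pos by (simp add: r_def)
  show ?thesis
  proof (induction j)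
    case (Suc j)
    have "M (Suc j) * M k = r j * (M j * M k)" by (simp add: Ms)
    also have "\<dots> \<le> r j * (M 0 * M (j + k))" using Suc rp[of j] by simp
    also have "\<dots> \<le> r (j + k) * (M 0 * M (j + k))" using r pos by (intro mult_right_mono) (auto intro: less_imp_le)
    finally show ?case by (simp add: Ms mult_ac)
  qed (use pos in simp)
qed

text \<open>Doubling s multiplies the p-th term of the supremum by 2^p, which beats C for p \<ge> P.
  The finitely many smaller p are compared with the P-th term, which overtakes them for large s; T
  is the point from which on it does.\<close>

lemma eo_double:
  assumes M: "weight_seq M"
  shows "\<exists>T\<ge>0. \<forall>s\<ge>T. C * eo M s \<le> eo M (2 * s)"
proof (cases "C \<le> 0")
  case True
  then have "C * eo M s \<le> eo M (2 * s)" for s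
    using mult_nonpos_nonneg[of C "eo M s"] eo_pos[of M "2 * s"] by (smt (verit) eo_nonneg)
  then show ?thesis by (intro exI[of _ 0]) auto
next
  case False
  note pos = weight_seq_pos[OF M]
  obtain P where P: "C < 2 ^ P" using real_arch_pow[of 2 C] by auto
  define T where "T = 1 + (\<Sum>p<P. C * M P / M p)"
  have T1: "1 \<le> T" unfolding T_def using False pos
    by (auto intro!: sum_nonneg intro: less_imp_le)
  have "C * eo M s \<le> eo M (2 * s)" if s: "T \<le> s" for s
  proof -
    have "eo M s \<le> eo M (2 * s) / C"
    proof (rule eo_le[OF M])
      fix p
      have "C * (s ^ p * M 0 / M p) \<le> eo M (2 * s)"
      proof (cases "p < P")
        case False
        then have "C \<le> 2 ^ p" using P power_increasing[of P p "2::real"] by linarith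
        then have "C * (s ^ p * M 0 / M p) \<le> 2 ^ p * (s ^ p * M 0 / M p)"
          using s T1 pos by (intro mult_right_mono) (auto intro: less_imp_le)
        also have "\<dots> = (2 * s) ^ p * M 0 / M p" by (simp add: power_mult_distrib)
        also have "\<dots> \<le> eo M (2 * s)" using s T1 by (intro eo_ge[OF M]) auto
        finally show ?thesis .
      next
        case True
        have "C * M P / M p \<le> (\<Sum>p<P. C * M P / M p)"
          using True \<open>\<not> C \<le> 0\<close> pos by (intro member_le_sum) (auto intro: less_imp_le)
        then have "C * M P / M p \<le> s" using s by (simp add: T_def)
        also have "s \<le> s ^ (P - p)" using True s T1 power_increasing[of 1 "P - p" s] by simp
        finally have "C * M P \<le> s ^ (P - p) * M p" using pos[of p] by (simp add: field_simps)
        then have "C * M P * (s ^ p * M 0) \<le> s ^ (P - p) * M p * (s ^ p * M 0)"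
          using s T1 pos[of 0] by (intro mult_right_mono) auto
        also have "\<dots> = s ^ P * M 0 * M p" using True by (simp add: power_add[symmetric] mult_ac)
        finally have "C * (s ^ p * M 0 / M p) \<le> s ^ P * M 0 / M P"
          using pos[of p] pos[of P] by (simp add: field_simps)
        also have "\<dots> \<le> (2 * s) ^ P * M 0 / M P"
          using s T1 pos by (intro divide_right_mono mult_right_mono power_mono) (auto intro: less_imp_le)
        also have "\<dots> \<le> eo M (2 * s)" using s T1 by (intro eo_ge[OF M]) auto
        finally show ?thesis .
      qed
      then show "s ^ p * M 0 / M p \<le> eo M (2 * s) / C" using False by (simp add: field_simps)
    qed (use s T1 in auto)
    then show ?thesis using False by (simp add: field_simps)
  qed
  then show ?thesis using T1 by (intro exI[of _ T]) auto
qed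

text \<open>The diagonal choice of coefficients needed in the Roumieu case: the power series with
  coefficients \<open>c\<close> dominates every one of countably many bounds of the form
  \<open>C m * eo M (t / (m + 1))\<close>, although \<open>c p * M p\<close> decays faster than any geometric sequence.\<close>
lemma diagonal_coefficients:
  fixes C :: "nat \<Rightarrow> real"
  assumes M: "weight_seq M"
  shows "\<exists>c. (\<forall>p. 0 \<le> c p) \<and> (\<forall>L>0. \<exists>B. \<forall>p. c p * M p * L ^ p \<le> B) \<and> c 0 = 1 \<and>
     (\<forall>n. \<exists>K>0. \<forall>t\<ge>0. \<exists>m\<ge>n. C m * eo M (t / real (Suc m)) \<le> K * (\<Sum>p. c p * t ^ p))"
proof -
  note pos = weight_seq_pos[OF M]
  have "\<forall>m. \<exists>T\<ge>0. \<forall>s\<ge>T. C m * eo M s \<le> eo M (2 * s)" using eo_double[OF M] by blast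
  then obtain T where T: "\<And>m. 0 \<le> T m" "\<And>m s. T m \<le> s \<Longrightarrow> C m * eo M s \<le> eo M (2 * s)"
    by metis
  \<comment> \<open>Between S m and S (m + 1) the m-th bound is the one to be dominated. S m \<ge>
    (m + 1) T m puts t / (m + 1) beyond T m there, and S m \<ge> m makes these intervals exhaust a
    half line.\<close>
  define S where "S m = (\<Sum>k\<le>m. real (Suc k) * T k) + real m" for m
  have S1: "real (Suc m) * T m \<le> S m" for m
    unfolding S_def using member_le_sum[of m "{..m}" "\<lambda>k. real (Suc k) * T k"] T(1) by simp
  have Sm: "real m \<le> S m" for m unfolding S_def using T(1) by (simp add: sum_nonneg)
  have S0: "0 \<le> S m" for m using Sm[of m] by linarith
  \<comment> \<open>For t below S (m + 1) the terms of index p \<ge> P m in the m-th supremum are at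
    most 1, hence covered by c 0 = 1. Only p < P m needs a substantial coefficient.\<close>
  have "\<exists>P\<ge>Suc m. \<forall>p\<ge>P. (2 * S (Suc m) / real (Suc m)) ^ p * M 0 / M p \<le> 1" for m
  proof -
    have "(\<lambda>p. (2 * S (Suc m) / real (Suc m)) ^ p / M p * M 0) \<longlonglongrightarrow> 0 * M 0"
      by (intro tendsto_mult summable_LIMSEQ_zero weight_seq_summable[OF M] tendsto_const)
        (use S0[of "Suc m"] in simp)
    then have "\<forall>\<^sub>F p in sequentially. (2 * S (Suc m) / real (Suc m)) ^ p / M p * M 0 < 1"
      by (rule order_tendstoD) simp
    then obtain N where "\<forall>p\<ge>N. (2 * S (Suc m) / real (Suc m)) ^ p / M p * M 0 < 1"
      unfolding eventually_sequentially by blast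
    then show ?thesis by (intro exI[of _ "max N (Suc m)"]) (auto intro: less_imp_le)
  qed
  then obtain P where P: "\<And>m. Suc m \<le> P m"
      "\<And>m p. P m \<le> p \<Longrightarrow> (2 * S (Suc m) / real (Suc m)) ^ p * M 0 / M p \<le> 1"
    by metis
  \<comment> \<open>The first stage at which the index p matters. As every P m is finite, \<mu> p
    tends to infinity with p, which gives the decay of c p; and p < P m implies \<mu> p \<le> m,
    which gives its size where it is needed.\<close>
  define \<mu> where "\<mu> p = (LEAST m. p < P m)" for p
  have \<mu>: "p < P (\<mu> p)" for p unfolding \<mu>_def by (rule LeastI[of _ p]) (use P(1)[of p] in simp)
  have \<mu>_le: "\<mu> p \<le> m" if "p < P m" for p m unfolding \<mu>_def using that by (rule Least_le)
  define c where "c p = M 0 * (2 / real (Suc (\<mu> p))) ^ p / M p" for p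
  have c0: "0 \<le> c p" for p using pos by (simp add: c_def less_imp_le)
  have cL: "\<exists>B. \<forall>p. c p * M p * L ^ p \<le> B" if L: "L > 0" for L
  proof -
    obtain n where n: "2 * L \<le> real n" using real_arch_simple by blast
    define p0 where "p0 = (\<Sum>k\<le>n. P k)"
    have *: "c p * M p * L ^ p = M 0 * (2 * L / real (Suc (\<mu> p))) ^ p" for p
      using pos[of p] by (simp add: c_def power_divide power_mult_distrib)
    have "c p * M p * L ^ p \<le> M 0 + (\<Sum>p<p0. \<bar>c p * M p * L ^ p\<bar>)" for p
    proof (cases "p < p0")
      case True
      then have "\<bar>c p * M p * L ^ p\<bar> \<le> (\<Sum>p<p0. \<bar>c p * M p * L ^ p\<bar>)" by (intro member_le_sum) auto
      then show ?thesis using pos[of 0] by linarith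
    next
      case False
      have "\<not> \<mu> p \<le> n"
      proof
        assume "\<mu> p \<le> n"
        then have "P (\<mu> p) \<le> p0" unfolding p0_def by (intro member_le_sum) auto
        then show False using \<mu>[of p] False by linarith
      qed
      then have "2 * L \<le> real (Suc (\<mu> p))" using n by linarith
      then have "(2 * L / real (Suc (\<mu> p))) ^ p \<le> 1" using L by (intro power_le_one) auto
      then have "c p * M p * L ^ p \<le> M 0 * 1" unfolding * using pos[of 0] by (intro mult_left_mono) auto
      moreover have "0 \<le> (\<Sum>p<p0. \<bar>c p * M p * L ^ p\<bar>)" by (intro sum_nonneg) auto
      ultimately show ?thesis by linarith
    qed
    then show ?thesis by blast
  qed
  have c_0: "c 0 = 1" using pos[of 0] by (simp add: c_def)
  have summ: "summable (\<lambda>p. c p * t ^ p)" if t: "0 \<le> t" for t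
  proof -
    obtain B where B: "\<And>p. c p * M p * 1 ^ p \<le> B" using cL[of 1] by auto
    show ?thesis
    proof (rule summable_comparison_test')
      show "summable (\<lambda>p. B * (t ^ p / M p))" by (intro summable_mult weight_seq_summable[OF M t])
      fix p
      have "c p * M p \<le> B" using B[of p] by simp
      then have "c p \<le> B / M p" using pos[of p] by (simp add: field_simps)
      then have "c p * t ^ p \<le> B / M p * t ^ p" using t by (intro mult_right_mono) auto
      then show "norm (c p * t ^ p) \<le> B * (t ^ p / M p)" using c0[of p] t by simp
    qed
  qed
  have term_le: "c p * t ^ p \<le> (\<Sum>p. c p * t ^ p)" if t: "0 \<le> t" for p t
    using sum_le_suminf[OF summ[OF t], of "{p}"] c0 t by simp
  have ge1: "1 \<le> (\<Sum>p. c p * t ^ p)" if t: "0 \<le> t" for t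
    using term_le[OF t, of 0] c_0 by simp
  have main: "\<exists>K>0. \<forall>t\<ge>0. \<exists>m\<ge>n. C m * eo M (t / real (Suc m)) \<le> K * (\<Sum>p. c p * t ^ p)" for n
  proof (intro exI[of _ "\<bar>C n\<bar> * eo M (S n / real (Suc n)) + 1"] conjI allI impI)
    show "0 < \<bar>C n\<bar> * eo M (S n / real (Suc n)) + 1" by (simp add: add_nonneg_pos)
    fix t :: real assume t: "0 \<le> t"
    let ?K = "\<bar>C n\<bar> * eo M (S n / real (Suc n)) + 1"
    show "\<exists>m\<ge>n. C m * eo M (t / real (Suc m)) \<le> ?K * (\<Sum>p. c p * t ^ p)"
    \<comment> \<open>Below S n no interval belonging to a stage m \<ge> n is available; m = n is
      used, and its bounded value there goes into K.\<close>
    proof (cases "t < S n")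
      case True
      have "C n * eo M (t / real (Suc n)) \<le> \<bar>C n\<bar> * eo M (S n / real (Suc n))"
        using True t by (intro mult_mono eo_mono[OF M] divide_right_mono) auto
      also have "\<dots> \<le> ?K * 1" by simp
      also have "\<dots> \<le> ?K * (\<Sum>p. c p * t ^ p)" using ge1[OF t] by (intro mult_left_mono) auto
      finally show ?thesis by blast
    next
      case False
      \<comment> \<open>The first threshold beyond t, so that S m \<le> t < S (m + 1) for m = k -
        1.\<close>
      define k where "k = (LEAST k. t < S k)"
      obtain N where "t < real N" using reals_Archimedean2 by blast
      then have "t < S N" using Sm[of N] by linarith
      then have k: "t < S k" unfolding k_def by (rule LeastI)
      have Smono: "S i \<le> S j" if "i \<le> j" for i j
        unfolding S_def using that T(1) by (intro add_mono sum_mono2) auto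
      have kn: "n < k" using k False Smono[of k n] by (meson leI le_less_trans less_le_trans not_less)
      define m where "m = k - 1"
      have m: "k = Suc m" "n \<le> m" using kn by (auto simp: m_def)
      have Sm: "S m \<le> t" using not_less_Least[of m "\<lambda>k. t < S k"] m unfolding k_def by simp
      let ?s = "t / real (Suc m)"
      have "T m \<le> ?s" using S1[of m] Sm by (simp add: field_simps)
      then have "C m * eo M ?s \<le> eo M (2 * ?s)" by (rule T(2))
      also have "\<dots> \<le> (\<Sum>p. c p * t ^ p)"
      proof (rule eo_le[OF M])
        fix p
        show "(2 * ?s) ^ p * M 0 / M p \<le> (\<Sum>p. c p * t ^ p)"
        proof (cases "p < P m")
          case True
          have "(2 / real (Suc m)) ^ p \<le> (2 / real (Suc (\<mu> p))) ^ p"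
            using \<mu>_le[OF True] by (intro power_mono divide_left_mono) auto
          then have "(2 * ?s) ^ p * M 0 / M p \<le> c p * t ^ p"
            using t pos[of 0] pos[of p] mult_right_mono[of "(2 / real (Suc m)) ^ p" "(2 / real (Suc (\<mu> p))) ^ p" "t ^ p * M 0 / M p"]
            by (simp add: c_def power_mult_distrib power_divide mult_ac)
          with term_le[OF t, of p] show ?thesis by linarith
        next
          case False
          have "(2 * ?s) ^ p * M 0 / M p \<le> (2 * S (Suc m) / real (Suc m)) ^ p * M 0 / M p"
            using t k m pos by (intro divide_right_mono mult_right_mono power_mono) (auto intro: less_imp_le simp: divide_right_mono)
          also have "\<dots> \<le> 1" using P(2)[of m p] False by simp
          finally show ?thesis using ge1[OF t] by linarith
        qed
      qed (use t in auto)
      also have "\<dots> \<le> ?K * (\<Sum>p. c p * t ^ p)" using ge1[OF t] mult_right_mono[of 1 ?K "\<Sum>p. c p * t ^ p"] by simp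
      finally show ?thesis using m by blast
    qed
  qed
  show ?thesis using c0 cL c_0 main by (intro exI[of _ c]) blast
qed

section \<open>Operations on smooth functions\<close>

lemma smooth_fn_add:
  assumes f: "smooth_fn f" and g: "smooth_fn g"
  shows "smooth_fn (\<lambda>x. f x + g x)" and "Dlist is (\<lambda>x. f x + g x) = (\<lambda>x. Dlist is f x + Dlist is g x)"
proof -
  have 1: "continuous_on UNIV (\<lambda>x. Dlist is f x + Dlist is g x)" for "is"
    by (intro continuous_intros smooth_fn_continuous f g)
  have 2: "((\<lambda>t. Dlist is f (x + t *\<^sub>R axis i 1) + Dlist is g (x + t *\<^sub>R axis i 1)) has_vector_derivative
      Dlist (i # is) f x + Dlist (i # is) g x) (at 0)" for "is" i x
    by (intro has_vector_derivative_add smooth_fn_has_vector_derivative0 f g)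
  show "smooth_fn (\<lambda>x. f x + g x)" "Dlist is (\<lambda>x. f x + g x) = (\<lambda>x. Dlist is f x + Dlist is g x)"
    by (rule smooth_fnI[where G="\<lambda>is x. Dlist is f x + Dlist is g x"]; use 1 2 in simp)+
qed

lemma smooth_fn_cmult:
  assumes f: "smooth_fn f"
  shows "smooth_fn (\<lambda>x. c * f x)" and "Dlist is (\<lambda>x. c * f x) = (\<lambda>x. c * Dlist is f x)"
proof -
  have 1: "continuous_on UNIV (\<lambda>x. c * Dlist is f x)" for "is"
    by (intro continuous_intros smooth_fn_continuous f)
  have 2: "((\<lambda>t. c * Dlist is f (x + t *\<^sub>R axis i 1)) has_vector_derivative
      c * Dlist (i # is) f x) (at 0)" for "is" i x
    by (intro has_vector_derivative_mult_right smooth_fn_has_vector_derivative0 f)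
  show "smooth_fn (\<lambda>x. c * f x)" "Dlist is (\<lambda>x. c * f x) = (\<lambda>x. c * Dlist is f x)"
    by (rule smooth_fnI[where G="\<lambda>is x. c * Dlist is f x"]; use 1 2 in simp)+
qed

lemma smooth_fn_zero:
  shows "smooth_fn (\<lambda>x. 0)" and "Dlist is (\<lambda>x. 0) = (\<lambda>x. 0)"
  by (rule smooth_fnI[where G="\<lambda>is x. 0"]; simp)+

lemma smooth_fn_sum:
  assumes "finite Z" "\<And>z. z \<in> Z \<Longrightarrow> smooth_fn (F z)"
  shows "smooth_fn (\<lambda>x. \<Sum>z\<in>Z. a z * F z x)"
    and "Dlist is (\<lambda>x. \<Sum>z\<in>Z. a z * F z x) = (\<lambda>x. \<Sum>z\<in>Z. a z * Dlist is (F z) x)"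
  using assms
  by (induction Z rule: finite_induct) (simp_all add: smooth_fn_zero smooth_fn_add smooth_fn_cmult)

lemma smooth_fn_cnj:
  assumes f: "smooth_fn f"
  shows "smooth_fn (\<lambda>x. cnj (f x))" and "Dlist is (\<lambda>x. cnj (f x)) = (\<lambda>x. cnj (Dlist is f x))"
proof -
  have 1: "continuous_on UNIV (\<lambda>x. cnj (Dlist is f x))" for "is"
    by (intro continuous_intros smooth_fn_continuous f)
  have 2: "((\<lambda>t. cnj (Dlist is f (x + t *\<^sub>R axis i 1))) has_vector_derivative
      cnj (Dlist (i # is) f x)) (at 0)" for "is" i x
    by (intro has_vector_derivative_cnj smooth_fn_has_vector_derivative0 f)
  show "smooth_fn (\<lambda>x. cnj (f x))" "Dlist is (\<lambda>x. cnj (f x)) = (\<lambda>x. cnj (Dlist is f x))"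
    by (rule smooth_fnI[where G="\<lambda>is x. cnj (Dlist is f x)"]; use 1 2 in simp)+
qed

lemma smooth_fn_translate:
  assumes f: "smooth_fn f"
  shows "smooth_fn (\<lambda>x. f (x + s))" and "Dlist is (\<lambda>x. f (x + s)) = (\<lambda>x. Dlist is f (x + s))"
proof -
  have 1: "continuous_on UNIV (\<lambda>x. Dlist is f (x + s))" for "is"
    by (intro continuous_on_compose2[OF smooth_fn_continuous[OF f]] continuous_intros) auto
  have 2: "((\<lambda>t. Dlist is f (x + t *\<^sub>R axis i 1 + s)) has_vector_derivative
      Dlist (i # is) f (x + s)) (at 0)" for "is" i x
    using smooth_fn_has_vector_derivative0[OF f, of "is" "x + s" i] by (simp add: algebra_simps)
  show "smooth_fn (\<lambda>x. f (x + s))" "Dlist is (\<lambda>x. f (x + s)) = (\<lambda>x. Dlist is f (x + s))"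
    by (rule smooth_fnI[where G="\<lambda>is x. Dlist is f (x + s)"]; use 1 2 in simp)+
qed

lemma smooth_fn_reflect:
  assumes f: "smooth_fn f"
  shows "smooth_fn (\<lambda>x. f (- x))" and "Dlist is (\<lambda>x. f (- x)) = (\<lambda>x. (-1) ^ length is * Dlist is f (- x))"
proof -
  have 1: "continuous_on UNIV (\<lambda>x. (-1) ^ length is * Dlist is f (- x))" for "is"
    by (intro continuous_intros continuous_on_compose2[OF smooth_fn_continuous[OF f]]) auto
  have 2: "((\<lambda>t. (-1) ^ length is * Dlist is f (- (x + t *\<^sub>R axis i 1))) has_vector_derivative
      (-1) ^ length (i # is) * Dlist (i # is) f (- x)) (at 0)" for "is" i x
  proof -
    have a: "(uminus has_vector_derivative -1) (at (0::real))" by (auto intro!: derivative_eq_intros)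
    have "((\<lambda>t. Dlist is f (- x + t *\<^sub>R axis i 1)) has_vector_derivative Dlist (i # is) f (- x)) (at (- 0))"
      using smooth_fn_has_vector_derivative0[OF f, of "is" "- x" i] by (simp only: minus_zero)
    from vector_diff_chain_at[OF a this]
    have "((\<lambda>t. Dlist is f (- x + t *\<^sub>R axis i 1)) \<circ> uminus has_vector_derivative - Dlist (i # is) f (- x)) (at 0)"
      by (simp del: Dlist.simps)
    moreover have "(\<lambda>t. Dlist is f (- x + t *\<^sub>R axis i 1)) \<circ> uminus = (\<lambda>t. Dlist is f (- (x + t *\<^sub>R axis i 1)))"
      by (rule ext, simp only: o_def, rule arg_cong[where f="Dlist is f"]) simp
    ultimately have "((\<lambda>t. Dlist is f (- (x + t *\<^sub>R axis i 1))) has_vector_derivative - Dlist (i # is) f (- x)) (at 0)"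
      by simp
    from has_vector_derivative_mult_right[OF this, of "(-1) ^ length is"] show ?thesis by simp
  qed
  show "smooth_fn (\<lambda>x. f (- x))" "Dlist is (\<lambda>x. f (- x)) = (\<lambda>x. (-1) ^ length is * Dlist is f (- x))"
    by (rule smooth_fnI[where G="\<lambda>is x. (-1) ^ length is * Dlist is f (- x)"]; use 1 2 in simp)+
qed

section \<open>Modulations\<close>

definition mo :: "real^'n \<Rightarrow> 'n::finite tfun \<Rightarrow> 'n tfun" where
  "mo \<xi> f = (\<lambda>x. cis (2 * pi * (\<xi> \<bullet> x)) * f x)"

text \<open>\<open>Dlist is\<close> conjugated by the modulation \<open>mo \<xi>\<close>.\<close>
fun Dmod :: "real^'n \<Rightarrow> 'n::finite list \<Rightarrow> 'n tfun \<Rightarrow> 'n tfun" where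
  "Dmod \<xi> [] f = f"
| "Dmod \<xi> (i # is) f = (\<lambda>x. (2 * pi * \<xi> $ i) *\<^sub>R (\<i> * Dmod \<xi> is f x) + pdir i (Dmod \<xi> is f) x)"

lemma smooth_fn_Dmod: "smooth_fn f \<Longrightarrow> smooth_fn (Dmod \<xi> is f)"
  by (induction "is")
    (auto simp: scaleR_conv_of_real mult.assoc[symmetric] intro!: smooth_fn_add smooth_fn_cmult smooth_fn_pdir)

lemma cis_line_derivative:
  "((\<lambda>t. cis (2 * pi * (\<xi> \<bullet> (x + t *\<^sub>R axis i 1)))) has_vector_derivative
     (2 * pi * \<xi> $ i) *\<^sub>R (\<i> * cis (2 * pi * (\<xi> \<bullet> x)))) (at 0)"
proof -
  have "((\<lambda>t. 2 * pi * (\<xi> \<bullet> (x + t *\<^sub>R axis i 1))) has_derivative (\<lambda>t. t *\<^sub>R (2 * pi * \<xi> $ i))) (at 0)"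
    by (auto intro!: derivative_eq_intros simp: inner_axis inner_add_right algebra_simps)
  from has_derivative_cis[OF this] show ?thesis
    by (simp add: has_vector_derivative_def mult.assoc)
qed

lemma smooth_fn_mo:
  assumes f: "smooth_fn f"
  shows "smooth_fn (mo \<xi> f)" and "Dlist is (mo \<xi> f) = mo \<xi> (Dmod \<xi> is f)"
proof -
  have 1: "continuous_on UNIV (mo \<xi> (Dmod \<xi> is f))" for "is"
    unfolding mo_def by (intro continuous_intros smooth_fn_continuous0 smooth_fn_Dmod f)
  have 2: "((\<lambda>t. mo \<xi> (Dmod \<xi> is f) (x + t *\<^sub>R axis i 1)) has_vector_derivative
      mo \<xi> (Dmod \<xi> (i # is) f) x) (at 0)" for "is" i x
  proof -
    have d: "((\<lambda>t. Dmod \<xi> is f (x + t *\<^sub>R axis i 1)) has_vector_derivative pdir i (Dmod \<xi> is f) x) (at 0)"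
      using smooth_fn_has_vector_derivative0[OF smooth_fn_Dmod[OF f], of "[]"] by simp
    show ?thesis unfolding mo_def
      using has_vector_derivative_mult[OF cis_line_derivative d]
      by (simp add: algebra_simps)
  qed
  show "smooth_fn (mo \<xi> f)" "Dlist is (mo \<xi> f) = mo \<xi> (Dmod \<xi> is f)"
    by (rule smooth_fnI[where G="\<lambda>is. mo \<xi> (Dmod \<xi> is f)"]; use 1 2 in simp)+
qed

lemma norm_mo [simp]: "norm (mo \<xi> f x) = norm (f x)"
  by (simp add: mo_def norm_mult)

section \<open>Increments controlled by partial derivatives\<close>

lemma line_increment_le:
  fixes f :: "(real^'n) \<Rightarrow> complex"
  assumes f: "smooth_fn f"
    and B: "\<And>u. 0 \<le> u \<Longrightarrow> u \<le> 1 \<Longrightarrow> norm (pdir i f (x + (u * t) *\<^sub>R axis i 1)) \<le> B"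
  shows "norm (f (x + t *\<^sub>R axis i 1) - f x) \<le> B * \<bar>t\<bar>"
proof -
  define g where "g u = f (x + (u * t) *\<^sub>R axis i 1)" for u
  have "norm (g 1 - g 0) \<le> (B * \<bar>t\<bar>) * 1"
  proof (rule norm_increment_le[where g'="\<lambda>u. t *\<^sub>R pdir i f (x + (u * t) *\<^sub>R axis i 1)"])
    fix u :: real assume u: "0 \<le> u" "u \<le> 1"
    have a: "((\<lambda>u. u * t) has_vector_derivative t) (at u)" by (auto intro!: derivative_eq_intros)
    show "(g has_vector_derivative t *\<^sub>R pdir i f (x + (u * t) *\<^sub>R axis i 1)) (at u)"
      unfolding g_def
      using vector_diff_chain_at[OF a smooth_fn_has_vector_derivative[OF f, of "[]" x i "u * t"]]
      by (simp add: o_def)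
    show "norm (t *\<^sub>R pdir i f (x + (u * t) *\<^sub>R axis i 1)) \<le> B * \<bar>t\<bar>"
      using mult_left_mono[OF B[OF u], of "\<bar>t\<bar>"] by (simp add: mult.commute)
  qed simp
  then show ?thesis by (simp add: g_def)
qed

text \<open>Only partial derivatives are under control, so z is turned into y one coordinate at a
  time. The intermediate points stay in the cube of half-width R, whereas they could leave a ball
  containing y and z.\<close>

lemma box_lipschitz:
  fixes f :: "(real^'n) \<Rightarrow> complex"
  assumes f: "smooth_fn f"
    and B: "\<And>i w. (\<And>k. \<bar>w $ k\<bar> \<le> R) \<Longrightarrow> norm (pdir i f (x + w)) \<le> B"
    and y: "\<And>k. \<bar>y $ k\<bar> \<le> R" and z: "\<And>k. \<bar>z $ k\<bar> \<le> R"
  shows "norm (f (x + y) - f (x + z)) \<le> B * (\<Sum>i\<in>UNIV. \<bar>y $ i - z $ i\<bar>)"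
proof -
  define p where "p J = (\<chi> i. if i \<in> J then y $ i else z $ i)" for J
  have seg: "norm (f (x + (w + t *\<^sub>R axis i 1)) - f (x + w)) \<le> B * \<bar>t\<bar>"
    if w: "\<And>k. \<bar>w $ k\<bar> \<le> R" and wt: "\<bar>w $ i + t\<bar> \<le> R" for w t i
  proof -
    have "norm (pdir i f (x + w + (u * t) *\<^sub>R axis i 1)) \<le> B" if u: "0 \<le> u" "u \<le> 1" for u
    proof -
      have "\<bar>(w + (u * t) *\<^sub>R axis i 1) $ k\<bar> \<le> R" for k
      proof (cases "k = i")
        case True
        have "w $ i + u * t = (1 - u) * w $ i + u * (w $ i + t)" by (simp add: algebra_simps)
        then have "\<bar>w $ i + u * t\<bar> \<le> \<bar>(1 - u) * w $ i\<bar> + \<bar>u * (w $ i + t)\<bar>"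
          by (metis abs_triangle_ineq)
        also have "\<dots> = (1 - u) * \<bar>w $ i\<bar> + u * \<bar>w $ i + t\<bar>" using u by (simp add: abs_mult)
        also have "\<dots> \<le> (1 - u) * R + u * R" using u w wt by (intro add_mono mult_left_mono) auto
        finally show ?thesis using True by (simp add: algebra_simps axis_def)
      qed (use w in \<open>simp add: axis_def\<close>)
      from B[OF this] show ?thesis by (simp add: add.assoc)
    qed
    from line_increment_le[OF f this] show ?thesis by (simp add: add.assoc)
  qed
  have pR: "\<bar>p J $ k\<bar> \<le> R" for J k using y z by (simp add: p_def)
  have "norm (f (x + p J) - f (x + z)) \<le> B * (\<Sum>i\<in>J. \<bar>y $ i - z $ i\<bar>)" if "finite J" for J
    using that
  proof (induction J rule: finite_induct)
    case empty
    have "p {} = z" by (simp add: p_def)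
    then show ?case by simp
  next
    case (insert i J)
    have eq: "p (insert i J) = p J + (y $ i - z $ i) *\<^sub>R axis i 1"
      using insert.hyps(2) by (auto simp: p_def vec_eq_iff axis_def)
    have "norm (f (x + p (insert i J)) - f (x + p J)) \<le> B * \<bar>y $ i - z $ i\<bar>"
      unfolding eq by (rule seg[OF pR]) (use insert.hyps(2) y in \<open>simp add: p_def\<close>)
    then have "norm (f (x + p (insert i J)) - f (x + p J) + (f (x + p J) - f (x + z))) \<le>
        B * \<bar>y $ i - z $ i\<bar> + B * (\<Sum>i\<in>J. \<bar>y $ i - z $ i\<bar>)"
      by (intro order_trans[OF norm_triangle_ineq] add_mono insert.IH)
    then show ?case using insert.hyps by (simp add: algebra_simps)
  qed
  from this[of UNIV] show ?thesis by (simp add: p_def)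
qed

lemma norm_cart_le: "(\<And>k. \<bar>w $ k\<bar> \<le> R) \<Longrightarrow> norm (w::real^'n::finite) \<le> real CARD('n) * R"
  using norm_le_l1_cart[of w] sum_bounded_above[of UNIV "\<lambda>k. \<bar>w $ k\<bar>" R] by fastforce

section \<open>The defining seminorms\<close>

text \<open>\<open>gb M A l \<phi> B\<close> is \<open>gs_sn M A l \<phi> \<le> B\<close> with extended reals avoided and multi-indices
  replaced by lists of directions; \<open>wb\<close> is its part of order zero.\<close>
definition gb :: "(nat \<Rightarrow> real) \<Rightarrow> (nat \<Rightarrow> real) \<Rightarrow> real \<Rightarrow> 'n::finite tfun \<Rightarrow> real \<Rightarrow> bool" where
  "gb M A l \<phi> B \<longleftrightarrow> (\<forall>is x. norm (Dlist is \<phi> x) * eo A (norm x / l) \<le> B * (l ^ length is * M (length is)))"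

definition wb :: "(nat \<Rightarrow> real) \<Rightarrow> real \<Rightarrow> 'n::finite tfun \<Rightarrow> real \<Rightarrow> bool" where
  "wb A q h P \<longleftrightarrow> (\<forall>x. norm (h x) * eo A (q * norm x) \<le> P)"

lemma gbD: "gb M A l \<phi> B \<Longrightarrow> norm (Dlist is \<phi> x) * eo A (norm x / l) \<le> B * (l ^ length is * M (length is))"
  unfolding gb_def by blast

lemma gb_wb: "gb M A l \<phi> B \<Longrightarrow> wb A (1 / l) (Dlist is \<phi>) (B * (l ^ length is * M (length is)))"
  unfolding gb_def wb_def by simp

lemma wbD: "wb A q h P \<Longrightarrow> norm (h x) * eo A (q * norm x) \<le> P"
  unfolding wb_def by blast

lemma wb_nonneg: "wb A q h P \<Longrightarrow> 0 \<le> P"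
  using wbD[of A q h P 0] eo_pos[of A] by (smt (verit) mult_nonneg_nonneg norm_ge_zero)

lemma wb_mono: "weight_seq A \<Longrightarrow> wb A q h P \<Longrightarrow> 0 \<le> q' \<Longrightarrow> q' \<le> q \<Longrightarrow> wb A q' h P"
  unfolding wb_def
  by (meson eo_mono mult_left_mono mult_nonneg_nonneg mult_right_mono norm_ge_zero order_trans)

lemma wb_mo [simp]: "wb A q (mo \<xi> h) P = wb A q h P"
  by (simp add: wb_def)

lemma wb_bound: "weight_seq A \<Longrightarrow> wb A q h P \<Longrightarrow> 0 \<le> q \<Longrightarrow> norm (h x) \<le> P"
  using wbD[of A q h P x] eo_ge1[of A "q * norm x"] mult_left_mono[of 1 "eo A (q * norm x)" "norm (h x)"] by force

locale gs_weights =
  fixes b :: bool and M A :: "nat \<Rightarrow> real"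
  assumes wsM: "weight_seq M" and wsA: "weight_seq A"
    and M1: "cond_M1 M" and M2M: "cond_M2' M" and M2A: "cond_M2' A"
begin

lemma Mpos [simp]: "0 < M p" and Mnn [simp]: "0 \<le> M p" and Mnz [simp]: "M p \<noteq> 0"
  using weight_seq_pos[OF wsM, of p] by auto

lemma gb_nonneg: "gb M A l \<phi> B \<Longrightarrow> 0 \<le> B"
proof -
  assume "gb M A l \<phi> B"
  from gbD[OF this, of "[]" 0] have "norm (\<phi> 0) * eo A 0 \<le> B * M 0" by simp
  moreover have "0 \<le> norm (\<phi> 0) * eo A 0" by simp
  ultimately have "0 \<le> B * M 0" by linarith
  then show "0 \<le> B" using Mpos[of 0] by (simp add: zero_le_mult_iff del: Mpos)
qed

lemma gb_mono_const: "gb M A l \<phi> B \<Longrightarrow> B \<le> B' \<Longrightarrow> 0 < l \<Longrightarrow> gb M A l \<phi> B'"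
  unfolding gb_def by (meson Mnn mult_nonneg_nonneg mult_right_mono order_trans zero_le_power less_imp_le)

lemma gb_mono:
  assumes "gb M A l \<phi> B" "0 < l" "l \<le> l'" shows "gb M A l' \<phi> B"
  unfolding gb_def
proof (intro allI)
  fix "is" x
  have "norm (Dlist is \<phi> x) * eo A (norm x / l') \<le> norm (Dlist is \<phi> x) * eo A (norm x / l)"
    using assms by (intro mult_left_mono eo_mono[OF wsA] divide_left_mono) auto
  also have "\<dots> \<le> B * (l ^ length is * M (length is))" by (rule gbD[OF assms(1)])
  also have "\<dots> \<le> B * (l' ^ length is * M (length is))"
    using assms gb_nonneg[OF assms(1)] by (intro mult_left_mono mult_right_mono power_mono) auto
  finally show "norm (Dlist is \<phi> x) * eo A (norm x / l') \<le> B * (l' ^ length is * M (length is))" .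
qed

section \<open>Effect of the basic operations on the seminorm bounds\<close>

lemma gb_zero: "0 \<le> B \<Longrightarrow> 0 < l \<Longrightarrow> gb M A l (\<lambda>x. 0) B"
  by (simp add: gb_def smooth_fn_zero)

lemma gb_add:
  assumes "smooth_fn f" "smooth_fn g" "gb M A l f B" "gb M A l g C"
  shows "gb M A l (\<lambda>x. f x + g x) (B + C)"
  unfolding gb_def smooth_fn_add(2)[OF assms(1,2)]
proof (intro allI)
  fix "is" x
  have "norm (Dlist is f x + Dlist is g x) * eo A (norm x / l) \<le>
      norm (Dlist is f x) * eo A (norm x / l) + norm (Dlist is g x) * eo A (norm x / l)"
    unfolding distrib_right[symmetric] by (intro mult_right_mono norm_triangle_ineq) auto
  also have "\<dots> \<le> B * (l ^ length is * M (length is)) + C * (l ^ length is * M (length is))"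
    by (intro add_mono gbD assms)
  finally show "norm (Dlist is f x + Dlist is g x) * eo A (norm x / l) \<le> (B + C) * (l ^ length is * M (length is))"
    by (simp add: algebra_simps)
qed

lemma gb_cmult:
  assumes "smooth_fn f" "gb M A l f B" shows "gb M A l (\<lambda>x. c * f x) (norm c * B)"
  unfolding gb_def smooth_fn_cmult(2)[OF assms(1)]
  using mult_left_mono[OF gbD[OF assms(2)], of "norm c"] by (simp add: norm_mult mult.assoc)

lemma gb_cnj: "smooth_fn f \<Longrightarrow> gb M A l f B \<Longrightarrow> gb M A l (\<lambda>x. cnj (f x)) B"
  by (simp add: gb_def smooth_fn_cnj)

lemma gb_reflect: "smooth_fn f \<Longrightarrow> gb M A l f B \<Longrightarrow> gb M A l (\<lambda>x. f (- x)) B"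
  unfolding gb_def by (auto simp: smooth_fn_reflect norm_mult norm_power)
    (metis norm_minus_cancel)

lemma gb_translate:
  assumes f: "smooth_fn f" and g: "gb M A l f B" and l: "0 < l"
  shows "gb M A (2 * l) (\<lambda>x. f (x + s)) (B * eo A (norm s / l))"
  unfolding gb_def smooth_fn_translate(2)[OF f]
proof (intro allI)
  fix "is" x
  have "eo A (norm x / (2 * l)) \<le> eo A (norm (x + s) / l) * eo A (norm s / l)"
    using eo_norm_triangle[OF wsA, of "1 / (2 * l)" x s] l by simp
  then have "norm (Dlist is f (x + s)) * eo A (norm x / (2 * l)) \<le>
      (norm (Dlist is f (x + s)) * eo A (norm (x + s) / l)) * eo A (norm s / l)"
    by (simp add: mult.assoc mult_left_mono)
  also have "\<dots> \<le> (B * (l ^ length is * M (length is))) * eo A (norm s / l)"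
    by (intro mult_right_mono gbD g) auto
  also have "\<dots> \<le> (B * ((2 * l) ^ length is * M (length is))) * eo A (norm s / l)"
    using l gb_nonneg[OF g] by (intro mult_right_mono mult_left_mono power_mono) auto
  finally show "norm (Dlist is f (x + s)) * eo A (norm x / (2 * l)) \<le>
      B * eo A (norm s / l) * ((2 * l) ^ length is * M (length is))" by (simp add: mult_ac)
qed

lemma M2_const: "\<exists>C\<ge>1. \<exists>H\<ge>1. \<forall>p. M (Suc p) \<le> C * H ^ p * M p"
proof -
  obtain C H where "1 \<le> C" "1 \<le> H" "\<And>p. M (Suc p) \<le> C * H ^ p * M p"
    using cond_M2'E[OF M2M wsM] by blast
  then show ?thesis by blast
qed

text \<open>Constants fixed once and for all, so that a derivative always costs the same factor
  \<open>HM\<close> in the parameter l.\<close>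

definition "CM = (SOME C. 1 \<le> C \<and> (\<exists>H\<ge>1. \<forall>p. M (Suc p) \<le> C * H ^ p * M p))"
definition "HM = (SOME H. 1 \<le> H \<and> (\<forall>p. M (Suc p) \<le> CM * H ^ p * M p))"

lemma CM: "1 \<le> CM" and HM: "1 \<le> HM" and M2_bound: "M (Suc p) \<le> CM * HM ^ p * M p"
proof -
  have 1: "1 \<le> CM \<and> (\<exists>H\<ge>1. \<forall>p. M (Suc p) \<le> CM * H ^ p * M p)"
    unfolding CM_def by (rule someI_ex) (rule M2_const)
  then have 2: "1 \<le> HM \<and> (\<forall>p. M (Suc p) \<le> CM * HM ^ p * M p)"
    unfolding HM_def by (intro someI_ex[where P="\<lambda>H. 1 \<le> H \<and> (\<forall>p. M (Suc p) \<le> CM * H ^ p * M p)"]) simp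
  show "1 \<le> CM" "1 \<le> HM" "M (Suc p) \<le> CM * HM ^ p * M p" using 1 2 by auto
qed

lemma gb_pdir:
  fixes f :: "(real^'n) \<Rightarrow> complex"
  assumes f: "smooth_fn f" and g: "gb M A l f B" and l: "0 < l"
  shows "gb M A (HM * l) (pdir i f) (B * CM * l)"
  unfolding gb_def
proof (intro allI)
  fix "is" and x :: "real^'n"
  have "norm x / (HM * l) \<le> norm x / l" using HM l by (intro divide_left_mono) auto
  then have "norm (Dlist is (pdir i f) x) * eo A (norm x / (HM * l)) \<le> norm (Dlist (i # is) f x) * eo A (norm x / l)"
    unfolding Dlist_Cons'[OF f] using HM l by (intro mult_left_mono eo_mono[OF wsA]) auto
  also have "\<dots> \<le> B * (l ^ Suc (length is) * M (Suc (length is)))"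
    using gbD[OF g, of "i # is" x] by simp
  also have "\<dots> \<le> B * (l ^ Suc (length is) * (CM * HM ^ length is * M (length is)))"
    using l gb_nonneg[OF g] by (intro mult_left_mono M2_bound) auto
  finally show "norm (Dlist is (pdir i f) x) * eo A (norm x / (HM * l)) \<le> B * CM * l * ((HM * l) ^ length is * M (length is))"
    by (simp add: mult_ac power_mult_distrib)
qed

text \<open>The locally Lipschitz dependence on the shift that Riemann sums of translates require.
  One extra derivative costs \<open>HM\<close> by (M.2)', moving the weight costs 2, and d R bounds
  the norm on the cube of half-width R.\<close>

lemma gb_translate_diff:
  fixes f :: "(real^'n) \<Rightarrow> complex"
  assumes f: "smooth_fn f" and g: "gb M A l f B" and l: "0 < l"
    and s: "norm s \<le> R" "norm s' \<le> R"
  shows "gb M A (2 * HM * l) (\<lambda>x. f (x + s) - f (x + s'))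
     (B * CM * l * eo A (real CARD('n) * R / l) * real CARD('n) * norm (s - s'))"
proof -
  let ?d = "real CARD('n)"
  let ?K = "B * CM * l * eo A (?d * R / l)"
  have R: "0 \<le> R" using s norm_ge_zero order_trans by blast
  have B: "0 \<le> B" by (rule gb_nonneg[OF g])
  have eq: "(\<lambda>x. f (x + s) - f (x + s')) = (\<lambda>x. f (x + s) + (-1) * f (x + s'))" by simp
  have D: "Dlist is (\<lambda>x. f (x + s) - f (x + s')) = (\<lambda>x. Dlist is f (x + s) - Dlist is f (x + s'))" for "is"
    unfolding eq smooth_fn_add(2)[OF smooth_fn_translate(1)[OF f] smooth_fn_cmult(1)[OF smooth_fn_translate(1)[OF f]]]
      smooth_fn_cmult(2)[OF smooth_fn_translate(1)[OF f]] smooth_fn_translate(2)[OF f] by simp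
  show ?thesis unfolding gb_def D
  proof (intro allI)
    fix "is" :: "'n list" and x :: "real^'n"
    let ?n = "length is"
    let ?E = "eo A (norm x / (2 * l))"
    have "norm (Dlist is f (x + s) - Dlist is f (x + s')) \<le>
       (?K * ((HM * l) ^ ?n * M ?n) / ?E) * (\<Sum>i\<in>UNIV. \<bar>s $ i - s' $ i\<bar>)"
    proof (rule box_lipschitz[OF smooth_fn_Dlist[OF f], where R=R])
      fix i and w :: "real^'n" assume w: "\<And>k. \<bar>w $ k\<bar> \<le> R"
      have "?E \<le> eo A (norm (x + w) / l) * eo A (norm w / l)"
        using eo_norm_triangle[OF wsA, of "1 / (2 * l)" x w] l by simp
      also have "\<dots> \<le> eo A (norm (x + w) / l) * eo A (?d * R / l)"
        using norm_cart_le[OF w] l by (intro mult_left_mono eo_mono[OF wsA] divide_right_mono) auto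
      finally have E: "?E \<le> eo A (norm (x + w) / l) * eo A (?d * R / l)" .
      have "norm (Dlist (i # is) f (x + w)) * ?E \<le>
          (norm (Dlist (i # is) f (x + w)) * eo A (norm (x + w) / l)) * eo A (?d * R / l)"
        using mult_left_mono[OF E, of "norm (Dlist (i # is) f (x + w))"] by (simp add: mult.assoc)
      also have "\<dots> \<le> (B * (l ^ Suc ?n * M (Suc ?n))) * eo A (?d * R / l)"
        using gbD[OF g, of "i # is" "x + w"] by (intro mult_right_mono) auto
      also have "\<dots> \<le> (B * (l ^ Suc ?n * (CM * HM ^ ?n * M ?n))) * eo A (?d * R / l)"
        using l B by (intro mult_right_mono mult_left_mono M2_bound) auto
      finally show "norm (pdir i (Dlist is f) (x + w)) \<le> ?K * ((HM * l) ^ ?n * M ?n) / ?E"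
        by (simp add: field_simps power_mult_distrib)
    qed (use s in \<open>meson component_le_norm_cart order_trans\<close>)+
    also have "\<dots> \<le> (?K * ((HM * l) ^ ?n * M ?n) / ?E) * (?d * norm (s - s'))"
    proof (rule mult_left_mono)
      show "(\<Sum>i\<in>UNIV. \<bar>s $ i - s' $ i\<bar>) \<le> ?d * norm (s - s')"
        using sum_bounded_above[of UNIV "\<lambda>i. \<bar>(s - s') $ i\<bar>" "norm (s - s')"] component_le_norm_cart[of "s - s'"]
        by simp
    qed (use B CM HM l in simp)
    finally have "norm (Dlist is f (x + s) - Dlist is f (x + s')) \<le>
        (?K * ((HM * l) ^ ?n * M ?n) / ?E) * (?d * norm (s - s'))" .
    then have 1: "norm (Dlist is f (x + s) - Dlist is f (x + s')) * ?E \<le>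
        (?K * ((HM * l) ^ ?n * M ?n)) * (?d * norm (s - s'))"
      by (simp add: pos_le_divide_eq[symmetric])
    have "norm x / (2 * HM * l) \<le> norm x / (2 * l)" using HM l by (intro divide_left_mono) auto
    then have "norm (Dlist is f (x + s) - Dlist is f (x + s')) * eo A (norm x / (2 * HM * l)) \<le>
        norm (Dlist is f (x + s) - Dlist is f (x + s')) * ?E"
      using HM l by (intro mult_left_mono eo_mono[OF wsA]) auto
    also note 1
    also have "(?K * ((HM * l) ^ ?n * M ?n)) * (?d * norm (s - s')) \<le> (?K * ((2 * HM * l) ^ ?n * M ?n)) * (?d * norm (s - s'))"
      using B CM HM l by (intro mult_right_mono mult_left_mono power_mono) auto
    finally show "norm (Dlist is f (x + s) - Dlist is f (x + s')) * eo A (norm x / (2 * HM * l)) \<le>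
        ?K * ?d * norm (s - s') * ((2 * HM * l) ^ ?n * M ?n)" by (simp add: mult_ac)
  qed
qed

text \<open>Each factor \<xi>_i produced by a derivative is traded for one more order of M, using
  \<open>eo_ge\<close> and M_j M_k \<le> M_0 M_(j+k), at the total price exp(omega_M(2 pi |\<xi>| /
  l)). This is the source of the growth in \<xi> in everything that follows.\<close>

lemma gb_mo:
  fixes f :: "(real^'n) \<Rightarrow> complex"
  assumes f: "smooth_fn f" and g: "gb M A l f B" and l: "0 < l"
  shows "gb M A (2 * l) (mo \<xi> f) (B * eo M (2 * pi * norm \<xi> / l))"
proof -
  let ?\<tau> = "2 * pi * norm \<xi>"
  let ?E = "eo M (?\<tau> / l)"
  have B: "0 \<le> B" by (rule gb_nonneg[OF g])
  have base: "?\<tau> ^ j * (l ^ m * M m) \<le> l ^ (j + m) * M (j + m) * ?E" for j m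
  proof -
    have "(?\<tau> / l) ^ j * M 0 / M j \<le> ?E" using l by (intro eo_ge[OF wsM]) auto
    then have "?\<tau> ^ j * M 0 \<le> l ^ j * M j * ?E" using l by (simp add: field_simps power_divide)
    then have "?\<tau> ^ j * M 0 * M m \<le> l ^ j * M j * ?E * M m" by (intro mult_right_mono) auto
    also have "\<dots> \<le> l ^ j * ?E * (M 0 * M (j + m))"
      using l cond_M1_supermult[OF wsM M1, of j m] by (simp add: mult_ac mult_left_mono)
    finally have "M 0 * (?\<tau> ^ j * M m) \<le> M 0 * (l ^ j * ?E * M (j + m))" by (simp add: mult_ac)
    then have "?\<tau> ^ j * M m \<le> l ^ j * ?E * M (j + m)" by simp
    then have "?\<tau> ^ j * M m * l ^ m \<le> l ^ j * ?E * M (j + m) * l ^ m" using l by (intro mult_right_mono) auto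
    then show ?thesis by (simp add: power_add mult_ac)
  qed
  \<comment> \<open>Generalised for the induction: j counts factors 2 pi |\<xi>| already collected,
    js holds derivatives still to be applied. Each direction in \<open>is\<close> splits the
    expression in two; the resulting power of 2 becomes the doubled l.\<close>
  have main: "?\<tau> ^ j * (norm (Dlist js (Dmod \<xi> is f) x) * eo A (norm x / l)) \<le>
     B * 2 ^ length is * (l ^ (j + length is + length js) * M (j + length is + length js) * ?E)" for j js "is" x
  proof (induction "is" arbitrary: j js)
    case Nil
    have "?\<tau> ^ j * (norm (Dlist js f x) * eo A (norm x / l)) \<le> ?\<tau> ^ j * (B * (l ^ length js * M (length js)))"
      by (intro mult_left_mono gbD[OF g]) auto
    also have "\<dots> \<le> B * (l ^ (j + length js) * M (j + length js) * ?E)"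
      using mult_left_mono[OF base B, of j "length js"] by (simp add: mult_ac)
    finally show ?case by simp
  next
    case (Cons i "is")
    let ?g = "Dmod \<xi> is f" let ?n = "length is" let ?m = "length js"
    have sg: "smooth_fn ?g" by (rule smooth_fn_Dmod[OF f])
    have "Dlist js (Dmod \<xi> (i # is) f) x = (2 * pi * \<xi> $ i) *\<^sub>R (\<i> * Dlist js ?g x) + Dlist (js @ [i]) ?g x"
      using sg by (simp add: scaleR_conv_of_real mult.assoc[symmetric] smooth_fn_add smooth_fn_cmult smooth_fn_pdir Dlist_append)
    also have "norm \<dots> \<le> 2 * pi * \<bar>\<xi> $ i\<bar> * norm (Dlist js ?g x) + norm (Dlist (js @ [i]) ?g x)"
      by (rule order_trans[OF norm_triangle_ineq]) (simp add: norm_mult abs_mult)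
    also have "\<dots> \<le> ?\<tau> * norm (Dlist js ?g x) + norm (Dlist (js @ [i]) ?g x)"
      using component_le_norm_cart[of \<xi> i] by (intro add_right_mono mult_right_mono) auto
    finally have "?\<tau> ^ j * (norm (Dlist js (Dmod \<xi> (i # is) f) x) * eo A (norm x / l)) \<le>
        ?\<tau> ^ j * ((?\<tau> * norm (Dlist js ?g x) + norm (Dlist (js @ [i]) ?g x)) * eo A (norm x / l))"
      by (intro mult_left_mono mult_right_mono) auto
    also have "\<dots> = ?\<tau> ^ Suc j * (norm (Dlist js ?g x) * eo A (norm x / l)) +
         ?\<tau> ^ j * (norm (Dlist (js @ [i]) ?g x) * eo A (norm x / l))" by (simp add: algebra_simps)
    also have "\<dots> \<le> B * 2 ^ ?n * (l ^ (Suc j + ?n + ?m) * M (Suc j + ?n + ?m) * ?E) +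
         B * 2 ^ ?n * (l ^ (j + ?n + length (js @ [i])) * M (j + ?n + length (js @ [i])) * ?E)"
      by (intro add_mono Cons.IH)
    finally show ?case by (simp add: algebra_simps)
  qed
  show ?thesis unfolding gb_def smooth_fn_mo(2)[OF f] norm_mo
  proof (intro allI)
    fix "is" :: "'n list" and x :: "real^'n"
    let ?n = "length is"
    have "norm (Dmod \<xi> is f x) * eo A (norm x / (2 * l)) \<le> norm (Dmod \<xi> is f x) * eo A (norm x / l)"
      using l by (intro mult_left_mono eo_mono[OF wsA] divide_left_mono) auto
    also have "\<dots> \<le> B * 2 ^ ?n * (l ^ ?n * M ?n * ?E)" using main[of 0 "[]" "is" x] by simp
    finally show "norm (Dmod \<xi> is f x) * eo A (norm x / (2 * l)) \<le> B * ?E * ((2 * l) ^ ?n * M ?n)"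
      by (simp add: mult_ac power_mult_distrib)
  qed
qed

section \<open>Comparison with the extended-real seminorms\<close>

lemma gs_sn_le_iff:
  assumes "smooth_fn \<phi>" "0 < l"
  shows "gs_sn M A l \<phi> \<le> ereal B \<longleftrightarrow> gb M A l \<phi> B"
proof -
  have 1: "norm (Dmi \<alpha> \<phi> x) * exp (assoc_fn A (norm x / l)) / (l ^ mlen \<alpha> * M (mlen \<alpha>)) \<le> B
     \<longleftrightarrow> norm (Dmi \<alpha> \<phi> x) * eo A (norm x / l) \<le> B * (l ^ mlen \<alpha> * M (mlen \<alpha>))" for \<alpha> x
    using assms(2) by (simp add: eo_def divide_le_eq mult.assoc)
  have "gs_sn M A l \<phi> \<le> ereal B \<longleftrightarrow> (\<forall>\<alpha> x. norm (Dmi \<alpha> \<phi> x) * eo A (norm x / l) \<le> B * (l ^ mlen \<alpha> * M (mlen \<alpha>)))"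
    unfolding gs_sn_def by (simp add: SUP_le_iff 1)
  also have "\<dots> \<longleftrightarrow> gb M A l \<phi> B"
  proof
    assume "\<forall>\<alpha> x. norm (Dmi \<alpha> \<phi> x) * eo A (norm x / l) \<le> B * (l ^ mlen \<alpha> * M (mlen \<alpha>))"
    then show "gb M A l \<phi> B" unfolding gb_def Dlist_eq_Dmi[OF assms(1)] by (metis mlen_count_list)
  next
    assume "gb M A l \<phi> B"
    then show "\<forall>\<alpha> x. norm (Dmi \<alpha> \<phi> x) * eo A (norm x / l) \<le> B * (l ^ mlen \<alpha> * M (mlen \<alpha>))"
      unfolding gb_def Dmi_def by (metis length_mi_list)
  qed
  finally show ?thesis .
qed

lemma gs_sn_nonneg: "0 < l \<Longrightarrow> 0 \<le> gs_sn M A l \<phi>"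
  unfolding gs_sn_def
  by (rule SUP_upper2[OF UNIV_I], rule SUP_upper2[OF UNIV_I]) (simp add: less_imp_le)

lemma gs_sn_finite_iff:
  assumes "smooth_fn \<phi>" "0 < l" shows "gs_sn M A l \<phi> < \<infinity> \<longleftrightarrow> (\<exists>B. gb M A l \<phi> B)"
proof -
  have "gs_sn M A l \<phi> < \<infinity> \<longleftrightarrow> (\<exists>B. gs_sn M A l \<phi> \<le> ereal B)"
    using gs_sn_nonneg[OF assms(2), of \<phi>] by (cases "gs_sn M A l \<phi>") auto
  then show ?thesis using gs_sn_le_iff[OF assms] by simp
qed

lemma real_gs_sn_le:
  assumes "smooth_fn \<phi>" "0 < l" "gb M A l \<phi> B" shows "real_of_ereal (gs_sn M A l \<phi>) \<le> B"
  using gs_sn_le_iff[OF assms(1,2), of B] gs_sn_nonneg[OF assms(2), of \<phi>] assms(3)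
  by (cases "gs_sn M A l \<phi>") auto

lemma GSsp_iff: "\<phi> \<in> GSsp b M A \<longleftrightarrow> smooth_fn \<phi> \<and>
   (if b then \<forall>l>0. \<exists>B. gb M A l \<phi> B else \<exists>l>0. \<exists>B. gb M A l \<phi> B)"
  unfolding GSsp_def mem_Collect_eq by (metis gs_sn_finite_iff)

lemma GSsp_smooth: "\<phi> \<in> GSsp b M A \<Longrightarrow> smooth_fn \<phi>"
  by (simp add: GSsp_def)

end

section \<open>Integration on \<open>real^'n\<close>\<close>

lemma integral_lborel_affine:
  fixes f :: "'a::euclidean_space \<Rightarrow> 'b::{banach, second_countable_topology}"
  assumes [measurable]: "f \<in> borel_measurable borel" and c: "c \<noteq> 0"
  shows "(LINT x|lborel. f x) = \<bar>c\<bar> ^ DIM('a) *\<^sub>R (LINT x|lborel. f (t + c *\<^sub>R x))"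
proof -
  have "(LINT x|lborel. f x) = integral\<^sup>L (density (distr lborel borel (\<lambda>x. t + c *\<^sub>R x)) (\<lambda>_. ennreal (\<bar>c\<bar> ^ DIM('a)))) f"
    by (subst lborel_affine[OF c, of t]) (simp add: ennreal_power)
  also have "\<dots> = (LINT x|distr lborel borel (\<lambda>x. t + c *\<^sub>R x). \<bar>c\<bar> ^ DIM('a) *\<^sub>R f x)"
    by (rule integral_density) auto
  also have "\<dots> = (LINT x|lborel. \<bar>c\<bar> ^ DIM('a) *\<^sub>R f (t + c *\<^sub>R x))"
    by (rule integral_distr) auto
  finally show ?thesis by simp
qed

lemma integrable_lborel_affine:
  fixes f :: "'a::euclidean_space \<Rightarrow> 'b::{banach, second_countable_topology}"
  assumes f: "integrable lborel f" and c: "c \<noteq> 0"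
  shows "integrable lborel (\<lambda>x. f (t + c *\<^sub>R x))"
proof -
  have [measurable]: "f \<in> borel_measurable borel" using f by auto
  have "integrable (density (distr lborel borel (\<lambda>x. t + c *\<^sub>R x)) (\<lambda>_. ennreal (\<bar>c\<bar> ^ DIM('a)))) f"
    using f by (subst (asm) lborel_affine[OF c, of t]) (simp add: ennreal_power)
  then have "integrable (distr lborel borel (\<lambda>x. t + c *\<^sub>R x)) (\<lambda>x. \<bar>c\<bar> ^ DIM('a) *\<^sub>R f x)"
    by (subst (asm) integrable_density) auto
  then have "integrable lborel (\<lambda>x. \<bar>c\<bar> ^ DIM('a) *\<^sub>R f (t + c *\<^sub>R x))"
    by (subst (asm) integrable_distr_eq) auto
  then have "integrable lborel (\<lambda>x. inverse (\<bar>c\<bar> ^ DIM('a)) *\<^sub>R \<bar>c\<bar> ^ DIM('a) *\<^sub>R f (t + c *\<^sub>R x))"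
    by (rule integrable_scaleR_right)
  then show ?thesis using c by simp
qed

lemma integral_lborel_translate:
  fixes f :: "'a::euclidean_space \<Rightarrow> 'b::{banach, second_countable_topology}"
  assumes "f \<in> borel_measurable borel"
  shows "(LINT x|lborel. f (t + x)) = (LINT x|lborel. f x)"
  using integral_lborel_affine[OF assms, of 1 t] by simp

lemma integral_lborel_reflect:
  fixes f :: "'a::euclidean_space \<Rightarrow> 'b::{banach, second_countable_topology}"
  assumes "f \<in> borel_measurable borel"
  shows "(LINT x|lborel. f (t - x)) = (LINT x|lborel. f x)"
  using integral_lborel_affine[OF assms, of "-1" t] by simp

text \<open>Lebesgue measure on \<open>real^'n\<close> is a product over \<open>Basis\<close>, while
  the integrand is indexed by coordinates; \<open>ix\<close> translates between the two index
  sets.\<close>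

lemma lborel_vec_prod:
  fixes g :: "'n::finite \<Rightarrow> real \<Rightarrow> 'b::{real_normed_field, banach, second_countable_topology}"
  assumes g: "\<And>i. integrable lborel (g i)"
  shows "integrable lborel (\<lambda>x::real^'n. \<Prod>i\<in>UNIV. g i (x $ i))"
    and "(LINT x|lborel. (\<Prod>i\<in>UNIV. g i ((x::real^'n) $ i))) = (\<Prod>i\<in>UNIV. LINT t|lborel. g i t)"
proof -
  interpret product_sigma_finite "\<lambda>_::real^'n. lborel :: real measure" by standard
  define T where "T f = (\<Sum>b\<in>Basis. f b *\<^sub>R b)" for f :: "real^'n \<Rightarrow> real"
  define ix where "ix = inv (\<lambda>i::'n. axis i (1::real))"
  have inj: "inj (\<lambda>i::'n. axis i (1::real))" by (auto simp: inj_def axis_eq_axis)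
  have ix: "ix (axis i 1) = i" for i unfolding ix_def by (rule inv_f_f[OF inj])
  have bas: "(Basis :: (real^'n) set) = range (\<lambda>i. axis i 1)"
    by (auto simp: Basis_vec_def)
  have [measurable]: "g i \<in> borel_measurable borel" for i using g[of i] by auto
  have T[measurable]: "T \<in> (\<Pi>\<^sub>M b\<in>Basis. lborel) \<rightarrow>\<^sub>M borel" unfolding T_def by measurable
  have comp: "T f $ i = f (axis i 1)" for f i
  proof -
    have "T f $ i = T f \<bullet> axis i 1" by (simp add: inner_axis)
    also have "\<dots> = f (axis i 1)" unfolding T_def by (rule inner_sum_left_Basis) (simp add: bas)
    finally show ?thesis .
  qed
  have prodeq: "(\<Prod>i\<in>UNIV. h (axis i 1)) = (\<Prod>b\<in>Basis. h b)" for h :: "real^'n \<Rightarrow> 'b"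
    unfolding bas by (simp add: prod.reindex[OF inj])
  have eq: "(\<Prod>i\<in>UNIV. g i (T f $ i)) = (\<Prod>b\<in>Basis. g (ix b) (f b))" for f
    using prodeq[of "\<lambda>b. g (ix b) (f b)"] by (simp add: comp ix)
  have lb: "lborel = distr (\<Pi>\<^sub>M b\<in>Basis. lborel) borel T" unfolding T_def by (rule lborel_eq)
  show "integrable lborel (\<lambda>x::real^'n. \<Prod>i\<in>UNIV. g i (x $ i))"
    by (subst lb, subst integrable_distr_eq[OF T]) (simp, simp add: eq product_integrable_prod[OF finite_Basis g])
  have "(LINT x|lborel. (\<Prod>i\<in>UNIV. g i ((x::real^'n) $ i))) = (LINT f|(\<Pi>\<^sub>M b\<in>Basis. lborel). (\<Prod>b\<in>Basis. g (ix b) (f b)))"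
    by (subst lb, subst integral_distr[OF T]) (simp, simp add: eq)
  also have "\<dots> = (\<Prod>b\<in>(Basis :: (real^'n) set). LINT t|lborel. g (ix b) t)"
    by (rule product_integral_prod[OF finite_Basis g])
  also have "\<dots> = (\<Prod>i\<in>UNIV. LINT t|lborel. g i t)"
    using prodeq[of "\<lambda>b. LINT t|lborel. g (ix b) t"] by (simp add: ix)
  finally show "(LINT x|lborel. (\<Prod>i\<in>UNIV. g i ((x::real^'n) $ i))) = (\<Prod>i\<in>UNIV. LINT t|lborel. g i t)" .
qed

text \<open>An integrable weight of product form: it factors under integration, and each factor 1 +
  x_i^2 corresponds to two integrations by parts in direction i, see
  \<open>Kop_mo_decay_aux\<close>.\<close>

definition Wt :: "real^'n::finite \<Rightarrow> real" where
  "Wt x = (\<Prod>i\<in>UNIV. inverse (1 + (x $ i)^2))"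

lemma Wt_pos [simp]: "0 < Wt x" and Wt_nonneg [simp]: "0 \<le> Wt x"
proof -
  show "0 < Wt x" unfolding Wt_def by (intro prod_pos) (auto simp: add_pos_nonneg)
  then show "0 \<le> Wt x" by simp
qed

lemma integrable_Wt: "integrable lborel (Wt :: real^'n \<Rightarrow> real)"
  unfolding Wt_def
  by (rule lborel_vec_prod) (use integrable_inverse_1_plus_square in \<open>simp add: set_integrable_def einterval_eq_UNIV\<close>)

text \<open>Each factor 1 + x_i^2 is at most (1 + |x|)^2; hence the exponent 2 d that recurs in
  \<open>absorb_const\<close>.\<close>

lemma Wt_power_bound: "1 \<le> (1 + norm x) ^ (2 * CARD('n)) * Wt (x :: real^'n)"
proof -
  have "(\<Prod>i\<in>(UNIV::'n set). 1 + (x $ i)^2) \<le> (\<Prod>i\<in>(UNIV::'n set). (1 + norm x)^2)"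
  proof (rule prod_mono, intro conjI)
    fix i
    have "(x $ i)^2 \<le> norm x ^ 2" using component_le_norm_cart[of x i] by (metis abs_le_square_iff abs_norm_cancel)
    also have "1 + norm x ^ 2 \<le> (1 + norm x)^2" by (simp add: power2_eq_square algebra_simps)
    finally show "1 + (x $ i)^2 \<le> (1 + norm x)^2" by simp
  qed (simp add: add_nonneg_nonneg)
  also have "\<dots> = (1 + norm x) ^ (2 * CARD('n))" by (simp add: power_mult)
  finally have 1: "(\<Prod>i\<in>(UNIV::'n set). 1 + (x $ i)^2) \<le> (1 + norm x) ^ (2 * CARD('n))" .
  have "Wt x = inverse (\<Prod>i\<in>(UNIV::'n set). 1 + (x $ i)^2)" unfolding Wt_def by (simp add: prod_inversef[symmetric] o_def)
  moreover have "0 < (\<Prod>i\<in>(UNIV::'n set). 1 + (x $ i)^2)" by (intro prod_pos) (auto simp: add_pos_nonneg)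
  ultimately show ?thesis using 1 by (simp add: field_simps)
qed

text \<open>The dilation H of \<open>eo_absorb_power\<close>, picked once. It depends on A and k but
  not on q, so it can stand inside statements quantified over q.\<close>

definition absorb_const :: "(nat \<Rightarrow> real) \<Rightarrow> nat \<Rightarrow> real" where
  "absorb_const A k = (SOME H. 1 \<le> H \<and> (\<forall>q>0. \<exists>C>0. \<forall>t\<ge>0. (1 + t) ^ k * eo A (q * t) \<le> C * eo A (H * q * t)))"

lemma absorb_const:
  assumes "weight_seq A" "cond_M2' A"
  shows "1 \<le> absorb_const A k"
    and "0 < q \<Longrightarrow> \<exists>C>0. \<forall>t\<ge>0. (1 + t) ^ k * eo A (q * t) \<le> C * eo A (absorb_const A k * q * t)"
proof -
  have "1 \<le> absorb_const A k \<and> (\<forall>q>0. \<exists>C>0. \<forall>t\<ge>0. (1 + t) ^ k * eo A (q * t) \<le> C * eo A (absorb_const A k * q * t))"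
    unfolding absorb_const_def
    by (rule someI_ex) (use eo_absorb_power[OF assms, of k] in blast)
  then show "1 \<le> absorb_const A k"
    "0 < q \<Longrightarrow> \<exists>C>0. \<forall>t\<ge>0. (1 + t) ^ k * eo A (q * t) \<le> C * eo A (absorb_const A k * q * t)" by auto
qed

text \<open>Trades a dilation of the weight for an integrable factor; applied to A for integrals in
  x and to M for integrals in \<xi>.\<close>

lemma eo_Wt:
  assumes A: "weight_seq A" "cond_M2' A" and q: "0 < q"
  shows "\<exists>C>0. \<forall>x::real^'n. eo A (q * norm x) \<le> C * Wt x * eo A (absorb_const A (2 * CARD('n)) * q * norm x)"
proof -
  obtain C where C: "C > 0" "\<And>t. t \<ge> 0 \<Longrightarrow> (1 + t) ^ (2 * CARD('n)) * eo A (q * t) \<le> C * eo A (absorb_const A (2 * CARD('n)) * q * t)"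
    using absorb_const(2)[OF A q] by blast
  have "eo A (q * norm x) \<le> C * Wt x * eo A (absorb_const A (2 * CARD('n)) * q * norm x)" for x :: "real^'n"
  proof -
    have "eo A (q * norm x) \<le> ((1 + norm x) ^ (2 * CARD('n)) * Wt x) * eo A (q * norm x)"
      using Wt_power_bound[of x] mult_right_mono[of 1 _ "eo A (q * norm x)"] by simp
    also have "\<dots> = Wt x * ((1 + norm x) ^ (2 * CARD('n)) * eo A (q * norm x))" by simp
    also have "\<dots> \<le> Wt x * (C * eo A (absorb_const A (2 * CARD('n)) * q * norm x))"
      by (intro mult_left_mono C) auto
    finally show ?thesis by (simp add: mult_ac)
  qed
  then show ?thesis using C(1) by blast
qed

lemma has_vector_derivative_at_0_iff:
  fixes f :: "real \<Rightarrow> 'b::real_normed_vector"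
  shows "(f has_vector_derivative D) (at 0) \<longleftrightarrow> ((\<lambda>h. (f h - f 0) /\<^sub>R h) \<longlongrightarrow> D) (at 0)"
proof -
  have "(f has_vector_derivative D) (at 0) \<longleftrightarrow> ((\<lambda>h. norm (f h - f 0 - h *\<^sub>R D) / norm h) \<longlongrightarrow> 0) (at 0)"
    unfolding has_vector_derivative_def has_derivative_at by (simp add: bounded_linear_scaleR_left)
  also have "\<dots> \<longleftrightarrow> ((\<lambda>h. norm ((f h - f 0) /\<^sub>R h - D)) \<longlongrightarrow> 0) (at 0)"
  proof (rule filterlim_cong[OF refl refl])
    show "\<forall>\<^sub>F h in at 0. norm (f h - f 0 - h *\<^sub>R D) / norm h = norm ((f h - f 0) /\<^sub>R h - D)"
    proof (rule eventually_at_filter[THEN iffD2], rule always_eventually, intro allI impI)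
      fix h :: real assume "h \<noteq> 0"
      then have "(f h - f 0) /\<^sub>R h - D = (1 / h) *\<^sub>R (f h - f 0 - h *\<^sub>R D)"
        by (simp add: scaleR_right_diff_distrib divide_inverse)
      then show "norm (f h - f 0 - h *\<^sub>R D) / norm h = norm ((f h - f 0) /\<^sub>R h - D)" by simp
    qed
  qed
  also have "\<dots> \<longleftrightarrow> ((\<lambda>h. (f h - f 0) /\<^sub>R h) \<longlongrightarrow> D) (at 0)"
    by (simp add: tendsto_norm_zero_iff LIM_zero_iff)
  finally show ?thesis .
qed

text \<open>Dominated convergence. By the mean value inequality the difference quotients of the
  derivative \<open>is\<close> are bounded by \<open>g (i # is)\<close>, so integrable bounds
  uniform in x on all derivatives suffice. With counting measure the lemma also differentiates
  series.\<close>

lemma smooth_fn_integral: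
  fixes F :: "'y \<Rightarrow> 'n::finite tfun"
  assumes F: "\<And>y. smooth_fn (F y)"
    and meas: "\<And>is x. (\<lambda>y. Dlist is (F y) x) \<in> borel_measurable \<mu>"
    and g: "\<And>is. integrable \<mu> (g is)"
    and bd: "\<And>is y x. norm (Dlist is (F y) x) \<le> g is y"
  shows "smooth_fn (\<lambda>x. LINT y|\<mu>. F y x)"
    and "Dlist is (\<lambda>x. LINT y|\<mu>. F y x) = (\<lambda>x. LINT y|\<mu>. Dlist is (F y) x)"
proof -
  have int: "integrable \<mu> (\<lambda>y. Dlist is (F y) x)" for "is" x
    by (rule Bochner_Integration.integrable_bound[OF g[of "is"] meas])
      (rule AE_I2, rule order_trans[OF bd], simp)
  have 1: "continuous_on UNIV (\<lambda>x. LINT y|\<mu>. Dlist is (F y) x)" for "is"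
  proof (rule continuous_on_sequentiallyI)
    fix u :: "nat \<Rightarrow> real^'n" and a assume u: "u \<longlonglongrightarrow> a"
    show "(\<lambda>n. LINT y|\<mu>. Dlist is (F y) (u n)) \<longlonglongrightarrow> (LINT y|\<mu>. Dlist is (F y) a)"
    proof (rule integral_dominated_convergence[OF meas meas g[of "is"]])
      have "(\<lambda>n. Dlist is (F y) (u n)) \<longlonglongrightarrow> Dlist is (F y) a" for y
        using smooth_fn_continuous[OF F[of y], of "is"] u by (rule continuous_on_tendsto_compose) auto
      then show "AE y in \<mu>. (\<lambda>n. Dlist is (F y) (u n)) \<longlonglongrightarrow> Dlist is (F y) a" by simp
    qed (simp add: bd)
  qed
  have 2: "((\<lambda>t. LINT y|\<mu>. Dlist is (F y) (x + t *\<^sub>R axis i 1)) has_vector_derivative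
      (LINT y|\<mu>. Dlist (i # is) (F y) x)) (at 0)" for "is" i x
    unfolding has_vector_derivative_at_0_iff tendsto_at_iff_sequentially
  proof (intro allI impI)
    fix h :: "nat \<Rightarrow> real" assume h0: "\<forall>n. h n \<in> UNIV - {0}" and h: "h \<longlonglongrightarrow> 0"
    let ?q = "\<lambda>n y. (Dlist is (F y) (x + h n *\<^sub>R axis i 1) - Dlist is (F y) x) /\<^sub>R h n"
    have "(\<lambda>n. LINT y|\<mu>. ?q n y) \<longlonglongrightarrow> (LINT y|\<mu>. Dlist (i # is) (F y) x)"
    proof (rule integral_dominated_convergence[OF meas _ g[of "i # is"]])
      show "?q n \<in> borel_measurable \<mu>" for n using meas by measurable
      have "(\<lambda>n. ?q n y) \<longlonglongrightarrow> Dlist (i # is) (F y) x" for y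
        using smooth_fn_has_vector_derivative0[OF F[of y], of "is" x i, unfolded has_vector_derivative_at_0_iff] h h0
        unfolding tendsto_at_iff_sequentially by (auto simp: o_def)
      then show "AE y in \<mu>. (\<lambda>n. ?q n y) \<longlonglongrightarrow> Dlist (i # is) (F y) x" by simp
      have "norm (?q n y) \<le> g (i # is) y" for n y
      proof -
        have "norm (Dlist is (F y) (x + h n *\<^sub>R axis i 1) - Dlist is (F y) x) \<le> g (i # is) y * \<bar>h n\<bar>"
          by (rule line_increment_le[OF smooth_fn_Dlist[OF F]]) (use bd[of "i # is"] in simp)
        then show ?thesis using h0 by (simp add: divide_simps divide_inverse_commute[symmetric])
      qed
      then show "AE y in \<mu>. norm (?q n y) \<le> g (i # is) y" for n by simp
    qed
    moreover have "(\<lambda>n. LINT y|\<mu>. ?q n y) = (\<lambda>h. ((LINT y|\<mu>. Dlist is (F y) (x + h *\<^sub>R axis i 1)) -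
        (LINT y|\<mu>. Dlist is (F y) (x + 0 *\<^sub>R axis i 1))) /\<^sub>R h) \<circ> h"
      by (rule ext) (simp add: Bochner_Integration.integral_diff[OF int int] o_def del: Dlist.simps)
    ultimately show "((\<lambda>h. ((LINT y|\<mu>. Dlist is (F y) (x + h *\<^sub>R axis i 1)) -
        (LINT y|\<mu>. Dlist is (F y) (x + 0 *\<^sub>R axis i 1))) /\<^sub>R h) \<circ> h) \<longlonglongrightarrow> (LINT y|\<mu>. Dlist (i # is) (F y) x)"
      by simp
  qed
  show "smooth_fn (\<lambda>x. LINT y|\<mu>. F y x)"
       "Dlist is (\<lambda>x. LINT y|\<mu>. F y x) = (\<lambda>x. LINT y|\<mu>. Dlist is (F y) x)"
    by (rule smooth_fnI[where G="\<lambda>is x. LINT y|\<mu>. Dlist is (F y) x"]; use 1 2 in simp)+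
qed

section \<open>Convolution operators\<close>

text \<open>\<open>Kop \<eta> \<psi>\<close> is the convolution of \<open>\<psi>\<close> with the reflection of \<open>\<eta>\<close>.\<close>
definition Kop :: "'n::finite tfun \<Rightarrow> 'n tfun \<Rightarrow> 'n tfun" where
  "Kop \<eta> \<psi> = (\<lambda>x. LINT s|lborel. \<psi> (x + s) * \<eta> s)"

lemma Kop_eq:
  assumes "\<eta> \<in> borel_measurable borel" "\<psi> \<in> borel_measurable borel"
  shows "Kop \<eta> \<psi> x = (LINT t|lborel. \<psi> t * \<eta> (t - x))"
proof -
  have [measurable]: "\<eta> \<in> borel_measurable borel" "\<psi> \<in> borel_measurable borel" by fact+
  show ?thesis
    using integral_lborel_translate[of "\<lambda>t. \<psi> t * \<eta> (t - x)" x] by (simp add: Kop_def)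
qed

context gs_weights
begin

abbreviation HA :: "nat \<Rightarrow> real" where "HA n \<equiv> absorb_const A (2 * n)"

lemma HA: "1 \<le> HA n" using absorb_const(1)[OF wsA M2A] .

lemma HA_pos [simp]: "0 < HA n" and HA_nn [simp]: "0 \<le> HA n" and HA_nz [simp]: "HA n \<noteq> 0" using HA[of n] by linarith+

lemma wb_Wt:
  assumes q: "0 < q"
  shows "\<exists>C>0. \<forall>\<eta> Q. \<forall>x::real^'n. wb A (HA CARD('n) * q) \<eta> Q \<longrightarrow> norm (\<eta> x) * eo A (q * norm x) \<le> Q * C * Wt x"
proof -
  obtain C where C: "C > 0" "\<And>x::real^'n. eo A (q * norm x) \<le> C * Wt x * eo A (HA CARD('n) * q * norm x)"
    using eo_Wt[OF wsA M2A q, where 'n='n] by blast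
  have "norm (\<eta> x) * eo A (q * norm x) \<le> Q * C * Wt x" if w: "wb A (HA CARD('n) * q) \<eta> Q" for \<eta> Q and x :: "real^'n"
  proof -
    have "norm (\<eta> x) * eo A (q * norm x) \<le> norm (\<eta> x) * (C * Wt x * eo A (HA CARD('n) * q * norm x))"
      by (intro mult_left_mono C) auto
    also have "\<dots> = (norm (\<eta> x) * eo A (HA CARD('n) * q * norm x)) * (C * Wt x)" by simp
    also have "\<dots> \<le> Q * (C * Wt x)" using C(1) by (intro mult_right_mono wbD[OF w]) auto
    finally show ?thesis by (simp add: mult_ac)
  qed
  then show ?thesis using C(1) by blast
qed

lemma wb_integrable_eo:
  fixes \<eta> :: "(real^'n) \<Rightarrow> complex"
  assumes q: "0 < q" and w: "wb A (HA CARD('n) * q) \<eta> Q" and [measurable]: "\<eta> \<in> borel_measurable borel"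
  shows "integrable lborel (\<lambda>x. norm (\<eta> x) * eo A (q * norm x))"
proof -
  obtain C where C: "\<And>x. norm (\<eta> x) * eo A (q * norm x) \<le> Q * C * Wt x"
    using wb_Wt[OF q, where 'n='n] w by blast
  \<comment> \<open>Measurability of the weight comes from its monotonicity on the half
    line.\<close>
  have m: "eo A \<in> borel_measurable (restrict_space borel {0..})"
    by (rule borel_measurable_mono_on_fnc) (auto simp: mono_on_def intro: eo_mono[OF wsA])
  have [measurable]: "(\<lambda>x::real^'n. eo A (q * norm x)) \<in> borel_measurable borel"
    by (rule measurable_compose_rev[OF m])
      (use q in \<open>auto intro!: measurable_restrict_space2\<close>)
  show ?thesis
    by (rule Bochner_Integration.integrable_bound[where f="\<lambda>x. Q * C * Wt x"])
      (use C in \<open>auto intro!: integrable_mult_right integrable_Wt AE_I2 order_trans[OF C]\<close>)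
qed

lemma wb_integrable:
  fixes \<eta> :: "(real^'n) \<Rightarrow> complex"
  assumes q: "0 < q" and w: "wb A q \<eta> Q" and [measurable]: "\<eta> \<in> borel_measurable borel"
  shows "integrable lborel \<eta>"
proof -
  let ?q = "q / HA CARD('n)"
  have "integrable lborel (\<lambda>x. norm (\<eta> x) * eo A (?q * norm x))"
    by (rule wb_integrable_eo) (use q w in auto)
  then show ?thesis
    by (rule Bochner_Integration.integrable_bound)
      (use q eo_ge1[OF wsA] in \<open>auto intro!: AE_I2 mult_right_le_one_le simp: abs_mult mult_le_cancel_left1\<close>)
qed

lemma Kop_integrable:
  fixes \<eta> \<psi> :: "(real^'n) \<Rightarrow> complex"
  assumes q: "0 < q" and w: "wb A q \<eta> Q" and [measurable]: "\<eta> \<in> borel_measurable borel" "\<psi> \<in> borel_measurable borel"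
    and P: "\<And>x. norm (\<psi> x) \<le> P"
  shows "integrable lborel (\<lambda>s. \<psi> (x + s) * \<eta> s)"
proof (rule Bochner_Integration.integrable_bound[where f="\<lambda>s. P * norm (\<eta> s)"])
  show "integrable lborel (\<lambda>s. P * norm (\<eta> s))"
    by (intro integrable_mult_right integrable_norm wb_integrable[OF q w]) auto
  show "AE s in lborel. norm (\<psi> (x + s) * \<eta> s) \<le> norm (P * norm (\<eta> s))"
    using P order_trans[OF norm_ge_zero P] by (auto simp: norm_mult abs_mult intro!: mult_right_mono)
qed auto

text \<open>The weight at x is split between x + s and s. The doubled parameter of \<psi> pays for
  the first part; \<eta> has to pay for the second and for the integrable factor \<open>Wt\<close>,
  hence its additional \<open>HA\<close>.\<close>

lemma Kop_wb:
  assumes q: "0 < q"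
  shows "\<exists>C>0. \<forall>\<psi> \<eta> P Q. \<psi> \<in> borel_measurable borel \<longrightarrow> \<eta> \<in> borel_measurable borel \<longrightarrow> wb A (2 * q) \<psi> P \<longrightarrow>
      wb A (2 * HA CARD('n) * q) \<eta> Q \<longrightarrow> wb A q (Kop \<eta> \<psi> :: 'n::finite tfun) (C * P * Q)"
proof -
  obtain C where C: "C > 0" "\<And>\<eta> Q x. wb A (HA CARD('n) * (2 * q)) \<eta> Q \<Longrightarrow> norm (\<eta> (x::real^'n)) * eo A (2 * q * norm x) \<le> Q * C * Wt x"
    using wb_Wt[of "2 * q", where 'n='n] q by auto
  define I where "I = (LINT x|lborel. Wt (x::real^'n))"
  have I: "0 \<le> I" unfolding I_def by (rule Bochner_Integration.integral_nonneg) simp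
  \<comment> \<open>I + 1 in place of I makes the positivity of the constant evident.\<close>
  have "wb A q (Kop \<eta> \<psi>) (C * (I + 1) * P * Q)"
    if [measurable]: "\<psi> \<in> borel_measurable borel" "\<eta> \<in> borel_measurable borel"
      and w1: "wb A (2 * q) \<psi> P" and w2: "wb A (2 * HA CARD('n) * q) \<eta> Q" for \<psi> \<eta> :: "'n tfun" and P Q
    unfolding wb_def
  proof
    fix x :: "real^'n"
    have PQ: "0 \<le> P" "0 \<le> Q" using wb_nonneg[OF w1] wb_nonneg[OF w2] by auto
    have w2': "wb A (HA CARD('n) * (2 * q)) \<eta> Q" using w2 by (simp add: mult_ac)
    let ?E = "eo A (q * norm x)"
    have bd: "norm (\<psi> (x + s) * \<eta> s) \<le> P * Q * C / ?E * Wt s" for s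
    proof -
      have "norm (\<psi> (x + s) * \<eta> s) * ?E \<le> norm (\<psi> (x + s)) * norm (\<eta> s) * (eo A (2 * q * norm (x + s)) * eo A (2 * q * norm s))"
        unfolding norm_mult using q by (intro mult_left_mono eo_norm_triangle[OF wsA]) auto
      also have "\<dots> = (norm (\<psi> (x + s)) * eo A (2 * q * norm (x + s))) * (norm (\<eta> s) * eo A (2 * q * norm s))" by simp
      also have "\<dots> \<le> P * (Q * C * Wt s)"
        by (intro mult_mono wbD[OF w1] C(2)[OF w2']) (use PQ in auto)
      finally show ?thesis by (simp add: field_simps)
    qed
    have i1: "integrable lborel (\<lambda>s::real^'n. P * Q * C / ?E * Wt s)" by (intro integrable_mult_right integrable_Wt)
    then have i2: "integrable lborel (\<lambda>s. \<psi> (x + s) * \<eta> s)"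
      by (rule Bochner_Integration.integrable_bound)
        (simp, rule AE_I2, rule order_trans[OF bd], unfold real_norm_def, rule abs_ge_self)
    have "norm (Kop \<eta> \<psi> x) \<le> (LINT s|lborel. norm (\<psi> (x + s) * \<eta> s))"
      unfolding Kop_def by (rule Bochner_Integration.integral_norm_bound)
    also have "\<dots> \<le> (LINT s::real^'n|lborel. P * Q * C / ?E * Wt s)"
      by (intro Bochner_Integration.integral_mono integrable_norm i1 i2 bd)
    also have "\<dots> = P * Q * C / ?E * I" by (simp add: I_def)
    finally have "norm (Kop \<eta> \<psi> x) * ?E \<le> P * Q * C * I" by (simp add: field_simps)
    also have "\<dots> \<le> C * (I + 1) * P * Q" using PQ C(1) by (simp add: algebra_simps)
    finally show "norm (Kop \<eta> \<psi> x) * ?E \<le> C * (I + 1) * P * Q" .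
  qed
  then show ?thesis using C(1) I by (intro exI[of _ "C * (I + 1)"]) auto
qed

lemma gb_bound: "gb M A l \<phi> B \<Longrightarrow> 0 < l \<Longrightarrow> norm (Dlist is \<phi> x) \<le> B * (l ^ length is * M (length is))"
  by (rule wb_bound[OF wsA gb_wb]) auto

lemma smooth_fn_Kop:
  fixes \<eta> \<psi> :: "'n::finite tfun"
  assumes \<psi>: "smooth_fn \<psi>" "gb M A l \<psi> B" "0 < l"
    and [measurable]: "\<eta> \<in> borel_measurable borel" and \<eta>: "wb A q \<eta> Q" "0 < q"
  shows "smooth_fn (Kop \<eta> \<psi>)" and "Dlist is (Kop \<eta> \<psi>) = Kop \<eta> (Dlist is \<psi>)"
proof -
  let ?F = "\<lambda>s x. \<eta> s * \<psi> (x + s)"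
  have D: "Dlist is (?F s) = (\<lambda>x. \<eta> s * Dlist is \<psi> (x + s))" for "is" s
    by (simp add: smooth_fn_cmult smooth_fn_translate \<psi>)
  have [measurable]: "Dlist is \<psi> \<in> borel_measurable borel" for "is" by (rule smooth_fn_measurable[OF \<psi>(1)])
  have 1: "smooth_fn (?F s)" for s by (intro smooth_fn_cmult smooth_fn_translate \<psi>)
  have 2: "(\<lambda>s. Dlist is (?F s) x) \<in> borel_measurable lborel" for "is" x unfolding D by measurable
  have 3: "integrable lborel (\<lambda>s. norm (\<eta> s) * (B * (l ^ length is * M (length is))))" for "is" :: "'n list"
    by (intro integrable_mult_left integrable_norm wb_integrable[OF \<eta>(2,1)]) auto
  have 4: "norm (Dlist is (?F s) x) \<le> norm (\<eta> s) * (B * (l ^ length is * M (length is)))" for "is" s x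
    unfolding D norm_mult by (intro mult_left_mono gb_bound \<psi>) auto
  have eq: "Kop \<eta> \<psi>' = (\<lambda>x. LINT s|lborel. \<eta> s * \<psi>' (x + s))" for \<psi>' by (simp add: Kop_def mult.commute)
  show "smooth_fn (Kop \<eta> \<psi>)" unfolding eq by (rule smooth_fn_integral(1)[OF 1 2 3 4])
  show "Dlist is (Kop \<eta> \<psi>) = Kop \<eta> (Dlist is \<psi>)" unfolding eq smooth_fn_integral(2)[OF 1 2 3 4] by (simp add: D)
qed

text \<open>After the substitution t = x + s the variable x sits in \<open>\<eta> (t - x)\<close>,
  so derivatives can be put on the window, each with a sign. Together with
  \<open>smooth_fn_Kop\<close> this is integration by parts.\<close>

lemma Dlist_Kop_left:
  fixes \<eta> \<psi> :: "'n::finite tfun"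
  assumes \<eta>: "smooth_fn \<eta>" "gb M A l \<eta> B" "0 < l"
    and [measurable]: "\<psi> \<in> borel_measurable borel" and \<psi>: "wb A q \<psi> Q" "0 < q"
  shows "Dlist is (Kop \<eta> \<psi>) = (\<lambda>x. (-1) ^ length is * Kop (Dlist is \<eta>) \<psi> x)"
proof -
  let ?F = "\<lambda>t x. \<psi> t * \<eta> (- (x + (- t)))"
  have D: "Dlist is (?F t) = (\<lambda>x. \<psi> t * ((-1) ^ length is * Dlist is \<eta> (- (x + - t))))" for "is" t
    using smooth_fn_translate[OF smooth_fn_reflect(1)[OF \<eta>(1)], where s="- t"]
    by (simp add: smooth_fn_cmult smooth_fn_reflect[OF \<eta>(1)])
  have [measurable]: "Dlist is \<eta> \<in> borel_measurable borel" for "is" by (rule smooth_fn_measurable[OF \<eta>(1)])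
  have m0: "\<eta> \<in> borel_measurable borel" using smooth_fn_measurable[OF \<eta>(1), of "[]"] by simp
  have 1: "smooth_fn (?F t)" for t
    by (intro smooth_fn_cmult(1) smooth_fn_translate(1)[OF smooth_fn_reflect(1)[OF \<eta>(1)]])
  have 2: "(\<lambda>t. Dlist is (?F t) x) \<in> borel_measurable lborel" for "is" x unfolding D by measurable
  have 3: "integrable lborel (\<lambda>t. norm (\<psi> t) * (B * (l ^ length is * M (length is))))" for "is" :: "'n list"
    by (intro integrable_mult_left integrable_norm wb_integrable[OF \<psi>(2,1)]) auto
  have 4: "norm (Dlist is (?F t) x) \<le> norm (\<psi> t) * (B * (l ^ length is * M (length is)))" for "is" t x
    unfolding D norm_mult norm_power using gb_bound[OF \<eta>(2,3)] by (simp add: mult_left_mono)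
  have eq: "Kop \<eta> \<psi> = (\<lambda>x. LINT t|lborel. ?F t x)"
    by (simp add: Kop_eq[OF m0] fun_eq_iff)
  show ?thesis unfolding eq smooth_fn_integral(2)[OF 1 2 3 4] D
    by (simp add: fun_eq_iff Kop_eq mult.left_commute[of _ "(-1) ^ length is"])
qed

text \<open>All derivatives fall on \<psi>, so \<eta> enters only through its size. Modulated
  windows, whose derivatives grow with \<xi>, can therefore be estimated uniformly in \<xi>.\<close>

lemma Kop_gb:
  assumes l: "0 < l"
  shows "\<exists>C>0. \<forall>\<psi> \<eta> B Q. smooth_fn \<psi> \<longrightarrow> \<eta> \<in> borel_measurable borel \<longrightarrow> gb M A l \<psi> B \<longrightarrow>
      wb A (1 / l) \<eta> Q \<longrightarrow> gb M A (2 * HA CARD('n) * l) (Kop \<eta> \<psi> :: 'n::finite tfun) (C * B * Q)"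
proof -
  let ?H = "HA CARD('n)" let ?q = "1 / (2 * HA CARD('n) * l)"
  have q: "0 < ?q" using l by simp
  have H1: "1 \<le> ?H" by (rule HA)
  obtain C where C: "C > 0" "\<And>\<psi> \<eta> P Q. \<psi> \<in> borel_measurable borel \<Longrightarrow> \<eta> \<in> borel_measurable borel \<Longrightarrow> wb A (2 * ?q) \<psi> P \<Longrightarrow>
      wb A (2 * ?H * ?q) \<eta> Q \<Longrightarrow> wb A ?q (Kop \<eta> \<psi> :: 'n tfun) (C * P * Q)"
    using Kop_wb[OF q, where 'n='n] by blast
  have "gb M A (2 * ?H * l) (Kop \<eta> \<psi>) (C * B * Q)"
    if \<psi>: "smooth_fn \<psi>" "gb M A l \<psi> B" and [measurable]: "\<eta> \<in> borel_measurable borel" and \<eta>: "wb A (1 / l) \<eta> Q"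
    for \<psi> \<eta> :: "'n tfun" and B Q
    unfolding gb_def
  proof (intro allI)
    fix "is" :: "'n list" and x :: "real^'n"
    have CBQ: "0 \<le> C * B * Q" using C(1) gb_nonneg[OF \<psi>(2)] wb_nonneg[OF \<eta>] by simp
    have D: "Dlist is (Kop \<eta> \<psi>) = Kop \<eta> (Dlist is \<psi>)"
      by (rule smooth_fn_Kop(2)[OF \<psi> l _ \<eta>]) (use l in auto)
    have "1 / (?H * l) \<le> 1 / l" using H1 l by (simp add: field_simps)
    then have "wb A (2 * ?q) (Dlist is \<psi>) (B * (l ^ length is * M (length is)))"
      by (intro wb_mono[OF wsA gb_wb[OF \<psi>(2)]]) (use l in auto)
    moreover have "wb A (2 * ?H * ?q) \<eta> Q" using \<eta> HA_pos[of "CARD('n)"] by (simp del: HA_pos)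
    ultimately have "wb A ?q (Kop \<eta> (Dlist is \<psi>)) (C * (B * (l ^ length is * M (length is))) * Q)"
      by (intro C(2) smooth_fn_measurable \<psi>) auto
    from wbD[OF this, of x] have "norm (Kop \<eta> (Dlist is \<psi>) x) * eo A (norm x / (2 * ?H * l)) \<le> C * B * Q * (l ^ length is * M (length is))"
      by (simp add: mult_ac)
    also have "\<dots> \<le> C * B * Q * ((2 * ?H * l) ^ length is * M (length is))"
      using CBQ l H1 by (intro mult_left_mono mult_right_mono power_mono) auto
    finally show "norm (Dlist is (Kop \<eta> \<psi>) x) * eo A (norm x / (2 * ?H * l)) \<le> C * B * Q * ((2 * ?H * l) ^ length is * M (length is))"
      unfolding D .
  qed
  then show ?thesis using C(1) by blast
qed

section \<open>Closure properties of the test function space\<close>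

text \<open>An operation that changes l only by a fixed factor c preserves the space in both cases:
  for every l one starts from l / c, for some l one arrives at c l.\<close>

lemma GSsp_transfer:
  assumes "\<phi> \<in> GSsp b M A" "smooth_fn \<phi>'" "0 < c"
    and "\<And>l B. 0 < l \<Longrightarrow> gb M A l \<phi> B \<Longrightarrow> \<exists>B'. gb M A (c * l) \<phi>' B'"
  shows "\<phi>' \<in> GSsp b M A"
proof (cases b)
  case True
  have "\<exists>B'. gb M A l \<phi>' B'" if "l > 0" for l
    using assms(1,3) assms(4)[of "l / c"] that True unfolding GSsp_iff by fastforce
  then show ?thesis unfolding GSsp_iff using True assms(2) by simp
next
  case False
  then show ?thesis using assms unfolding GSsp_iff by (metis mult_pos_pos)
qed

lemma GSsp_transfer2:
  assumes "\<phi> \<in> GSsp b M A" "\<psi> \<in> GSsp b M A" "smooth_fn \<phi>'" "0 < c"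
    and "\<And>l B C. 0 < l \<Longrightarrow> gb M A l \<phi> B \<Longrightarrow> gb M A l \<psi> C \<Longrightarrow> \<exists>B'. gb M A (c * l) \<phi>' B'"
  shows "\<phi>' \<in> GSsp b M A"
proof (cases b)
  case True
  have "\<exists>B'. gb M A l \<phi>' B'" if "l > 0" for l
    using assms(1,2,4) assms(5)[of "l / c"] that True unfolding GSsp_iff by fastforce
  then show ?thesis unfolding GSsp_iff using True assms(3) by simp
next
  case False
  obtain l1 B where 1: "l1 > 0" "gb M A l1 \<phi> B" using assms(1)[unfolded GSsp_iff] False by auto
  obtain l2 C where 2: "l2 > 0" "gb M A l2 \<psi> C" using assms(2)[unfolded GSsp_iff] False by auto
  \<comment> \<open>Two Roumieu functions come with different parameters; both bounds persist at the
    larger one.\<close>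
  have "\<exists>B'. gb M A (c * max l1 l2) \<phi>' B'"
    by (rule assms(5)[of _ B C]) (use 1 2 in \<open>auto intro: gb_mono\<close>)
  moreover have "0 < c * max l1 l2" using assms(4) 1(1) by simp
  ultimately show ?thesis unfolding GSsp_iff using False assms(3) by auto
qed

lemma GSsp_zero: "(\<lambda>x. 0) \<in> GSsp b M A"
  unfolding GSsp_iff using gb_zero[of 0] smooth_fn_zero(1) zero_less_one[where 'a=real] by (metis order_refl)

lemma GSsp_add: "\<phi> \<in> GSsp b M A \<Longrightarrow> \<psi> \<in> GSsp b M A \<Longrightarrow> (\<lambda>x. \<phi> x + \<psi> x) \<in> GSsp b M A"
  by (rule GSsp_transfer2[where c=1 and \<phi>=\<phi> and \<psi>=\<psi>]) (auto intro: smooth_fn_add gb_add GSsp_smooth)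

lemma GSsp_cmult: "\<phi> \<in> GSsp b M A \<Longrightarrow> (\<lambda>x. c * \<phi> x) \<in> GSsp b M A"
  by (rule GSsp_transfer[where c=1]) (auto intro: smooth_fn_cmult gb_cmult GSsp_smooth)

lemma GSsp_diff: "\<phi> \<in> GSsp b M A \<Longrightarrow> \<psi> \<in> GSsp b M A \<Longrightarrow> (\<lambda>x. \<phi> x - \<psi> x) \<in> GSsp b M A"
  using GSsp_add[of \<phi> "\<lambda>x. (-1) * \<psi> x"] GSsp_cmult[of \<psi> "-1"] by simp

lemma GSsp_sum:
  "finite Z \<Longrightarrow> (\<And>z. z \<in> Z \<Longrightarrow> F z \<in> GSsp b M A) \<Longrightarrow> (\<lambda>x. \<Sum>z\<in>Z. a z * F z x) \<in> GSsp b M A"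
  by (induction Z rule: finite_induct) (simp_all add: GSsp_zero GSsp_add GSsp_cmult)

lemma GSsp_cnj: "\<phi> \<in> GSsp b M A \<Longrightarrow> (\<lambda>x. cnj (\<phi> x)) \<in> GSsp b M A"
  by (rule GSsp_transfer[where c=1]) (auto intro: smooth_fn_cnj gb_cnj GSsp_smooth)

lemma GSsp_reflect: "\<phi> \<in> GSsp b M A \<Longrightarrow> (\<lambda>x. \<phi> (- x)) \<in> GSsp b M A"
  by (rule GSsp_transfer[where c=1]) (auto intro: smooth_fn_reflect gb_reflect GSsp_smooth)

lemma GSsp_translate: "\<phi> \<in> GSsp b M A \<Longrightarrow> (\<lambda>x. \<phi> (x + s)) \<in> GSsp b M A"
  by (rule GSsp_transfer[where c=2]) (auto intro: smooth_fn_translate gb_translate GSsp_smooth)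

lemma GSsp_mo: "\<phi> \<in> GSsp b M A \<Longrightarrow> mo \<xi> \<phi> \<in> GSsp b M A"
  by (rule GSsp_transfer[where c=2]) (auto intro: smooth_fn_mo gb_mo GSsp_smooth)

lemma GSsp_pdir: "\<phi> \<in> GSsp b M A \<Longrightarrow> pdir i \<phi> \<in> GSsp b M A"
  by (rule GSsp_transfer[where c=HM]) (use HM in \<open>auto intro: smooth_fn_pdir gb_pdir GSsp_smooth\<close>)

lemma GSsp_Dlist: "\<phi> \<in> GSsp b M A \<Longrightarrow> Dlist is \<phi> \<in> GSsp b M A"
  by (induction "is") (auto intro: GSsp_pdir)

lemma GSsp_measurable: "\<phi> \<in> GSsp b M A \<Longrightarrow> \<phi> \<in> borel_measurable borel"
  using smooth_fn_measurable[OF GSsp_smooth, of \<phi> "[]"] by simp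

lemma GSsp_gb: "\<phi> \<in> GSsp b M A \<Longrightarrow> \<exists>l>0. \<exists>B. gb M A l \<phi> B"
  unfolding GSsp_iff by (metis zero_less_one)

lemma GSsp_wb:
  assumes "\<phi> \<in> GSsp b M A" shows "\<exists>q>0. \<exists>B. wb A q \<phi> B"
proof -
  obtain l B where "l > 0" "gb M A l \<phi> B" using GSsp_gb[OF assms] by blast
  with gb_wb[of M A l \<phi> B "[]"] show ?thesis by (intro exI[of _ "1 / l"]) auto
qed

lemma GSsp_Kop:
  fixes \<eta> \<psi> :: "'n::finite tfun"
  assumes \<eta>: "\<eta> \<in> GSsp b M A" and \<psi>: "\<psi> \<in> GSsp b M A"
  shows "Kop \<eta> \<psi> \<in> GSsp b M A" and "Dlist is (Kop \<eta> \<psi>) = Kop \<eta> (Dlist is \<psi>)"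
    and "Dlist is (Kop \<eta> \<psi>) = (\<lambda>x. (-1) ^ length is * Kop (Dlist is \<eta>) \<psi> x)"
proof -
  obtain l B where l: "l > 0" "gb M A l \<psi> B" using GSsp_gb[OF \<psi>] by blast
  obtain q Q where q: "q > 0" "wb A q \<eta> Q" using GSsp_wb[OF \<eta>] by blast
  obtain l' B' where l': "l' > 0" "gb M A l' \<eta> B'" using GSsp_gb[OF \<eta>] by blast
  obtain q' Q' where q': "q' > 0" "wb A q' \<psi> Q'" using GSsp_wb[OF \<psi>] by blast
  note m = GSsp_measurable[OF \<eta>] GSsp_measurable[OF \<psi>]
  show "Dlist is (Kop \<eta> \<psi>) = Kop \<eta> (Dlist is \<psi>)"
    by (rule smooth_fn_Kop[OF GSsp_smooth[OF \<psi>] l(2,1) m(1) q(2,1)])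
  show "Dlist is (Kop \<eta> \<psi>) = (\<lambda>x. (-1) ^ length is * Kop (Dlist is \<eta>) \<psi> x)"
    by (rule Dlist_Kop_left[OF GSsp_smooth[OF \<eta>] l'(2,1) m(2) q'(2,1)])
  show "Kop \<eta> \<psi> \<in> GSsp b M A"
  proof (rule GSsp_transfer2[OF \<psi> \<eta>, where c="2 * HA CARD('n)"])
    show "smooth_fn (Kop \<eta> \<psi>)"
      by (rule smooth_fn_Kop[OF GSsp_smooth[OF \<psi>] l(2,1) m(1) q(2,1)])
    fix l :: real and B C assume l: "0 < l" and g: "gb M A l \<psi> B" "gb M A l \<eta> C"
    have "wb A (1 / l) \<eta> (C * M 0)" using gb_wb[OF g(2), of "[]"] by simp
    then show "\<exists>B'. gb M A (2 * HA CARD('n) * l) (Kop \<eta> \<psi>) B'"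
      using Kop_gb[OF l, where 'n='n] GSsp_smooth[OF \<psi>] g(1) m(1) by blast
  qed simp
qed

end

section \<open>Uniform Riemann sums\<close>

lemma locally_lipschitz_continuous:
  fixes h :: "'a::real_normed_vector \<Rightarrow> complex"
  assumes "\<And>R y z. norm y \<le> R \<Longrightarrow> norm z \<le> R \<Longrightarrow> norm (h y - h z) \<le> L R * norm (y - z)"
  shows "continuous_on UNIV h"
proof -
  have "isCont h y" for y
  proof -
    let ?R = "norm y + 1"
    have "(h \<longlongrightarrow> h y) (at y)"
    proof (rule LIM_zero_cancel, rule Lim_null_comparison)
      have "\<forall>\<^sub>F z in at y. dist z y < 1" unfolding eventually_at by (intro exI[of _ 1]) auto
      then show "\<forall>\<^sub>F z in at y. norm (h z - h y) \<le> L ?R * norm (z - y)"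
      proof eventually_elim
        case (elim z)
        have "norm z \<le> ?R" using elim norm_triangle_ineq2[of z y] by (simp add: dist_norm)
        then show ?case using assms[of z ?R y] by simp
      qed
      show "((\<lambda>z. L ?R * norm (z - y)) \<longlongrightarrow> 0) (at y)"
        by (auto intro!: tendsto_eq_intros)
    qed
    then show ?thesis by (simp add: isCont_def)
  qed
  then show ?thesis by (simp add: continuous_at_imp_continuous_on)
qed

text \<open>Nodes and weights are chosen before h: they depend only on \<rho>, L and \<epsilon>.
  Later h runs over all derivatives at all points of a map with values in the test functions, so
  this uniformity turns pointwise integrals into approximation in a seminorm.\<close>

lemma uniform_riemann_sums:
  fixes \<rho> :: "'a::euclidean_space \<Rightarrow> real" and L :: "real \<Rightarrow> real"
  assumes \<rho>: "integrable lborel \<rho>" and \<epsilon>: "0 < \<epsilon>"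
  shows "\<exists>Z a. finite Z \<and> (\<forall>z. 0 \<le> a z) \<and> (\<forall>h :: 'a \<Rightarrow> complex. (\<forall>y. norm (h y) \<le> \<rho> y) \<longrightarrow>
     (\<forall>R y z. norm y \<le> R \<longrightarrow> norm z \<le> R \<longrightarrow> norm (h y - h z) \<le> L R * norm (y - z)) \<longrightarrow>
     norm ((\<Sum>z\<in>Z. of_real (a z) * h z) - (LINT y|lborel. h y)) \<le> \<epsilon>)"
proof -
  have [measurable]: "\<rho> \<in> borel_measurable borel" using \<rho> by auto
  \<comment> \<open>The part outside a large ball is small uniformly in h, because \<rho> alone
    controls it.\<close>
  have "(\<lambda>n. LINT y|lborel. indicator (- cball 0 (real n)) y * \<rho> y) \<longlonglongrightarrow> (LINT y::'a|lborel. 0 :: real)"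
  proof (rule integral_dominated_convergence[where w="\<lambda>y. \<bar>\<rho> y\<bar>"])
    have "(\<lambda>n. indicator (- cball 0 (real n)) y * \<rho> y) \<longlonglongrightarrow> 0" for y
    proof (rule tendsto_eventually)
      obtain N where "norm y \<le> real N" using real_arch_simple by blast
      then show "\<forall>\<^sub>F n in sequentially. indicator (- cball 0 (real n)) y * \<rho> y = 0"
        unfolding eventually_sequentially
        by (intro exI[of _ N]) (auto simp: indicator_def)
    qed
    then show "AE y in lborel. (\<lambda>n. indicator (- cball 0 (real n)) y * \<rho> y) \<longlonglongrightarrow> 0" by simp
  qed (use \<rho> in \<open>auto simp: indicator_def\<close>)
  then have "\<forall>\<^sub>F n in sequentially. (LINT y|lborel. indicator (- cball 0 (real n)) y * \<rho> y) < \<epsilon> / 2"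
    using \<epsilon> by (intro order_tendstoD(2)) auto
  then obtain n where n: "(LINT y|lborel. indicator (- cball 0 (real n)) y * \<rho> y) < \<epsilon> / 2"
    by (meson eventually_sequentially order_refl)
  define R where "R = real n"
  define K where "K = cball (0::'a) R"
  have K[measurable]: "K \<in> sets borel" by (simp add: K_def)
  have Kfin: "emeasure lborel K < \<infinity>" unfolding K_def by (rule emeasure_lborel_cball_finite)
  \<comment> \<open>Simple functions approximating the identity: their finitely many values will be
    the nodes, their level sets inside K the cells.\<close>
  obtain s :: "nat \<Rightarrow> 'a \<Rightarrow> 'a" where s: "\<And>i. simple_function lborel (s i)" "\<And>x. (\<lambda>i. s i x) \<longlonglongrightarrow> x"
      "\<And>i x. dist (s i x) 0 \<le> 2 * dist x 0"
    using borel_measurable_implies_sequence_metric[of "\<lambda>x. x" "lborel :: 'a measure" 0] by auto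
  have [measurable]: "s i \<in> borel_measurable borel" for i using borel_measurable_simple_function[OF s(1)] by simp
  \<comment> \<open>Points of K are moved to nodes of norm at most 2 R, so the Lipschitz constant is
    taken on the ball of radius 2 R; adding 1 permits division by it.\<close>
  define L' where "L' = \<bar>L (2 * R)\<bar> + 1"
  have Kint: "integrable lborel (\<lambda>y. indicator K y * c)" for c :: real
    using Kfin by (intro integrable_mult_left integrable_real_indicator) auto
  have bdK: "norm (indicator K y * norm (s i y - y)) \<le> indicator K y * (3 * R)" for i y
  proof (cases "y \<in> K")
    case True
    then have "norm y \<le> R" by (simp add: K_def)
    moreover have "norm (s i y) \<le> 2 * norm y" using s(3)[of i y] by simp
    moreover have "norm (s i y - y) \<le> norm (s i y) + norm y" by (rule norm_triangle_ineq4)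
    ultimately show ?thesis using True by simp
  qed simp
  have "(\<lambda>i. LINT y|lborel. indicator K y * norm (s i y - y)) \<longlonglongrightarrow> (LINT y::'a|lborel. 0 :: real)"
  proof (rule integral_dominated_convergence[where w="\<lambda>y. indicator K y * (3 * R)"])
    have "(\<lambda>i. indicator K y * norm (s i y - y)) \<longlonglongrightarrow> 0" for y
      using s(2)[of y] by (intro tendsto_mult_right_zero) (simp add: tendsto_norm_zero_iff LIM_zero_iff)
    then show "AE y in lborel. (\<lambda>i. indicator K y * norm (s i y - y)) \<longlonglongrightarrow> 0" by simp
  qed (use Kint bdK in auto)
  then have "\<forall>\<^sub>F i in sequentially. (LINT y|lborel. indicator K y * norm (s i y - y)) < \<epsilon> / 2 / L'"
    using \<epsilon> by (intro order_tendstoD(2)) (auto simp: L'_def)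
  then obtain i where i: "(LINT y|lborel. indicator K y * norm (s i y - y)) < \<epsilon> / 2 / L'"
    by (meson eventually_sequentially order_refl)
  define t where "t = s i"
  have t[measurable]: "t \<in> borel_measurable borel" by (simp add: t_def)
  define Z where "Z = range t"
  define a where "a z = measure lborel (K \<inter> t -` {z})" for z
  have Zfin: "finite Z" using simple_functionD(1)[OF s(1)[of i]] by (simp add: Z_def t_def)
  have setm: "K \<inter> t -` {z} \<in> sets lborel" for z
    using measurable_sets[OF t, of "{z}"] by auto
  have emfin: "emeasure lborel (K \<inter> t -` {z}) < \<infinity>" for z
    by (rule le_less_trans[OF emeasure_mono Kfin]) auto
  have main: "norm ((\<Sum>z\<in>Z. of_real (a z) * h z) - (LINT y|lborel. h y)) \<le> \<epsilon>"
    if h\<rho>: "\<And>y. norm (h y) \<le> \<rho> y"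
      and hL: "\<And>R y z. norm y \<le> R \<Longrightarrow> norm z \<le> R \<Longrightarrow> norm (h y - h z) \<le> L R * norm (y - z)"
    for h :: "'a \<Rightarrow> complex"
  proof -
    have [measurable]: "h \<in> borel_measurable borel"
      by (rule borel_measurable_continuous_onI, rule locally_lipschitz_continuous, rule hL)
    have hint: "integrable lborel h"
      by (rule Bochner_Integration.integrable_bound[OF \<rho>]) (auto intro!: AE_I2 order_trans[OF h\<rho>])
    have eq: "indicator K y *\<^sub>R h (t y) = (\<Sum>z\<in>Z. indicator (K \<inter> t -` {z}) y *\<^sub>R h z)" for y
    proof -
      have "(\<Sum>z\<in>Z. indicator (K \<inter> t -` {z}) y *\<^sub>R h z) = (\<Sum>z\<in>Z. if z = t y then indicator K y *\<^sub>R h z else 0)"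
        by (rule sum.cong) (auto simp: indicator_def)
      also have "\<dots> = indicator K y *\<^sub>R h (t y)" using Zfin by (simp add: Z_def)
      finally show ?thesis by simp
    qed
    have int1: "integrable lborel (\<lambda>y. indicator (K \<inter> t -` {z}) y *\<^sub>R h z)" for z
      using setm emfin by (intro integrable_scaleR_left integrable_real_indicator) auto
    have sumeq: "(LINT y|lborel. indicator K y *\<^sub>R h (t y)) = (\<Sum>z\<in>Z. of_real (a z) * h z)"
      unfolding eq using int1
      by (simp add: Bochner_Integration.integral_sum a_def scaleR_conv_of_real)
    have inth: "integrable lborel (\<lambda>y. indicator K y *\<^sub>R h (t y))" unfolding eq using int1 by simp
    have split: "(LINT y|lborel. indicator K y *\<^sub>R h (t y)) - (LINT y|lborel. h y) =
        (LINT y|lborel. indicator K y *\<^sub>R h (t y) - h y)"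
      by (rule Bochner_Integration.integral_diff[symmetric, OF inth hint])
    have i2: "integrable lborel (\<lambda>y. indicator K y * norm (t y - y))"
      by (rule Bochner_Integration.integrable_bound[OF Kint[of "3 * R"]])
        (simp, rule AE_I2, unfold t_def, rule order_trans[OF bdK], unfold real_norm_def, rule abs_ge_self)
    have i3: "integrable lborel (\<lambda>y. indicator (- K) y * \<rho> y)"
      by (rule Bochner_Integration.integrable_bound[OF \<rho>]) (auto simp: indicator_def)
    have pt: "norm (indicator K y *\<^sub>R h (t y) - h y) \<le> L' * (indicator K y * norm (t y - y)) + indicator (- K) y * \<rho> y" for y
    proof (cases "y \<in> K")
      case True
      then have yR: "norm y \<le> R" by (simp add: K_def)
      have "0 \<le> R" by (rule order_trans[OF norm_ge_zero yR])
      then have y: "norm y \<le> 2 * R" using yR by linarith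
      have ty: "norm (t y) \<le> 2 * R" using s(3)[of i y] True by (simp add: t_def K_def)
      have "norm (h (t y) - h y) \<le> L (2 * R) * norm (t y - y)" by (rule hL[OF ty y])
      also have "\<dots> \<le> L' * norm (t y - y)" by (intro mult_right_mono) (auto simp: L'_def)
      finally show ?thesis using True by simp
    qed (use h\<rho> in simp)
    have "norm ((\<Sum>z\<in>Z. of_real (a z) * h z) - (LINT y|lborel. h y)) \<le> (LINT y|lborel. norm (indicator K y *\<^sub>R h (t y) - h y))"
      unfolding sumeq[symmetric] split by (rule Bochner_Integration.integral_norm_bound)
    also have "\<dots> \<le> (LINT y|lborel. L' * (indicator K y * norm (t y - y)) + indicator (- K) y * \<rho> y)"
      by (intro Bochner_Integration.integral_mono integrable_norm Bochner_Integration.integrable_diff inth hint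
          Bochner_Integration.integrable_add integrable_mult_right i2 i3 pt)
    also have "\<dots> = L' * (LINT y|lborel. indicator K y * norm (t y - y)) + (LINT y|lborel. indicator (- K) y * \<rho> y)"
      using i2 i3 by simp
    also have "\<dots> \<le> L' * (\<epsilon> / 2 / L') + \<epsilon> / 2"
      using n i by (intro add_mono mult_left_mono) (auto simp: L'_def t_def K_def R_def less_imp_le)
    also have "\<dots> = \<epsilon>" using L'_def by (simp add: field_simps)
    finally show ?thesis .
  qed
  show ?thesis
  proof (intro exI conjI allI impI)
    show "finite Z" by (rule Zfin)
    show "0 \<le> a z" for z by (simp add: a_def)
  qed (rule main, blast+)
qed

lemma smooth_fn_diff:
  assumes "smooth_fn f" "smooth_fn g"
  shows "smooth_fn (\<lambda>x. f x - g x)" and "Dlist is (\<lambda>x. f x - g x) = (\<lambda>x. Dlist is f x - Dlist is g x)"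
proof -
  have eq: "(\<lambda>x. f x - g x) = (\<lambda>x. f x + (-1) * g x)" by simp
  show "smooth_fn (\<lambda>x. f x - g x)" unfolding eq by (intro smooth_fn_add(1) smooth_fn_cmult(1) assms)
  show "Dlist is (\<lambda>x. f x - g x) = (\<lambda>x. Dlist is f x - Dlist is g x)"
    unfolding eq smooth_fn_add(2)[OF assms(1) smooth_fn_cmult(1)[OF assms(2)]] smooth_fn_cmult(2)[OF assms(2)] by simp
qed

lemma lin_on_add: "lin_on S u \<Longrightarrow> \<phi> \<in> S \<Longrightarrow> \<psi> \<in> S \<Longrightarrow> u (\<lambda>x. \<phi> x + \<psi> x) = u \<phi> + u \<psi>"
  and lin_on_cmult: "lin_on S u \<Longrightarrow> \<phi> \<in> S \<Longrightarrow> u (\<lambda>x. c * \<phi> x) = c * u \<phi>"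
  unfolding lin_on_def by blast+

lemma cis_lipschitz: "norm (cis a - cis c) \<le> \<bar>a - c\<bar>"
proof -
  define g where "g s = cis (c + s * (a - c))" for s
  have "norm (g 1 - g 0) \<le> \<bar>a - c\<bar> * 1"
  proof (rule norm_increment_le[where g'="\<lambda>s. (a - c) *\<^sub>R (\<i> * cis (c + s * (a - c)))"])
    fix s :: real
    have "((\<lambda>s. c + s * (a - c)) has_derivative (\<lambda>t. t *\<^sub>R (a - c))) (at s)"
      by (auto intro!: derivative_eq_intros)
    from has_derivative_cis[OF this]
    show "(g has_vector_derivative (a - c) *\<^sub>R (\<i> * cis (c + s * (a - c)))) (at s)"
      by (simp add: g_def[abs_def] has_vector_derivative_def mult.assoc)
  qed (auto simp: norm_mult)
  then show ?thesis by (simp add: g_def)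
qed

context gs_weights
begin

lemma lin_on_diff:
  assumes "lin_on (GSsp b M A) u" "\<phi> \<in> GSsp b M A" "\<psi> \<in> GSsp b M A"
  shows "u (\<lambda>x. \<phi> x - \<psi> x) = u \<phi> - u \<psi>"
  using lin_on_add[OF assms(1,2) GSsp_cmult[OF assms(3), of "-1"]] lin_on_cmult[OF assms(1,3), of "-1"] by simp

lemma lin_on_sum:
  assumes "lin_on (GSsp b M A) u" "finite Z" "\<And>z. z \<in> Z \<Longrightarrow> F z \<in> GSsp b M A"
  shows "u (\<lambda>x. \<Sum>z\<in>Z. a z * F z x) = (\<Sum>z\<in>Z. a z * u (F z))"
  using assms(2,3)
proof (induction Z rule: finite_induct)
  case empty
  show ?case using lin_on_cmult[OF assms(1) GSsp_zero, of 0] by simp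
next
  case (insert z Z)
  then show ?case
    using lin_on_add[OF assms(1), of "\<lambda>x. a z * F z x" "\<lambda>x. \<Sum>z\<in>Z. a z * F z x"]
    by (simp add: GSsp_cmult GSsp_sum lin_on_cmult[OF assms(1)])
qed

text \<open>A substitute for integration with values in the test functions: v is the integral of F
  derivative by derivative, and Riemann sums approximate it in the seminorm. The last conjunct
  retains the scalar estimate for the same nodes, so that values of a functional on the
  \<open>F y\<close> can be summed along with them.\<close>

lemma gb_integral_approx:
  fixes F :: "(real^'n) \<Rightarrow> 'n::finite tfun"
  assumes l: "0 < l" and F: "\<And>y. smooth_fn (F y)" and v: "smooth_fn v"
    and gF: "\<And>y. gb M A l (F y) (\<rho> y)" and \<rho>: "integrable lborel \<rho>"
    and lip: "\<And>R y z. norm y \<le> R \<Longrightarrow> norm z \<le> R \<Longrightarrow> gb M A l (\<lambda>x. F y x - F z x) (L R * norm (y - z))"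
    and D: "\<And>is x. Dlist is v x = (LINT y|lborel. Dlist is (F y) x)"
    and \<epsilon>: "0 < \<epsilon>"
  shows "\<exists>Z a. finite Z \<and> (\<forall>z. 0 \<le> a z) \<and> gb M A l (\<lambda>x. (\<Sum>z\<in>Z. of_real (a z) * F z x) - v x) \<epsilon> \<and>
     (\<forall>h :: real^'n \<Rightarrow> complex. (\<forall>y. norm (h y) \<le> \<rho> y) \<longrightarrow>
     (\<forall>R y z. norm y \<le> R \<longrightarrow> norm z \<le> R \<longrightarrow> norm (h y - h z) \<le> L R * norm (y - z)) \<longrightarrow>
     norm ((\<Sum>z\<in>Z. of_real (a z) * h z) - (LINT y|lborel. h y)) \<le> \<epsilon>)"
proof -
  obtain Z a where Za: "finite Z" "\<And>z. 0 \<le> a z" and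
    st: "\<forall>h :: real^'n \<Rightarrow> complex. (\<forall>y. norm (h y) \<le> \<rho> y) \<longrightarrow>
     (\<forall>R y z. norm y \<le> R \<longrightarrow> norm z \<le> R \<longrightarrow> norm (h y - h z) \<le> L R * norm (y - z)) \<longrightarrow>
     norm ((\<Sum>z\<in>Z. of_real (a z) * h z) - (LINT y|lborel. h y)) \<le> \<epsilon>"
    using uniform_riemann_sums[OF \<rho> \<epsilon>, of L] by (elim exE conjE) (rule that, simp_all)
  note * = st[rule_format]
  have sm: "smooth_fn (\<lambda>x. \<Sum>z\<in>Z. of_real (a z) * F z x)" by (rule smooth_fn_sum(1)[OF Za(1) F])
  have "gb M A l (\<lambda>x. (\<Sum>z\<in>Z. of_real (a z) * F z x) - v x) \<epsilon>"
    unfolding gb_def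
  proof (intro allI)
    fix "is" :: "'n list" and x :: "real^'n"
    \<comment> \<open>This factor normalises the derivative \<open>is\<close> at x: all these
      functions of y then share the majorant \<rho> and the Lipschitz constants L.\<close>
    let ?w = "eo A (norm x / l) / (l ^ length is * M (length is))"
    have w: "0 < ?w" using l by simp
    have nw: "norm (complex_of_real ?w) = ?w" using w by (simp only: norm_of_real abs_of_pos)
    let ?h = "\<lambda>y. of_real ?w * Dlist is (F y) x"
    have "norm ((\<Sum>z\<in>Z. of_real (a z) * ?h z) - (LINT y|lborel. ?h y)) \<le> \<epsilon>"
    proof (rule *)
      show "norm (?h y) \<le> \<rho> y" for y
        using gbD[OF gF[of y], of "is" x] l unfolding norm_mult nw by (simp add: field_simps)
      fix R and y z :: "real^'n" assume yz: "norm y \<le> R" "norm z \<le> R"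
      have "norm (?h y - ?h z) = ?w * norm (Dlist is (F y) x - Dlist is (F z) x)"
        unfolding right_diff_distrib[symmetric] norm_mult nw ..
      also have "\<dots> \<le> L R * norm (y - z)"
        using gbD[OF lip[OF yz], of "is" x] l
        by (simp add: smooth_fn_diff[OF F F] field_simps)
      finally show "norm (?h y - ?h z) \<le> L R * norm (y - z)" .
    qed
    also have "(\<Sum>z\<in>Z. of_real (a z) * ?h z) - (LINT y|lborel. ?h y) =
        of_real ?w * ((\<Sum>z\<in>Z. of_real (a z) * Dlist is (F z) x) - Dlist is v x)"
      unfolding D by (simp only: right_diff_distrib sum_distrib_left mult.left_commute[of "of_real ?w"] integral_mult_right_zero)
    finally have "?w * norm ((\<Sum>z\<in>Z. of_real (a z) * Dlist is (F z) x) - Dlist is v x) \<le> \<epsilon>"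
      unfolding norm_mult nw .
    then show "norm (Dlist is (\<lambda>x. (\<Sum>z\<in>Z. of_real (a z) * F z x) - v x) x) * eo A (norm x / l) \<le> \<epsilon> * (l ^ length is * M (length is))"
      unfolding smooth_fn_diff(2)[OF sm v] smooth_fn_sum(2)[OF Za(1) F] using l by (simp add: field_simps)
  qed
  then show ?thesis
    by (intro exI[of _ Z] exI[of _ a] conjI) (use Za in simp, use Za in simp, assumption, rule st)
qed

text \<open>Continuity of u in a single seminorm lets it pass under the integral: u of a Riemann sum
  is close to u v by the seminorm estimate and to the integral of \<open>u (F y)\<close> by the
  scalar estimate for the same nodes.\<close>

lemma functional_integral:
  fixes F :: "(real^'n) \<Rightarrow> 'n::finite tfun"
  assumes l: "0 < l" and F: "\<And>y. F y \<in> GSsp b M A" and v: "v \<in> GSsp b M A"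
    and gF: "\<And>y. gb M A l (F y) (\<rho> y)" and \<rho>: "integrable lborel \<rho>"
    and lip: "\<And>R y z. norm y \<le> R \<Longrightarrow> norm z \<le> R \<Longrightarrow> gb M A l (\<lambda>x. F y x - F z x) (L R * norm (y - z))"
    and D: "\<And>is x. Dlist is v x = (LINT y|lborel. Dlist is (F y) x)"
    and u: "lin_on (GSsp b M A) u" and uC: "\<And>\<phi> B. \<phi> \<in> GSsp b M A \<Longrightarrow> gb M A l \<phi> B \<Longrightarrow> norm (u \<phi>) \<le> C * B"
  shows "u v = (LINT y|lborel. u (F y))"
proof -
  \<comment> \<open>C may be zero or negative; dividing by the positive C' brings
    \<open>u (F y)\<close> into the class handled by the Riemann sums.\<close>
  define C' where "C' = \<bar>C\<bar> + 1"
  have C': "0 < C'" by (simp add: C'_def)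
  have uC': "norm (u \<phi>) \<le> C' * B" if "\<phi> \<in> GSsp b M A" "gb M A l \<phi> B" for \<phi> B
  proof -
    have "C * B \<le> C' * B" by (intro mult_right_mono gb_nonneg[OF that(2)]) (simp add: C'_def)
    with uC[OF that] show ?thesis by linarith
  qed
  have "norm (u v - (LINT y|lborel. u (F y))) \<le> 0 + e" if e: "0 < e" for e
  proof -
    have pos: "0 < e / (2 * C')" using e C' by simp
    have ex: "\<exists>Z a. finite Z \<and> (\<forall>z. 0 \<le> a z) \<and> gb M A l (\<lambda>x. (\<Sum>z\<in>Z. of_real (a z) * F z x) - v x) (e / (2 * C')) \<and>
     (\<forall>h :: real^'n \<Rightarrow> complex. (\<forall>y. norm (h y) \<le> \<rho> y) \<longrightarrow>
     (\<forall>R y z. norm y \<le> R \<longrightarrow> norm z \<le> R \<longrightarrow> norm (h y - h z) \<le> L R * norm (y - z)) \<longrightarrow>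
     norm ((\<Sum>z\<in>Z. of_real (a z) * h z) - (LINT y|lborel. h y)) \<le> e / (2 * C'))"
      by (rule gb_integral_approx[OF l GSsp_smooth[OF F] GSsp_smooth[OF v] gF \<rho> _ D pos]) (fact lip)
    obtain Z a where Z: "finite Z" "\<And>z. 0 \<le> a z" "gb M A l (\<lambda>x. (\<Sum>z\<in>Z. of_real (a z) * F z x) - v x) (e / (2 * C'))" and
      st: "\<forall>h :: real^'n \<Rightarrow> complex. (\<forall>y. norm (h y) \<le> \<rho> y) \<longrightarrow>
       (\<forall>R y z. norm y \<le> R \<longrightarrow> norm z \<le> R \<longrightarrow> norm (h y - h z) \<le> L R * norm (y - z)) \<longrightarrow>
       norm ((\<Sum>z\<in>Z. of_real (a z) * h z) - (LINT y|lborel. h y)) \<le> e / (2 * C')"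
      using ex by (elim exE conjE) (rule that, simp_all)
    note * = st[rule_format]
    have S: "(\<lambda>x. \<Sum>z\<in>Z. of_real (a z) * F z x) \<in> GSsp b M A" by (rule GSsp_sum[OF Z(1) F])
    have "norm (u (\<lambda>x. (\<Sum>z\<in>Z. of_real (a z) * F z x) - v x)) \<le> C' * (e / (2 * C'))"
      by (rule uC'[OF GSsp_diff[OF S v] Z(3)])
    then have 1: "norm ((\<Sum>z\<in>Z. of_real (a z) * u (F z)) - u v) \<le> e / 2"
      using C' by (simp add: lin_on_diff[OF u S v] lin_on_sum[OF u Z(1) F])
    let ?h = "\<lambda>y. u (F y) / of_real C'"
    have "norm ((\<Sum>z\<in>Z. of_real (a z) * ?h z) - (LINT y|lborel. ?h y)) \<le> e / (2 * C')"
    proof (rule *)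
      show "norm (?h y) \<le> \<rho> y" for y using uC'[OF F gF, of y] C' by (simp add: norm_divide field_simps)
      fix R and y z :: "real^'n" assume yz: "norm y \<le> R" "norm z \<le> R"
      have "norm (u (F y) - u (F z)) \<le> C' * (L R * norm (y - z))"
        using uC'[OF GSsp_diff[OF F F] lip[OF yz]] by (simp add: lin_on_diff[OF u F F])
      then show "norm (?h y - ?h z) \<le> L R * norm (y - z)"
        using C' by (simp add: norm_divide field_simps flip: diff_divide_distrib)
    qed
    also have "(\<Sum>z\<in>Z. of_real (a z) * ?h z) - (LINT y|lborel. ?h y) =
       ((\<Sum>z\<in>Z. of_real (a z) * u (F z)) - (LINT y|lborel. u (F y))) / of_real C'"
      by (simp add: diff_divide_distrib sum_divide_distrib)
    finally have 2: "norm ((\<Sum>z\<in>Z. of_real (a z) * u (F z)) - (LINT y|lborel. u (F y))) \<le> e / 2"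
      using C' by (simp add: norm_divide field_simps)
    have "u v - (LINT y|lborel. u (F y)) = ((\<Sum>z\<in>Z. of_real (a z) * u (F z)) - (LINT y|lborel. u (F y)))
        - ((\<Sum>z\<in>Z. of_real (a z) * u (F z)) - u v)" by simp
    then show ?thesis using norm_triangle_ineq4[of "(\<Sum>z\<in>Z. of_real (a z) * u (F z)) - (LINT y|lborel. u (F y))"
         "(\<Sum>z\<in>Z. of_real (a z) * u (F z)) - u v"] 1 2 by simp
  qed
  then have "norm (u v - (LINT y|lborel. u (F y))) \<le> 0" by (rule field_le_epsilon)
  then show ?thesis by simp
qed

text \<open>Minkowski's integral inequality, again by Riemann sums, for a seminorm N controlled at
  the parameter l. It is applied to the norm of E, with \<kappa> coming from the translation
  bound.\<close>

lemma seminorm_integral: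
  fixes F :: "(real^'n) \<Rightarrow> 'n::finite tfun" and N :: "'n tfun \<Rightarrow> real"
  assumes l: "0 < l" and F: "\<And>y. F y \<in> GSsp b M A" and v: "v \<in> GSsp b M A"
    and gF: "\<And>y. gb M A l (F y) (\<rho> y)" and \<rho>: "integrable lborel \<rho>"
    and lip: "\<And>R y z. norm y \<le> R \<Longrightarrow> norm z \<le> R \<Longrightarrow> gb M A l (\<lambda>x. F y x - F z x) (L R * norm (y - z))"
    and D: "\<And>is x. Dlist is v x = (LINT y|lborel. Dlist is (F y) x)"
    and Nadd: "\<And>\<phi> \<psi>. \<phi> \<in> GSsp b M A \<Longrightarrow> \<psi> \<in> GSsp b M A \<Longrightarrow> N (\<lambda>x. \<phi> x + \<psi> x) \<le> N \<phi> + N \<psi>"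
    and Ncm: "\<And>\<phi> c. \<phi> \<in> GSsp b M A \<Longrightarrow> N (\<lambda>x. c * \<phi> x) = norm c * N \<phi>"
    and Nnn: "\<And>\<phi>. \<phi> \<in> GSsp b M A \<Longrightarrow> 0 \<le> N \<phi>"
    and NC: "\<And>\<phi> B. \<phi> \<in> GSsp b M A \<Longrightarrow> gb M A l \<phi> B \<Longrightarrow> N \<phi> \<le> C * B"
    and \<kappa>: "integrable lborel \<kappa>" "\<And>y. N (F y) \<le> \<kappa> y"
  shows "N v \<le> (LINT y|lborel. \<kappa> y)"
proof -
  define C' where "C' = \<bar>C\<bar> + 1"
  have C': "0 < C'" by (simp add: C'_def)
  have NC': "N \<phi> \<le> C' * B" if "\<phi> \<in> GSsp b M A" "gb M A l \<phi> B" for \<phi> B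
  proof -
    have "C * B \<le> C' * B" by (intro mult_right_mono gb_nonneg[OF that(2)]) (simp add: C'_def)
    with NC[OF that] show ?thesis by linarith
  qed
  have Nneg: "N (\<lambda>x. \<phi> x - \<psi> x) = N (\<lambda>x. \<psi> x - \<phi> x)" if "\<phi> \<in> GSsp b M A" "\<psi> \<in> GSsp b M A" for \<phi> \<psi>
    using Ncm[OF GSsp_diff[OF that], of "-1"] by simp
  have Ntri: "N \<phi> \<le> N \<psi> + N (\<lambda>x. \<phi> x - \<psi> x)" if "\<phi> \<in> GSsp b M A" "\<psi> \<in> GSsp b M A" for \<phi> \<psi>
    using Nadd[OF that(2) GSsp_diff[OF that]] by simp
  have Nsum: "N (\<lambda>x. \<Sum>z\<in>Z. of_real (a z) * F z x) \<le> (\<Sum>z\<in>Z. a z * N (F z))"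
    if "finite Z" "\<And>z. 0 \<le> a z" for Z and a :: "real^'n \<Rightarrow> real"
    using that(1)
  proof (induction Z rule: finite_induct)
    case empty show ?case using Ncm[OF GSsp_zero, of 0] by simp
  next
    case (insert z Z)
    have az: "N (\<lambda>x. of_real (a z) * F z x) = a z * N (F z)" using Ncm[OF F, of "of_real (a z)" z] that(2) by simp
    have "N (\<lambda>x. of_real (a z) * F z x + (\<Sum>z\<in>Z. of_real (a z) * F z x)) \<le> a z * N (F z) + N (\<lambda>x. \<Sum>z\<in>Z. of_real (a z) * F z x)"
      unfolding az[symmetric] by (rule Nadd[OF GSsp_cmult[OF F] GSsp_sum[OF insert.hyps(1) F]])
    then show ?case using insert by simp
  qed
  have dL: "norm (N (F y) - N (F z)) \<le> C' * (L R * norm (y - z))" if yz: "norm y \<le> R" "norm z \<le> R" for R y z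
    using Ntri[OF F F, of y z] Ntri[OF F F, of z y] Nneg[OF F F, of z y] NC'[OF GSsp_diff[OF F F] lip[OF yz]] by simp
  have cont: "continuous_on UNIV (\<lambda>y. complex_of_real (N (F y)))"
  proof (rule locally_lipschitz_continuous)
    show "norm (complex_of_real (N (F y)) - complex_of_real (N (F z))) \<le> (C' * L R) * norm (y - z)"
      if "norm y \<le> R" "norm z \<le> R" for R y z
      using dL[OF that] by (simp add: mult.assoc flip: of_real_diff)
  qed
  then have "continuous_on UNIV (\<lambda>y. Re (complex_of_real (N (F y))))" by (rule continuous_on_Re)
  then have m: "(\<lambda>y. N (F y)) \<in> borel_measurable borel" by (intro borel_measurable_continuous_onI) simp
  have Nint: "integrable lborel (\<lambda>y. N (F y))"
    by (rule Bochner_Integration.integrable_bound[OF \<kappa>(1)])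
      (use m \<kappa>(2) Nnn[OF F] in \<open>auto intro!: AE_I2 order_trans[OF _ abs_ge_self]\<close>)
  have "N v \<le> (LINT y|lborel. N (F y)) + e" if e: "0 < e" for e
  proof -
    have pos: "0 < e / (2 * C')" using e C' by simp
    have ex: "\<exists>Z a. finite Z \<and> (\<forall>z. 0 \<le> a z) \<and> gb M A l (\<lambda>x. (\<Sum>z\<in>Z. of_real (a z) * F z x) - v x) (e / (2 * C')) \<and>
     (\<forall>h :: real^'n \<Rightarrow> complex. (\<forall>y. norm (h y) \<le> \<rho> y) \<longrightarrow>
     (\<forall>R y z. norm y \<le> R \<longrightarrow> norm z \<le> R \<longrightarrow> norm (h y - h z) \<le> L R * norm (y - z)) \<longrightarrow>
     norm ((\<Sum>z\<in>Z. of_real (a z) * h z) - (LINT y|lborel. h y)) \<le> e / (2 * C'))"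
      by (rule gb_integral_approx[OF l GSsp_smooth[OF F] GSsp_smooth[OF v] gF \<rho> _ D pos]) (fact lip)
    obtain Z a where Z: "finite Z" "\<And>z. 0 \<le> a z" "gb M A l (\<lambda>x. (\<Sum>z\<in>Z. of_real (a z) * F z x) - v x) (e / (2 * C'))" and
      st: "\<forall>h :: real^'n \<Rightarrow> complex. (\<forall>y. norm (h y) \<le> \<rho> y) \<longrightarrow>
       (\<forall>R y z. norm y \<le> R \<longrightarrow> norm z \<le> R \<longrightarrow> norm (h y - h z) \<le> L R * norm (y - z)) \<longrightarrow>
       norm ((\<Sum>z\<in>Z. of_real (a z) * h z) - (LINT y|lborel. h y)) \<le> e / (2 * C')"
      using ex by (elim exE conjE) (rule that, simp_all)
    note * = st[rule_format]
    have S: "(\<lambda>x. \<Sum>z\<in>Z. of_real (a z) * F z x) \<in> GSsp b M A" by (rule GSsp_sum[OF Z(1) F])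
    have "N (\<lambda>x. (\<Sum>z\<in>Z. of_real (a z) * F z x) - v x) \<le> C' * (e / (2 * C'))"
      by (rule NC'[OF GSsp_diff[OF S v] Z(3)])
    moreover have ns: "N (\<lambda>x. \<Sum>z\<in>Z. of_real (a z) * F z x) \<le> (\<Sum>z\<in>Z. a z * N (F z))"
      by (rule Nsum[OF Z(1)]) (rule Z(2))
    ultimately have 1: "N v \<le> (\<Sum>z\<in>Z. a z * N (F z)) + e / 2"
      using Ntri[OF v S] Nneg[OF v S] ns C' by simp
    let ?h = "\<lambda>y. complex_of_real (N (F y) / C')"
    have "norm ((\<Sum>z\<in>Z. of_real (a z) * ?h z) - (LINT y|lborel. ?h y)) \<le> e / (2 * C')"
    proof (rule *)
      show "norm (?h y) \<le> \<rho> y" for y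
        unfolding norm_of_real using NC'[OF F gF, of y] Nnn[OF F, of y] C' by (simp add: field_simps)
      fix R and y z :: "real^'n" assume yz: "norm y \<le> R" "norm z \<le> R"
      show "norm (?h y - ?h z) \<le> L R * norm (y - z)"
        unfolding of_real_diff[symmetric] norm_of_real diff_divide_distrib[symmetric]
        using dL[OF yz] C' by (simp add: field_simps)
    qed
    also have "(\<Sum>z\<in>Z. of_real (a z) * ?h z) - (LINT y|lborel. ?h y) =
       of_real (((\<Sum>z\<in>Z. a z * N (F z)) - (LINT y|lborel. N (F y))) / C')"
      by (simp add: diff_divide_distrib sum_divide_distrib)
    finally have "\<bar>(\<Sum>z\<in>Z. a z * N (F z)) - (LINT y|lborel. N (F y))\<bar> \<le> e / 2"
      unfolding norm_of_real using C' by (simp add: field_simps)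
    with 1 show ?thesis by linarith
  qed
  then have "N v \<le> (LINT y|lborel. N (F y))" by (rule field_le_epsilon)
  also have "\<dots> \<le> (LINT y|lborel. \<kappa> y)" by (intro Bochner_Integration.integral_mono Nint \<kappa>)
  finally show ?thesis .
qed

end

section \<open>Fourier inversion at the origin\<close>

definition gaussian :: "real^'n::finite \<Rightarrow> real" where
  "gaussian z = (\<Prod>i\<in>UNIV. std_normal_density (z $ i))"

lemma integrable_gaussian: "integrable lborel (gaussian :: real^'n::finite \<Rightarrow> real)"
  unfolding gaussian_def by (rule lborel_vec_prod) simp

lemma integral_gaussian: "(LINT z|lborel. gaussian (z :: real^'n::finite)) = 1"
  unfolding gaussian_def by (subst lborel_vec_prod) (simp_all add: integral_normal_density)

lemma gaussian_nonneg: "0 \<le> gaussian z"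
  unfolding gaussian_def by (intro prod_nonneg) auto

lemma gaussian_measurable [measurable]: "gaussian \<in> borel_measurable borel"
  using integrable_gaussian by auto

lemma isCont_gaussian: "isCont gaussian z"
  unfolding gaussian_def normal_density_def by (intro continuous_intros) auto

lemma gaussian_le: "gaussian (z :: real^'n::finite) \<le> 1 / sqrt (2 * pi) ^ CARD('n)"
proof -
  have "gaussian z \<le> (\<Prod>i\<in>(UNIV::'n set). 1 / sqrt (2 * pi))"
    unfolding gaussian_def by (rule prod_mono) (auto simp: normal_density_def intro!: divide_right_mono)
  then show ?thesis by (simp add: power_divide)
qed

text \<open>The coordinates separate, and each one-dimensional factor is the characteristic function
  of the standard normal distribution.\<close>

lemma fourier_gaussian:
  "(LINT z|lborel. of_real (gaussian z) * cis (u \<bullet> z)) = complex_of_real (sqrt (2 * pi) ^ CARD('n) * gaussian (u :: real^'n::finite))"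
proof -
  have int: "integrable lborel (\<lambda>t. complex_of_real (std_normal_density t) * iexp (u $ i * t))" for i
    by (rule Bochner_Integration.integrable_bound[where f=std_normal_density]) (auto simp: norm_mult)
  have one: "(LINT t|lborel. complex_of_real (std_normal_density t) * iexp (u $ i * t)) =
      complex_of_real (sqrt (2 * pi) * std_normal_density (u $ i))" for i
  proof -
    have "(LINT t|lborel. complex_of_real (std_normal_density t) * iexp (u $ i * t)) = char std_normal_distribution (u $ i)"
      unfolding char_def by (subst integral_density) (auto simp: scaleR_conv_of_real)
    also have "\<dots> = complex_of_real (exp (- ((u $ i)^2) / 2))" by (simp add: char_std_normal_distribution)
    finally show ?thesis by (simp add: std_normal_density_def)
  qed
  have "of_real (gaussian z) * cis (u \<bullet> z) = (\<Prod>i\<in>UNIV. complex_of_real (std_normal_density (z $ i)) * iexp (u $ i * z $ i))" for z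
    by (simp add: gaussian_def prod.distrib cis_conv_exp inner_vec_def sum_distrib_left exp_sum)
  then have "(LINT z|lborel. of_real (gaussian z) * cis (u \<bullet> z)) =
     (\<Prod>i\<in>UNIV. LINT t|lborel. complex_of_real (std_normal_density t) * iexp (u $ i * t))"
    using lborel_vec_prod(2)[of "\<lambda>i t. complex_of_real (std_normal_density t) * iexp (u $ i * t)", OF int] by simp
  also have "\<dots> = (\<Prod>i\<in>UNIV. complex_of_real (sqrt (2 * pi) * std_normal_density (u $ i)))"
    by (rule prod.cong[OF refl one])
  finally show ?thesis by (simp add: gaussian_def prod.distrib)
qed

lemma cis_inner_measurable [measurable]: "(\<lambda>z. cis (c * (u \<bullet> z))) \<in> borel_measurable (borel :: (real^'n::finite) measure)"
  by (intro borel_measurable_continuous_onI continuous_intros)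

text \<open>Both sides are integrals of \<open>h\<close> against a Gaussian; the scaling by \<open>e\<close> makes it an
  approximate identity on the left and an approximate unit on the right.\<close>
lemma fourier_gaussian_swap:
  fixes h :: "real^'n::finite \<Rightarrow> complex"
  assumes h: "integrable lborel h" and e: "0 < e"
  shows "(LINT u|lborel. h (e *\<^sub>R u) * of_real (gaussian u)) =
     of_real (sqrt (2 * pi) ^ CARD('n)) *
       (LINT \<xi>|lborel. of_real (gaussian ((2 * pi * e) *\<^sub>R \<xi>)) * (LINT s|lborel. h s * cis (2 * pi * (\<xi> \<bullet> s))))"
proof -
  let ?n = "CARD('n)" and ?c = "2 * pi * e"
  have c: "0 < ?c" using e by simp
  have [measurable]: "h \<in> borel_measurable borel" using h by auto
  have gi: "integrable lborel (\<lambda>\<xi>::real^'n. gaussian (?c *\<^sub>R \<xi>))"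
    using integrable_lborel_affine[OF integrable_gaussian, of ?c 0] e by simp
  have cm [measurable]: "(\<lambda>p::(real^'n) \<times> (real^'n). cis (2 * pi * (fst p \<bullet> snd p))) \<in> borel_measurable borel"
    by (intro borel_measurable_continuous_onI continuous_intros)
  have cm' [measurable]: "(\<lambda>p::(real^'n) \<times> (real^'n). cis (2 * pi * (fst p \<bullet> snd p))) \<in> borel_measurable (lborel \<Otimes>\<^sub>M lborel)"
    using cm by (simp add: lborel_prod)
  \<comment> \<open>The transform of the dilated Gaussian, by the substitution z = 2 pi e
    \<xi>.\<close>
  have inner: "(LINT \<xi>|lborel. of_real (gaussian (?c *\<^sub>R \<xi>)) * cis (2 * pi * (\<xi> \<bullet> s))) =
      of_real (sqrt (2 * pi) ^ ?n / ?c ^ ?n * gaussian ((1 / e) *\<^sub>R s))" for s :: "real^'n"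
  proof -
    have "of_real (sqrt (2 * pi) ^ ?n * gaussian ((1 / e) *\<^sub>R s)) =
       (LINT z|lborel. of_real (gaussian z) * cis (((1 / e) *\<^sub>R s) \<bullet> z))"
      by (rule fourier_gaussian[symmetric])
    also have "\<dots> = ?c ^ ?n *\<^sub>R (LINT \<xi>|lborel. of_real (gaussian (?c *\<^sub>R \<xi>)) * cis (((1 / e) *\<^sub>R s) \<bullet> (?c *\<^sub>R \<xi>)))"
      using integral_lborel_affine[of "\<lambda>z. of_real (gaussian z) * cis (((1 / e) *\<^sub>R s) \<bullet> z)" ?c 0] e
        cis_inner_measurable[of "1/e" s] by simp
    also have "(\<lambda>\<xi>. cis (((1 / e) *\<^sub>R s) \<bullet> (?c *\<^sub>R \<xi>))) = (\<lambda>\<xi>. cis (2 * pi * (\<xi> \<bullet> s)))"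
      using e by (simp add: fun_eq_iff inner_commute mult.assoc)
    finally have F: "complex_of_real (sqrt (2 * pi) ^ ?n * gaussian ((1 / e) *\<^sub>R s)) =
       ?c ^ ?n *\<^sub>R (LINT \<xi>|lborel. of_real (gaussian (?c *\<^sub>R \<xi>)) * cis (2 * pi * (\<xi> \<bullet> s)))" .
    have "complex_of_real (sqrt (2 * pi) ^ ?n / ?c ^ ?n * gaussian ((1 / e) *\<^sub>R s)) =
       inverse (?c ^ ?n) *\<^sub>R complex_of_real (sqrt (2 * pi) ^ ?n * gaussian ((1 / e) *\<^sub>R s))"
      unfolding scaleR_conv_of_real of_real_mult[symmetric] by (simp only: divide_inverse mult_ac)
    then show ?thesis unfolding F scaleR_scaleR using e by simp
  qed
  have fub: "(LINT \<xi>|lborel. LINT s|lborel. of_real (gaussian (?c *\<^sub>R \<xi>)) * (h s * cis (2 * pi * (\<xi> \<bullet> s)))) =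
     (LINT s|lborel. LINT \<xi>|lborel. of_real (gaussian (?c *\<^sub>R \<xi>)) * (h s * cis (2 * pi * (\<xi> \<bullet> s))))"
  proof (rule lborel_pair.Fubini_integral[symmetric])
    let ?f = "\<lambda>p. complex_of_real (gaussian (?c *\<^sub>R fst p)) * (h (snd p) * cis (2 * pi * (fst p \<bullet> snd p)))"
    have "integrable (lborel \<Otimes>\<^sub>M lborel) ?f"
    proof (rule lborel_pair.Fubini_integrable)
      show "?f \<in> borel_measurable (lborel \<Otimes>\<^sub>M lborel)" by measurable
      have "integrable lborel (\<lambda>\<xi>::real^'n. gaussian (?c *\<^sub>R \<xi>) * (LINT s|lborel. norm (h s)))"
        by (intro integrable_mult_left gi)
      then show "integrable lborel (\<lambda>\<xi>. LINT s|lborel. norm (?f (\<xi>, s)))"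
        by (simp add: norm_mult gaussian_nonneg)
      have "integrable lborel (\<lambda>s. h s * cis (2 * pi * (\<xi> \<bullet> s)))" for \<xi>
        by (rule Bochner_Integration.integrable_bound[OF h]) (auto simp: norm_mult)
      then show "AE \<xi> in lborel. integrable lborel (\<lambda>s. ?f (\<xi>, s))" by simp
    qed
    then show "integrable (lborel \<Otimes>\<^sub>M lborel) (\<lambda>(\<xi>, s). complex_of_real (gaussian (?c *\<^sub>R \<xi>)) * (h s * cis (2 * pi * (\<xi> \<bullet> s))))"
      by (simp add: case_prod_unfold)
  qed
  have sw: "(LINT \<xi>|lborel. of_real (gaussian (?c *\<^sub>R \<xi>)) * (h s * cis (2 * pi * (\<xi> \<bullet> s)))) =
      h s * (LINT \<xi>|lborel. of_real (gaussian (?c *\<^sub>R \<xi>)) * cis (2 * pi * (\<xi> \<bullet> s)))" for s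
    by (subst mult.left_commute) (rule integral_mult_right_zero)
  have "(LINT \<xi>|lborel. of_real (gaussian (?c *\<^sub>R \<xi>)) * (LINT s|lborel. h s * cis (2 * pi * (\<xi> \<bullet> s)))) =
     (LINT s|lborel. h s * (LINT \<xi>|lborel. of_real (gaussian (?c *\<^sub>R \<xi>)) * cis (2 * pi * (\<xi> \<bullet> s))))"
    using fub unfolding integral_mult_right_zero sw .
  also have "\<dots> = of_real (sqrt (2 * pi) ^ ?n / ?c ^ ?n) * (LINT s|lborel. h s * of_real (gaussian ((1 / e) *\<^sub>R s)))"
    unfolding inner
    by (subst integral_mult_right_zero[symmetric], rule Bochner_Integration.integral_cong[OF refl])
      (simp only: of_real_mult mult_ac)
  also have "(LINT s|lborel. h s * of_real (gaussian ((1 / e) *\<^sub>R s))) =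
     of_real (e ^ ?n) * (LINT u|lborel. h (e *\<^sub>R u) * of_real (gaussian u))"
  proof -
    have m: "(\<lambda>s. h s * of_real (gaussian ((1 / e) *\<^sub>R s))) \<in> borel_measurable borel" by measurable
    have "(LINT s|lborel. h s * of_real (gaussian ((1 / e) *\<^sub>R s))) =
       \<bar>e\<bar> ^ DIM(real^'n) *\<^sub>R (LINT u|lborel. h (0 + e *\<^sub>R u) * of_real (gaussian ((1 / e) *\<^sub>R (0 + e *\<^sub>R u))))"
      by (rule integral_lborel_affine[OF m]) (use e in simp)
    then show ?thesis using e by (simp add: scaleR_conv_of_real[of "e ^ CARD('n)"])
  qed
  finally have "of_real (sqrt (2 * pi) ^ ?n) * (LINT \<xi>|lborel. of_real (gaussian (?c *\<^sub>R \<xi>)) * (LINT s|lborel. h s * cis (2 * pi * (\<xi> \<bullet> s)))) =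
     of_real (sqrt (2 * pi) ^ ?n * (sqrt (2 * pi) ^ ?n / ?c ^ ?n * e ^ ?n)) * (LINT u|lborel. h (e *\<^sub>R u) * of_real (gaussian u))"
    by (simp add: mult.assoc)
  \<comment> \<open>All constants cancel: (2 pi)^n e^n / (2 pi e)^n = 1.\<close>
  also have "sqrt (2 * pi) ^ ?n * (sqrt (2 * pi) ^ ?n / ?c ^ ?n * e ^ ?n) = 1"
    using e by (simp add: power_mult_distrib[symmetric] power_divide[symmetric] del: power_mult_distrib)
  finally show ?thesis by simp
qed

text \<open>Let e tend to 0 in \<open>fourier_gaussian_swap\<close>: by dominated convergence one
  side tends to h 0, the other to the integral of the transform. The value at the origin is enough,
  since \<open>Kop\<close> already contains the translation to an arbitrary point.\<close>

lemma fourier_inversion_origin: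
  fixes h :: "real^'n::finite \<Rightarrow> complex"
  assumes h: "integrable lborel h" and cont: "isCont h 0" and bd: "\<And>x. norm (h x) \<le> B"
    and hhat: "integrable lborel (\<lambda>\<xi>. LINT s|lborel. h s * cis (2 * pi * (\<xi> \<bullet> s)))"
  shows "(LINT \<xi>|lborel. LINT s|lborel. h s * cis (2 * pi * (\<xi> \<bullet> s))) = h 0"
proof -
  let ?k = "sqrt (2 * pi) ^ CARD('n)"
  let ?H = "\<lambda>\<xi>. LINT s|lborel. h s * cis (2 * pi * (\<xi> \<bullet> s))"
  have [measurable]: "h \<in> borel_measurable borel" "?H \<in> borel_measurable borel" using h hhat by auto
  define e where "e n = inverse (real (Suc n))" for n
  have e: "0 < e n" for n by (simp add: e_def)
  have e0: "e \<longlonglongrightarrow> 0" unfolding e_def by (rule LIMSEQ_inverse_real_of_nat)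
  have 1: "(\<lambda>n. LINT u|lborel. h (e n *\<^sub>R u) * of_real (gaussian u)) \<longlonglongrightarrow> (LINT u::real^'n|lborel. h 0 * of_real (gaussian u))"
  proof (rule integral_dominated_convergence[where w="\<lambda>u. B * gaussian u"])
    have "(\<lambda>n. h (e n *\<^sub>R u) * of_real (gaussian u)) \<longlonglongrightarrow> h 0 * of_real (gaussian u)" for u :: "real^'n"
    proof (intro tendsto_mult tendsto_const isCont_tendsto_compose[OF cont])
      show "(\<lambda>n. e n *\<^sub>R u) \<longlonglongrightarrow> 0" using tendsto_scaleR[OF e0 tendsto_const[of u]] by simp
    qed
    then show "AE u in lborel. (\<lambda>n. h (e n *\<^sub>R u) * of_real (gaussian u)) \<longlonglongrightarrow> h 0 * of_real (gaussian u)" by simp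
  qed (auto simp: norm_mult gaussian_nonneg abs_of_nonneg intro!: integrable_mult_right integrable_gaussian mult_right_mono bd AE_I2)
  have "(LINT u::real^'n|lborel. h 0 * of_real (gaussian u)) = h 0"
    using integral_gaussian[where 'n='n] by simp
  with 1 have 1: "(\<lambda>n. LINT u|lborel. h (e n *\<^sub>R u) * of_real (gaussian u)) \<longlonglongrightarrow> h 0" by (simp only:)
  have "(\<lambda>n. LINT \<xi>|lborel. of_real (gaussian ((2 * pi * e n) *\<^sub>R \<xi>)) * ?H \<xi>) \<longlonglongrightarrow> (LINT \<xi>::real^'n|lborel. of_real (gaussian (0::real^'n)) * ?H \<xi>)"
  proof (rule integral_dominated_convergence[where w="\<lambda>\<xi>. 1 / ?k * norm (?H \<xi>)"])
    have "(\<lambda>n. of_real (gaussian ((2 * pi * e n) *\<^sub>R \<xi>)) * ?H \<xi>) \<longlonglongrightarrow> of_real (gaussian (0::real^'n)) * ?H \<xi>" for \<xi>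
    proof (intro tendsto_mult tendsto_const tendsto_of_real isCont_tendsto_compose[OF isCont_gaussian])
      show "(\<lambda>n. (2 * pi * e n) *\<^sub>R \<xi>) \<longlonglongrightarrow> 0"
        using tendsto_scaleR[OF tendsto_mult_right_zero[OF e0, of "2 * pi"] tendsto_const[of \<xi>]] by simp
    qed
    then show "AE \<xi> in lborel. (\<lambda>n. of_real (gaussian ((2 * pi * e n) *\<^sub>R \<xi>)) * ?H \<xi>) \<longlonglongrightarrow> of_real (gaussian (0::real^'n)) * ?H \<xi>"
      by simp
    show "integrable lborel (\<lambda>\<xi>. 1 / ?k * norm (?H \<xi>))" by (intro integrable_mult_right integrable_norm hhat)
    show "AE \<xi> in lborel. norm (of_real (gaussian ((2 * pi * e n) *\<^sub>R \<xi>)) * ?H \<xi>) \<le> 1 / ?k * norm (?H \<xi>)" for n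
      unfolding norm_mult norm_of_real abs_of_nonneg[OF gaussian_nonneg]
      by (intro AE_I2 mult_right_mono gaussian_le) auto
  qed measurable
  then have "(\<lambda>n. of_real ?k * (LINT \<xi>|lborel. of_real (gaussian ((2 * pi * e n) *\<^sub>R \<xi>)) * ?H \<xi>)) \<longlonglongrightarrow>
      of_real ?k * (LINT \<xi>::real^'n|lborel. of_real (gaussian (0::real^'n)) * ?H \<xi>)"
    by (intro tendsto_mult tendsto_const)
  moreover have "of_real ?k * (LINT \<xi>::real^'n|lborel. of_real (gaussian (0::real^'n)) * ?H \<xi>) = (LINT \<xi>|lborel. ?H \<xi>)"
  proof -
    have "?k * gaussian (0::real^'n) = 1" by (simp add: gaussian_def normal_density_def power_divide)
    then have "complex_of_real ?k * of_real (gaussian (0::real^'n)) = 1" by (simp only: of_real_mult[symmetric] of_real_1)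
    then show ?thesis unfolding integral_mult_right_zero mult.assoc[symmetric] by (simp only: mult_1)
  qed
  ultimately have A: "(\<lambda>n. of_real ?k * (LINT \<xi>|lborel. of_real (gaussian ((2 * pi * e n) *\<^sub>R \<xi>)) * ?H \<xi>)) \<longlonglongrightarrow>
      (LINT \<xi>|lborel. ?H \<xi>)" by (simp only:)
  have B: "(\<lambda>n. of_real ?k * (LINT \<xi>|lborel. of_real (gaussian ((2 * pi * e n) *\<^sub>R \<xi>)) * ?H \<xi>)) =
      (\<lambda>n. LINT u|lborel. h (e n *\<^sub>R u) * of_real (gaussian u))"
    by (rule ext) (rule fourier_gaussian_swap[OF h e, symmetric])
  show ?thesis by (rule LIMSEQ_unique[OF A]) (unfold B, rule 1)
qed

section \<open>The reproducing formula\<close>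

text \<open>Membership in the test function space is a condition of the form \<open>qb b P\<close> with \<open>P\<close>
  upward closed; continuity of a functional is one of the dual form \<open>bq b P\<close>.\<close>
definition qb :: "bool \<Rightarrow> (real \<Rightarrow> bool) \<Rightarrow> bool" where
  "qb b P \<longleftrightarrow> (if b then (\<forall>l>0. P l) else (\<exists>l>0. P l))"

text \<open>The two quantifier patterns are dual, so a test function and a continuous functional
  always have a parameter in common. This spares many arguments the distinction between the two
  cases.\<close>

lemma qb_bq_meet: "qb b P \<Longrightarrow> bq b Q \<Longrightarrow> \<exists>l>0. P l \<and> Q l"
  unfolding qb_def bq_def by (auto split: if_splits)

lemma qb_ex: "qb b P \<Longrightarrow> \<exists>l>0. P l"
  unfolding qb_def by (metis zero_less_one)

lemma qb_mono: "qb b P \<Longrightarrow> (\<And>l. 0 < l \<Longrightarrow> P l \<Longrightarrow> Q l) \<Longrightarrow> qb b Q"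
  unfolding qb_def by (auto split: if_splits)

lemma bq_mono: "bq b P \<Longrightarrow> (\<And>l. P l \<Longrightarrow> Q l) \<Longrightarrow> bq b Q"
  unfolding bq_def by (auto split: if_splits)

lemma qb_conj:
  assumes "qb b P" "qb b Q" "\<And>l l'. 0 < l \<Longrightarrow> l \<le> l' \<Longrightarrow> P l \<Longrightarrow> P l'" "\<And>l l'. 0 < l \<Longrightarrow> l \<le> l' \<Longrightarrow> Q l \<Longrightarrow> Q l'"
  shows "qb b (\<lambda>l. P l \<and> Q l)"
proof (cases b)
  case False
  then obtain l1 l2 where "l1 > 0" "P l1" "l2 > 0" "Q l2" using assms(1,2) by (auto simp: qb_def)
  then have "P (max l1 l2) \<and> Q (max l1 l2)" "0 < max l1 l2"
    using assms(3)[of l1 "max l1 l2"] assms(4)[of l2 "max l1 l2"] by auto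
  then show ?thesis using False unfolding qb_def by auto
qed (use assms in \<open>simp add: qb_def\<close>)

lemma qb_scale:
  assumes "qb b P" "0 < c" shows "qb b (\<lambda>l. P (l / c))"
proof (cases b)
  case False
  then obtain l where "l > 0" "P l" using assms(1) by (auto simp: qb_def)
  then show ?thesis using False assms(2) unfolding qb_def by (auto intro!: exI[of _ "l * c"])
qed (use assms in \<open>simp add: qb_def\<close>)

text \<open>The difference of two characters produces a factor |s|, which is absorbed into the
  weight by enlarging its parameter.\<close>

lemma mo_diff_wb:
  assumes A: "weight_seq A" "cond_M2' A" and q: "0 < q"
  shows "\<exists>C>0. \<forall>\<eta> Q. \<forall>\<xi> \<xi>' :: real^'n::finite. wb A (absorb_const A (2 * CARD('n)) * q) \<eta> Q \<longrightarrow>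
     wb A q (\<lambda>s. mo \<xi> \<eta> s - mo \<xi>' \<eta> s) (C * Q * norm (\<xi> - \<xi>'))"
proof -
  let ?H = "absorb_const A (2 * CARD('n))"
  obtain C where C: "C > 0" "\<And>t. t \<ge> 0 \<Longrightarrow> (1 + t) ^ (2 * CARD('n)) * eo A (q * t) \<le> C * eo A (?H * q * t)"
    using absorb_const(2)[OF A q] by blast
  have "wb A q (\<lambda>s. mo \<xi> \<eta> s - mo \<xi>' \<eta> s) (2 * pi * C * Q * norm (\<xi> - \<xi>'))"
    if w: "wb A (?H * q) \<eta> Q" for \<eta> Q and \<xi> \<xi>' :: "real^'n"
    unfolding wb_def
  proof
    fix s :: "real^'n"
    have "norm (mo \<xi> \<eta> s - mo \<xi>' \<eta> s) = norm (cis (2 * pi * (\<xi> \<bullet> s)) - cis (2 * pi * (\<xi>' \<bullet> s))) * norm (\<eta> s)"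
      by (simp add: mo_def norm_mult flip: left_diff_distrib)
    also have "\<dots> \<le> \<bar>2 * pi * (\<xi> \<bullet> s) - 2 * pi * (\<xi>' \<bullet> s)\<bar> * norm (\<eta> s)"
      by (intro mult_right_mono cis_lipschitz) auto
    also have "\<bar>2 * pi * (\<xi> \<bullet> s) - 2 * pi * (\<xi>' \<bullet> s)\<bar> = 2 * pi * \<bar>(\<xi> - \<xi>') \<bullet> s\<bar>"
      by (simp add: inner_diff_left abs_mult flip: right_diff_distrib)
    also have "\<bar>(\<xi> - \<xi>') \<bullet> s\<bar> \<le> norm (\<xi> - \<xi>') * norm s" by (rule Cauchy_Schwarz_ineq2)
    finally have 1: "norm (mo \<xi> \<eta> s - mo \<xi>' \<eta> s) \<le> 2 * pi * (norm (\<xi> - \<xi>') * norm s) * norm (\<eta> s)"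
      by (simp add: mult_left_mono mult_right_mono)
    have "norm s \<le> (1 + norm s) ^ 1" by simp
    also have "\<dots> \<le> (1 + norm s) ^ (2 * CARD('n))" by (rule power_increasing) auto
    finally have "norm s * eo A (q * norm s) \<le> (1 + norm s) ^ (2 * CARD('n)) * eo A (q * norm s)"
      by (rule mult_right_mono) auto
    also have "\<dots> \<le> C * eo A (?H * q * norm s)" by (rule C(2)) auto
    finally have 2: "norm s * eo A (q * norm s) \<le> C * eo A (?H * q * norm s)" .
    have "norm (mo \<xi> \<eta> s - mo \<xi>' \<eta> s) * eo A (q * norm s) \<le> (2 * pi * (norm (\<xi> - \<xi>') * norm s) * norm (\<eta> s)) * eo A (q * norm s)"
      by (intro mult_right_mono 1) auto
    also have "\<dots> = 2 * pi * norm (\<xi> - \<xi>') * norm (\<eta> s) * (norm s * eo A (q * norm s))" by simp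
    also have "\<dots> \<le> 2 * pi * norm (\<xi> - \<xi>') * norm (\<eta> s) * (C * eo A (?H * q * norm s))"
      by (intro mult_left_mono 2) auto
    also have "\<dots> = 2 * pi * norm (\<xi> - \<xi>') * C * (norm (\<eta> s) * eo A (?H * q * norm s))" by simp
    also have "\<dots> \<le> 2 * pi * norm (\<xi> - \<xi>') * C * Q" using C(1) by (intro mult_left_mono wbD[OF w]) auto
    finally show "norm (mo \<xi> \<eta> s - mo \<xi>' \<eta> s) * eo A (q * norm s) \<le> 2 * pi * C * Q * norm (\<xi> - \<xi>')"
      by (simp add: mult_ac)
  qed
  then show ?thesis using C(1) by (intro exI[of _ "2 * pi * C"]) auto
qed

text \<open>The binomial theorem for m acting as a sum of two commuting index shifts. In the
  application m is - 2 pi i \<xi>_i, a counts derivatives of the window and c derivatives of the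
  argument.\<close>

lemma binomial_recursion:
  fixes T :: "nat \<Rightarrow> nat \<Rightarrow> 'a::comm_ring_1"
  assumes "\<And>a c. m * T a c = T (Suc a) c + T a (Suc c)"
  shows "m ^ p * T a c = (\<Sum>j\<le>p. of_nat (p choose j) * T (a + j) (c + (p - j)))"
proof (induction p arbitrary: a c)
  case (Suc p)
  let ?U = "\<lambda>j. T (a + j) (c + (Suc p - j))"
  have "m ^ Suc p * T a c = m ^ p * (m * T a c)" by (simp add: mult_ac)
  also have "\<dots> = m ^ p * T (Suc a) c + m ^ p * T a (Suc c)" unfolding assms by (rule distrib_left)
  also have "\<dots> = (\<Sum>j\<le>p. of_nat (p choose j) * ?U (Suc j)) + (\<Sum>j\<le>p. of_nat (p choose j) * ?U j)"
    unfolding Suc by (intro arg_cong2[where f="(+)"] sum.cong) (auto simp: Suc_diff_le)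
  also have "(\<Sum>j\<le>p. of_nat (p choose j) * ?U j) = (\<Sum>j\<le>Suc p. of_nat (p choose j) * ?U j)"
    by (simp add: binomial_eq_0)
  also have "\<dots> = ?U 0 + (\<Sum>j\<le>p. of_nat (p choose Suc j) * ?U (Suc j))"
    by (subst sum.atMost_Suc_shift) simp
  also have "(\<Sum>j\<le>p. of_nat (p choose j) * ?U (Suc j)) + (?U 0 + (\<Sum>j\<le>p. of_nat (p choose Suc j) * ?U (Suc j))) =
      ?U 0 + (\<Sum>j\<le>p. of_nat (Suc p choose Suc j) * ?U (Suc j))"
    by (simp add: sum.distrib algebra_simps)
  also have "\<dots> = (\<Sum>j\<le>Suc p. of_nat (Suc p choose j) * ?U j)"
    by (subst sum.atMost_Suc_shift) simp
  finally show ?case .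
qed simp

section \<open>Modulated windows: composition, integration by parts, decay in frequency\<close>

lemma mo_Kop_reflect:
  "mo \<xi> (Kop (\<lambda>x. \<eta>1 (- x)) \<eta>2) = Kop (\<lambda>x. mo \<xi> \<eta>1 (- x)) (mo \<xi> \<eta>2)"
proof
  fix x
  have key: "cis (2 * pi * (\<xi> \<bullet> (x + s))) * \<eta>2 (x + s) * (cis (2 * pi * (\<xi> \<bullet> - s)) * \<eta>1 (- s)) =
      cis (2 * pi * (\<xi> \<bullet> x)) * (\<eta>2 (x + s) * \<eta>1 (- s))" for s
  proof -
    have "cis (2 * pi * (\<xi> \<bullet> (x + s))) * cis (2 * pi * (\<xi> \<bullet> - s)) = cis (2 * pi * (\<xi> \<bullet> x))"
      by (simp add: cis_mult inner_add_right algebra_simps)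
    moreover have "cis (2 * pi * (\<xi> \<bullet> (x + s))) * \<eta>2 (x + s) * (cis (2 * pi * (\<xi> \<bullet> - s)) * \<eta>1 (- s)) =
      (cis (2 * pi * (\<xi> \<bullet> (x + s))) * cis (2 * pi * (\<xi> \<bullet> - s))) * (\<eta>2 (x + s) * \<eta>1 (- s))"
      by (simp only: mult_ac)
    ultimately show ?thesis by (simp only:)
  qed
  show "mo \<xi> (Kop (\<lambda>x. \<eta>1 (- x)) \<eta>2) x = Kop (\<lambda>x. mo \<xi> \<eta>1 (- x)) (mo \<xi> \<eta>2) x"
    unfolding mo_def Kop_def key by (rule integral_mult_right_zero[symmetric])
qed

context gs_weights
begin

lemma GSsp_qb: "\<phi> \<in> GSsp b M A \<longleftrightarrow> smooth_fn \<phi> \<and> qb b (\<lambda>l. \<exists>B. gb M A l \<phi> B)"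
  unfolding GSsp_iff qb_def by simp

lemma Kop_GSsp_integrable:
  assumes "\<eta> \<in> GSsp b M A" "\<psi> \<in> GSsp b M A"
  shows "integrable lborel (\<lambda>s. \<psi> (x + s) * \<eta> s)"
proof -
  obtain q Q where q: "q > 0" "wb A q \<eta> Q" using GSsp_wb[OF assms(1)] by blast
  obtain q' P where q': "q' > 0" "wb A q' \<psi> P" using GSsp_wb[OF assms(2)] by blast
  show ?thesis
    by (rule Kop_integrable[OF q GSsp_measurable[OF assms(1)] GSsp_measurable[OF assms(2)]
          wb_bound[OF wsA q'(2) less_imp_le[OF q'(1)]]])
qed

lemma Kop_add_left:
  assumes "\<eta> \<in> GSsp b M A" "\<eta>' \<in> GSsp b M A" "\<psi> \<in> GSsp b M A"
  shows "Kop (\<lambda>x. \<eta> x + \<eta>' x) \<psi> x = Kop \<eta> \<psi> x + Kop \<eta>' \<psi> x"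
  unfolding Kop_def distrib_left
  by (rule Bochner_Integration.integral_add) (intro Kop_GSsp_integrable assms)+

lemma Kop_diff_left:
  assumes "\<eta> \<in> GSsp b M A" "\<eta>' \<in> GSsp b M A" "\<psi> \<in> GSsp b M A"
  shows "Kop (\<lambda>x. \<eta> x - \<eta>' x) \<psi> x = Kop \<eta> \<psi> x - Kop \<eta>' \<psi> x"
  unfolding Kop_def right_diff_distrib
  by (rule Bochner_Integration.integral_diff) (intro Kop_GSsp_integrable assms)+

lemma Kop_cmult_left: "Kop (\<lambda>x. c * \<eta> x) \<psi> x = c * Kop \<eta> \<psi> x"
  unfolding Kop_def by (subst mult.left_commute) (rule integral_mult_right_zero)

lemma Kop_add_right:
  assumes "\<eta> \<in> GSsp b M A" "\<psi> \<in> GSsp b M A" "\<psi>' \<in> GSsp b M A"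
  shows "Kop \<eta> (\<lambda>x. \<psi> x + \<psi>' x) x = Kop \<eta> \<psi> x + Kop \<eta> \<psi>' x"
  unfolding Kop_def distrib_right
  by (rule Bochner_Integration.integral_add) (intro Kop_GSsp_integrable assms)+

lemma Kop_cmult_right: "Kop \<eta> (\<lambda>x. c * \<psi> x) x = c * Kop \<eta> \<psi> x"
  unfolding Kop_def by (simp add: mult.assoc)

text \<open>Associativity of convolution. \<open>Kop\<close> reflects its window, so undoing this
  for the outer one leaves \<eta>1 reflected. The exchange of integrals rests on absolute
  integrability on the product space.\<close>

lemma Kop_Kop:
  fixes \<psi> :: "'n::finite tfun"
  assumes S: "\<eta>1 \<in> GSsp b M A" "\<eta>2 \<in> GSsp b M A" "\<psi> \<in> GSsp b M A"
  shows "Kop \<eta>1 (Kop \<eta>2 \<psi>) = Kop (Kop (\<lambda>x. \<eta>1 (- x)) \<eta>2) \<psi>"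
proof
  fix x
  note [measurable] = S[THEN GSsp_measurable]
  obtain q P where q: "q > 0" "wb A q \<psi> P" using GSsp_wb[OF S(3)] by blast
  have P: "norm (\<psi> y) \<le> P" for y by (rule wb_bound[OF wsA q(2) less_imp_le[OF q(1)]])
  have int: "integrable lborel \<eta>" if "\<eta> \<in> GSsp b M A" for \<eta> :: "'n tfun"
    using GSsp_wb[OF that] GSsp_measurable[OF that] wb_integrable by blast
  let ?f = "\<lambda>p. \<psi> (x + snd p) * (\<eta>2 (snd p - fst p) * \<eta>1 (fst p))"
  have m: "?f \<in> borel_measurable (lborel \<Otimes>\<^sub>M lborel)" by measurable
  have i2: "integrable lborel (\<lambda>s. \<eta>2 (s - t))" for t
    using integrable_lborel_affine[OF int[OF S(2)], of 1 "- t"] by simp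
  have bdf: "norm (?f (t, s)) \<le> P * norm (\<eta>1 t) * norm (\<eta>2 (s - t))" for t s
    using mult_right_mono[OF P[of "x + s"], of "norm (\<eta>1 t) * norm (\<eta>2 (s - t))"]
    by (simp add: norm_mult mult_ac)
  have i2': "integrable lborel (\<lambda>s. ?f (t, s))" for t
  proof (rule Bochner_Integration.integrable_bound[where f="\<lambda>s. P * norm (\<eta>1 t) * norm (\<eta>2 (s - t))"])
    show "integrable lborel (\<lambda>s. P * norm (\<eta>1 t) * norm (\<eta>2 (s - t)))"
      by (intro integrable_mult_right integrable_norm i2)
    show "AE s in lborel. norm (?f (t, s)) \<le> norm (P * norm (\<eta>1 t) * norm (\<eta>2 (s - t)))"
      by (rule AE_I2, rule order_trans[OF bdf], unfold real_norm_def, rule abs_ge_self)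
    show "(\<lambda>s. ?f (t, s)) \<in> borel_measurable lborel" unfolding fst_conv snd_conv by measurable
  qed
  have nn: "(LINT s|lborel. norm (\<eta>2 (s - t))) = (LINT s|lborel. norm (\<eta>2 s))" for t
    using integral_lborel_translate[of "\<lambda>s. norm (\<eta>2 s)" "- t"] by simp
  have fint: "integrable (lborel \<Otimes>\<^sub>M lborel) ?f"
  proof (rule lborel_pair.Fubini_integrable[OF m])
    show "AE t in lborel. integrable lborel (\<lambda>s. ?f (t, s))" using i2' by simp
    show "integrable lborel (\<lambda>t. LINT s|lborel. norm (?f (t, s)))"
    proof (rule Bochner_Integration.integrable_bound[where f="\<lambda>t. P * norm (\<eta>1 t) * (LINT s|lborel. norm (\<eta>2 s))"])
      show "integrable lborel (\<lambda>t. P * norm (\<eta>1 t) * (LINT s|lborel. norm (\<eta>2 s)))"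
        by (intro integrable_mult_left integrable_mult_right integrable_norm int S)
      show "(\<lambda>t. LINT s|lborel. norm (?f (t, s))) \<in> borel_measurable lborel"
        by (rule lborel.borel_measurable_lebesgue_integral) measurable
      have "(LINT s|lborel. norm (?f (t, s))) \<le> P * norm (\<eta>1 t) * (LINT s|lborel. norm (\<eta>2 s))" for t
      proof -
        have "(LINT s|lborel. norm (?f (t, s))) \<le> (LINT s|lborel. P * norm (\<eta>1 t) * norm (\<eta>2 (s - t)))"
          by (intro Bochner_Integration.integral_mono integrable_norm i2' integrable_mult_right i2 bdf)
        then show ?thesis by (simp add: nn)
      qed
      then show "AE t in lborel. norm (LINT s|lborel. norm (?f (t, s))) \<le> norm (P * norm (\<eta>1 t) * (LINT s|lborel. norm (\<eta>2 s)))"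
        by (auto intro!: AE_I2 order_trans[OF _ abs_ge_self])
    qed
  qed
  have "Kop \<eta>1 (Kop \<eta>2 \<psi>) x = (LINT t|lborel. LINT s|lborel. ?f (t, s))"
  proof -
    have "Kop \<eta>2 \<psi> (x + t) * \<eta>1 t = (LINT s|lborel. ?f (t, s))" for t
    proof -
      have "Kop \<eta>2 \<psi> (x + t) = (LINT s|lborel. \<psi> (x + s) * \<eta>2 (s - t))"
        using integral_lborel_translate[of "\<lambda>s. \<psi> (x + s) * \<eta>2 (s - t)" t] by (simp add: Kop_def add.assoc)
      then show ?thesis by (simp add: mult.assoc flip: integral_mult_left_zero)
    qed
    then show ?thesis by (simp add: Kop_def[of \<eta>1])
  qed
  also have "\<dots> = (LINT s|lborel. LINT t|lborel. ?f (t, s))"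
    by (rule lborel_pair.Fubini_integral[symmetric]) (use fint in \<open>simp add: case_prod_unfold\<close>)
  also have "\<dots> = Kop (Kop (\<lambda>x. \<eta>1 (- x)) \<eta>2) \<psi> x"
  proof -
    have r: "(LINT t|lborel. ?f (t, s)) = \<psi> (x + s) * Kop (\<lambda>x. \<eta>1 (- x)) \<eta>2 s" for s
      using integral_lborel_reflect[of "\<lambda>t. \<eta>2 (s - t) * \<eta>1 t" 0] by (simp add: Kop_def)
    show ?thesis unfolding r by (simp only: Kop_def[of _ \<psi>])
  qed
  finally show "Kop \<eta>1 (Kop \<eta>2 \<psi>) x = Kop (Kop (\<lambda>x. \<eta>1 (- x)) \<eta>2) \<psi> x" .
qed

text \<open>Two windows modulated by the same \<xi> act as one modulated window, so a reproducing
  formula for one window can be rewritten with two.\<close>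

lemma Kop_mo_Kop_mo:
  assumes "\<eta>1 \<in> GSsp b M A" "\<eta>2 \<in> GSsp b M A" "\<psi> \<in> GSsp b M A"
  shows "Kop (mo \<xi> \<eta>1) (Kop (mo \<xi> \<eta>2) \<psi>) = Kop (mo \<xi> (Kop (\<lambda>x. \<eta>1 (- x)) \<eta>2)) \<psi>"
  unfolding mo_Kop_reflect by (rule Kop_Kop) (intro GSsp_mo assms)+

text \<open>Differentiating the modulated window yields 2 pi i \<xi>_i times the window plus the
  modulated derivative of \<eta>; the whole derivative can also be moved to \<psi> with a minus
  sign.\<close>

lemma Kop_mo_pdir:
  assumes \<eta>: "\<eta> \<in> GSsp b M A" and \<psi>: "\<psi> \<in> GSsp b M A"
  shows "- (2 * pi * \<xi> $ i * \<i>) * Kop (mo \<xi> \<eta>) \<psi> x = Kop (mo \<xi> (pdir i \<eta>)) \<psi> x + Kop (mo \<xi> \<eta>) (pdir i \<psi>) x"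
proof -
  have "pdir i (mo \<xi> \<eta>) = (\<lambda>x. (2 * pi * \<xi> $ i * \<i>) * mo \<xi> \<eta> x + mo \<xi> (pdir i \<eta>) x)"
    using smooth_fn_mo(2)[OF GSsp_smooth[OF \<eta>], of "[i]" \<xi>]
    by (simp add: mo_def fun_eq_iff scaleR_conv_of_real algebra_simps)
  then have "Kop (pdir i (mo \<xi> \<eta>)) \<psi> x = (2 * pi * \<xi> $ i * \<i>) * Kop (mo \<xi> \<eta>) \<psi> x + Kop (mo \<xi> (pdir i \<eta>)) \<psi> x"
    by (simp add: Kop_add_left[OF GSsp_cmult[OF GSsp_mo[OF \<eta>]] GSsp_mo[OF GSsp_pdir[OF \<eta>]] \<psi>] Kop_cmult_left)
  moreover have "Kop (mo \<xi> \<eta>) (pdir i \<psi>) x = - Kop (pdir i (mo \<xi> \<eta>)) \<psi> x"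
    using GSsp_Kop(2)[OF GSsp_mo[OF \<eta>, of \<xi>] \<psi>, of "[i]"] GSsp_Kop(3)[OF GSsp_mo[OF \<eta>, of \<xi>] \<psi>, of "[i]"]
    by (simp add: fun_eq_iff)
  ultimately show ?thesis by simp
qed

lemma Kop_mo_power:
  assumes \<eta>: "\<eta> \<in> GSsp b M A" and \<psi>: "\<psi> \<in> GSsp b M A"
  shows "(- (2 * pi * \<xi> $ i * \<i>)) ^ p * Kop (mo \<xi> \<eta>) \<psi> x =
    (\<Sum>j\<le>p. of_nat (p choose j) * Kop (mo \<xi> (Dlist (replicate j i) \<eta>)) (Dlist (replicate (p - j) i) \<psi>) x)"
  using binomial_recursion[where a=0 and c=0 and p=p and m="- (2 * pi * \<xi> $ i * \<i>)" and
      T="\<lambda>a c. Kop (mo \<xi> (Dlist (replicate a i) \<eta>)) (Dlist (replicate c i) \<psi>) x"]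
    Kop_mo_pdir[OF GSsp_Dlist[OF \<eta>] GSsp_Dlist[OF \<psi>]] by simp

lemma Kop_mo_bounded:
  assumes \<eta>: "\<eta> \<in> GSsp b M A" and \<psi>: "(\<psi> :: 'n::finite tfun) \<in> GSsp b M A"
  shows "qb b (\<lambda>l. \<exists>C. \<forall>\<xi>. gb M A l (Kop (mo \<xi> \<eta>) \<psi>) C)"
proof -
  let ?H = "HA CARD('n)"
  have "qb b (\<lambda>l. (\<exists>B. gb M A l \<eta> B) \<and> (\<exists>B. gb M A l \<psi> B))"
    using assms by (intro qb_conj) (auto simp: GSsp_qb intro: gb_mono)
  then have "qb b (\<lambda>l. (\<exists>B. gb M A (l / (2 * ?H)) \<eta> B) \<and> (\<exists>B. gb M A (l / (2 * ?H)) \<psi> B))"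
    by (rule qb_scale) simp
  then show ?thesis
  proof (rule qb_mono)
    fix l :: real assume l: "0 < l" and "(\<exists>B. gb M A (l / (2 * ?H)) \<eta> B) \<and> (\<exists>B. gb M A (l / (2 * ?H)) \<psi> B)"
    then obtain B1 B2 where B: "gb M A (l / (2 * ?H)) \<eta> B1" "gb M A (l / (2 * ?H)) \<psi> B2" by blast
    let ?l = "l / (2 * ?H)"
    have l': "0 < ?l" using l by simp
    obtain C where C: "\<And>\<psi> \<eta> B Q. smooth_fn \<psi> \<Longrightarrow> \<eta> \<in> borel_measurable borel \<Longrightarrow> gb M A ?l \<psi> B \<Longrightarrow>
      wb A (1 / ?l) \<eta> Q \<Longrightarrow> gb M A (2 * ?H * ?l) (Kop \<eta> \<psi> :: 'n tfun) (C * B * Q)"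
      using Kop_gb[OF l', where 'n='n] by blast
    have "gb M A l (Kop (mo \<xi> \<eta>) \<psi>) (C * B2 * (B1 * M 0))" for \<xi>
      using C[OF GSsp_smooth[OF \<psi>] GSsp_measurable[OF GSsp_mo[OF \<eta>]] B(2), of \<xi> "B1 * M 0"] gb_wb[OF B(1), of "[]"]
      by simp
    then show "\<exists>C. \<forall>\<xi>. gb M A l (Kop (mo \<xi> \<eta>) \<psi>) C" by blast
  qed
qed

text \<open>Supplies the Lipschitz hypothesis for Riemann sums in \<xi>. The parameter of \<eta> is
  divided once more by \<open>HA\<close> to pay for the factor |s| in
  \<open>mo_diff_wb\<close>.\<close>

lemma Kop_mo_lipschitz:
  assumes \<eta>: "\<eta> \<in> GSsp b M A" and \<psi>: "(\<psi> :: 'n::finite tfun) \<in> GSsp b M A"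
  shows "qb b (\<lambda>l. \<exists>C\<ge>0. \<forall>\<xi> \<xi>'. gb M A l (\<lambda>x. Kop (mo \<xi> \<eta>) \<psi> x - Kop (mo \<xi>' \<eta>) \<psi> x) (C * norm (\<xi> - \<xi>')))"
proof -
  let ?H = "HA CARD('n)"
  have "qb b (\<lambda>l. (\<exists>B. gb M A (l / ?H) \<eta> B) \<and> (\<exists>B. gb M A l \<psi> B))"
  proof (intro qb_conj)
    show "qb b (\<lambda>l. \<exists>B. gb M A (l / ?H) \<eta> B)"
      by (rule qb_scale[where c="?H" and P="\<lambda>l. \<exists>B. gb M A l \<eta> B"]) (use \<eta> in \<open>simp_all add: GSsp_qb\<close>)
    show "\<exists>B. gb M A (l' / ?H) \<eta> B" if "0 < l" "l \<le> l'" "\<exists>B. gb M A (l / ?H) \<eta> B" for l l'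
      using that gb_mono[of "l / ?H" \<eta> _ "l' / ?H"] by (auto simp: divide_right_mono)
  qed (use \<psi> in \<open>auto simp: GSsp_qb intro: gb_mono\<close>)
  then have "qb b (\<lambda>l. (\<exists>B. gb M A (l / (2 * ?H) / ?H) \<eta> B) \<and> (\<exists>B. gb M A (l / (2 * ?H)) \<psi> B))"
    by (rule qb_scale) simp
  then show ?thesis
  proof (rule qb_mono)
    fix l :: real assume l: "0 < l" and "(\<exists>B. gb M A (l / (2 * ?H) / ?H) \<eta> B) \<and> (\<exists>B. gb M A (l / (2 * ?H)) \<psi> B)"
    then obtain B1 B2 where B: "gb M A (l / (2 * ?H) / ?H) \<eta> B1" "gb M A (l / (2 * ?H)) \<psi> B2" by blast
    let ?l = "l / (2 * ?H)"
    have l': "0 < ?l" "0 < 1 / ?l" using l by simp_all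
    obtain C where C: "C > 0" "\<And>\<psi> \<eta> B Q. smooth_fn \<psi> \<Longrightarrow> \<eta> \<in> borel_measurable borel \<Longrightarrow> gb M A ?l \<psi> B \<Longrightarrow>
      wb A (1 / ?l) \<eta> Q \<Longrightarrow> gb M A (2 * ?H * ?l) (Kop \<eta> \<psi> :: 'n tfun) (C * B * Q)"
      using Kop_gb[OF l'(1), where 'n='n] by blast
    obtain C2 where C2: "C2 > 0" "\<And>\<eta> Q \<xi> \<xi>'. wb A (?H * (1 / ?l)) \<eta> Q \<Longrightarrow>
       wb A (1 / ?l) (\<lambda>s. mo \<xi> \<eta> s - mo \<xi>' (\<eta> :: 'n tfun) s) (C2 * Q * norm (\<xi> - \<xi>'))"
      using mo_diff_wb[OF wsA M2A l'(2), where 'n='n] by blast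
    have lH: "?H * (1 / ?l) = 1 / (l / (2 * ?H) / ?H)" by (simp add: field_simps)
    have "wb A (?H * (1 / ?l)) \<eta> (B1 * M 0)" unfolding lH using gb_wb[OF B(1), of "[]"] by simp
    from C2(2)[OF this] have w: "wb A (1 / ?l) (\<lambda>s. mo \<xi> \<eta> s - mo \<xi>' \<eta> s) (C2 * (B1 * M 0) * norm (\<xi> - \<xi>'))" for \<xi> \<xi>' .
    have "gb M A l (\<lambda>x. Kop (mo \<xi> \<eta>) \<psi> x - Kop (mo \<xi>' \<eta>) \<psi> x) ((C * B2 * (C2 * (B1 * M 0))) * norm (\<xi> - \<xi>'))" for \<xi> \<xi>'
      using C(2)[OF GSsp_smooth[OF \<psi>] GSsp_measurable[OF GSsp_diff[OF GSsp_mo[OF \<eta>] GSsp_mo[OF \<eta>]]] B(2) w, of \<xi> \<xi>']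
      by (simp add: Kop_diff_left[OF GSsp_mo[OF \<eta>] GSsp_mo[OF \<eta>] \<psi>, symmetric] mult.assoc)
    moreover have "0 \<le> C * B2 * (C2 * (B1 * M 0))"
      using C(1) C2(1) gb_nonneg[OF B(1)] gb_nonneg[OF B(2)] by simp
    ultimately show "\<exists>C\<ge>0. \<forall>\<xi> \<xi>'. gb M A l (\<lambda>x. Kop (mo \<xi> \<eta>) \<psi> x - Kop (mo \<xi>' \<eta>) \<psi> x) (C * norm (\<xi> - \<xi>'))" by blast
  qed
qed

text \<open>Two integrations by parts in direction i gain the factor 1 + \<xi>_i^2. They replace
  \<eta> and \<psi> by derivatives, so the induction over the coordinates runs over arbitrary test
  functions.\<close>

lemma Kop_mo_decay_aux:
  assumes "finite J"
  shows "\<eta> \<in> GSsp b M A \<Longrightarrow> (\<psi> :: 'n::finite tfun) \<in> GSsp b M A \<Longrightarrow>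
     qb b (\<lambda>l. \<exists>C. \<forall>\<xi>. gb M A l (Kop (mo \<xi> \<eta>) \<psi>) (C * (\<Prod>i\<in>J. inverse (1 + (\<xi> $ i)^2))))"
  using assms
proof (induction J arbitrary: \<eta> \<psi> rule: finite_induct)
  case empty
  then show ?case using Kop_mo_bounded by simp
next
  case (insert i J)
  let ?w = "\<lambda>\<xi>::real^'n. \<Prod>i\<in>J. inverse (1 + (\<xi> $ i)^2)"
  let ?P = "\<lambda>\<eta> \<psi> l. \<exists>C. \<forall>\<xi>. gb M A l (Kop (mo \<xi> \<eta>) (\<psi> :: 'n tfun)) (C * ?w \<xi>)"
  note \<eta> = insert.prems(1) and \<psi> = insert.prems(2)
  have mono: "0 < l \<Longrightarrow> l \<le> l' \<Longrightarrow> ?P \<eta> \<psi> l \<Longrightarrow> ?P \<eta> \<psi> l'" for l l' and \<eta> \<psi> :: "'n tfun"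
    by (meson gb_mono)
  let ?e2 = "pdir i (pdir i \<eta>)" and ?p2 = "pdir i (pdir i \<psi>)"
  have "qb b (\<lambda>l. ?P \<eta> \<psi> l \<and> (?P ?e2 \<psi> l \<and> (?P (pdir i \<eta>) (pdir i \<psi>) l \<and> ?P \<eta> ?p2 l)))"
    by (intro qb_conj insert.IH GSsp_pdir \<eta> \<psi>) (use mono in \<open>(blast)+\<close>)
  then show ?case
  proof (rule qb_mono)
    fix l :: real assume l: "0 < l" and "?P \<eta> \<psi> l \<and> (?P ?e2 \<psi> l \<and> (?P (pdir i \<eta>) (pdir i \<psi>) l \<and> ?P \<eta> ?p2 l))"
    then obtain C1 C2 C3 C4 where C: "\<And>\<xi>. gb M A l (Kop (mo \<xi> \<eta>) \<psi>) (C1 * ?w \<xi>)"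
        "\<And>\<xi>. gb M A l (Kop (mo \<xi> ?e2) \<psi>) (C2 * ?w \<xi>)"
        "\<And>\<xi>. gb M A l (Kop (mo \<xi> (pdir i \<eta>)) (pdir i \<psi>)) (C3 * ?w \<xi>)"
        "\<And>\<xi>. gb M A l (Kop (mo \<xi> \<eta>) ?p2) (C4 * ?w \<xi>)" by blast
    \<comment> \<open>Since (- 2 pi i \<xi>_i)^2 = - 4 pi^2 \<xi>_i^2, the product of \<xi>_i^2 with
      \<open>?K1\<close> is minus \<open>?k\<close> times the second-order binomial
      expansion.\<close>
    let ?k = "1 / (4 * pi^2)"
    have "gb M A l (Kop (mo \<xi> \<eta>) \<psi>) ((C1 + ?k * (C2 + 2 * C3 + C4)) * (\<Prod>i\<in>insert i J. inverse (1 + (\<xi> $ i)^2)))" for \<xi>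
    proof -
      let ?K1 = "Kop (mo \<xi> \<eta>) \<psi>" and ?K2 = "Kop (mo \<xi> ?e2) \<psi>" and ?K3 = "Kop (mo \<xi> (pdir i \<eta>)) (pdir i \<psi>)"
        and ?K4 = "Kop (mo \<xi> \<eta>) ?p2"
      let ?L = "\<lambda>x. ?K1 x + of_real (- ?k) * (?K2 x + (2 * ?K3 x + ?K4 x))"
      have S: "?K1 \<in> GSsp b M A" "?K2 \<in> GSsp b M A" "?K3 \<in> GSsp b M A" "?K4 \<in> GSsp b M A"
        by (intro GSsp_Kop GSsp_mo GSsp_pdir \<eta> \<psi>)+
      note sm = S[THEN GSsp_smooth]
      have eq: "of_real (1 + (\<xi> $ i)^2) * ?K1 x = ?L x" for x
      proof -
        have "of_real (- 4 * pi^2 * (\<xi> $ i)^2) * ?K1 x = (- (2 * pi * \<xi> $ i * \<i>))^2 * ?K1 x"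
          by (simp add: power_mult_distrib)
        also have "\<dots> = ?K2 x + (2 * ?K3 x + ?K4 x)"
          using Kop_mo_power[OF \<eta> \<psi>, of \<xi> i 2 x] by (simp add: numeral_2_eq_2 algebra_simps)
        finally have "?K2 x + (2 * ?K3 x + ?K4 x) = of_real (- 4 * pi^2 * (\<xi> $ i)^2) * ?K1 x" ..
        then have "?L x = ?K1 x + of_real (- ?k) * (of_real (- 4 * pi^2 * (\<xi> $ i)^2) * ?K1 x)" by (simp only:)
        also have "of_real (- ?k) * (of_real (- 4 * pi^2 * (\<xi> $ i)^2) * ?K1 x) = of_real ((\<xi> $ i)^2) * ?K1 x"
          unfolding mult.assoc[symmetric] of_real_mult[symmetric] by simp
        finally show ?thesis by (simp add: algebra_simps)
      qed
      have pos: "0 < 1 + (\<xi> $ i)^2" by (simp add: add_pos_nonneg)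
      have eq': "?K1 = (\<lambda>x. of_real (inverse (1 + (\<xi> $ i)^2)) * ?L x)"
      proof
        fix x
        have "of_real (inverse (1 + (\<xi> $ i)^2)) * ?L x = (of_real (inverse (1 + (\<xi> $ i)^2)) * of_real (1 + (\<xi> $ i)^2)) * ?K1 x"
          unfolding eq[symmetric] mult.assoc ..
        also have "of_real (inverse (1 + (\<xi> $ i)^2)) * of_real (1 + (\<xi> $ i)^2) = (1::complex)"
          unfolding of_real_mult[symmetric] using pos by simp
        finally show "?K1 x = of_real (inverse (1 + (\<xi> $ i)^2)) * ?L x" by simp
      qed
      have g: "gb M A l ?L (C1 * ?w \<xi> + norm (complex_of_real (- ?k)) * (C2 * ?w \<xi> + (norm (2::complex) * (C3 * ?w \<xi>) + C4 * ?w \<xi>)))"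
        by (intro gb_add gb_cmult smooth_fn_add(1) smooth_fn_cmult(1) sm C)
      have smL: "smooth_fn ?L" by (intro smooth_fn_add(1) smooth_fn_cmult(1) sm)
      have "gb M A l ?K1 (norm (complex_of_real (inverse (1 + (\<xi> $ i)^2))) *
          (C1 * ?w \<xi> + norm (complex_of_real (- ?k)) * (C2 * ?w \<xi> + (norm (2::complex) * (C3 * ?w \<xi>) + C4 * ?w \<xi>))))"
        by (subst eq') (rule gb_cmult[OF smL g])
      moreover have n1: "norm (complex_of_real (inverse (1 + (\<xi> $ i)^2))) = inverse (1 + (\<xi> $ i)^2)"
        unfolding norm_of_real using pos by simp
      moreover have n2: "norm (complex_of_real (- ?k)) = ?k" unfolding norm_of_real by simp
      moreover have "inverse (1 + (\<xi> $ i)^2) * (C1 * ?w \<xi> + ?k * (C2 * ?w \<xi> + (norm (2::complex) * (C3 * ?w \<xi>) + C4 * ?w \<xi>))) =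
         (C1 + ?k * (C2 + 2 * C3 + C4)) * (\<Prod>i\<in>insert i J. inverse (1 + (\<xi> $ i)^2))"
      proof -
        have "v * (C1 * w + k * (C2 * w + (2 * (C3 * w) + C4 * w))) = (C1 + k * (C2 + 2 * C3 + C4)) * (v * w)" for v w k
          by (simp add: algebra_simps)
        then show ?thesis using insert.hyps by (simp only: prod.insert norm_numeral if_False not_False_eq_True)
      qed
      ultimately show ?thesis by (simp only:)
    qed
    then show "\<exists>C. \<forall>\<xi>. gb M A l (Kop (mo \<xi> \<eta>) \<psi>) (C * (\<Prod>i\<in>insert i J. inverse (1 + (\<xi> $ i)^2)))" by blast
  qed
qed

lemma Kop_mo_decay:
  assumes "\<eta> \<in> GSsp b M A" "(\<psi> :: 'n::finite tfun) \<in> GSsp b M A"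
  shows "qb b (\<lambda>l. \<exists>C. \<forall>\<xi>. gb M A l (Kop (mo \<xi> \<eta>) \<psi>) (C * Wt \<xi>))"
  using Kop_mo_decay_aux[OF finite assms, of UNIV] by (simp add: Wt_def)

lemma gb_pointwise: "gb M A l \<phi> B \<Longrightarrow> 0 < l \<Longrightarrow> norm (\<phi> x) \<le> B * M 0"
  using gb_bound[of l \<phi> B "[]" x] by simp

text \<open>For fixed x the integrand is the Fourier integral, with positive sign in the exponent,
  of the function \<open>\<psi> (x + s) * \<eta> s\<close> of s, whose value at 0 inversion
  recovers. Its integrability in \<xi> is the decay just shown.\<close>

lemma Kop_mo_inversion:
  assumes \<eta>: "\<eta> \<in> GSsp b M A" and \<psi>: "(\<psi> :: 'n::finite tfun) \<in> GSsp b M A"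
  shows "(LINT \<xi>|lborel. Kop (mo \<xi> \<eta>) \<psi> x) = \<psi> x * \<eta> 0"
proof -
  let ?h = "\<lambda>s. \<psi> (x + s) * \<eta> s"
  have eq: "Kop (mo \<xi> \<eta>) \<psi> x = (LINT s|lborel. ?h s * cis (2 * pi * (\<xi> \<bullet> s)))" for \<xi>
    by (simp add: Kop_def mo_def mult_ac)
  obtain q P where q: "q > 0" "wb A q \<psi> P" using GSsp_wb[OF \<psi>] by blast
  have P: "norm (\<psi> y) \<le> P" for y by (rule wb_bound[OF wsA q(2) less_imp_le[OF q(1)]])
  obtain q' Q where q': "q' > 0" "wb A q' \<eta> Q" using GSsp_wb[OF \<eta>] by blast
  have Q: "norm (\<eta> y) \<le> Q" for y by (rule wb_bound[OF wsA q'(2) less_imp_le[OF q'(1)]])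
  obtain l C where lC: "l > 0" "\<And>\<xi>. gb M A l (Kop (mo \<xi> \<eta>) \<psi>) (C * Wt \<xi>)"
    using qb_ex[OF Kop_mo_decay[OF \<eta> \<psi>]] by blast
  obtain l' C' where lC': "l' > 0" "\<And>\<xi> \<xi>'. gb M A l' (\<lambda>x. Kop (mo \<xi> \<eta>) \<psi> x - Kop (mo \<xi>' \<eta>) \<psi> x) (C' * norm (\<xi> - \<xi>'))"
    using qb_ex[OF Kop_mo_lipschitz[OF \<eta> \<psi>]] by blast
  have cont: "continuous_on UNIV (\<lambda>\<xi>. Kop (mo \<xi> \<eta>) \<psi> x)"
  proof (rule locally_lipschitz_continuous)
    show "norm (Kop (mo \<xi> \<eta>) \<psi> x - Kop (mo \<xi>' \<eta>) \<psi> x) \<le> (C' * M 0) * norm (\<xi> - \<xi>')" for \<xi> \<xi>'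
      using gb_pointwise[OF lC'(2)[of \<xi> \<xi>'] lC'(1), of x] by (simp add: mult_ac)
  qed
  have int: "integrable lborel (\<lambda>\<xi>. Kop (mo \<xi> \<eta>) \<psi> x)"
  proof (rule Bochner_Integration.integrable_bound[where f="\<lambda>\<xi>. (C * M 0) * Wt \<xi>"])
    show "integrable lborel (\<lambda>\<xi>::real^'n. (C * M 0) * Wt \<xi>)" by (intro integrable_mult_right integrable_Wt)
    show "(\<lambda>\<xi>. Kop (mo \<xi> \<eta>) \<psi> x) \<in> borel_measurable lborel" using borel_measurable_continuous_onI[OF cont] by simp
    show "AE \<xi> in lborel. norm (Kop (mo \<xi> \<eta>) \<psi> x) \<le> norm ((C * M 0) * Wt \<xi>)"
      using gb_pointwise[OF lC(2,1), of _ x]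
      by (intro AE_I2) (smt (verit) mult.assoc mult.commute real_norm_def)
  qed
  have "(LINT \<xi>|lborel. LINT s|lborel. ?h s * cis (2 * pi * (\<xi> \<bullet> s))) = ?h 0"
  proof (rule fourier_inversion_origin)
    show "integrable lborel ?h" by (rule Kop_GSsp_integrable[OF \<eta> \<psi>])
    have "continuous_on UNIV ?h"
      by (intro continuous_on_mult continuous_on_compose2[OF smooth_fn_continuous0[OF GSsp_smooth[OF \<psi>]]]
          smooth_fn_continuous0 GSsp_smooth \<eta> continuous_intros) auto
    then show "isCont ?h 0" by (simp add: continuous_on_eq_continuous_at)
    show "norm (?h s) \<le> P * Q" for s
      unfolding norm_mult by (intro mult_mono P Q norm_ge_zero order_trans[OF norm_ge_zero P])
    show "integrable lborel (\<lambda>\<xi>. LINT s|lborel. ?h s * cis (2 * pi * (\<xi> \<bullet> s)))" using int unfolding eq .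
  qed
  then show ?thesis unfolding eq by simp
qed

text \<open>Passes from the seminorms of the definitions to \<open>gb\<close>. As the seminorm is
  nonnegative, |C| can replace a possibly negative C, and any upper bound B can replace its
  value.\<close>

lemma bq_gs_sn_gb:
  fixes N :: "'n::finite tfun \<Rightarrow> real"
  assumes "bq b (\<lambda>l. \<exists>C. \<forall>\<phi>\<in>GSsp b M A. gs_sn M A l \<phi> < \<infinity> \<longrightarrow> N \<phi> \<le> C * real_of_ereal (gs_sn M A l \<phi>))"
  shows "bq b (\<lambda>l. 0 < l \<longrightarrow> (\<exists>C. \<forall>\<phi>\<in>GSsp b M A. \<forall>B. gb M A l \<phi> B \<longrightarrow> N \<phi> \<le> C * B))"
proof -
  have *: "\<exists>C. \<forall>\<phi>\<in>GSsp b M A. \<forall>B. gb M A l \<phi> B \<longrightarrow> N \<phi> \<le> C * B"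
    if l: "0 < l" and C: "\<forall>\<phi>\<in>GSsp b M A. gs_sn M A l \<phi> < \<infinity> \<longrightarrow> N \<phi> \<le> C * real_of_ereal (gs_sn M A l \<phi>)" for l C
  proof (intro exI[of _ "\<bar>C\<bar>"] ballI allI impI)
    fix \<phi> :: "'n tfun" and B assume \<phi>: "\<phi> \<in> GSsp b M A" and g: "gb M A l \<phi> B"
    have fin: "gs_sn M A l \<phi> < \<infinity>" using gs_sn_finite_iff[OF GSsp_smooth[OF \<phi>] l] g by blast
    have "N \<phi> \<le> C * real_of_ereal (gs_sn M A l \<phi>)" using C \<phi> fin by blast
    also have "\<dots> \<le> \<bar>C\<bar> * real_of_ereal (gs_sn M A l \<phi>)"
      using real_of_ereal_pos[OF gs_sn_nonneg[OF l]] by (intro mult_right_mono) auto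
    also have "\<dots> \<le> \<bar>C\<bar> * B" using real_gs_sn_le[OF GSsp_smooth[OF \<phi>] l g] by (intro mult_left_mono) auto
    finally show "N \<phi> \<le> \<bar>C\<bar> * B" .
  qed
  show ?thesis
  proof (cases b)
    case True
    then obtain l C where "0 < l" "\<forall>\<phi>\<in>GSsp b M A. gs_sn M A l \<phi> < \<infinity> \<longrightarrow> N \<phi> \<le> C * real_of_ereal (gs_sn M A l \<phi>)"
      using assms unfolding bq_def by auto
    from *[OF this] show ?thesis using True \<open>0 < l\<close> unfolding bq_def by auto
  next
    case False
    then have H: "\<exists>C. \<forall>\<phi>\<in>GSsp b M A. gs_sn M A l \<phi> < \<infinity> \<longrightarrow> N \<phi> \<le> C * real_of_ereal (gs_sn M A l \<phi>)" if "0 < l" for l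
      using assms that unfolding bq_def by auto
    show ?thesis unfolding bq_def if_not_P[OF False] using H * by blast
  qed
qed

lemma GSdualD:
  assumes "f \<in> GSdual b M A"
  shows "\<phi> \<notin> GSsp b M A \<Longrightarrow> f \<phi> = 0" and "lin_on (GSsp b M A) f"
    and "bq b (\<lambda>l. 0 < l \<longrightarrow> (\<exists>C. \<forall>\<phi>\<in>GSsp b M A. \<forall>B. gb M A l \<phi> B \<longrightarrow> norm (f \<phi>) \<le> C * B))"
  using assms by (auto simp: GSdual_def intro: bq_gs_sn_gb)

text \<open>Provides the measurability in \<xi> of such pairings, see
  \<open>V_measurable\<close>.\<close>

lemma functional_Kop_mo_continuous:
  assumes f: "f \<in> GSdual b M A" and \<eta>: "\<eta> \<in> GSsp b M A" and \<psi>: "(\<psi> :: 'n::finite tfun) \<in> GSsp b M A"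
  shows "continuous_on UNIV (\<lambda>\<xi>. f (Kop (mo \<xi> \<eta>) \<psi>))"
proof -
  obtain l C K where l: "l > 0" and C: "\<And>\<xi> \<xi>'. gb M A l (\<lambda>x. Kop (mo \<xi> \<eta>) \<psi> x - Kop (mo \<xi>' \<eta>) \<psi> x) (C * norm (\<xi> - \<xi>'))"
     and K: "\<And>\<phi> B. \<phi> \<in> GSsp b M A \<Longrightarrow> gb M A l \<phi> B \<Longrightarrow> norm (f \<phi>) \<le> K * B"
    using qb_bq_meet[OF Kop_mo_lipschitz[OF \<eta> \<psi>] GSdualD(3)[OF f]] by blast
  have S: "Kop (mo \<xi> \<eta>) \<psi> \<in> GSsp b M A" for \<xi> by (intro GSsp_Kop GSsp_mo \<eta> \<psi>)
  show ?thesis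
  proof (rule locally_lipschitz_continuous)
    show "norm (f (Kop (mo \<xi> \<eta>) \<psi>) - f (Kop (mo \<xi>' \<eta>) \<psi>)) \<le> (K * C) * norm (\<xi> - \<xi>')" for \<xi> \<xi>'
      using K[OF GSsp_diff[OF S S] C, of \<xi> \<xi>'] lin_on_diff[OF GSdualD(2)[OF f] S S, of \<xi> \<xi>'] by (simp add: mult.assoc)
  qed
qed

text \<open>Inversion holds for \<psi> and all its derivatives with the same window, so \<psi> is an
  integral in the sense of \<open>functional_integral\<close> and f passes under it.\<close>

lemma functional_reproducing:
  assumes f: "f \<in> GSdual b M A" and \<eta>: "\<eta> \<in> GSsp b M A" "\<eta> 0 = 1" and \<psi>: "(\<psi> :: 'n::finite tfun) \<in> GSsp b M A"
  shows "f \<psi> = (LINT \<xi>|lborel. f (Kop (mo \<xi> \<eta>) \<psi>))"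
proof -
  have "qb b (\<lambda>l. (\<exists>C. \<forall>\<xi>. gb M A l (Kop (mo \<xi> \<eta>) \<psi>) (C * Wt \<xi>)) \<and>
      (\<exists>C\<ge>0. \<forall>\<xi> \<xi>'. gb M A l (\<lambda>x. Kop (mo \<xi> \<eta>) \<psi> x - Kop (mo \<xi>' \<eta>) \<psi> x) (C * norm (\<xi> - \<xi>'))))"
    by (intro qb_conj Kop_mo_decay Kop_mo_lipschitz \<eta> \<psi>) (meson gb_mono)+
  from qb_bq_meet[OF this GSdualD(3)[OF f]]
  obtain l C C' K where l: "l > 0" and C: "\<And>\<xi>. gb M A l (Kop (mo \<xi> \<eta>) \<psi>) (C * Wt \<xi>)"
     and C': "C' \<ge> 0" "\<And>\<xi> \<xi>'. gb M A l (\<lambda>x. Kop (mo \<xi> \<eta>) \<psi> x - Kop (mo \<xi>' \<eta>) \<psi> x) (C' * norm (\<xi> - \<xi>'))"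
     and K: "\<And>\<phi> B. \<phi> \<in> GSsp b M A \<Longrightarrow> gb M A l \<phi> B \<Longrightarrow> norm (f \<phi>) \<le> K * B"
    by blast
  show ?thesis
  proof (rule functional_integral[where L="\<lambda>_. C'", OF l _ \<psi> C _ C'(2) _ GSdualD(2)[OF f] K])
    show "Kop (mo \<xi> \<eta>) \<psi> \<in> GSsp b M A" for \<xi> by (intro GSsp_Kop GSsp_mo \<eta> \<psi>)
    show "integrable lborel (\<lambda>\<xi>::real^'n. C * Wt \<xi>)" by (intro integrable_mult_right integrable_Wt)
    show "Dlist is \<psi> x = (LINT \<xi>|lborel. Dlist is (Kop (mo \<xi> \<eta>) \<psi>) x)" for "is" x
      using Kop_mo_inversion[OF \<eta>(1) GSsp_Dlist[OF \<psi>, of "is"], of x] \<eta>(2)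
      by (simp add: GSsp_Kop(2)[OF GSsp_mo[OF \<eta>(1)] \<psi>])
  qed
qed

end

section \<open>The space \<open>E\<close> and its dual\<close>

context gs_weights
begin

lemma emb_apply: "\<psi> \<in> GSsp b M A \<Longrightarrow> emb b M A \<phi> \<psi> = (LINT x|lborel. \<phi> x * \<psi> x)"
  by (simp add: emb_def restr_def)

lemma emb_outside: "\<psi> \<notin> GSsp b M A \<Longrightarrow> emb b M A \<phi> \<psi> = 0"
  by (simp add: emb_def restr_def)

lemma emb_eq_Kop: "\<psi> \<in> GSsp b M A \<Longrightarrow> emb b M A \<phi> \<psi> = Kop \<psi> \<phi> 0"
  by (simp add: emb_apply Kop_def)

lemma emb_add:
  assumes "\<phi> \<in> GSsp b M A" "\<psi> \<in> GSsp b M A"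
  shows "emb b M A (\<lambda>x. \<phi> x + \<psi> x) = (\<lambda>\<theta>. emb b M A \<phi> \<theta> + emb b M A \<psi> \<theta>)"
proof
  fix \<theta> show "emb b M A (\<lambda>x. \<phi> x + \<psi> x) \<theta> = emb b M A \<phi> \<theta> + emb b M A \<psi> \<theta>"
    by (cases "\<theta> \<in> GSsp b M A") (simp_all add: emb_eq_Kop Kop_add_right assms emb_outside)
qed

lemma emb_cmult: "emb b M A (\<lambda>x. c * \<phi> x) = (\<lambda>\<theta>. c * emb b M A \<phi> \<theta>)"
proof
  fix \<theta> :: "'a tfun" show "emb b M A (\<lambda>x. c * \<phi> x) \<theta> = c * emb b M A \<phi> \<theta>"
    by (cases "\<theta> \<in> GSsp b M A") (simp_all add: emb_eq_Kop Kop_cmult_right emb_outside)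
qed

lemma emb_diff:
  assumes "\<phi> \<in> GSsp b M A" "\<psi> \<in> GSsp b M A"
  shows "emb b M A (\<lambda>x. \<phi> x - \<psi> x) = (\<lambda>\<theta>. emb b M A \<phi> \<theta> - emb b M A \<psi> \<theta>)"
  using emb_add[OF assms(1) GSsp_cmult[OF assms(2), of "-1"]] emb_cmult[of "-1" \<psi>] by simp

lemma emb_zero: "emb b M A (\<lambda>x. 0) = (\<lambda>\<theta>. 0)"
  using emb_cmult[of 0 "\<lambda>x. 0"] by simp

lemma Tr_emb:
  assumes "\<phi> \<in> GSsp b M A"
  shows "Tr b M A x (emb b M A \<phi>) = emb b M A (\<lambda>t. \<phi> (t - x))"
proof
  fix \<theta>
  show "Tr b M A x (emb b M A \<phi>) \<theta> = emb b M A (\<lambda>t. \<phi> (t - x)) \<theta>"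
  proof (cases "\<theta> \<in> GSsp b M A")
    case True
    have [measurable]: "\<phi> \<in> borel_measurable borel" "\<theta> \<in> borel_measurable borel"
      by (rule GSsp_measurable, fact)+
    have "(LINT t|lborel. \<phi> t * \<theta> (t + x)) = (LINT t|lborel. \<phi> (t - x) * \<theta> t)"
      using integral_lborel_translate[of "\<lambda>t. \<phi> (t - x) * \<theta> t" x] by (simp add: add.commute)
    then show ?thesis using True GSsp_translate[OF True] by (simp add: Tr_def restr_def emb_apply)
  qed (simp add: Tr_def restr_def emb_outside)
qed

text \<open>The two formulas for the derivatives of \<open>Kop \<phi> \<theta>\<close>, evaluated at
  0, give the integration by parts that shifts the derivative from \<theta> to \<phi>.\<close>

lemma dder_emb:
  assumes \<phi>: "\<phi> \<in> GSsp b M A"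
  shows "dder b M A \<alpha> (emb b M A \<phi>) = emb b M A (Dmi \<alpha> \<phi>)"
proof
  fix \<theta>
  show "dder b M A \<alpha> (emb b M A \<phi>) \<theta> = emb b M A (Dmi \<alpha> \<phi>) \<theta>"
  proof (cases "\<theta> \<in> GSsp b M A")
    case True
    let ?is = "mi_list \<alpha>"
    have "emb b M A \<phi> (Dmi \<alpha> \<theta>) = Kop \<phi> (Dlist ?is \<theta>) 0"
      by (simp add: emb_apply[OF GSsp_Dlist[OF True]] Dmi_def Kop_def mult.commute)
    also have "\<dots> = (-1) ^ mlen \<alpha> * Kop (Dlist ?is \<phi>) \<theta> 0"
      using GSsp_Kop(2)[OF \<phi> True, of ?is] GSsp_Kop(3)[OF \<phi> True, of ?is] by (simp add: fun_eq_iff)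
    finally show ?thesis using True
      by (simp add: dder_def restr_def emb_apply Kop_def Dmi_def mult.commute flip: power_mult_distrib mult.assoc)
  qed (simp add: dder_def restr_def emb_outside)
qed

lemma conv_eq:
  assumes "\<phi> \<in> GSsp b M A"
  shows "conv b M A f \<phi> = restr (GSsp b M A) (\<lambda>\<psi>. f (Kop \<phi> \<psi>))"
proof
  fix \<psi>
  show "conv b M A f \<phi> \<psi> = restr (GSsp b M A) (\<lambda>\<psi>. f (Kop \<phi> \<psi>)) \<psi>"
    using Kop_eq[OF GSsp_measurable[OF assms] GSsp_measurable, of \<psi>]
    by (auto simp: conv_def restr_def fun_eq_iff intro!: arg_cong[where f=f])
qed

lemma Dmi_GSsp: "\<phi> \<in> GSsp b M A \<Longrightarrow> Dmi \<alpha> \<phi> \<in> GSsp b M A"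
  unfolding Dmi_def by (rule GSsp_Dlist)

lemma GSsp_lipschitz:
  assumes \<eta>: "(\<eta> :: 'n::finite tfun) \<in> GSsp b M A"
  shows "\<exists>L\<ge>0. \<forall>y z. norm (\<eta> y - \<eta> z) \<le> L * norm (y - z)"
proof -
  obtain l B where l: "l > 0" "gb M A l \<eta> B" using GSsp_gb[OF \<eta>] by blast
  let ?B = "B * (l * M 1)"
  have B: "norm (pdir i \<eta> x) \<le> ?B" for i x using gb_bound[OF l(2,1), of "[i]" x] by simp
  have B0: "0 \<le> ?B" using order_trans[OF norm_ge_zero B] .
  have "norm (\<eta> y - \<eta> z) \<le> (?B * real CARD('n)) * norm (y - z)" for y z
  proof -
    have "norm (\<eta> (0 + y) - \<eta> (0 + z)) \<le> ?B * (\<Sum>i\<in>UNIV. \<bar>y $ i - z $ i\<bar>)"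
    proof (rule box_lipschitz[OF GSsp_smooth[OF \<eta>], where R="max (norm y) (norm z)"])
      show "norm (pdir i \<eta> (0 + w)) \<le> ?B" for i w by (rule B)
      show "\<bar>y $ k\<bar> \<le> max (norm y) (norm z)" "\<bar>z $ k\<bar> \<le> max (norm y) (norm z)" for k
        using component_le_norm_cart[of y k] component_le_norm_cart[of z k] by auto
    qed
    also have "\<dots> \<le> ?B * (real CARD('n) * norm (y - z))"
      using sum_bounded_above[of UNIV "\<lambda>i. \<bar>(y - z) $ i\<bar>" "norm (y - z)"] component_le_norm_cart[of "y - z"]
      by (intro mult_left_mono B0) simp
    finally show ?thesis by (simp add: mult_ac)
  qed
  moreover have "0 \<le> ?B * real CARD('n)" using B0 by simp
  ultimately show ?thesis by blast
qed

end

locale tmib = gs_weights b M A for b M A +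
  fixes E :: "'n::finite udist set" and nE :: "'n udist \<Rightarrow> real"
  assumes TMIB: "TMIB b M A E nE"
begin

lemmas TMIB' = TMIB[unfolded TMIB_def]

lemma E_GSdual: "E \<subseteq> GSdual b M A" using TMIB' by (elim conjE)
lemma E_add: "f \<in> E \<Longrightarrow> g \<in> E \<Longrightarrow> (\<lambda>\<phi>. f \<phi> + g \<phi>) \<in> E" using TMIB' by (elim conjE) blast
lemma E_cmult: "f \<in> E \<Longrightarrow> (\<lambda>\<phi>. c * f \<phi>) \<in> E" using TMIB' by (elim conjE) blast
lemma nE_nonneg: "f \<in> E \<Longrightarrow> 0 \<le> nE f" using TMIB' by (elim conjE) blast
lemma nE_add: "f \<in> E \<Longrightarrow> g \<in> E \<Longrightarrow> nE (\<lambda>\<phi>. f \<phi> + g \<phi>) \<le> nE f + nE g" using TMIB' by (elim conjE) blast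
lemma nE_cmult: "f \<in> E \<Longrightarrow> nE (\<lambda>\<phi>. c * f \<phi>) = norm c * nE f" using TMIB' by (elim conjE) blast
lemma emb_E: "\<phi> \<in> GSsp b M A \<Longrightarrow> emb b M A \<phi> \<in> E" using TMIB' by (elim conjE) blast
lemma E_dense: "f \<in> E \<Longrightarrow> 0 < e \<Longrightarrow> \<exists>\<phi>\<in>GSsp b M A. nE (\<lambda>\<psi>. f \<psi> - emb b M A \<phi> \<psi>) < e"
  using TMIB' by (elim conjE) blast

lemma emb_bound:
  "bq b (\<lambda>l. 0 < l \<longrightarrow> (\<exists>C. \<forall>\<phi>\<in>GSsp b M A. \<forall>B. gb M A l \<phi> B \<longrightarrow> nE (emb b M A \<phi>) \<le> C * B))"
  by (rule bq_gs_sn_gb) (use TMIB' in \<open>elim conjE\<close>)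

lemma Tr_bound:
  "bq b (\<lambda>q. \<exists>C>0. \<forall>x f. f \<in> E \<longrightarrow> nE (Tr b M A x f) \<le> C * eo A (q * norm x) * nE f)"
proof -
  have "bq b (\<lambda>q. \<exists>C>0. \<forall>x f. f \<in> E \<longrightarrow>
             nE (Tr b M A x f) \<le> C * exp (assoc_fn A (q * norm x)) * nE f \<and>
             nE (Md b M A (- x) f) \<le> C * exp (assoc_fn M (q * norm x)) * nE f)"
    using TMIB' by (elim conjE)
  then show ?thesis by (rule bq_mono) (unfold eo_def, blast)
qed

lemma E_diff: "f \<in> E \<Longrightarrow> g \<in> E \<Longrightarrow> (\<lambda>\<phi>. f \<phi> - g \<phi>) \<in> E"
  using E_add[OF _ E_cmult[of g "-1"], of f] by simp

lemma nE_diff_commute: "f \<in> E \<Longrightarrow> g \<in> E \<Longrightarrow> nE (\<lambda>\<phi>. f \<phi> - g \<phi>) = nE (\<lambda>\<phi>. g \<phi> - f \<phi>)"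
  using nE_cmult[OF E_diff, of f g "-1"] by simp

lemma nE_triangle: "f \<in> E \<Longrightarrow> g \<in> E \<Longrightarrow> nE f \<le> nE g + nE (\<lambda>\<phi>. f \<phi> - g \<phi>)"
  using nE_add[OF _ E_diff, of g f g] by simp

lemma nE_triangle3:
  "f \<in> E \<Longrightarrow> g \<in> E \<Longrightarrow> h \<in> E \<Longrightarrow> nE (\<lambda>\<phi>. f \<phi> - h \<phi>) \<le> nE (\<lambda>\<phi>. f \<phi> - g \<phi>) + nE (\<lambda>\<phi>. g \<phi> - h \<phi>)"
  using nE_add[OF E_diff E_diff, of f g g h] by simp

definition N :: "'n tfun \<Rightarrow> real" where "N \<phi> = nE (emb b M A \<phi>)"

lemma N_nonneg: "\<phi> \<in> GSsp b M A \<Longrightarrow> 0 \<le> N \<phi>"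
  unfolding N_def by (intro nE_nonneg emb_E)

lemma N_add: "\<phi> \<in> GSsp b M A \<Longrightarrow> \<psi> \<in> GSsp b M A \<Longrightarrow> N (\<lambda>x. \<phi> x + \<psi> x) \<le> N \<phi> + N \<psi>"
  unfolding N_def by (simp add: emb_add nE_add emb_E)

lemma N_cmult: "\<phi> \<in> GSsp b M A \<Longrightarrow> N (\<lambda>x. c * \<phi> x) = norm c * N \<phi>"
  unfolding N_def by (simp add: emb_cmult nE_cmult emb_E)

lemma N_diff: "\<phi> \<in> GSsp b M A \<Longrightarrow> \<psi> \<in> GSsp b M A \<Longrightarrow>
    N (\<lambda>x. \<phi> x - \<psi> x) = nE (\<lambda>\<theta>. emb b M A \<phi> \<theta> - emb b M A \<psi> \<theta>)"
  unfolding N_def by (simp add: emb_diff)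

text \<open>Extension by continuity along the dense inclusion of the test functions.\<close>
lemma EdualI:
  assumes g: "lin_on (GSsp b M A) g" and C: "\<And>\<phi>. \<phi> \<in> GSsp b M A \<Longrightarrow> norm (g \<phi>) \<le> C * N \<phi>" and C0: "0 \<le> C"
  shows "restr (GSsp b M A) g \<in> Edual b M A E nE"
proof -
  have "\<forall>h n. h \<in> E \<longrightarrow> (\<exists>\<phi>\<in>GSsp b M A. nE (\<lambda>\<psi>. h \<psi> - emb b M A \<phi> \<psi>) < inverse (real (Suc n)))"
    using E_dense by simp
  then obtain \<Phi> where \<Phi>: "\<And>h n. h \<in> E \<Longrightarrow> \<Phi> h n \<in> GSsp b M A"
      "\<And>h n. h \<in> E \<Longrightarrow> nE (\<lambda>\<psi>. h \<psi> - emb b M A (\<Phi> h n) \<psi>) < inverse (real (Suc n))"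
    by metis
  define G where "G h = lim (\<lambda>n. g (\<Phi> h n))" for h
  have gd: "norm (g \<phi> - g \<psi>) \<le> C * (nE (\<lambda>\<theta>. h \<theta> - emb b M A \<phi> \<theta>) + nE (\<lambda>\<theta>. h \<theta> - emb b M A \<psi> \<theta>))"
    if S: "\<phi> \<in> GSsp b M A" "\<psi> \<in> GSsp b M A" and h: "h \<in> E" for \<phi> \<psi> h
  proof -
    have "norm (g \<phi> - g \<psi>) \<le> C * N (\<lambda>x. \<phi> x - \<psi> x)"
      using C[OF GSsp_diff[OF S]] by (simp add: lin_on_diff[OF g S])
    also have "N (\<lambda>x. \<phi> x - \<psi> x) \<le> nE (\<lambda>\<theta>. h \<theta> - emb b M A \<phi> \<theta>) + nE (\<lambda>\<theta>. h \<theta> - emb b M A \<psi> \<theta>)"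
      unfolding N_diff[OF S]
      using nE_triangle3[OF emb_E[OF S(1)] h emb_E[OF S(2)]] nE_diff_commute[OF h emb_E[OF S(1)]] by simp
    finally show ?thesis using C0 by (simp add: mult_left_mono)
  qed
  have conv: "(\<lambda>n. g (\<Phi> h n)) \<longlonglongrightarrow> G h" if h: "h \<in> E" for h
  proof -
    have "Cauchy (\<lambda>n. g (\<Phi> h n))"
    proof (rule metric_CauchyI)
      fix e :: real assume e: "0 < e"
      obtain n0 where n0: "inverse (real (Suc n0)) < e / (2 * (C + 1))"
        using reals_Archimedean[of "e / (2 * (C + 1))"] e C0 by auto
      have "dist (g (\<Phi> h m)) (g (\<Phi> h n)) < e" if mn: "n0 \<le> m" "n0 \<le> n" for m n
      proof -
        have small: "nE (\<lambda>\<psi>. h \<psi> - emb b M A (\<Phi> h k) \<psi>) \<le> e / (2 * (C + 1))" if "n0 \<le> k" for k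
        proof -
          have "inverse (real (Suc k)) \<le> inverse (real (Suc n0))" using that by (simp add: field_simps)
          then show ?thesis using \<Phi>(2)[OF h, of k] n0 by linarith
        qed
        have "norm (g (\<Phi> h m) - g (\<Phi> h n)) \<le> C * (e / (2 * (C + 1)) + e / (2 * (C + 1)))"
          by (rule order_trans[OF gd[OF \<Phi>(1)[OF h] \<Phi>(1)[OF h] h]]) (intro mult_left_mono add_mono small mn C0)
        also have "\<dots> < e"
        proof -
          have "C * (d + d) < (2 * (C + 1)) * d" if "0 < d" for d using that by (simp add: algebra_simps)
          from this[of "e / (2 * (C + 1))"] show ?thesis using e C0 by simp
        qed
        finally show ?thesis by (simp add: dist_norm)
      qed
      then show "\<exists>M. \<forall>m\<ge>M. \<forall>n\<ge>M. dist (g (\<Phi> h m)) (g (\<Phi> h n)) < e" by blast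
    qed
    then show ?thesis unfolding G_def by (simp add: Cauchy_convergent_iff convergent_LIMSEQ_iff)
  qed
  \<comment> \<open>Compares G h with g at an arbitrary test function near h. Linearity of G, its
    agreement with g and its bound all follow from this estimate by approximation.\<close>
  have key: "norm (G h - g \<phi>) \<le> C * nE (\<lambda>\<theta>. h \<theta> - emb b M A \<phi> \<theta>)" if h: "h \<in> E" and \<phi>: "\<phi> \<in> GSsp b M A" for h \<phi>
  proof (rule LIMSEQ_le)
    show "(\<lambda>n. norm (g (\<Phi> h n) - g \<phi>)) \<longlonglongrightarrow> norm (G h - g \<phi>)" by (intro tendsto_intros conv[OF h])
    have "(\<lambda>n. C * (inverse (real (Suc n)) + nE (\<lambda>\<theta>. h \<theta> - emb b M A \<phi> \<theta>))) \<longlonglongrightarrow> C * (0 + nE (\<lambda>\<theta>. h \<theta> - emb b M A \<phi> \<theta>))"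
      by (intro tendsto_mult tendsto_add tendsto_const LIMSEQ_inverse_real_of_nat)
    then show "(\<lambda>n. C * (inverse (real (Suc n)) + nE (\<lambda>\<theta>. h \<theta> - emb b M A \<phi> \<theta>))) \<longlonglongrightarrow> C * nE (\<lambda>\<theta>. h \<theta> - emb b M A \<phi> \<theta>)" by simp
    have "norm (g (\<Phi> h n) - g \<phi>) \<le> C * (inverse (real (Suc n)) + nE (\<lambda>\<theta>. h \<theta> - emb b M A \<phi> \<theta>))" for n
      by (rule order_trans[OF gd[OF \<Phi>(1)[OF h] \<phi> h]])
        (intro mult_left_mono add_mono less_imp_le[OF \<Phi>(2)[OF h]] order_refl C0)
    then show "\<exists>n0. \<forall>n\<ge>n0. norm (g (\<Phi> h n) - g \<phi>) \<le> C * (inverse (real (Suc n)) + nE (\<lambda>\<theta>. h \<theta> - emb b M A \<phi> \<theta>))" by blast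
  qed
  have zero: "z = 0" if "\<And>e. 0 < e \<Longrightarrow> norm z \<le> K * e" and "0 \<le> K" for z :: complex and K
  proof -
    have "norm z \<le> 0"
    proof (rule field_le_epsilon)
      fix e :: real assume e: "0 < e"
      have "norm z \<le> K * (e / (K + 1))" using that(1)[of "e / (K + 1)"] that(2) e by simp
      also have "\<dots> \<le> e" using that(2) e by (simp add: field_simps)
      finally show "norm z \<le> 0 + e" by simp
    qed
    then show ?thesis by simp
  qed
  have add: "G (\<lambda>\<phi>. h \<phi> + k \<phi>) = G h + G k" if h: "h \<in> E" and k: "k \<in> E" for h k
  proof -
    have "G (\<lambda>\<phi>. h \<phi> + k \<phi>) - (G h + G k) = 0"
    proof (rule zero[where K="4 * C"])
      fix e :: real assume e: "0 < e"
      obtain \<phi> where \<phi>: "\<phi> \<in> GSsp b M A" "nE (\<lambda>\<psi>. h \<psi> - emb b M A \<phi> \<psi>) < e" using E_dense[OF h e] by blast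
      obtain \<psi> where \<psi>: "\<psi> \<in> GSsp b M A" "nE (\<lambda>\<theta>. k \<theta> - emb b M A \<psi> \<theta>) < e" using E_dense[OF k e] by blast
      have "nE (\<lambda>\<theta>. (h \<theta> - emb b M A \<phi> \<theta>) + (k \<theta> - emb b M A \<psi> \<theta>)) \<le> e + e"
        by (rule order_trans[OF nE_add[OF E_diff[OF h emb_E[OF \<phi>(1)]] E_diff[OF k emb_E[OF \<psi>(1)]]]])
          (use \<phi>(2) \<psi>(2) in linarith)
      then have "nE (\<lambda>\<theta>. (h \<theta> + k \<theta>) - emb b M A (\<lambda>x. \<phi> x + \<psi> x) \<theta>) \<le> 2 * e"
        by (simp add: emb_add[OF \<phi>(1) \<psi>(1)] algebra_simps)
      then have "norm (G (\<lambda>\<phi>. h \<phi> + k \<phi>) - g (\<lambda>x. \<phi> x + \<psi> x)) \<le> C * (2 * e)"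
        using key[OF E_add[OF h k] GSsp_add[OF \<phi>(1) \<psi>(1)]] C0 by (meson mult_left_mono order_trans)
      moreover have "norm (G h - g \<phi>) \<le> C * e" using key[OF h \<phi>(1)] \<phi>(2) C0 by (meson less_imp_le mult_left_mono order_trans)
      moreover have "norm (G k - g \<psi>) \<le> C * e" using key[OF k \<psi>(1)] \<psi>(2) C0 by (meson less_imp_le mult_left_mono order_trans)
      moreover have eq: "G (\<lambda>\<phi>. h \<phi> + k \<phi>) - (G h + G k) = (G (\<lambda>\<phi>. h \<phi> + k \<phi>) - g (\<lambda>x. \<phi> x + \<psi> x)) - ((G h - g \<phi>) + (G k - g \<psi>))"
        by (simp add: lin_on_add[OF g \<phi>(1) \<psi>(1)])
      have "norm (G (\<lambda>\<phi>. h \<phi> + k \<phi>) - (G h + G k)) \<le> norm (G (\<lambda>\<phi>. h \<phi> + k \<phi>) - g (\<lambda>x. \<phi> x + \<psi> x)) + (norm (G h - g \<phi>) + norm (G k - g \<psi>))"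
        unfolding eq by (rule order_trans[OF norm_triangle_ineq4 add_left_mono[OF norm_triangle_ineq]])
      ultimately show "norm (G (\<lambda>\<phi>. h \<phi> + k \<phi>) - (G h + G k)) \<le> (4 * C) * e" by linarith
    qed (use C0 in simp)
    then show ?thesis by simp
  qed
  have cm: "G (\<lambda>\<phi>. c * h \<phi>) = c * G h" if h: "h \<in> E" for h c
  proof -
    have "G (\<lambda>\<phi>. c * h \<phi>) - c * G h = 0"
    proof (rule zero[where K="2 * norm c * C"])
      fix e :: real assume e: "0 < e"
      obtain \<phi> where \<phi>: "\<phi> \<in> GSsp b M A" "nE (\<lambda>\<psi>. h \<psi> - emb b M A \<phi> \<psi>) < e" using E_dense[OF h e] by blast
      have "nE (\<lambda>\<theta>. c * h \<theta> - emb b M A (\<lambda>x. c * \<phi> x) \<theta>) = norm c * nE (\<lambda>\<theta>. h \<theta> - emb b M A \<phi> \<theta>)"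
        using nE_cmult[OF E_diff[OF h emb_E[OF \<phi>(1)]], of c] by (simp add: emb_cmult algebra_simps)
      also have "\<dots> \<le> norm c * e" using \<phi>(2) by (intro mult_left_mono) auto
      finally have "norm (G (\<lambda>\<phi>. c * h \<phi>) - g (\<lambda>x. c * \<phi> x)) \<le> C * (norm c * e)"
        using key[OF E_cmult[OF h] GSsp_cmult[OF \<phi>(1)]] C0 by (meson mult_left_mono order_trans)
      moreover have "norm (G h - g \<phi>) \<le> C * e" using key[OF h \<phi>(1)] \<phi>(2) C0 by (meson less_imp_le mult_left_mono order_trans)
      then have "norm (c * (G h - g \<phi>)) \<le> norm c * (C * e)" unfolding norm_mult by (intro mult_left_mono) auto
      moreover have eq: "G (\<lambda>\<phi>. c * h \<phi>) - c * G h = (G (\<lambda>\<phi>. c * h \<phi>) - g (\<lambda>x. c * \<phi> x)) - c * (G h - g \<phi>)"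
        by (simp add: lin_on_cmult[OF g \<phi>(1)] algebra_simps)
      have "norm (G (\<lambda>\<phi>. c * h \<phi>) - c * G h) \<le> norm (G (\<lambda>\<phi>. c * h \<phi>) - g (\<lambda>x. c * \<phi> x)) + norm (c * (G h - g \<phi>))"
        unfolding eq by (rule norm_triangle_ineq4)
      ultimately show "norm (G (\<lambda>\<phi>. c * h \<phi>) - c * G h) \<le> (2 * norm c * C) * e" by (simp add: mult_ac)
    qed (use C0 in simp)
    then show ?thesis by simp
  qed
  have Gemb: "G (emb b M A \<phi>) = g \<phi>" if \<phi>: "\<phi> \<in> GSsp b M A" for \<phi>
    using key[OF emb_E[OF \<phi>] \<phi>] N_diff[OF \<phi> \<phi>] N_cmult[OF \<phi>, of 0] by simp
  have bd: "norm (G h) \<le> C * nE h" if h: "h \<in> E" for h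
  proof (rule LIMSEQ_le_const)
    show "(\<lambda>n. C * (nE h + inverse (real (Suc n))) + C * inverse (real (Suc n))) \<longlonglongrightarrow> C * nE h"
      using tendsto_add[OF tendsto_mult[OF tendsto_const tendsto_add[OF tendsto_const LIMSEQ_inverse_real_of_nat]]
          tendsto_mult[OF tendsto_const LIMSEQ_inverse_real_of_nat], of C "nE h" C] by simp
    have "norm (G h) \<le> C * (nE h + inverse (real (Suc n))) + C * inverse (real (Suc n))" for n
    proof -
      have 1: "norm (G h - g (\<Phi> h n)) \<le> C * inverse (real (Suc n))"
        using key[OF h \<Phi>(1)[OF h]] \<Phi>(2)[OF h] C0 by (meson less_imp_le mult_left_mono order_trans)
      have "N (\<Phi> h n) \<le> nE h + inverse (real (Suc n))"
        using nE_triangle[OF emb_E[OF \<Phi>(1)[OF h, of n]] h] \<Phi>(2)[OF h, of n] nE_diff_commute[OF h emb_E[OF \<Phi>(1)[OF h, of n]]]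
        by (simp add: N_def)
      then have "norm (g (\<Phi> h n)) \<le> C * (nE h + inverse (real (Suc n)))"
        using C[OF \<Phi>(1)[OF h]] C0 by (meson mult_left_mono order_trans)
      then show ?thesis using 1 norm_triangle_ineq[of "G h - g (\<Phi> h n)" "g (\<Phi> h n)"] by simp
    qed
    then show "\<exists>n0. \<forall>n\<ge>n0. norm (G h) \<le> C * (nE h + inverse (real (Suc n))) + C * inverse (real (Suc n))" by blast
  qed
  have "restr (GSsp b M A) g = restr (GSsp b M A) (\<lambda>\<phi>. G (emb b M A \<phi>))"
    using Gemb by (auto simp: restr_def fun_eq_iff)
  moreover have "lin_on E G" unfolding lin_on_def using add cm by blast
  ultimately show ?thesis unfolding Edual_def using bd by blast
qed

lemma Edual_bound: "g \<in> Edual b M A E nE \<Longrightarrow> \<exists>C. \<forall>\<phi>\<in>GSsp b M A. norm (g \<phi>) \<le> C * N \<phi>"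
  unfolding Edual_def N_def restr_def using emb_E by fastforce

lemma Edual_norm_le:
  assumes "\<And>\<phi>. \<phi> \<in> GSsp b M A \<Longrightarrow> norm (g \<phi>) \<le> C * N \<phi>" "0 \<le> C"
  shows "Edual_norm b M A nE g \<le> C"
  unfolding Edual_norm_def
proof (rule cSup_least)
  show "{norm (g \<phi>) |\<phi>. \<phi> \<in> GSsp b M A \<and> nE (emb b M A \<phi>) \<le> 1} \<noteq> {}"
    using GSsp_zero nE_cmult[OF emb_E[OF GSsp_zero], of 0] by (auto simp: emb_zero intro!: exI[of _ "\<lambda>x. 0"])
  fix x assume "x \<in> {norm (g \<phi>) |\<phi>. \<phi> \<in> GSsp b M A \<and> nE (emb b M A \<phi>) \<le> 1}"
  then obtain \<phi> where \<phi>: "x = norm (g \<phi>)" "\<phi> \<in> GSsp b M A" "N \<phi> \<le> 1" by (auto simp: N_def)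
  have "x \<le> C * N \<phi>" unfolding \<phi>(1) by (rule assms(1)[OF \<phi>(2)])
  also have "\<dots> \<le> C * 1" by (intro mult_left_mono \<phi> assms)
  finally show "x \<le> C" by simp
qed

text \<open>\<open>Edual_norm\<close> sees only test functions in the unit ball; density carries the
  bound to all of E, and the a priori constant C drops out as the approximation error tends to
  0.\<close>

lemma Edual_norm_bound:
  assumes G: "lin_on E G" and C: "\<And>f. f \<in> E \<Longrightarrow> norm (G f) \<le> C * nE f"
    and g: "g = restr (GSsp b M A) (\<lambda>\<phi>. G (emb b M A \<phi>))" and h: "h \<in> E"
  shows "norm (G h) \<le> Edual_norm b M A nE g * nE h" and "0 \<le> Edual_norm b M A nE g"
proof -
  let ?S = "Edual_norm b M A nE g"
  let ?X = "{norm (g \<phi>) |\<phi>. \<phi> \<in> GSsp b M A \<and> nE (emb b M A \<phi>) \<le> 1}"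
  have bdd: "bdd_above ?X"
  proof (rule bdd_aboveI[of _ "\<bar>C\<bar>"])
    fix x assume "x \<in> ?X"
    then obtain \<phi> where \<phi>: "x = norm (G (emb b M A \<phi>))" "\<phi> \<in> GSsp b M A" "nE (emb b M A \<phi>) \<le> 1" by (auto simp: g restr_def)
    have "x \<le> C * nE (emb b M A \<phi>)" unfolding \<phi>(1) by (rule C[OF emb_E[OF \<phi>(2)]])
    also have "\<dots> \<le> \<bar>C\<bar> * 1" using \<phi>(3) nE_nonneg[OF emb_E[OF \<phi>(2)]] by (intro mult_mono) auto
    finally show "x \<le> \<bar>C\<bar>" by simp
  qed
  have up: "norm (G (emb b M A \<phi>)) \<le> ?S" if "\<phi> \<in> GSsp b M A" "nE (emb b M A \<phi>) \<le> 1" for \<phi>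
    unfolding Edual_norm_def by (rule cSup_upper[OF _ bdd]) (use that in \<open>auto simp: g restr_def\<close>)
  show S0: "0 \<le> ?S"
    using order_trans[OF norm_ge_zero up[OF GSsp_zero]] nE_cmult[OF emb_E[OF GSsp_zero], of 0] by (simp add: emb_zero)
  have onS: "norm (G (emb b M A \<phi>)) \<le> ?S * nE (emb b M A \<phi>)" if \<phi>: "\<phi> \<in> GSsp b M A" for \<phi>
  proof (cases "nE (emb b M A \<phi>) = 0")
    case True
    then show ?thesis using C[OF emb_E[OF \<phi>]] by simp
  next
    case False
    then have pos: "0 < nE (emb b M A \<phi>)" using nE_nonneg[OF emb_E[OF \<phi>]] by simp
    let ?c = "complex_of_real (1 / nE (emb b M A \<phi>))"
    have nc: "norm ?c = 1 / nE (emb b M A \<phi>)" unfolding norm_of_real using pos by simp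
    have "norm (G (emb b M A (\<lambda>x. ?c * \<phi> x))) \<le> ?S"
    proof (rule up[OF GSsp_cmult[OF \<phi>]])
      show "nE (emb b M A (\<lambda>x. ?c * \<phi> x)) \<le> 1"
        unfolding emb_cmult nE_cmult[OF emb_E[OF \<phi>]] nc using pos by simp
    qed
    then have "(1 / nE (emb b M A \<phi>)) * norm (G (emb b M A \<phi>)) \<le> ?S"
      unfolding emb_cmult lin_on_cmult[OF G emb_E[OF \<phi>]] norm_mult nc .
    then show ?thesis using pos by (simp add: field_simps)
  qed
  have "norm (G h) \<le> ?S * nE h + e" if e: "0 < e" for e
  proof -
    let ?d = "e / (?S + \<bar>C\<bar> + 1)"
    have d: "0 < ?d" using e S0 by simp
    obtain \<phi> where \<phi>: "\<phi> \<in> GSsp b M A" "nE (\<lambda>\<psi>. h \<psi> - emb b M A \<phi> \<psi>) < ?d" using E_dense[OF h d] by blast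
    let ?k = "\<lambda>\<psi>. h \<psi> - emb b M A \<phi> \<psi>"
    have k: "?k \<in> E" by (rule E_diff[OF h emb_E[OF \<phi>(1)]])
    have "G h = G (emb b M A \<phi>) + G ?k" using lin_on_add[OF G emb_E[OF \<phi>(1)] k] by simp
    then have "norm (G h) \<le> norm (G (emb b M A \<phi>)) + norm (G ?k)" by (simp add: norm_triangle_ineq)
    also have "\<dots> \<le> ?S * (nE h + ?d) + \<bar>C\<bar> * ?d"
    proof (rule add_mono)
      have "nE (emb b M A \<phi>) \<le> nE h + ?d"
        using nE_triangle[OF emb_E[OF \<phi>(1)] h] nE_diff_commute[OF h emb_E[OF \<phi>(1)]] \<phi>(2) by simp
      then show "norm (G (emb b M A \<phi>)) \<le> ?S * (nE h + ?d)"
        using onS[OF \<phi>(1)] S0 by (meson mult_left_mono order_trans)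
      have "norm (G ?k) \<le> C * nE ?k" by (rule C[OF k])
      also have "\<dots> \<le> \<bar>C\<bar> * ?d" using \<phi>(2) nE_nonneg[OF k] by (intro mult_mono) auto
      finally show "norm (G ?k) \<le> \<bar>C\<bar> * ?d" .
    qed
    also have "\<dots> = ?S * nE h + (?S + \<bar>C\<bar>) * ?d"
    proof -
      have "s * (n + d) + c * d = s * n + (s + c) * d" for s n c d :: real by (simp add: algebra_simps)
      then show ?thesis .
    qed
    also have "(?S + \<bar>C\<bar>) * ?d \<le> e" using e S0 by (simp add: field_simps)
    finally show ?thesis by simp
  qed
  then show "norm (G h) \<le> ?S * nE h" by (rule field_le_epsilon)
qed

text \<open>\<open>Kop \<eta> \<psi>\<close> is an average of translates of \<psi>, so Minkowski's
  inequality and the translation bound of E give an estimate in which \<eta> enters only through its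
  weight and \<psi> only through its norm in E. Up to the factor \<open>HA\<close>, q carries the
  quantifier of that translation bound.\<close>

lemma N_Kop_bound:
  "bq b (\<lambda>q. 0 < q \<longrightarrow> (\<exists>C\<ge>0. \<forall>\<eta>\<in>GSsp b M A. \<forall>\<psi>\<in>GSsp b M A. \<forall>Q. wb A q \<eta> Q \<longrightarrow> N (Kop \<eta> \<psi>) \<le> C * Q * N \<psi>))"
proof -
  let ?H = "HA CARD('n)" and ?d = "real CARD('n)"
  have main: "\<exists>C\<ge>0. \<forall>\<eta>\<in>GSsp b M A. \<forall>\<psi>\<in>GSsp b M A. \<forall>Q. wb A (?H * q) \<eta> Q \<longrightarrow> N (Kop \<eta> \<psi>) \<le> C * Q * N \<psi>"
    if q: "0 < q" and CT: "CT > 0" "\<And>x f. f \<in> E \<Longrightarrow> nE (Tr b M A x f) \<le> CT * eo A (q * norm x) * nE f" for q CT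
  proof -
    obtain C2 where C2: "C2 > 0" "\<And>\<eta> Q x. wb A (?H * q) \<eta> Q \<Longrightarrow> norm (\<eta> (x::real^'n)) * eo A (q * norm x) \<le> Q * C2 * Wt x"
      using wb_Wt[OF q, where 'n='n] by blast
    define I where "I = (LINT x|lborel. Wt (x::real^'n))"
    have I: "0 \<le> I" unfolding I_def by (rule Bochner_Integration.integral_nonneg) simp
    have "N (Kop \<eta> \<psi>) \<le> (CT * C2 * I) * Q * N \<psi>"
      if \<eta>: "\<eta> \<in> GSsp b M A" and \<psi>: "\<psi> \<in> GSsp b M A" and w: "wb A (?H * q) \<eta> Q" for \<eta> \<psi> Q
    proof -
      \<comment> \<open>One parameter l has to serve both the continuity of the inclusion into E and
        the hypotheses of \<open>seminorm_integral\<close>. Dividing by 2 \<open>HM\<close> leaves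
        room for differences of translates, dividing by \<open>HA\<close> for the integrability of
        \<eta> against the weight.\<close>
      have "qb b (\<lambda>l. (\<exists>B. gb M A (l / ?H) \<eta> B) \<and> (\<exists>B. gb M A l \<psi> B))"
      proof (intro qb_conj)
        show "qb b (\<lambda>l. \<exists>B. gb M A (l / ?H) \<eta> B)"
          by (rule qb_scale[where c="?H" and P="\<lambda>l. \<exists>B. gb M A l \<eta> B"]) (use \<eta> in \<open>simp_all add: GSsp_qb\<close>)
        show "\<exists>B. gb M A (l' / ?H) \<eta> B" if "0 < l" "l \<le> l'" "\<exists>B. gb M A (l / ?H) \<eta> B" for l l'
          using that gb_mono[of "l / ?H" \<eta> _ "l' / ?H"] by (auto simp: divide_right_mono)
      qed (use \<psi> in \<open>auto simp: GSsp_qb intro: gb_mono\<close>)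
      then have "qb b (\<lambda>l. (\<exists>B. gb M A (l / (2 * HM) / ?H) \<eta> B) \<and> (\<exists>B. gb M A (l / (2 * HM)) \<psi> B))"
        by (rule qb_scale) (use HM in simp)
      from qb_bq_meet[OF this emb_bound] obtain l B1 B2 CN where l: "0 < l" and B1: "gb M A (l / (2 * HM) / ?H) \<eta> B1"
        and B2: "gb M A (l / (2 * HM)) \<psi> B2" and CN: "\<And>\<phi> B. \<phi> \<in> GSsp b M A \<Longrightarrow> gb M A l \<phi> B \<Longrightarrow> N \<phi> \<le> CN * B"
        unfolding N_def by blast
      define l0 where "l0 = l / (2 * HM)"
      have l0: "0 < l0" "l = 2 * HM * l0" "2 * l0 \<le> l" using l HM by (auto simp: l0_def field_simps)
      note smp = GSsp_smooth[OF \<psi>]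
      obtain L\<eta> where L\<eta>: "L\<eta> \<ge> 0" "\<And>y z. norm (\<eta> y - \<eta> z) \<le> L\<eta> * norm (y - z)" using GSsp_lipschitz[OF \<eta>] by blast
      have B20: "0 \<le> B2" using gb_nonneg[OF B2] .
      have w\<eta>: "wb A (?H * (1 / l0)) \<eta> (B1 * M 0)"
      proof -
        have "?H * (1 / l0) = 1 / (l / (2 * HM) / ?H)" using HM by (simp add: l0_def field_simps)
        then show ?thesis using gb_wb[OF B1, of "[]"] by simp
      qed
      have \<eta>bd: "norm (\<eta> s) \<le> B1 * M 0" for s by (rule wb_bound[OF wsA w\<eta>]) (use l0 in simp)
      let ?F = "\<lambda>s x. \<eta> s * \<psi> (x + s)"
      let ?\<rho> = "\<lambda>s. norm (\<eta> s) * (B2 * eo A (norm s / l0))"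
      let ?K = "\<lambda>R. B2 * CM * l0 * eo A (?d * R / l0) * ?d"
      \<comment> \<open>Product rule for \<open>\<eta> s * \<psi> (x + s)\<close>: the first summand
        accounts for the change of the translate, the second for the change of \<eta>.\<close>
      let ?L = "\<lambda>R. B1 * M 0 * ?K R + L\<eta> * (B2 * eo A (R / l0))"
      have Kop: "Dlist is (Kop \<eta> \<psi>) x = (LINT s|lborel. Dlist is (?F s) x)" for "is" x
        by (subst GSsp_Kop(2)[OF \<eta> \<psi>]) (simp add: Kop_def smooth_fn_cmult smooth_fn_translate smp mult.commute)
      have gt: "gb M A l (\<lambda>x. \<psi> (x + s)) (B2 * eo A (norm s / l0))" for s
        using gb_translate[OF smp B2[folded l0_def] l0(1), of s] l0 by (auto intro: gb_mono)
      have "N (Kop \<eta> \<psi>) \<le> (LINT s::real^'n|lborel. (CT * N \<psi> * Q * C2) * Wt s)"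
      proof (rule seminorm_integral[where N=N and F="?F" and \<rho>="?\<rho>" and L="?L" and l=l and C=CN and v="Kop \<eta> \<psi>"
            and \<kappa>="\<lambda>s::real^'n. (CT * N \<psi> * Q * C2) * Wt s"])
        show "0 < l" by (rule l)
        show "Dlist is (Kop \<eta> \<psi>) x = (LINT s|lborel. Dlist is (?F s) x)" for "is" x by (rule Kop)
        show "N (\<lambda>x. \<phi> x + \<psi> x) \<le> N \<phi> + N \<psi>" if "\<phi> \<in> GSsp b M A" "\<psi> \<in> GSsp b M A" for \<phi> \<psi> by (rule N_add[OF that])
        show "N (\<lambda>x. c * \<phi> x) = norm c * N \<phi>" if "\<phi> \<in> GSsp b M A" for \<phi> c by (rule N_cmult[OF that])
        show "0 \<le> N \<phi>" if "\<phi> \<in> GSsp b M A" for \<phi> by (rule N_nonneg[OF that])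
        show "N \<phi> \<le> CN * B" if "\<phi> \<in> GSsp b M A" "gb M A l \<phi> B" for \<phi> B by (rule CN[OF that])
        show FS: "?F s \<in> GSsp b M A" for s by (intro GSsp_cmult GSsp_translate \<psi>)
        show "Kop \<eta> \<psi> \<in> GSsp b M A" by (rule GSsp_Kop(1)[OF \<eta> \<psi>])
        show "gb M A l (?F s) (?\<rho> s)" for s by (rule gb_cmult[OF smooth_fn_translate(1)[OF smp] gt])
        show "integrable lborel ?\<rho>"
          using integrable_mult_left[OF wb_integrable_eo[OF _ w\<eta> GSsp_measurable[OF \<eta>]], of B2] l0
          by (simp add: mult_ac)
        show "gb M A l (\<lambda>x. ?F y x - ?F z x) (?L R * norm (y - z))" if yz: "norm y \<le> R" "norm z \<le> R" for R y z
        proof -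
          have eq: "(\<lambda>x. ?F y x - ?F z x) = (\<lambda>x. \<eta> y * (\<psi> (x + y) - \<psi> (x + z)) + (\<eta> y - \<eta> z) * \<psi> (x + z))"
            by (simp add: algebra_simps)
          have R: "0 \<le> R" using yz(1) norm_ge_zero order_trans by blast
          have 1: "gb M A l (\<lambda>x. \<psi> (x + y) - \<psi> (x + z)) (?K R * norm (y - z))"
            using gb_translate_diff[OF smp B2[folded l0_def] l0(1) yz] l0(2) by simp
          have s1: "smooth_fn (\<lambda>x. \<psi> (x + y) - \<psi> (x + z))" by (intro smooth_fn_diff smooth_fn_translate smp)
          have "gb M A l (\<lambda>x. ?F y x - ?F z x) (norm (\<eta> y) * (?K R * norm (y - z)) + norm (\<eta> y - \<eta> z) * (B2 * eo A (norm z / l0)))"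
            unfolding eq by (intro gb_add gb_cmult smooth_fn_cmult(1) s1 smooth_fn_translate(1) smp 1 gt)
          then show ?thesis
          proof (rule gb_mono_const[OF _ _ l])
            have "norm (\<eta> y) * (?K R * norm (y - z)) \<le> (B1 * M 0) * (?K R * norm (y - z))"
              using B20 CM l0 by (intro mult_right_mono \<eta>bd) auto
            moreover have "norm (\<eta> y - \<eta> z) * (B2 * eo A (norm z / l0)) \<le> (L\<eta> * norm (y - z)) * (B2 * eo A (R / l0))"
              using yz l0 B20 L\<eta> R by (intro mult_mono L\<eta> eo_mono[OF wsA] divide_right_mono) auto
            ultimately show "norm (\<eta> y) * (?K R * norm (y - z)) + norm (\<eta> y - \<eta> z) * (B2 * eo A (norm z / l0)) \<le> ?L R * norm (y - z)"
              by (simp add: algebra_simps)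
          qed
        qed
        show "integrable lborel (\<lambda>s::real^'n. (CT * N \<psi> * Q * C2) * Wt s)" by (intro integrable_mult_right integrable_Wt)
        show "N (?F s) \<le> (CT * N \<psi> * Q * C2) * Wt s" for s
        proof -
          have "N (\<lambda>x. \<psi> (x + s)) \<le> CT * eo A (q * norm s) * N \<psi>"
            using CT(2)[OF emb_E[OF \<psi>], of "- s"] by (simp add: Tr_emb[OF \<psi>] N_def)
          then have "N (?F s) \<le> norm (\<eta> s) * (CT * eo A (q * norm s) * N \<psi>)"
            by (simp add: N_cmult[OF GSsp_translate[OF \<psi>]] mult_left_mono)
          also have "\<dots> = (CT * N \<psi>) * (norm (\<eta> s) * eo A (q * norm s))" by simp
          also have "\<dots> \<le> (CT * N \<psi>) * (Q * C2 * Wt s)"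
            using CT(1) N_nonneg[OF \<psi>] by (intro mult_left_mono C2(2)[OF w]) auto
          finally show ?thesis by (simp add: mult_ac)
        qed
      qed
      then show ?thesis by (simp add: I_def mult_ac)
    qed
    moreover have "0 \<le> CT * C2 * I" using CT C2 I by simp
    ultimately show ?thesis by blast
  qed
  show ?thesis
  proof (cases b)
    case True
    then obtain q CT where "0 < q" "CT > 0" "\<And>x f. f \<in> E \<Longrightarrow> nE (Tr b M A x f) \<le> CT * eo A (q * norm x) * nE f"
      using Tr_bound unfolding bq_def by auto
    then show ?thesis unfolding bq_def if_P[OF True]
      using main[of q CT] HA_pos[of "CARD('n)"] by (intro exI[where x="?H * q" and P="\<lambda>l. 0 < l \<and> (0 < l \<longrightarrow> _ l)"] conjI impI) simp_all
  next
    case False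
    have "\<exists>C\<ge>0. \<forall>\<eta>\<in>GSsp b M A. \<forall>\<psi>\<in>GSsp b M A. \<forall>Q. wb A q \<eta> Q \<longrightarrow> N (Kop \<eta> \<psi>) \<le> C * Q * N \<psi>" if q: "0 < q" for q
    proof -
      have q': "0 < q / ?H" using q by simp
      obtain CT where "CT > 0" "\<And>x f. f \<in> E \<Longrightarrow> nE (Tr b M A x f) \<le> CT * eo A ((q / ?H) * norm x) * nE f"
        using Tr_bound q' False unfolding bq_def by auto
      from main[OF q' this] show ?thesis by simp
    qed
    then show ?thesis unfolding bq_def if_not_P[OF False] by blast
  qed
qed

end

text \<open>Every finite set of multi-indices lies in a box, over which the sum factors into d
  partial geometric sums.\<close>

lemma summable_on_geometric_mlen:
  assumes r: "0 \<le> r" "r < (1::real)"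
  shows "(\<lambda>\<alpha>::'n::finite \<Rightarrow> nat. r ^ mlen \<alpha>) summable_on UNIV"
proof (rule nonneg_bdd_above_summable_on)
  let ?s = "\<Sum>k. r ^ k"
  have sm: "summable (\<lambda>k. r ^ k)" using r by (intro summable_geometric) auto
  show "bdd_above (sum (\<lambda>\<alpha>::'n \<Rightarrow> nat. r ^ mlen \<alpha>) ` {F. F \<subseteq> UNIV \<and> finite F})"
  proof (rule bdd_aboveI2)
    fix F :: "('n \<Rightarrow> nat) set" assume "F \<in> {F. F \<subseteq> UNIV \<and> finite F}"
    then have F: "finite F" by simp
    define m where "m = Max (insert 0 (mlen ` F))"
    have sub: "F \<subseteq> PiE UNIV (\<lambda>_::'n. {..m})"
    proof
      fix \<alpha> assume \<alpha>: "\<alpha> \<in> F"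
      have "\<alpha> i \<le> m" for i
      proof -
        have "\<alpha> i \<le> mlen \<alpha>" unfolding mlen_def by (rule member_le_sum) auto
        also have "\<dots> \<le> m" unfolding m_def using \<alpha> F by (intro Max_ge) auto
        finally show ?thesis .
      qed
      then show "\<alpha> \<in> PiE UNIV (\<lambda>_::'n. {..m})" by (auto simp: PiE_def)
    qed
    have "(\<Sum>\<alpha>\<in>F. r ^ mlen \<alpha>) \<le> (\<Sum>\<alpha>\<in>PiE UNIV (\<lambda>_::'n. {..m}). r ^ mlen \<alpha>)"
      using r by (intro sum_mono2 sub finite_PiE) auto
    also have "\<dots> = (\<Sum>\<alpha>\<in>PiE UNIV (\<lambda>_::'n. {..m}). \<Prod>i\<in>UNIV. r ^ \<alpha> i)"
      by (simp add: mlen_def power_sum)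
    also have "\<dots> = (\<Prod>i\<in>(UNIV::'n set). \<Sum>k\<le>m. r ^ k)"
      by (subst prod_sum_PiE) auto
    also have "\<dots> \<le> (\<Prod>i\<in>(UNIV::'n set). ?s)"
      using r by (intro prod_mono conjI sum_nonneg sum_le_suminf sm) auto
    finally show "(\<Sum>\<alpha>\<in>F. r ^ mlen \<alpha>) \<le> (\<Prod>i\<in>(UNIV::'n set). ?s)" .
  qed
qed (use r in simp)

context tmib
begin

section \<open>The space D_E and its dual\<close>

lemma dder_add: "dder b M A \<alpha> (\<lambda>\<phi>. f \<phi> + g \<phi>) = (\<lambda>\<phi>. dder b M A \<alpha> f \<phi> + dder b M A \<alpha> g \<phi>)"
  by (auto simp: dder_def restr_def fun_eq_iff algebra_simps)

lemma dder_cmult: "dder b M A \<alpha> (\<lambda>\<phi>. c * f \<phi>) = (\<lambda>\<phi>. c * dder b M A \<alpha> f \<phi>)"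
  by (auto simp: dder_def restr_def fun_eq_iff)

lemma DE_sn_nonneg:
  assumes "f \<in> DEstep b M A E nE l" "0 < l" shows "0 \<le> DE_sn b M A nE l f"
proof -
  have "0 \<le> ereal (nE (dder b M A (\<lambda>_. 0) f) / (l ^ mlen (\<lambda>_::'n. 0) * M (mlen (\<lambda>_::'n. 0))))"
    using assms by (simp add: DEstep_def nE_nonneg)
  also have "\<dots> \<le> DE_sn b M A nE l f" unfolding DE_sn_def by (rule SUP_upper) simp
  finally show ?thesis .
qed

lemma nE_dder_le:
  assumes "f \<in> DEstep b M A E nE l" "0 < l"
  shows "nE (dder b M A \<alpha> f) \<le> real_of_ereal (DE_sn b M A nE l f) * (l ^ mlen \<alpha> * M (mlen \<alpha>))"
proof -
  have fin: "DE_sn b M A nE l f < \<infinity>" using assms by (simp add: DEstep_def)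
  have "ereal (nE (dder b M A \<alpha> f) / (l ^ mlen \<alpha> * M (mlen \<alpha>))) \<le> DE_sn b M A nE l f"
    unfolding DE_sn_def by (rule SUP_upper) simp
  also have "\<dots> = ereal (real_of_ereal (DE_sn b M A nE l f))"
    using fin DE_sn_nonneg[OF assms] by (cases "DE_sn b M A nE l f") auto
  finally show ?thesis using assms(2) by (simp add: pos_divide_le_eq)
qed

text \<open>With all derivatives on \<phi>, its seminorm supplies the factors required by D_E, and
  only the norm of \<psi> in E is left on the right.\<close>

lemma DE_Kop:
  assumes \<phi>: "\<phi> \<in> GSsp b M A"
  shows "qb b (\<lambda>l. \<exists>K\<ge>0. \<forall>\<psi>\<in>GSsp b M A. emb b M A (Kop \<phi> \<psi>) \<in> DEstep b M A E nE l \<and>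
      DE_sn b M A nE l (emb b M A (Kop \<phi> \<psi>)) \<le> ereal (K * N \<psi>))"
proof -
  have main: "\<exists>K\<ge>0. \<forall>\<psi>\<in>GSsp b M A. emb b M A (Kop \<phi> \<psi>) \<in> DEstep b M A E nE l \<and>
      DE_sn b M A nE l (emb b M A (Kop \<phi> \<psi>)) \<le> ereal (K * N \<psi>)"
    if l: "0 < l1" "l1 \<le> l" and q: "0 < q" "q \<le> 1 / l1" and B: "gb M A l1 \<phi> B"
      and C: "C \<ge> 0" "\<forall>\<eta>\<in>GSsp b M A. \<forall>\<psi>\<in>GSsp b M A. \<forall>Q. wb A q \<eta> Q \<longrightarrow> N (Kop \<eta> \<psi>) \<le> C * Q * N \<psi>" for l l1 q B C
  proof (intro exI[of _ "C * B"] conjI ballI)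
    have B0: "0 \<le> B" by (rule gb_nonneg[OF B])
    show "0 \<le> C * B" using B0 C(1) by simp
    fix \<psi> :: "'n tfun" assume \<psi>: "\<psi> \<in> GSsp b M A"
    have bd: "nE (dder b M A \<alpha> (emb b M A (Kop \<phi> \<psi>))) \<le> C * B * N \<psi> * (l ^ mlen \<alpha> * M (mlen \<alpha>))" for \<alpha>
    proof -
      let ?is = "mi_list \<alpha>"
      have "nE (dder b M A \<alpha> (emb b M A (Kop \<phi> \<psi>))) = N (Dlist ?is (Kop \<phi> \<psi>))"
        by (simp add: dder_emb GSsp_Kop \<phi> \<psi> N_def Dmi_def)
      also have "\<dots> = N (Kop (Dlist ?is \<phi>) \<psi>)"
        unfolding GSsp_Kop(3)[OF \<phi> \<psi>] N_cmult[OF GSsp_Kop(1)[OF GSsp_Dlist[OF \<phi>] \<psi>]] by (simp add: norm_power)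
      also have "\<dots> \<le> C * (B * (l1 ^ mlen \<alpha> * M (mlen \<alpha>))) * N \<psi>"
        using wb_mono[OF wsA gb_wb[OF B, of ?is], of q] q C(2) \<psi> GSsp_Dlist[OF \<phi>, of ?is] by simp
      also have "\<dots> \<le> C * (B * (l ^ mlen \<alpha> * M (mlen \<alpha>))) * N \<psi>"
        using l B0 C(1) N_nonneg[OF \<psi>] by (intro mult_right_mono mult_left_mono power_mono) auto
      finally show ?thesis by (simp add: mult_ac)
    qed
    show DE: "DE_sn b M A nE l (emb b M A (Kop \<phi> \<psi>)) \<le> ereal (C * B * N \<psi>)"
      unfolding DE_sn_def by (rule SUP_least) (use bd l in \<open>simp add: pos_divide_le_eq\<close>)
    have "dder b M A \<alpha> (emb b M A (Kop \<phi> \<psi>)) \<in> E" for \<alpha>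
      by (simp add: dder_emb GSsp_Kop \<phi> \<psi> emb_E Dmi_GSsp)
    then show "emb b M A (Kop \<phi> \<psi>) \<in> DEstep b M A E nE l"
      using E_GSdual emb_E[OF GSsp_Kop(1)[OF \<phi> \<psi>]] le_less_trans[OF DE, of \<infinity>] by (auto simp: DEstep_def)
  qed
  show ?thesis
  proof (cases b)
    case True
    obtain q C where q: "0 < q" and C: "C \<ge> 0" "\<forall>\<eta>\<in>GSsp b M A. \<forall>\<psi>\<in>GSsp b M A. \<forall>Q. wb A q \<eta> Q \<longrightarrow> N (Kop \<eta> \<psi>) \<le> C * Q * N \<psi>"
      using N_Kop_bound unfolding bq_def if_P[OF True] by blast
    show ?thesis unfolding qb_def if_P[OF True]
    proof (intro allI impI)
      fix l :: real assume l: "0 < l"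
      \<comment> \<open>l1 must be small both for the target parameter l and for the weight q
        demanded by \<open>N_Kop_bound\<close>; a Beurling test function has a bound at every
        l1.\<close>
      define l1 where "l1 = min l (1 / q)"
      have l1: "0 < l1" "l1 \<le> l" "q \<le> 1 / l1" using l q by (auto simp: l1_def min_def field_simps)
      obtain B where "gb M A l1 \<phi> B" using \<phi> l1(1) True unfolding GSsp_iff by auto
      from main[OF l1(1,2) q l1(3) this C] show "\<exists>K\<ge>0. \<forall>\<psi>\<in>GSsp b M A. emb b M A (Kop \<phi> \<psi>) \<in> DEstep b M A E nE l \<and>
        DE_sn b M A nE l (emb b M A (Kop \<phi> \<psi>)) \<le> ereal (K * N \<psi>)" .
    qed
  next
    case False
    obtain l B where l: "0 < l" and B: "gb M A l \<phi> B" using GSsp_gb[OF \<phi>] by blast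
    have q: "0 < 1 / l" using l by simp
    obtain C where C: "C \<ge> 0" "\<forall>\<eta>\<in>GSsp b M A. \<forall>\<psi>\<in>GSsp b M A. \<forall>Q. wb A (1 / l) \<eta> Q \<longrightarrow> N (Kop \<eta> \<psi>) \<le> C * Q * N \<psi>"
      using N_Kop_bound q unfolding bq_def if_not_P[OF False] by blast
    from main[OF l order_refl q order_refl B C] show ?thesis
      unfolding qb_def if_not_P[OF False] using l by blast
  qed
qed

lemma lin_on_functional_Kop:
  fixes \<phi> :: "'n tfun"
  assumes f: "lin_on (GSsp b M A) f" and \<phi>: "\<phi> \<in> GSsp b M A"
  shows "lin_on (GSsp b M A) (\<lambda>\<psi>. f (Kop \<phi> \<psi>))"
  unfolding lin_on_def
proof (intro ballI allI conjI)
  fix \<psi> \<theta> :: "'n tfun" and c assume S: "\<psi> \<in> GSsp b M A" "\<theta> \<in> GSsp b M A"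
  have "Kop \<phi> (\<lambda>x. \<psi> x + \<theta> x) = (\<lambda>x. Kop \<phi> \<psi> x + Kop \<phi> \<theta> x)" by (rule ext) (rule Kop_add_right[OF \<phi> S])
  then show "f (Kop \<phi> (\<lambda>x. \<psi> x + \<theta> x)) = f (Kop \<phi> \<psi>) + f (Kop \<phi> \<theta>)"
    by (simp add: lin_on_add[OF f] GSsp_Kop \<phi> S)
  have "Kop \<phi> (\<lambda>x. c * \<psi> x) = (\<lambda>x. c * Kop \<phi> \<psi> x)" by (rule ext) (rule Kop_cmult_right)
  then show "f (Kop \<phi> (\<lambda>x. c * \<psi> x)) = c * f (Kop \<phi> \<psi>)"
    by (simp add: lin_on_cmult[OF f] GSsp_Kop \<phi> S)
qed

proposition DEdual_imp_conv_Edual: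
  assumes f: "f \<in> DEdual b M A E nE" and \<phi>: "\<phi> \<in> GSsp b M A"
  shows "conv b M A f \<phi> \<in> Edual b M A E nE"
proof -
  have fd: "f \<in> GSdual b M A" using f by (simp add: DEdual_def)
  obtain G where G: "if b then (\<exists>l>0. \<exists>C. \<forall>f\<in>DE b M A E nE. norm (G f) \<le> C * real_of_ereal (DE_sn b M A nE l f))
            else (\<forall>l>0. \<exists>C. \<forall>f\<in>DEstep b M A E nE l. norm (G f) \<le> C * real_of_ereal (DE_sn b M A nE l f))"
    and fG: "\<forall>\<phi>\<in>GSsp b M A. f \<phi> = G (emb b M A \<phi>)"
    using f unfolding DEdual_def by blast
  \<comment> \<open>In the Beurling case G fixes l and is bounded on D_E only, so membership has to
    hold at all parameters. In the Roumieu case the convolution fixes l, and G is bounded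
    there.\<close>
  have "\<exists>l>0. \<exists>K\<ge>0. \<exists>C. \<forall>\<psi>\<in>GSsp b M A. emb b M A (Kop \<phi> \<psi>) \<in> DEstep b M A E nE l \<and>
      DE_sn b M A nE l (emb b M A (Kop \<phi> \<psi>)) \<le> ereal (K * N \<psi>) \<and>
      norm (G (emb b M A (Kop \<phi> \<psi>))) \<le> C * real_of_ereal (DE_sn b M A nE l (emb b M A (Kop \<phi> \<psi>)))"
  proof (cases b)
    case True
    obtain l C where lC: "l > 0" "\<forall>f\<in>DE b M A E nE. norm (G f) \<le> C * real_of_ereal (DE_sn b M A nE l f)"
      using G True by auto
    have all: "\<exists>K\<ge>0. \<forall>\<psi>\<in>GSsp b M A. emb b M A (Kop \<phi> \<psi>) \<in> DEstep b M A E nE l \<and>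
      DE_sn b M A nE l (emb b M A (Kop \<phi> \<psi>)) \<le> ereal (K * N \<psi>)" if "0 < l" for l
      using DE_Kop[OF \<phi>] that unfolding qb_def if_P[OF True] by blast
    then have "emb b M A (Kop \<phi> \<psi>) \<in> DE b M A E nE" if "\<psi> \<in> GSsp b M A" for \<psi>
      using that True unfolding DE_def if_P[OF True] by blast
    then show ?thesis using all[OF lC(1)] lC by blast
  next
    case False
    show ?thesis using DE_Kop[OF \<phi>] G unfolding qb_def if_not_P[OF False] by meson
  qed
  then obtain l K C where l: "l > 0" and K: "K \<ge> 0" and *: "\<And>\<psi>. \<psi> \<in> GSsp b M A \<Longrightarrow> emb b M A (Kop \<phi> \<psi>) \<in> DEstep b M A E nE l"
      "\<And>\<psi>. \<psi> \<in> GSsp b M A \<Longrightarrow> DE_sn b M A nE l (emb b M A (Kop \<phi> \<psi>)) \<le> ereal (K * N \<psi>)"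
      "\<And>\<psi>. \<psi> \<in> GSsp b M A \<Longrightarrow> norm (G (emb b M A (Kop \<phi> \<psi>))) \<le> C * real_of_ereal (DE_sn b M A nE l (emb b M A (Kop \<phi> \<psi>)))"
    by blast
  have "norm (f (Kop \<phi> \<psi>)) \<le> \<bar>C\<bar> * K * N \<psi>" if \<psi>: "\<psi> \<in> GSsp b M A" for \<psi>
  proof -
    let ?D = "real_of_ereal (DE_sn b M A nE l (emb b M A (Kop \<phi> \<psi>)))"
    have D: "0 \<le> ?D" "?D \<le> K * N \<psi>"
      using DE_sn_nonneg[OF *(1)[OF \<psi>] l] *(2)[OF \<psi>]
      by (cases "DE_sn b M A nE l (emb b M A (Kop \<phi> \<psi>))"; simp)+
    have "norm (f (Kop \<phi> \<psi>)) \<le> C * ?D" using *(3)[OF \<psi>] fG GSsp_Kop(1)[OF \<phi> \<psi>] by simp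
    also have "\<dots> \<le> \<bar>C\<bar> * (K * N \<psi>)" using D by (intro mult_mono) auto
    finally show ?thesis by simp
  qed
  moreover have "0 \<le> \<bar>C\<bar> * K" using K by simp
  ultimately show ?thesis unfolding conv_eq[OF \<phi>]
    by (rule EdualI[OF lin_on_functional_Kop[OF GSdualD(2)[OF fd] \<phi>]])
qed

proposition sum_representation_imp_DEdual:
  assumes f: "f \<in> GSdual b M A" and fa: "\<And>\<alpha>. fa \<alpha> \<in> Edual b M A E nE"
    and sum: "\<And>\<phi>. \<phi> \<in> GSsp b M A \<Longrightarrow> ((\<lambda>\<alpha>. dder b M A \<alpha> (fa \<alpha>) \<phi>) has_sum f \<phi>) UNIV"
    and bdd: "bq b (\<lambda>l. bdd_above (range (\<lambda>\<alpha>. l ^ mlen \<alpha> * M (mlen \<alpha>) * Edual_norm b M A nE (fa \<alpha>))))"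
  shows "f \<in> DEdual b M A E nE"
proof -
  let ?e = "\<lambda>\<alpha>. Edual_norm b M A nE (fa \<alpha>)"
  have "\<forall>\<alpha>. \<exists>G C. lin_on E G \<and> (\<forall>f\<in>E. norm (G f) \<le> C * nE f) \<and> fa \<alpha> = restr (GSsp b M A) (\<lambda>\<phi>. G (emb b M A \<phi>))"
    using fa unfolding Edual_def by blast
  then obtain G C where G: "\<And>\<alpha>. lin_on E (G \<alpha>)" "\<And>\<alpha> f. f \<in> E \<Longrightarrow> norm (G \<alpha> f) \<le> C \<alpha> * nE f"
      "\<And>\<alpha>. fa \<alpha> = restr (GSsp b M A) (\<lambda>\<phi>. G \<alpha> (emb b M A \<phi>))"
    by metis
  have Ge: "norm (G \<alpha> h) \<le> ?e \<alpha> * nE h" "0 \<le> ?e \<alpha>" if "h \<in> E" for \<alpha> h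
    using Edual_norm_bound[OF G(1) G(2) G(3) that] by blast+
  define T where "T h \<alpha> = (-1) ^ mlen \<alpha> * G \<alpha> (dder b M A \<alpha> h)" for h \<alpha>
  define s where "s = (\<Sum>\<^sub>\<infinity>\<alpha>::'n \<Rightarrow> nat. (1/2::real) ^ mlen \<alpha>)"
  have geo: "(\<lambda>\<alpha>::'n \<Rightarrow> nat. (1/2::real) ^ mlen \<alpha>) summable_on UNIV" by (rule summable_on_geometric_mlen) auto
  \<comment> \<open>The hypothesis is used at 2 l in order to gain a factor (1/2)^|\<alpha>|, which
    makes the series over all multi-indices converge.\<close>
  have bound: "T h summable_on UNIV \<and> norm (\<Sum>\<^sub>\<infinity>\<alpha>. T h \<alpha>) \<le> (K * s) * real_of_ereal (DE_sn b M A nE l h)"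
    if l: "0 < l" and K: "\<And>\<alpha>. (2 * l) ^ mlen \<alpha> * M (mlen \<alpha>) * ?e \<alpha> \<le> K" and h: "h \<in> DEstep b M A E nE l" for l K h
  proof -
    let ?D = "real_of_ereal (DE_sn b M A nE l h)"
    have D0: "0 \<le> ?D" using DE_sn_nonneg[OF h l] by (simp add: real_of_ereal_pos)
    have hE: "dder b M A \<alpha> h \<in> E" for \<alpha> using h by (simp add: DEstep_def)
    have le: "norm (T h \<alpha>) \<le> (K * ?D) * (1/2) ^ mlen \<alpha>" for \<alpha>
    proof -
      have "norm (T h \<alpha>) \<le> ?e \<alpha> * nE (dder b M A \<alpha> h)"
        using Ge(1)[OF hE] by (simp add: T_def norm_mult norm_power)
      also have "\<dots> \<le> ?e \<alpha> * (?D * (l ^ mlen \<alpha> * M (mlen \<alpha>)))"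
        by (intro mult_left_mono nE_dder_le[OF h l] Ge(2)[OF hE])
      also have "\<dots> = ((2 * l) ^ mlen \<alpha> * M (mlen \<alpha>) * ?e \<alpha>) * (?D * (1/2) ^ mlen \<alpha>)"
        by (simp add: power_mult_distrib power_divide)
      also have "\<dots> \<le> K * (?D * (1/2) ^ mlen \<alpha>)" using D0 by (intro mult_right_mono K) auto
      finally show ?thesis by (simp add: mult_ac)
    qed
    have maj: "(\<lambda>\<alpha>::'n \<Rightarrow> nat. (K * ?D) * (1/2) ^ mlen \<alpha>) summable_on UNIV"
      by (rule summable_on_cmult_right[OF geo])
    have abs: "(\<lambda>\<alpha>. norm (T h \<alpha>)) summable_on UNIV"
      by (rule summable_on_comparison_test[OF maj]) (use le in auto)
    have "norm (\<Sum>\<^sub>\<infinity>\<alpha>. T h \<alpha>) \<le> (\<Sum>\<^sub>\<infinity>\<alpha>. norm (T h \<alpha>))" by (rule norm_infsum_bound[OF abs])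
    also have "\<dots> \<le> (\<Sum>\<^sub>\<infinity>\<alpha>::'n \<Rightarrow> nat. (K * ?D) * (1/2) ^ mlen \<alpha>)" by (rule infsum_mono[OF abs maj le])
    also have "\<dots> = (K * ?D) * s" unfolding s_def by (rule infsum_cmult_right') 
    finally show ?thesis using abs_summable_summable[OF abs] by (simp add: mult_ac)
  qed
  have step: "\<exists>K. \<forall>h\<in>DEstep b M A E nE l. T h summable_on UNIV \<and> norm (\<Sum>\<^sub>\<infinity>\<alpha>. T h \<alpha>) \<le> K * real_of_ereal (DE_sn b M A nE l h)"
    if l: "0 < l" and b: "bdd_above (range (\<lambda>\<alpha>. (2 * l) ^ mlen \<alpha> * M (mlen \<alpha>) * ?e \<alpha>))" for l
  proof -
    obtain K where "\<And>\<alpha>. (2 * l) ^ mlen \<alpha> * M (mlen \<alpha>) * ?e \<alpha> \<le> K" using b unfolding bdd_above_def by auto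
    from bound[OF l this] show ?thesis by blast
  qed
  define GG where "GG h = (\<Sum>\<^sub>\<infinity>\<alpha>. T h \<alpha>)" for h
  have bqs: "bq b (\<lambda>l. 0 < l \<longrightarrow> (\<exists>K. \<forall>h\<in>DEstep b M A E nE l. T h summable_on UNIV \<and> norm (GG h) \<le> K * real_of_ereal (DE_sn b M A nE l h)))"
  proof (cases b)
    case True
    then obtain L where L: "0 < L" "bdd_above (range (\<lambda>\<alpha>. L ^ mlen \<alpha> * M (mlen \<alpha>) * ?e \<alpha>))"
      using bdd unfolding bq_def by auto
    show ?thesis unfolding bq_def if_P[OF True] GG_def using step[of "L / 2"] L by (intro exI[of _ "L / 2"]) simp
  next
    case False
    have bd: "bdd_above (range (\<lambda>\<alpha>. l ^ mlen \<alpha> * M (mlen \<alpha>) * ?e \<alpha>))" if "0 < l" for l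
      using bdd[unfolded bq_def if_not_P[OF False], rule_format, OF that] .
    show ?thesis unfolding bq_def if_not_P[OF False] GG_def
      by (intro allI impI, rule step, assumption, rule bd, simp)
  qed
  have DE_step: "qb b (\<lambda>l. h \<in> DEstep b M A E nE l)" if "h \<in> DE b M A E nE" for h
    using that by (auto simp: DE_def qb_def split: if_splits)
  have summ: "T h summable_on UNIV \<and> (\<forall>\<alpha>. dder b M A \<alpha> h \<in> E)" if "h \<in> DE b M A E nE" for h
    using qb_bq_meet[OF DE_step[OF that] bqs] by (auto simp: DEstep_def)
  have lin: "lin_on (DE b M A E nE) GG"
    unfolding lin_on_def
  proof (intro ballI allI conjI)
    fix h k c assume h: "h \<in> DE b M A E nE" and k: "k \<in> DE b M A E nE"
    have "T (\<lambda>x. h x + k x) = (\<lambda>\<alpha>. T h \<alpha> + T k \<alpha>)"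
      using summ[OF h] summ[OF k] by (simp add: T_def dder_add lin_on_add[OF G(1)] fun_eq_iff algebra_simps)
    then show "GG (\<lambda>x. h x + k x) = GG h + GG k"
      unfolding GG_def using summ[OF h] summ[OF k] by (simp add: infsum_add)
    have "T (\<lambda>x. c * h x) = (\<lambda>\<alpha>. c * T h \<alpha>)"
      using summ[OF h] by (simp add: T_def dder_cmult lin_on_cmult[OF G(1)] fun_eq_iff)
    then show "GG (\<lambda>x. c * h x) = c * GG h"
      unfolding GG_def by (simp add: infsum_cmult_right')
  qed
  have emb: "f \<phi> = GG (emb b M A \<phi>)" if \<phi>: "\<phi> \<in> GSsp b M A" for \<phi>
  proof -
    have "T (emb b M A \<phi>) \<alpha> = dder b M A \<alpha> (fa \<alpha>) \<phi>" for \<alpha>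
    proof -
      have "fa \<alpha> (Dmi \<alpha> \<phi>) = G \<alpha> (emb b M A (Dmi \<alpha> \<phi>))"
        by (subst G(3)) (simp add: restr_def Dmi_GSsp[OF \<phi>])
      then show ?thesis unfolding T_def dder_emb[OF \<phi>] using \<phi> by (simp add: dder_def restr_def)
    qed
    then have "T (emb b M A \<phi>) = (\<lambda>\<alpha>. dder b M A \<alpha> (fa \<alpha>) \<phi>)" by (rule ext)
    then show ?thesis unfolding GG_def using infsumI[OF sum[OF \<phi>]] by (simp only:)
  qed
  have "if b then (\<exists>l>0. \<exists>C. \<forall>f\<in>DE b M A E nE. norm (GG f) \<le> C * real_of_ereal (DE_sn b M A nE l f))
            else (\<forall>l>0. \<exists>C. \<forall>f\<in>DEstep b M A E nE l. norm (GG f) \<le> C * real_of_ereal (DE_sn b M A nE l f))"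
  proof (cases b)
    case True
    then obtain l K where "0 < l" "\<forall>h\<in>DEstep b M A E nE l. norm (GG h) \<le> K * real_of_ereal (DE_sn b M A nE l h)"
      using bqs unfolding bq_def by auto
    moreover from this(1) have "DE b M A E nE \<subseteq> DEstep b M A E nE l" using True by (auto simp: DE_def)
    ultimately show ?thesis using True by auto
  next
    case False
    then show ?thesis using bqs unfolding bq_def if_not_P[OF False] by blast
  qed
  with f lin emb show ?thesis unfolding DEdual_def by blast
qed

end

section \<open>Uniform bounds from the convolution condition\<close>

text \<open>A uniform boundedness principle in which only series with weights 3^(-k) have to be
  controlled. Stage n picks p and q with a dominating n-th term: it is at least (2/3) S p 3^(-n),
  the later terms add up to at most (1/2) S p 3^(-n), and the remaining sixth exceeds n plus all
  earlier terms.\<close>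

lemma gliding_hump:
  fixes t :: "'p \<Rightarrow> 'q \<Rightarrow> complex"
  assumes bq: "\<And>p. p \<in> B \<Longrightarrow> \<exists>C. \<forall>q\<in>\<Phi>. norm (t p q) \<le> C"
    and bp: "\<And>q. q \<in> \<Phi> \<Longrightarrow> \<exists>C. \<forall>p\<in>B. norm (t p q) \<le> C"
    and series: "\<And>\<phi>. (\<And>k. \<phi> k \<in> \<Phi>) \<Longrightarrow> \<exists>C. \<forall>p\<in>B. norm (\<Sum>k. (1/3) ^ k * t p (\<phi> k)) \<le> C"
  shows "\<exists>C. \<forall>p\<in>B. \<forall>q\<in>\<Phi>. norm (t p q) \<le> C"
proof (rule ccontr)
  assume "\<not> ?thesis"
  then have unb: "\<And>C. \<exists>p\<in>B. \<exists>q\<in>\<Phi>. C < norm (t p q)" by (meson not_le)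
  define S where "S p = (SUP q\<in>\<Phi>. norm (t p q))" for p
  have S: "norm (t p q) \<le> S p" if "p \<in> B" "q \<in> \<Phi>" for p q
    unfolding S_def using bq[OF that(1)] that(2) by (intro cSUP_upper) (auto simp: bdd_above_def)
  have "\<forall>q\<in>\<Phi>. \<exists>C\<ge>0. \<forall>p\<in>B. norm (t p q) \<le> C"
    using bp by (meson abs_ge_self abs_ge_zero order_trans)
  then obtain Cq where Cq: "\<And>q. q \<in> \<Phi> \<Longrightarrow> 0 \<le> Cq q" "\<And>p q. q \<in> \<Phi> \<Longrightarrow> p \<in> B \<Longrightarrow> norm (t p q) \<le> Cq q" by metis
  \<comment> \<open>a bounds the contribution of the earlier stages. It belongs to the state because
    the next p has to beat it.\<close>
  define P where "P n x \<longleftrightarrow> (case x of (a, p, q) \<Rightarrow> p \<in> B \<and> q \<in> \<Phi> \<and> real n + a \<le> S p * (1/3) ^ n / 6 \<and>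
      2/3 * S p \<le> norm (t p q))" for n :: nat and x :: "real \<times> 'p \<times> 'q"
  have ex: "\<exists>p q. P n (a, p, q)" for n a
  proof -
    let ?K = "(\<bar>a\<bar> + real n + 1) * 6 * 3 ^ n"
    obtain p q where pq: "p \<in> B" "q \<in> \<Phi>" "?K < norm (t p q)" using unb by blast
    have Sp: "?K < S p" using S[OF pq(1,2)] pq(3) by linarith
    then have "0 < S p" by (smt (verit) mult_nonneg_nonneg of_nat_0_le_iff zero_le_power)
    then have "2/3 * S p < (SUP q\<in>\<Phi>. norm (t p q))" by (simp add: S_def)
    then obtain q' where q': "q' \<in> \<Phi>" "2/3 * S p < norm (t p q')"
      using less_cSUP_iff[of \<Phi> "\<lambda>q. norm (t p q)" "2/3 * S p"] bq[OF pq(1)] pq(2) by (auto simp: bdd_above_def)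
    have "(real n + a) * (6 * 3 ^ n) \<le> ?K" by (simp add: mult.assoc mult_right_mono)
    then have "real n + a \<le> S p * (1/3) ^ n / 6" using Sp by (simp add: power_one_over field_simps)
    then show ?thesis using pq q' by (auto simp: P_def intro!: exI[of _ p] exI[of _ q'])
  qed
  \<comment> \<open>The first component is forced by the previous stage: it adds the weighted
    pointwise bound for the q just chosen, valid for every later p.\<close>
  have "\<exists>x. \<forall>n. P n (x n) \<and> (fst (x (Suc n)) = fst (x n) + (1/3) ^ n * Cq (snd (snd (x n))) \<and> (n = 0 \<longrightarrow> fst (x n) = 0))"
  proof -
    have "\<exists>x. \<forall>n. (P n (x n) \<and> (n = 0 \<longrightarrow> fst (x n) = 0)) \<and> (fst (x (Suc n)) = fst (x n) + (1/3) ^ n * Cq (snd (snd (x n))))"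
    proof (rule dependent_nat_choice)
      show "\<exists>x. P 0 x \<and> (0 = 0 \<longrightarrow> fst x = 0)" using ex[of 0 0] by auto
      show "\<exists>y. (P (Suc n) y \<and> (Suc n = 0 \<longrightarrow> fst y = 0)) \<and> fst y = fst x + (1/3) ^ n * Cq (snd (snd x))" for x n
        using ex[of "Suc n" "fst x + (1/3) ^ n * Cq (snd (snd x))"] by auto
    qed
    then show ?thesis by blast
  qed
  then obtain x where x: "\<And>n. P n (x n)" "\<And>n. fst (x (Suc n)) = fst (x n) + (1/3) ^ n * Cq (snd (snd (x n)))" "fst (x 0) = 0"
    by blast
  define p where "p n = fst (snd (x n))" for n
  define q where "q n = snd (snd (x n))" for n
  have pB: "p n \<in> B" and q\<Phi>: "q n \<in> \<Phi>" and Pn: "real n + fst (x n) \<le> S (p n) * (1/3) ^ n / 6"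
    and hump: "2/3 * S (p n) \<le> norm (t (p n) (q n))" for n
    using x(1)[of n] by (auto simp: P_def p_def q_def split: prod.splits)
  have acc: "fst (x n) = (\<Sum>k<n. (1/3) ^ k * Cq (q k))" for n
    by (induction n) (simp_all add: x q_def)
  obtain C where C: "\<And>p. p \<in> B \<Longrightarrow> norm (\<Sum>k. (1/3) ^ k * t p (q k)) \<le> C" using series[of q] q\<Phi> by blast
  have "real n \<le> C" for n
  proof -
    let ?f = "\<lambda>k. (1/3) ^ k * t (p n) (q k)"
    have fle: "norm (?f k) \<le> S (p n) * (1/3) ^ k" for k
      using S[OF pB q\<Phi>, of n k] by (simp add: norm_mult norm_power mult.commute mult_left_mono)
    have geo: "summable (\<lambda>k. S (p n) * (1/3::real) ^ k)" by (intro summable_mult summable_geometric) simp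
    have sm: "summable ?f" by (rule summable_comparison_test'[OF geo fle])
    have S0: "0 \<le> S (p n)" using order_trans[OF norm_ge_zero S[OF pB q\<Phi>]] .
    have tail: "norm (\<Sum>k. ?f (k + Suc n)) \<le> S (p n) * (1/3) ^ n / 2"
    proof -
      have "norm (\<Sum>k. ?f (k + Suc n)) \<le> (\<Sum>k. S (p n) * (1/3) ^ (k + Suc n))"
        by (rule norm_suminf_le[OF fle]) (rule summable_ignore_initial_segment[OF geo])
      also have "\<dots> = (\<Sum>k. S (p n) * (1/3) ^ Suc n * (1/3) ^ k)" by (simp add: power_add mult_ac)
      also have "\<dots> = S (p n) * (1/3) ^ Suc n * (1 / (1 - 1/3))"
        by (subst suminf_mult) (auto simp: suminf_geometric summable_geometric)
      finally show ?thesis by simp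
    qed
    have head: "norm (\<Sum>k<n. ?f k) \<le> fst (x n)"
      unfolding acc by (rule sum_norm_le) (simp add: norm_mult norm_power Cq(2)[OF q\<Phi> pB] mult_left_mono)
    have mid: "S (p n) * (1/3) ^ n * (2/3) \<le> norm (?f n)"
      using mult_left_mono[OF hump[of n], of "(1/3) ^ n"] by (simp add: norm_mult norm_power mult_ac)
    have eq: "?f n = (\<Sum>k. ?f k) - (\<Sum>k. ?f (k + Suc n)) - (\<Sum>k<n. ?f k)"
      using suminf_split_initial_segment[OF sm, of "Suc n"] by simp
    have "norm (?f n) \<le> norm (\<Sum>k. ?f k) + norm (\<Sum>k. ?f (k + Suc n)) + norm (\<Sum>k<n. ?f k)"
      by (subst eq) (rule order_trans[OF norm_triangle_ineq4 add_right_mono[OF norm_triangle_ineq4]])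
    then have "S (p n) * (1/3) ^ n * (2/3) \<le> C + S (p n) * (1/3) ^ n / 2 + fst (x n)"
      using C[OF pB, of n] tail head mid by linarith
    then show ?thesis using Pn[of n] by simp
  qed
  then show False by (meson not_le reals_Archimedean2)
qed

lemma bq_ex: "bq b P \<Longrightarrow> \<exists>l>0. P l"
  unfolding bq_def by (auto split: if_splits intro: exI[of _ 1])

context gs_weights
begin

lemma lin_on_functional_Kop_left:
  assumes f: "lin_on (GSsp b M A) f" and \<psi>: "(\<psi> :: 'n::finite tfun) \<in> GSsp b M A"
  shows "lin_on (GSsp b M A) (\<lambda>\<phi>. f (Kop \<phi> \<psi>))"
  unfolding lin_on_def
proof (intro ballI allI conjI)
  fix \<phi> \<theta> :: "'n tfun" and c assume S: "\<phi> \<in> GSsp b M A" "\<theta> \<in> GSsp b M A"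
  have "Kop (\<lambda>x. \<phi> x + \<theta> x) \<psi> = (\<lambda>x. Kop \<phi> \<psi> x + Kop \<theta> \<psi> x)" by (rule ext) (rule Kop_add_left[OF S \<psi>])
  then show "f (Kop (\<lambda>x. \<phi> x + \<theta> x) \<psi>) = f (Kop \<phi> \<psi>) + f (Kop \<theta> \<psi>)"
    by (simp add: lin_on_add[OF f] GSsp_Kop \<psi> S)
  have "Kop (\<lambda>x. c * \<phi> x) \<psi> = (\<lambda>x. c * Kop \<phi> \<psi> x)" by (rule ext) (rule Kop_cmult_left)
  then show "f (Kop (\<lambda>x. c * \<phi> x) \<psi>) = c * f (Kop \<phi> \<psi>)"
    by (simp add: lin_on_cmult[OF f] GSsp_Kop \<psi> S)
qed

text \<open>R is carried along because the bounds on a family of windows and the continuity of f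
  have to hold at the same parameter.\<close>

lemma functional_Kop_left_bound:
  assumes f: "f \<in> GSdual b M A" and \<psi>: "(\<psi> :: 'n::finite tfun) \<in> GSsp b M A"
    and R: "qb b R" and mono: "\<And>l l'. 0 < l \<Longrightarrow> l \<le> l' \<Longrightarrow> R l \<Longrightarrow> R l'"
  shows "\<exists>l>0. R l \<and> (\<exists>K\<ge>0. \<forall>\<phi>\<in>GSsp b M A. \<forall>B. gb M A l \<phi> B \<longrightarrow> norm (f (Kop \<phi> \<psi>)) \<le> K * B)"
proof -
  let ?H = "HA CARD('n)"
  have "qb b (\<lambda>l. R l \<and> (\<exists>B. gb M A l \<psi> B))"
    by (rule qb_conj[OF R _ mono]) (use \<psi> in \<open>auto simp: GSsp_qb intro: gb_mono\<close>)
  then have "qb b (\<lambda>l. R (l / (2 * ?H)) \<and> (\<exists>B. gb M A (l / (2 * ?H)) \<psi> B))"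
    by (rule qb_scale) simp
  from qb_bq_meet[OF this GSdualD(3)[OF f]] obtain l B2 Cf where l: "0 < l" and Rl: "R (l / (2 * ?H))"
    and B2: "gb M A (l / (2 * ?H)) \<psi> B2" and Cf: "\<And>\<phi> B. \<phi> \<in> GSsp b M A \<Longrightarrow> gb M A l \<phi> B \<Longrightarrow> norm (f \<phi>) \<le> Cf * B"
    by blast
  let ?l = "l / (2 * ?H)"
  have l': "0 < ?l" using l by simp
  obtain C where C: "C > 0" "\<And>\<psi> \<eta> B Q. smooth_fn \<psi> \<Longrightarrow> \<eta> \<in> borel_measurable borel \<Longrightarrow> gb M A ?l \<psi> B \<Longrightarrow>
      wb A (1 / ?l) \<eta> Q \<Longrightarrow> gb M A (2 * ?H * ?l) (Kop \<eta> \<psi> :: 'n tfun) (C * B * Q)"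
    using Kop_gb[OF l', where 'n='n] by blast
  have "norm (f (Kop \<phi> \<psi>)) \<le> (\<bar>Cf\<bar> * C * B2 * M 0) * B" if \<phi>: "\<phi> \<in> GSsp b M A" and B: "gb M A ?l \<phi> B" for \<phi> B
  proof -
    have "wb A (1 / ?l) \<phi> (B * M 0)" using gb_wb[OF B, of "[]"] by simp
    from C(2)[OF GSsp_smooth[OF \<psi>] GSsp_measurable[OF \<phi>] B2 this]
    have g: "gb M A l (Kop \<phi> \<psi>) (C * B2 * (B * M 0))" by simp
    have "norm (f (Kop \<phi> \<psi>)) \<le> Cf * (C * B2 * (B * M 0))" by (rule Cf[OF GSsp_Kop(1)[OF \<phi> \<psi>] g])
    also have "\<dots> \<le> \<bar>Cf\<bar> * (C * B2 * (B * M 0))" by (intro mult_right_mono gb_nonneg[OF g]) auto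
    finally show ?thesis by (simp add: mult_ac)
  qed
  moreover have "0 \<le> \<bar>Cf\<bar> * C * B2 * M 0" using C(1) gb_nonneg[OF B2] by simp
  ultimately show ?thesis using l' Rl by blast
qed

text \<open>The tail estimate holds wherever the family is uniformly bounded, and for n = 0 it shows
  membership. The constant 2 rounds up 3/2, the sum of all 3^(-k).\<close>

lemma GSsp_series:
  fixes \<phi> :: "nat \<Rightarrow> 'n::finite tfun"
  assumes \<phi>: "\<And>k. \<phi> k \<in> GSsp b M A" and bd: "qb b (\<lambda>l. \<exists>C. \<forall>k. gb M A l (\<phi> k) C)"
  shows "(\<lambda>x. \<Sum>k. (1/3) ^ k * \<phi> k x) \<in> GSsp b M A"
    and "\<And>l C n. 0 < l \<Longrightarrow> (\<And>k. gb M A l (\<phi> k) C) \<Longrightarrow>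
        gb M A l (\<lambda>x. (\<Sum>k. (1/3) ^ k * \<phi> k x) - (\<Sum>k<n. (1/3) ^ k * \<phi> k x)) (2 * C * (1/3) ^ n)"
proof -
  note sm = GSsp_smooth[OF \<phi>]
  let ?F = "\<lambda>k x. (1/3) ^ k * \<phi> k x"
  obtain l0 C0 where l0: "0 < l0" and C0: "\<And>k. gb M A l0 (\<phi> k) C0" using qb_ex[OF bd] by blast
  have D: "Dlist is (?F k) = (\<lambda>x. (1/3) ^ k * Dlist is (\<phi> k) x)" for "is" k by (rule smooth_fn_cmult(2)[OF sm])
  have geo: "summable (\<lambda>k. (1/3::real) ^ k)" by (rule summable_geometric) simp
  have le: "norm (Dlist is (?F k) x) \<le> (1/3) ^ k * (C0 * (l0 ^ length is * M (length is)))" for "is" k x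
    unfolding D norm_mult norm_power using gb_bound[OF C0 l0, of "is" k x] by (simp add: mult_left_mono)
  have summ: "summable (\<lambda>k. norm (Dlist is (?F k) x))" for "is" x
    by (rule summable_comparison_test'[where N=0, OF summable_mult2[OF geo, of "C0 * (l0 ^ length is * M (length is))"]])
      (use le in simp)
  have int: "integrable (count_space UNIV) (\<lambda>k. Dlist is (?F k) x)" for "is" x
    unfolding integrable_count_space_nat_iff by (rule summ)
  have A1: "smooth_fn (?F k)" for k by (rule smooth_fn_cmult(1)[OF sm])
  have A2: "(\<lambda>k. Dlist is (?F k) x) \<in> borel_measurable (count_space UNIV)" for "is" x by simp
  have A3: "integrable (count_space UNIV) (\<lambda>k. (1/3) ^ k * (C0 * (l0 ^ length is * M (length is))))" for "is" :: "'n list"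
    unfolding integrable_count_space_nat_iff norm_mult norm_power
    using summable_mult2[OF geo, of "\<bar>C0 * (l0 ^ length is * M (length is))\<bar>"]
    by (simp add: abs_mult power_abs)
  \<comment> \<open>Read as an integral over counting measure, the series is differentiated termwise
    by \<open>smooth_fn_integral\<close>.\<close>
  have eq: "(\<Sum>k. ?F k x) = (LINT k|count_space UNIV. ?F k x)" for x
    using integral_count_space_nat[OF int[of "[]" x]] by simp
  have sS: "smooth_fn (\<lambda>x. \<Sum>k. ?F k x)" unfolding eq by (rule smooth_fn_integral(1)[OF A1 A2 A3 le])
  have DS: "Dlist is (\<lambda>x. \<Sum>k. ?F k x) = (\<lambda>x. \<Sum>k. Dlist is (?F k) x)" for "is"
    unfolding eq smooth_fn_integral(2)[OF A1 A2 A3 le] using integral_count_space_nat[OF int] by simp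
  show tail: "gb M A l (\<lambda>x. (\<Sum>k. ?F k x) - (\<Sum>k<n. ?F k x)) (2 * C * (1/3) ^ n)"
    if l: "0 < l" and C: "\<And>k. gb M A l (\<phi> k) C" for l C n
    unfolding gb_def
  proof (intro allI)
    fix "is" :: "'n list" and x :: "real^'n"
    let ?E = "eo A (norm x / l)" and ?m = "l ^ length is * M (length is)"
    have ss: "smooth_fn (\<lambda>x. \<Sum>k<n. ?F k x)" by (rule smooth_fn_sum(1)) (simp_all add: sm)
    have "Dlist is (\<lambda>x. (\<Sum>k. ?F k x) - (\<Sum>k<n. ?F k x)) x = (\<Sum>k. Dlist is (?F k) x) - (\<Sum>k<n. Dlist is (?F k) x)"
      unfolding smooth_fn_diff(2)[OF sS ss] DS using smooth_fn_sum(2)[where Z="{..<n}" and F=\<phi> and a="\<lambda>k. (1/3) ^ k"] sm by (simp add: D)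
    also have "\<dots> = (\<Sum>k. Dlist is (?F (k + n)) x)"
      using suminf_minus_initial_segment[OF summable_norm_cancel[OF summ[of "is" x]], of n] by simp
    also have "norm \<dots> \<le> (\<Sum>k. (1/3) ^ k * ((1/3) ^ n * (C * ?m / ?E)))"
    proof (rule norm_suminf_le)
      show "norm (Dlist is (?F (k + n)) x) \<le> (1/3) ^ k * ((1/3) ^ n * (C * ?m / ?E))" for k
      proof -
        have "norm (Dlist is (\<phi> (k + n)) x) \<le> C * ?m / ?E" using gbD[OF C, of "is" "k + n" x] by (simp add: field_simps)
        from mult_left_mono[OF this, of "(1/3) ^ k * (1/3) ^ n"]
        show ?thesis unfolding D norm_mult norm_power by (simp add: power_add mult_ac)
      qed
      show "summable (\<lambda>k. (1/3) ^ k * ((1/3) ^ n * (C * ?m / ?E)))" by (rule summable_mult2[OF geo])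
    qed
    also have "\<dots> = (3/2) * ((1/3) ^ n * (C * ?m / ?E))"
      by (subst suminf_mult2[OF geo, symmetric]) (simp add: suminf_geometric)
    also have "\<dots> \<le> 2 * ((1/3) ^ n * (C * ?m / ?E))"
      using l gb_nonneg[OF C] by (intro mult_right_mono) auto
    finally show "norm (Dlist is (\<lambda>x. (\<Sum>k. ?F k x) - (\<Sum>k<n. ?F k x)) x) * ?E \<le> 2 * C * (1/3) ^ n * ?m"
      by (simp add: field_simps)
  qed
  show "(\<lambda>x. \<Sum>k. ?F k x) \<in> GSsp b M A"
    unfolding GSsp_qb
  proof (intro conjI sS qb_mono[OF bd])
    fix l assume "0 < l" "\<exists>C. \<forall>k. gb M A l (\<phi> k) C"
    then obtain C where "\<And>k. gb M A l (\<phi> k) C" by blast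
    from tail[OF \<open>0 < l\<close> this, of 0] show "\<exists>B. gb M A l (\<lambda>x. \<Sum>k. ?F k x) B" by auto
  qed
qed

end

context tmib
begin

text \<open>The gliding hump with \<psi> in the unit ball of E and \<phi> in the family. Its series
  condition holds because the weighted sum of windows is again a test function, to which the
  hypothesis on convolutions applies.\<close>

lemma conv_uniformly_bounded:
  assumes f: "f \<in> GSdual b M A" and conv: "\<And>\<phi>. \<phi> \<in> GSsp b M A \<Longrightarrow> conv b M A f \<phi> \<in> Edual b M A E nE"
    and \<Phi>: "\<Phi> \<subseteq> GSsp b M A" "qb b (\<lambda>l. \<exists>C. \<forall>\<phi>\<in>\<Phi>. gb M A l \<phi> C)"
  shows "\<exists>C\<ge>0. \<forall>\<phi>\<in>\<Phi>. \<forall>\<psi>\<in>GSsp b M A. norm (f (Kop \<phi> \<psi>)) \<le> C * N \<psi>"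
proof -
  have cb: "\<exists>C. \<forall>\<psi>\<in>GSsp b M A. norm (f (Kop \<phi> \<psi>)) \<le> C * N \<psi>" if \<phi>: "\<phi> \<in> GSsp b M A" for \<phi>
    using Edual_bound[OF conv[OF \<phi>]] by (simp add: conv_eq[OF \<phi>] restr_def)
  let ?B = "{\<psi> \<in> GSsp b M A. N \<psi> \<le> 1}"
  have cb1: "\<exists>C. \<forall>\<psi>\<in>?B. norm (f (Kop \<phi> \<psi>)) \<le> C" if \<phi>: "\<phi> \<in> GSsp b M A" for \<phi>
  proof -
    obtain C where C: "\<And>\<psi>. \<psi> \<in> GSsp b M A \<Longrightarrow> norm (f (Kop \<phi> \<psi>)) \<le> C * N \<psi>" using cb[OF \<phi>] by blast
    have "norm (f (Kop \<phi> \<psi>)) \<le> \<bar>C\<bar>" if "\<psi> \<in> ?B" for \<psi>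
    proof -
      have "norm (f (Kop \<phi> \<psi>)) \<le> C * N \<psi>" using C that by simp
      also have "\<dots> \<le> \<bar>C\<bar> * 1" using that N_nonneg[of \<psi>] by (intro mult_mono) auto
      finally show ?thesis by simp
    qed
    then show ?thesis by blast
  qed
  have Rmono: "\<exists>C. \<forall>\<phi>\<in>\<Phi>. gb M A l' \<phi> C" if "0 < l" "l \<le> l'" "\<exists>C. \<forall>\<phi>\<in>\<Phi>. gb M A l \<phi> C" for l l'
    using that by (meson gb_mono)
  have key: "\<exists>l>0. (\<exists>C. \<forall>\<phi>\<in>\<Phi>. gb M A l \<phi> C) \<and> (\<exists>K\<ge>0. \<forall>\<phi>\<in>GSsp b M A. \<forall>B. gb M A l \<phi> B \<longrightarrow> norm (f (Kop \<phi> \<psi>)) \<le> K * B)"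
    if "\<psi> \<in> GSsp b M A" for \<psi>
    by (rule functional_Kop_left_bound[OF f that \<Phi>(2) Rmono])
  have "\<exists>C. \<forall>\<psi>\<in>?B. \<forall>\<phi>\<in>\<Phi>. norm (f (Kop \<phi> \<psi>)) \<le> C"
  proof (rule gliding_hump)
    show "\<exists>C. \<forall>\<phi>\<in>\<Phi>. norm (f (Kop \<phi> \<psi>)) \<le> C" if "\<psi> \<in> ?B" for \<psi>
      using key[of \<psi>] that \<Phi>(1) by blast
    show "\<exists>C. \<forall>\<psi>\<in>?B. norm (f (Kop \<phi> \<psi>)) \<le> C" if "\<phi> \<in> \<Phi>" for \<phi>
      using cb1 \<Phi>(1) that by blast
    fix \<phi> :: "nat \<Rightarrow> 'n tfun" assume \<phi>\<Phi>: "\<And>k. \<phi> k \<in> \<Phi>"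
    then have \<phi>: "\<phi> k \<in> GSsp b M A" for k using \<Phi>(1) by blast
    have bd: "qb b (\<lambda>l. \<exists>C. \<forall>k. gb M A l (\<phi> k) C)" by (rule qb_mono[OF \<Phi>(2)]) (use \<phi>\<Phi> in blast)
    let ?s = "\<lambda>x. \<Sum>k. (1/3) ^ k * \<phi> k x"
    have sS: "?s \<in> GSsp b M A" by (rule GSsp_series(1)[OF \<phi> bd])
    have "(\<Sum>k. (1/3) ^ k * f (Kop (\<phi> k) \<psi>)) = f (Kop ?s \<psi>)" if \<psi>: "\<psi> \<in> GSsp b M A" for \<psi>
    proof (rule sums_unique[symmetric])
      obtain l C K where l: "0 < l" and C: "\<And>k. gb M A l (\<phi> k) C"
        and K: "\<And>\<theta> B. \<theta> \<in> GSsp b M A \<Longrightarrow> gb M A l \<theta> B \<Longrightarrow> norm (f (Kop \<theta> \<psi>)) \<le> K * B"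
        using key[OF \<psi>] \<phi>\<Phi> by blast
      note lin = lin_on_functional_Kop_left[OF GSdualD(2)[OF f] \<psi>]
      have bound: "norm (f (Kop ?s \<psi>) - (\<Sum>k<n. (1/3) ^ k * f (Kop (\<phi> k) \<psi>))) \<le> K * (2 * C * (1/3) ^ n)" for n
      proof -
        have S: "(\<lambda>x. \<Sum>k<n. (1/3) ^ k * \<phi> k x) \<in> GSsp b M A" by (rule GSsp_sum) (simp_all add: \<phi>)
        have "norm (f (Kop (\<lambda>x. ?s x - (\<Sum>k<n. (1/3) ^ k * \<phi> k x)) \<psi>)) \<le> K * (2 * C * (1/3) ^ n)"
          by (rule K[OF GSsp_diff[OF sS S] GSsp_series(2)[OF \<phi> bd l C]])
        then show ?thesis using lin_on_diff[OF lin sS S] lin_on_sum[OF lin, of "{..<n}" \<phi> "\<lambda>k. (1/3) ^ k"] \<phi> by simp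
      qed
      have "(\<lambda>n. K * (2 * C * (1/3) ^ n)) \<longlonglongrightarrow> K * (2 * C * 0)"
        by (intro tendsto_mult tendsto_const LIMSEQ_realpow_zero) auto
      then have "(\<lambda>n. K * (2 * C * (1/3) ^ n)) \<longlonglongrightarrow> 0" by simp
      then have "(\<lambda>n. f (Kop ?s \<psi>) - (\<Sum>k<n. (1/3) ^ k * f (Kop (\<phi> k) \<psi>))) \<longlonglongrightarrow> 0"
        by (rule Lim_null_comparison[rotated]) (use bound in simp)
      then have "(\<lambda>n. f (Kop ?s \<psi>) - (f (Kop ?s \<psi>) - (\<Sum>k<n. (1/3) ^ k * f (Kop (\<phi> k) \<psi>)))) \<longlonglongrightarrow> f (Kop ?s \<psi>) - 0"
        by (intro tendsto_diff tendsto_const)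
      then show "(\<lambda>k. (1/3) ^ k * f (Kop (\<phi> k) \<psi>)) sums f (Kop ?s \<psi>)" by (simp add: sums_def)
    qed
    then show "\<exists>C. \<forall>\<psi>\<in>?B. norm (\<Sum>k. (1/3) ^ k * f (Kop (\<phi> k) \<psi>)) \<le> C" using cb1[OF sS] by simp
  qed
  then obtain C where C: "\<And>\<phi> \<psi>. \<psi> \<in> ?B \<Longrightarrow> \<phi> \<in> \<Phi> \<Longrightarrow> norm (f (Kop \<phi> \<psi>)) \<le> C" by blast
  have "norm (f (Kop \<phi> \<psi>)) \<le> \<bar>C\<bar> * N \<psi>" if \<phi>: "\<phi> \<in> \<Phi>" and \<psi>: "\<psi> \<in> GSsp b M A" for \<phi> \<psi>
  \<comment> \<open>With N \<psi> = 0 no scaling to norm 1 is possible, but the bound for the single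
    window already forces the value 0.\<close>
  proof (cases "N \<psi> = 0")
    case True
    obtain C' where "\<forall>\<psi>\<in>GSsp b M A. norm (f (Kop \<phi> \<psi>)) \<le> C' * N \<psi>" using cb[of \<phi>] \<phi> \<Phi>(1) by blast
    then have "norm (f (Kop \<phi> \<psi>)) \<le> C' * N \<psi>" using \<psi> by blast
    then show ?thesis using True by simp
  next
    case False
    then have pos: "0 < N \<psi>" using N_nonneg[OF \<psi>] by simp
    let ?c = "complex_of_real (1 / N \<psi>)"
    have nc: "norm ?c = 1 / N \<psi>" unfolding norm_of_real using pos by simp
    have "(\<lambda>x. ?c * \<psi> x) \<in> ?B" using GSsp_cmult[OF \<psi>, of ?c] N_cmult[OF \<psi>, of ?c] unfolding nc using pos by simp
    from C[OF this \<phi>] have "norm (?c * f (Kop \<phi> \<psi>)) \<le> C"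
      using lin_on_cmult[OF lin_on_functional_Kop[OF GSdualD(2)[OF f], of \<phi>] \<psi>, of ?c] \<phi> \<Phi>(1) by (auto dest!: subsetD)
    then have "norm (f (Kop \<phi> \<psi>)) \<le> C * N \<psi>" unfolding norm_mult nc using pos by (simp add: field_simps)
    also have "\<dots> \<le> \<bar>C\<bar> * N \<psi>" using pos by (intro mult_right_mono) auto
    finally show ?thesis .
  qed
  then show ?thesis by (intro exI[of _ "\<bar>C\<bar>"]) auto
qed

text \<open>By \<open>gb_mo\<close>, modulated windows divided by exp(omega_M(q |\<xi>|)) are
  bounded at the parameter 2 l if q \<ge> 2 pi / l. In the Roumieu case one large l is enough, so
  every q is reached. In the Beurling case all l are needed and no q serves them all; instead,
  counterexamples for q = n + 1 form a family bounded at every l, which contradicts uniform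
  boundedness.\<close>

lemma conv_mo_growth:
  assumes f: "f \<in> GSdual b M A" and conv: "\<And>\<phi>. \<phi> \<in> GSsp b M A \<Longrightarrow> conv b M A f \<phi> \<in> Edual b M A E nE"
    and \<eta>: "\<eta> \<in> GSsp b M A"
  shows "bq b (\<lambda>q. 0 < q \<longrightarrow> (\<exists>C\<ge>0. \<forall>\<xi>. \<forall>\<psi>\<in>GSsp b M A. norm (f (Kop (mo \<xi> \<eta>) \<psi>)) \<le> C * eo M (q * norm \<xi>) * N \<psi>))"
proof -
  define w where "w q \<xi> = (\<lambda>x. complex_of_real (1 / eo M (q * norm \<xi>)) * mo \<xi> \<eta> x)" for q and \<xi> :: "real^'n"
  have wS: "w q \<xi> \<in> GSsp b M A" for q \<xi> unfolding w_def by (intro GSsp_cmult GSsp_mo \<eta>)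
  have wf: "norm (f (Kop (mo \<xi> \<eta>) \<psi>)) = eo M (q * norm \<xi>) * norm (f (Kop (w q \<xi>) \<psi>))" if \<psi>: "\<psi> \<in> GSsp b M A" for q \<xi> \<psi>
  proof -
    have "f (Kop (w q \<xi>) \<psi>) = complex_of_real (1 / eo M (q * norm \<xi>)) * f (Kop (mo \<xi> \<eta>) \<psi>)"
      unfolding w_def by (rule lin_on_cmult[OF lin_on_functional_Kop_left[OF GSdualD(2)[OF f] \<psi>] GSsp_mo[OF \<eta>]])
    then show ?thesis by (simp add: norm_divide)
  qed
  have wg: "gb M A (2 * l) (w q \<xi>) (B * (eo M (2 * pi * norm \<xi> / l) / eo M (q * norm \<xi>)))" if "0 < l" "gb M A l \<eta> B" for l B q \<xi>
    using gb_cmult[OF smooth_fn_mo(1)[OF GSsp_smooth[OF \<eta>]] gb_mo[OF GSsp_smooth[OF \<eta>] that(2,1)], of "complex_of_real (1 / eo M (q * norm \<xi>))" \<xi>]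
    unfolding w_def norm_of_real by (simp add: mult_ac)
  have ratio: "eo M (s * norm \<xi>) / eo M (q * norm \<xi>) \<le> 1" if "0 \<le> s" "s \<le> q" for s q and \<xi> :: "real^'n"
    using eo_mono[OF wsM, of "s * norm \<xi>" "q * norm \<xi>"] that by (simp add: mult_right_mono)
  show ?thesis
  proof (cases b)
    case False
    show ?thesis unfolding bq_def if_not_P[OF False]
    proof (intro allI impI)
      fix q :: real assume q: "0 < q"
      obtain l0 B where l0: "0 < l0" and B: "gb M A l0 \<eta> B" using GSsp_gb[OF \<eta>] by blast
      define l where "l = max l0 (2 * pi / q)"
      have l: "0 < l" "l0 \<le> l" "2 * pi / l \<le> q" using l0 q by (auto simp: l_def max_def field_simps)
      have "gb M A (2 * l) (w q \<xi>) B" for \<xi>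
      proof (rule gb_mono_const[OF wg[OF l(1) gb_mono[OF B l0 l(2)]]])
        have "eo M ((2 * pi / l) * norm \<xi>) / eo M (q * norm \<xi>) \<le> 1" using l by (intro ratio) auto
        then show "B * (eo M (2 * pi * norm \<xi> / l) / eo M (q * norm \<xi>)) \<le> B"
          using gb_nonneg[OF B] by (intro mult_left_le) auto
      qed (use l in simp)
      then have "qb b (\<lambda>l. \<exists>C. \<forall>\<phi>\<in>range (w q). gb M A l \<phi> C)"
        unfolding qb_def if_not_P[OF False] using l(1) by (intro exI[of _ "2 * l"]) auto
      from conv_uniformly_bounded[OF f conv _ this] wS
      obtain C where "C \<ge> 0" "\<And>\<xi> \<psi>. \<psi> \<in> GSsp b M A \<Longrightarrow> norm (f (Kop (w q \<xi>) \<psi>)) \<le> C * N \<psi>" by blast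
      then show "\<exists>C\<ge>0. \<forall>\<xi>. \<forall>\<psi>\<in>GSsp b M A. norm (f (Kop (mo \<xi> \<eta>) \<psi>)) \<le> C * eo M (q * norm \<xi>) * N \<psi>"
        using wf[where q=q] by (intro exI[of _ C]) (auto simp: mult.commute mult.left_commute mult_left_mono)
    qed
  next
    case True
    have "\<exists>q>0. \<exists>C\<ge>0. \<forall>\<xi>. \<forall>\<psi>\<in>GSsp b M A. norm (f (Kop (mo \<xi> \<eta>) \<psi>)) \<le> C * eo M (q * norm \<xi>) * N \<psi>"
    proof (rule ccontr)
      assume "\<not> ?thesis"
      then have "\<And>q C. 0 < q \<Longrightarrow> 0 \<le> C \<Longrightarrow> \<exists>\<xi>. \<exists>\<psi>\<in>GSsp b M A. C * eo M (q * norm \<xi>) * N \<psi> < norm (f (Kop (mo \<xi> \<eta>) \<psi>))"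
        by (meson not_le)
      then have "\<forall>n. \<exists>\<xi> \<psi>. \<psi> \<in> GSsp b M A \<and> real n * eo M (real (Suc n) * norm \<xi>) * N \<psi> < norm (f (Kop (mo \<xi> \<eta>) \<psi>))"
        by (metis of_nat_0_le_iff of_nat_0_less_iff zero_less_Suc)
      then obtain \<xi> \<psi> where \<xi>: "\<And>n. \<psi> n \<in> GSsp b M A" "\<And>n. real n * eo M (real (Suc n) * norm (\<xi> n)) * N (\<psi> n) < norm (f (Kop (mo (\<xi> n) \<eta>) (\<psi> n)))"
        by metis
      let ?w = "\<lambda>n. w (real (Suc n)) (\<xi> n)"
      have "\<exists>C. \<forall>\<phi>\<in>range ?w. gb M A l \<phi> C" if l: "0 < l" for l
      proof -
        have l2: "0 < l / 2" using l by simp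
        obtain B where B: "gb M A (l / 2) \<eta> B" using \<eta> l2 unfolding GSsp_iff if_P[OF True] by blast
        let ?r = "\<lambda>n. eo M ((4 * pi / l) * norm (\<xi> n)) / eo M (real (Suc n) * norm (\<xi> n))"
        obtain n0 where n0: "4 * pi / l \<le> real n0" using real_arch_simple by blast
        \<comment> \<open>For n \<ge> n0 the ratio is at most 1; the finitely many others are added
          to the constant.\<close>
        have r: "?r n \<le> 1 + (\<Sum>k<n0. ?r k)" for n
        proof (cases "n < n0")
          case True
          then have "?r n \<le> (\<Sum>k<n0. ?r k)" by (intro member_le_sum) auto
          then show ?thesis by linarith
        next
          case False
          then have "?r n \<le> 1" using n0 l by (intro ratio) auto
          moreover have "0 \<le> (\<Sum>k<n0. ?r k)" by (intro sum_nonneg) auto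
          ultimately show ?thesis by linarith
        qed
        have "gb M A l (?w n) (B * (1 + (\<Sum>k<n0. ?r k)))" for n
        proof (rule gb_mono_const[OF _ _ l])
          show "gb M A l (?w n) (B * ?r n)" using wg[OF l2 B, of "real (Suc n)" "\<xi> n"] by (simp add: mult_ac)
          show "B * ?r n \<le> B * (1 + (\<Sum>k<n0. ?r k))" by (intro mult_left_mono r gb_nonneg[OF B])
        qed
        then show ?thesis by blast
      qed
      then have "qb b (\<lambda>l. \<exists>C. \<forall>\<phi>\<in>range ?w. gb M A l \<phi> C)" unfolding qb_def if_P[OF True] by blast
      from conv_uniformly_bounded[OF f conv _ this] wS
      obtain C where C: "\<And>n \<psi>. \<psi> \<in> GSsp b M A \<Longrightarrow> norm (f (Kop (?w n) \<psi>)) \<le> C * N \<psi>" by blast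
      obtain n where n: "C \<le> real n" using real_arch_simple by blast
      have "real n * eo M (real (Suc n) * norm (\<xi> n)) * N (\<psi> n) < eo M (real (Suc n) * norm (\<xi> n)) * (C * N (\<psi> n))"
        using \<xi>(2)[of n] wf[OF \<xi>(1)[of n], of "\<xi> n" "real (Suc n)"] mult_left_mono[OF C[OF \<xi>(1)[of n], of n], of "eo M (real (Suc n) * norm (\<xi> n))"]
        by simp
      also have "\<dots> \<le> eo M (real (Suc n) * norm (\<xi> n)) * (real n * N (\<psi> n))"
        using n N_nonneg[OF \<xi>(1)[of n]] by (intro mult_left_mono mult_right_mono) auto
      finally show False by (simp add: mult_ac)
    qed
    then show ?thesis unfolding bq_def if_P[OF True] by blast
  qed
qed

text \<open>Companion of \<open>conv_mo_growth\<close> from the continuity of f alone. All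
  derivatives go to the modulated window, so h is measured by its weight only. This will control f
  on expressions built from derivatives of a fixed test function.\<close>

lemma functional_mo_growth:
  fixes \<eta> :: "'n tfun"
  assumes f: "f \<in> GSdual b M A" and \<eta>: "\<eta> \<in> GSsp b M A"
  shows "bq b (\<lambda>q. 0 < q \<longrightarrow> (\<exists>C\<ge>0. \<forall>\<xi>. \<forall>h\<in>GSsp b M A. \<forall>P. wb A q h P \<longrightarrow> norm (f (Kop (mo \<xi> \<eta>) h)) \<le> C * eo M (q * norm \<xi>) * P))"
proof -
  let ?H = "HA CARD('n)"
  have main: "\<exists>C\<ge>0. \<forall>\<xi>. \<forall>h\<in>GSsp b M A. \<forall>P. wb A (2 * pi / l1) h P \<longrightarrow> norm (f (Kop (mo \<xi> \<eta>) h)) \<le> C * eo M (2 * pi / l1 * norm \<xi>) * P"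
    if l1: "0 < l1" and B: "gb M A l1 \<eta> B"
      and Cf: "\<forall>\<phi>\<in>GSsp b M A. \<forall>B. gb M A (4 * ?H * l1) \<phi> B \<longrightarrow> norm (f \<phi>) \<le> Cf * B" for l1 B Cf
  proof -
    \<comment> \<open>A factor 2 for the modulation and 2 \<open>HA\<close> for the convolution:
      then 2 HA ?q = 1 / (2 l1) is the weight of the modulated window.\<close>
    let ?l = "4 * ?H * l1" let ?q = "1 / ?l"
    have H1: "1 \<le> ?H" by (rule HA)
    have q: "0 < ?q" using l1 by simp
    obtain C where C: "C > 0" "\<And>\<psi> \<eta> P Q. \<psi> \<in> borel_measurable borel \<Longrightarrow> \<eta> \<in> borel_measurable borel \<Longrightarrow> wb A (2 * ?q) \<psi> P \<Longrightarrow>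
      wb A (2 * ?H * ?q) \<eta> Q \<Longrightarrow> wb A ?q (Kop \<eta> \<psi> :: 'n tfun) (C * P * Q)"
      using Kop_wb[OF q, where 'n='n] by blast
    have B0: "0 \<le> B" by (rule gb_nonneg[OF B])
    have "norm (f (Kop (mo \<xi> \<eta>) h)) \<le> (\<bar>Cf\<bar> * C * B) * eo M (2 * pi / l1 * norm \<xi>) * P"
      if h: "h \<in> GSsp b M A" and w: "wb A (2 * pi / l1) h P" for \<xi> h P
    proof -
      have P0: "0 \<le> P" by (rule wb_nonneg[OF w])
      let ?E = "eo M (2 * pi * norm \<xi> / l1)"
      have "2 * ?q \<le> 2 * pi / l1"
      proof -
        have "2 * ?q = (1 / (2 * ?H)) / l1" by simp
        also have "\<dots> \<le> (2 * pi) / l1"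
        proof (rule divide_right_mono)
          have "1 / (2 * ?H) \<le> 1" using H1 by (simp add: field_simps)
          then show "1 / (2 * ?H) \<le> 2 * pi" using pi_ge_two by linarith
        qed (use l1 in simp)
        finally show ?thesis .
      qed
      then have w2: "wb A (2 * ?q) h P" using q by (intro wb_mono[OF wsA w]) auto
      note S = GSsp_mo[OF \<eta>, of \<xi>]
      have g: "gb M A (2 * l1) (mo \<xi> \<eta>) (B * ?E)" by (rule gb_mo[OF GSsp_smooth[OF \<eta>] B l1])
      have "gb M A ?l (Kop (mo \<xi> \<eta>) h) (C * P * (B * ?E))"
        unfolding gb_def
      proof (intro allI)
        fix "is" :: "'n list" and x :: "real^'n"
        have "wb A (2 * ?H * ?q) (Dlist is (mo \<xi> \<eta>)) (B * ?E * ((2 * l1) ^ length is * M (length is)))"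
          using gb_wb[OF g, of "is"] by simp
        from C(2)[OF GSsp_measurable[OF h] GSsp_measurable[OF GSsp_Dlist[OF S]] w2 this]
        have "wb A ?q (Kop (Dlist is (mo \<xi> \<eta>)) h) (C * P * (B * ?E * ((2 * l1) ^ length is * M (length is))))" .
        from wbD[OF this, of x] have "norm (Dlist is (Kop (mo \<xi> \<eta>) h) x) * eo A (norm x / ?l) \<le> C * P * (B * ?E * ((2 * l1) ^ length is * M (length is)))"
          by (simp add: GSsp_Kop(3)[OF S h] norm_mult norm_power del: HA_pos)
        also have "\<dots> \<le> C * P * (B * ?E * (?l ^ length is * M (length is)))"
          using C(1) P0 B0 l1 H1 by (intro mult_left_mono mult_right_mono power_mono) auto
        finally show "norm (Dlist is (Kop (mo \<xi> \<eta>) h) x) * eo A (norm x / ?l) \<le> C * P * (B * ?E) * (?l ^ length is * M (length is))"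
          by (simp add: mult_ac)
      qed
      note gK = this
      have "norm (f (Kop (mo \<xi> \<eta>) h)) \<le> Cf * (C * P * (B * ?E))" using Cf gK GSsp_Kop(1)[OF S h] by blast
      also have "\<dots> \<le> \<bar>Cf\<bar> * (C * P * (B * ?E))" by (intro mult_right_mono gb_nonneg[OF gK]) auto
      finally show ?thesis by (simp add: mult_ac)
    qed
    moreover have "0 \<le> \<bar>Cf\<bar> * C * B" using C(1) B0 by simp
    ultimately show ?thesis by blast
  qed
  show ?thesis
  proof (cases b)
    case True
    obtain l Cf where l: "0 < l" and Cf: "\<forall>\<phi>\<in>GSsp b M A. \<forall>B. gb M A l \<phi> B \<longrightarrow> norm (f \<phi>) \<le> Cf * B"
      using GSdualD(3)[OF f] unfolding bq_def if_P[OF True] by blast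
    define l1 where "l1 = l / (4 * ?H)"
    have l1: "0 < l1" "4 * ?H * l1 = l" using l by (simp_all add: l1_def)
    obtain B where B: "gb M A l1 \<eta> B" using \<eta> l1(1) True unfolding GSsp_iff by auto
    have "0 < 2 * pi / l1" using l1 by simp
    then show ?thesis unfolding bq_def if_P[OF True] using main[OF l1(1) B, unfolded l1(2), OF Cf] by blast
  next
    case False
    have "\<exists>C\<ge>0. \<forall>\<xi>. \<forall>h\<in>GSsp b M A. \<forall>P. wb A q h P \<longrightarrow> norm (f (Kop (mo \<xi> \<eta>) h)) \<le> C * eo M (q * norm \<xi>) * P" if q: "0 < q" for q
    proof -
      obtain l0 B where l0: "0 < l0" and B: "gb M A l0 \<eta> B" using GSsp_gb[OF \<eta>] by blast
      define l where "l = max l0 (2 * pi / q)"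
      have l: "0 < l" "l0 \<le> l" "2 * pi / l \<le> q" using l0 q by (auto simp: l_def max_def field_simps)
      have "0 < 4 * ?H * l" using l by simp
      then obtain Cf where Cf: "\<forall>\<phi>\<in>GSsp b M A. \<forall>B. gb M A (4 * ?H * l) \<phi> B \<longrightarrow> norm (f \<phi>) \<le> Cf * B"
        using GSdualD(3)[OF f] unfolding bq_def if_not_P[OF False] by blast
      from main[OF l(1) gb_mono[OF B l0 l(2)] this] obtain C where C: "C \<ge> 0"
        "\<And>\<xi> h P. h \<in> GSsp b M A \<Longrightarrow> wb A (2 * pi / l) h P \<Longrightarrow> norm (f (Kop (mo \<xi> \<eta>) h)) \<le> C * eo M (2 * pi / l * norm \<xi>) * P" by blast
      have "norm (f (Kop (mo \<xi> \<eta>) h)) \<le> C * eo M (q * norm \<xi>) * P" if h: "h \<in> GSsp b M A" and w: "wb A q h P" for \<xi> h P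
      proof -
        have "norm (f (Kop (mo \<xi> \<eta>) h)) \<le> C * eo M (2 * pi / l * norm \<xi>) * P"
          by (rule C(2)[OF h wb_mono[OF wsA w _ l(3)]]) (use l in simp)
        also have "\<dots> \<le> C * eo M (q * norm \<xi>) * P"
          using C(1) wb_nonneg[OF w] l by (intro mult_right_mono mult_left_mono eo_mono[OF wsM]) auto
        finally show ?thesis .
      qed
      then show ?thesis using C(1) by blast
    qed
    then show ?thesis unfolding bq_def if_not_P[OF False] by blast
  qed
qed

end

section \<open>Construction of the representing series\<close>

lemma exists_max_component: "\<exists>i. norm (\<xi>::real^'n::finite) \<le> real CARD('n) * \<bar>\<xi> $ i\<bar>"
proof -
  let ?m = "Max (range (\<lambda>i. \<bar>\<xi> $ i\<bar>))"
  have "?m \<in> range (\<lambda>i. \<bar>\<xi> $ i\<bar>)" by (rule Max_in) auto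
  then obtain i where i: "?m = \<bar>\<xi> $ i\<bar>" by (elim imageE)
  have "\<bar>\<xi> $ k\<bar> \<le> \<bar>\<xi> $ i\<bar>" for k unfolding i[symmetric] by (rule Max_ge) auto
  then show ?thesis using norm_cart_le[of \<xi> "\<bar>\<xi> $ i\<bar>"] by blast
qed

text \<open>Single components are used because a sign recovers |\<xi>_i|^p from the p-th power of
  \<xi>_i, and the largest component controls |\<xi>| up to the factor d.\<close>

definition wsum :: "(nat \<Rightarrow> real) \<Rightarrow> real^'n::finite \<Rightarrow> real" where
  "wsum c \<xi> = (\<Sum>i\<in>UNIV. \<Sum>p. c p * \<bar>\<xi> $ i\<bar> ^ p)"

text \<open>Rearrangement of an absolutely convergent double series. Diagonals r + j = p arise from
  the binomial expansion of order p, rows from collecting the terms with r derivatives on the test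
  function.\<close>

lemma triangle_has_sum:
  fixes I :: "nat \<Rightarrow> nat \<Rightarrow> complex"
  assumes I: "\<And>r j. norm (I r j) \<le> K * (1/4) ^ r * (1/4) ^ j"
  shows "((\<lambda>r. \<Sum>\<^sub>\<infinity>j. I r j) has_sum (\<Sum>p. \<Sum>j\<le>p. I (p - j) j)) UNIV"
proof -
  let ?g = "\<lambda>(r, j). K * (1/4) ^ r * (1/4::real) ^ j"
  have K0: "0 \<le> K" using order_trans[OF norm_ge_zero I[of 0 0]] by simp
  have geo: "((\<lambda>j. C * (1/4::real) ^ j) has_sum (C * (4/3))) UNIV" if "0 \<le> C" for C
    using sums_mult[OF geometric_sums[of "1/4::real"], of C] that by (intro sums_nonneg_imp_has_sum) auto
  have "?g summable_on Sigma UNIV (\<lambda>_. UNIV)"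
  proof (rule summable_on_SigmaI)
    show "((\<lambda>j. ?g (r, j)) has_sum (K * (1/4) ^ r * (4/3))) UNIV" for r using geo K0 by simp
    show "(\<lambda>r. K * (1/4::real) ^ r * (4/3)) summable_on UNIV"
      by (rule summable_on_cmult_left) (rule has_sum_imp_summable[OF geo[OF K0]])
  qed (use K0 in auto)
  then have "(\<lambda>z. norm (case z of (r, j) \<Rightarrow> I r j)) summable_on Sigma UNIV (\<lambda>_. UNIV)"
    by (rule summable_on_comparison_test) (use I in auto)
  then have sm: "(\<lambda>(r, j). I r j) summable_on Sigma UNIV (\<lambda>_. UNIV)" by (rule abs_summable_summable)
  define S where "S = (\<Sum>\<^sub>\<infinity>(r, j)\<in>Sigma UNIV (\<lambda>_. UNIV). I r j)"
  have S: "((\<lambda>(r, j). I r j) has_sum S) (Sigma UNIV (\<lambda>_. UNIV))" unfolding S_def by (rule has_sum_infsum[OF sm])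
  have row: "((\<lambda>j. I r j) has_sum (\<Sum>\<^sub>\<infinity>j. I r j)) UNIV" for r
  proof (rule has_sum_infsum, rule abs_summable_summable)
    show "(\<lambda>j. norm (I r j)) summable_on UNIV"
      by (rule summable_on_comparison_test[OF has_sum_imp_summable[OF geo[of "K * (1/4) ^ r"]]]) (use I K0 in auto)
  qed
  have 1: "((\<lambda>r. \<Sum>\<^sub>\<infinity>j. I r j) has_sum S) UNIV" by (rule has_sum_SigmaD[OF S]) (simp add: row)
  have "((\<lambda>(p, j). I (p - j) j) has_sum S) (Sigma UNIV (\<lambda>p. {..p}))"
    by (rule has_sum_reindex_bij_witness[where i="\<lambda>(r, j). (r + j, j)" and j="\<lambda>(p, j). (p - j, j)", THEN iffD2, OF _ _ _ _ _ _ S]) auto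
  then have "((\<lambda>p. \<Sum>j\<le>p. I (p - j) j) has_sum S) UNIV" by (rule has_sum_SigmaD) simp
  then have "(\<Sum>p. \<Sum>j\<le>p. I (p - j) j) = S" by (simp add: has_sum_imp_sums sums_unique[symmetric])
  with 1 show ?thesis by simp
qed

context gs_weights
begin

text \<open>Q stands for the estimates to be dominated; only its monotonicity matters. If growth is
  known for one q, the coefficients are those of a dilated \<open>eo M\<close>; if it is known for
  all q, they come from \<open>diagonal_coefficients\<close>.\<close>

lemma dominating_series:
  fixes Q :: "real \<Rightarrow> real^'n::finite \<Rightarrow> real \<Rightarrow> bool"
  assumes mono: "\<And>q q' \<xi> \<kappa> \<kappa>'. 0 < q \<Longrightarrow> q \<le> q' \<Longrightarrow> \<kappa> \<le> \<kappa>' \<Longrightarrow> Q q \<xi> \<kappa> \<Longrightarrow> Q q' \<xi> \<kappa>'"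
    and growth: "bq b (\<lambda>q. 0 < q \<longrightarrow> (\<exists>C. \<forall>\<xi>. Q q \<xi> (C * eo M (q * norm \<xi>))))"
  shows "\<exists>c. (\<forall>p. 0 \<le> c p) \<and> c 0 = 1 \<and> bq b (\<lambda>L. 0 < L \<longrightarrow> (\<exists>B. \<forall>p. c p * M p * L ^ p \<le> B)) \<and>
    (\<forall>t\<ge>0. summable (\<lambda>p. c p * t ^ p)) \<and> bq b (\<lambda>q. 0 < q \<longrightarrow> (\<exists>C\<ge>0. \<forall>\<xi>. Q q \<xi> (C * wsum c \<xi>)))"
proof -
  let ?d = "real CARD('n)"
  have d: "0 < ?d" by simp
  have summ: "summable (\<lambda>p. c p * t ^ p)"
    if c: "\<And>p. 0 \<le> c p" and L: "0 < L" "\<And>p. c p * M p * L ^ p \<le> B" and t: "0 \<le> t" for c L B t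
  proof (rule summable_comparison_test')
    show "summable (\<lambda>p. B * ((t / L) ^ p / M p))"
      by (intro summable_mult weight_seq_summable[OF wsM]) (use t L in simp)
    fix p
    have "c p * t ^ p \<le> B * ((t / L) ^ p / M p)"
      using mult_right_mono[OF L(2)[of p], of "t ^ p / (M p * L ^ p)"] L(1) t by (simp add: power_divide mult.commute)
    then show "norm (c p * t ^ p) \<le> B * ((t / L) ^ p / M p)" using c[of p] t by simp
  qed
  have le_wsum: "(\<Sum>p. c p * \<bar>\<xi> $ i\<bar> ^ p) \<le> wsum c \<xi>"
    if "\<And>p. 0 \<le> c p" "\<And>t. 0 \<le> t \<Longrightarrow> summable (\<lambda>p. c p * t ^ p)" for c and \<xi> :: "real^'n" and i
    unfolding wsum_def by (rule member_le_sum) (use that in \<open>auto intro!: suminf_nonneg\<close>)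
  show ?thesis
  proof (cases b)
    case True
    then obtain q C where q: "0 < q" and C: "\<And>\<xi>. Q q \<xi> (C * eo M (q * norm \<xi>))"
      using growth unfolding bq_def if_P[OF True] by blast
    \<comment> \<open>The dilation by d compensates |\<xi>| \<le> d |\<xi>_i| for the largest
      component, so the p-th summand there exceeds the p-th term of
      \<open>eo M (q * norm \<xi>)\<close>.\<close>
    define c where "c p = M 0 * (?d * q) ^ p / M p" for p
    have c0: "0 \<le> c p" for p using q by (simp add: c_def)
    have L: "0 < 1 / (?d * q)" "\<And>p. c p * M p * (1 / (?d * q)) ^ p \<le> M 0"
      using q by (simp_all add: c_def power_one_over)
    have sm: "summable (\<lambda>p. c p * t ^ p)" if "0 \<le> t" for t by (rule summ[OF c0 L that])
    have "Q q \<xi> (\<bar>C\<bar> * wsum c \<xi>)" for \<xi>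
    proof (rule mono[OF q order_refl _ C])
      obtain i where i: "norm \<xi> \<le> ?d * \<bar>\<xi> $ i\<bar>" using exists_max_component by blast
      have "eo M (q * norm \<xi>) \<le> (\<Sum>p. c p * \<bar>\<xi> $ i\<bar> ^ p)"
      proof (rule eo_le[OF wsM])
        fix p
        have "(q * norm \<xi>) ^ p * M 0 / M p \<le> (q * (?d * \<bar>\<xi> $ i\<bar>)) ^ p * M 0 / M p"
          using q i by (intro divide_right_mono mult_right_mono power_mono mult_left_mono) auto
        also have "\<dots> = c p * \<bar>\<xi> $ i\<bar> ^ p" by (simp add: c_def power_mult_distrib)
        also have "\<dots> \<le> (\<Sum>p. c p * \<bar>\<xi> $ i\<bar> ^ p)"
          using sum_le_suminf[OF sm, of "\<bar>\<xi> $ i\<bar>" "{p}"] c0 by simp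
        finally show "(q * norm \<xi>) ^ p * M 0 / M p \<le> (\<Sum>p. c p * \<bar>\<xi> $ i\<bar> ^ p)" .
      qed (use q in simp)
      also have "\<dots> \<le> wsum c \<xi>" by (rule le_wsum[OF c0 sm])
      finally have "\<bar>C\<bar> * eo M (q * norm \<xi>) \<le> \<bar>C\<bar> * wsum c \<xi>" by (rule mult_left_mono) simp
      moreover have "C * eo M (q * norm \<xi>) \<le> \<bar>C\<bar> * eo M (q * norm \<xi>)" by (rule mult_right_mono) auto
      ultimately show "C * eo M (q * norm \<xi>) \<le> \<bar>C\<bar> * wsum c \<xi>" by linarith
    qed
    then have "\<exists>C\<ge>0. \<forall>\<xi>. Q q \<xi> (C * wsum c \<xi>)" by (meson abs_ge_zero)
    then have Qb: "bq b (\<lambda>q. 0 < q \<longrightarrow> (\<exists>C\<ge>0. \<forall>\<xi>. Q q \<xi> (C * wsum c \<xi>)))"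
      unfolding bq_def if_P[OF True] using q by blast
    have Lb: "bq b (\<lambda>L. 0 < L \<longrightarrow> (\<exists>B. \<forall>p. c p * M p * L ^ p \<le> B))"
      unfolding bq_def if_P[OF True] using L by blast
    have "c 0 = 1" by (simp add: c_def)
    then show ?thesis using c0 Lb sm Qb by blast
  next
    case False
    \<comment> \<open>Sampling at q = 1 / (d (m + 1)) makes the largest component appear as
      \<open>eo M (t / real (Suc m))\<close>, the shape treated by
      \<open>diagonal_coefficients\<close>. For a given q, only m with 1 / (d (m + 1)) \<le> q are
      compared.\<close>
    have "\<forall>m. \<exists>C. \<forall>\<xi>. Q (1 / (?d * real (Suc m))) \<xi> (C * eo M (1 / (?d * real (Suc m)) * norm \<xi>))"
      by (intro allI growth[unfolded bq_def if_not_P[OF False], rule_format]) simp_all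
    then obtain C where C: "\<And>m \<xi>. Q (1 / (?d * real (Suc m))) \<xi> (C m * eo M (1 / (?d * real (Suc m)) * norm \<xi>))" by metis
    obtain c where c0: "\<And>p. 0 \<le> c p" and cL: "\<And>L. 0 < L \<Longrightarrow> \<exists>B. \<forall>p. c p * M p * L ^ p \<le> B" and c_0: "c 0 = 1"
      and dom: "\<And>n. \<exists>K>0. \<forall>t\<ge>0. \<exists>m\<ge>n. \<bar>C m\<bar> * eo M (t / real (Suc m)) \<le> K * (\<Sum>p. c p * t ^ p)"
      using diagonal_coefficients[OF wsM, of "\<lambda>m. \<bar>C m\<bar>"] by blast
    obtain B1 where B1: "\<And>p. c p * M p * 1 ^ p \<le> B1" using cL[of 1] by auto
    have sm: "summable (\<lambda>p. c p * t ^ p)" if "0 \<le> t" for t by (rule summ[OF c0 zero_less_one B1 that])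
    have "\<exists>K\<ge>0. \<forall>\<xi>. Q q \<xi> (K * wsum c \<xi>)" if q: "0 < q" for q
    proof -
      obtain n where n: "1 / (?d * q) \<le> real n" using real_arch_simple by blast
      obtain K where K: "K > 0" "\<And>t. t \<ge> 0 \<Longrightarrow> \<exists>m\<ge>n. \<bar>C m\<bar> * eo M (t / real (Suc m)) \<le> K * (\<Sum>p. c p * t ^ p)"
        using dom[of n] by blast
      have "Q q \<xi> (K * wsum c \<xi>)" for \<xi>
      proof -
        obtain i where i: "norm \<xi> \<le> ?d * \<bar>\<xi> $ i\<bar>" using exists_max_component by blast
        obtain m where m: "n \<le> m" "\<bar>C m\<bar> * eo M (\<bar>\<xi> $ i\<bar> / real (Suc m)) \<le> K * (\<Sum>p. c p * \<bar>\<xi> $ i\<bar> ^ p)"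
          using K(2)[of "\<bar>\<xi> $ i\<bar>"] by auto
        show ?thesis
        proof (rule mono[OF _ _ _ C[of m]])
          show "0 < 1 / (?d * real (Suc m))" by simp
          have "1 / (?d * q) \<le> real (Suc m)" using n m(1) by linarith
          then show "1 / (?d * real (Suc m)) \<le> q" using q d by (simp add: pos_divide_le_eq mult_ac del: of_nat_Suc)
          have "1 / (?d * real (Suc m)) * norm \<xi> \<le> 1 / (?d * real (Suc m)) * (?d * \<bar>\<xi> $ i\<bar>)"
            by (rule mult_left_mono[OF i]) simp
          also have "\<dots> = \<bar>\<xi> $ i\<bar> / real (Suc m)" by simp
          finally have "eo M (1 / (?d * real (Suc m)) * norm \<xi>) \<le> eo M (\<bar>\<xi> $ i\<bar> / real (Suc m))"
            by (intro eo_mono[OF wsM]) auto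
          then have "\<bar>C m\<bar> * eo M (1 / (?d * real (Suc m)) * norm \<xi>) \<le> \<bar>C m\<bar> * eo M (\<bar>\<xi> $ i\<bar> / real (Suc m))"
            by (rule mult_left_mono) simp
          moreover have "C m * eo M (1 / (?d * real (Suc m)) * norm \<xi>) \<le> \<bar>C m\<bar> * eo M (1 / (?d * real (Suc m)) * norm \<xi>)"
            by (rule mult_right_mono) auto
          moreover have "K * (\<Sum>p. c p * \<bar>\<xi> $ i\<bar> ^ p) \<le> K * wsum c \<xi>"
            using K(1) by (intro mult_left_mono le_wsum[OF c0 sm]) auto
          ultimately show "C m * eo M (1 / (?d * real (Suc m)) * norm \<xi>) \<le> K * wsum c \<xi>" using m(2) by linarith
        qed
      qed
      then show ?thesis using K(1) by (meson less_imp_le)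
    qed
    then have Qb: "bq b (\<lambda>q. 0 < q \<longrightarrow> (\<exists>C\<ge>0. \<forall>\<xi>. Q q \<xi> (C * wsum c \<xi>)))"
      unfolding bq_def if_not_P[OF False] by blast
    have Lb: "bq b (\<lambda>L. 0 < L \<longrightarrow> (\<exists>B. \<forall>p. c p * M p * L ^ p \<le> B))"
      unfolding bq_def if_not_P[OF False] using cL by blast
    show ?thesis using c0 c_0 Lb sm Qb by blast
  qed
qed

text \<open>Take \<eta>1 = \<theta> and for \<eta>2 a multiple of its conjugate reflection: the
  value at 0 is a multiple of the integral of |\<theta>|^2, which is nonzero because a continuous
  \<theta> cannot vanish almost everywhere without vanishing.\<close>

lemma window_exists:
  assumes \<theta>: "(\<theta> :: 'n::finite tfun) \<in> GSsp b M A" and nz: "\<theta> \<noteq> (\<lambda>x. 0)"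
  shows "\<exists>\<eta>1\<in>GSsp b M A. \<exists>\<eta>2\<in>GSsp b M A. Kop (\<lambda>x. \<eta>1 (- x)) \<eta>2 (0 :: real^'n) = 1"
proof -
  let ?r = "\<lambda>x. \<theta> (- x)"
  let ?s = "\<lambda>x. cnj (\<theta> (- x))"
  have S: "?r \<in> GSsp b M A" "?s \<in> GSsp b M A" by (intro GSsp_reflect GSsp_cnj \<theta>)+
  let ?c = "Kop ?r ?s 0"
  have int: "integrable lborel (\<lambda>x. (norm (\<theta> (- x)))^2)"
    using integrable_norm[OF Kop_GSsp_integrable[OF S, of 0]] by (simp add: norm_mult power2_eq_square)
  have c: "?c = complex_of_real (LINT x|lborel. (norm (\<theta> (- x)))^2)"
  proof -
    have "cnj z * z = complex_of_real ((norm z)^2)" for z :: complex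
      by (simp only: complex_norm_square mult.commute)
    then show ?thesis by (simp add: Kop_def flip: of_real_power)
  qed
  have "?c \<noteq> 0"
  proof
    assume "?c = 0"
    then have "(LINT x|lborel. (norm (\<theta> (- x)))^2) = 0" unfolding c by simp
    then have "AE x in lborel. (norm (\<theta> (- x)))^2 = 0"
      by (subst (asm) integral_nonneg_eq_0_iff_AE[OF int]) auto
    then have ae: "AE x in lborel. ?r x = 0" by simp
    let ?U = "{x. ?r x \<noteq> 0}"
    have "continuous_on UNIV ?r" by (rule smooth_fn_continuous0[OF GSsp_smooth[OF S(1)]])
    then have op: "open ?U" by (rule open_Collect_neq) (rule continuous_on_const)
    obtain x where "\<theta> x \<noteq> 0" using nz by auto
    then have ne: "?U \<noteq> {}" by (auto intro!: exI[of _ "- x"])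
    have "?U \<in> null_sets lborel"
      using ae op by (subst AE_iff_null_sets) auto
    then have "negligible ?U" by (simp add: negligible_iff_null_sets null_sets_completionI)
    then show False using open_not_negligible[OF op ne] by simp
  qed
  then have "Kop ?r (\<lambda>x. (1 / ?c) * ?s x) 0 = 1" unfolding Kop_cmult_right by simp
  moreover have "(\<lambda>x. (1 / ?c) * ?s x) \<in> GSsp b M A" by (rule GSsp_cmult[OF S(2)])
  ultimately show ?thesis using \<theta> by blast
qed

end

context tmib
begin

text \<open>Two estimates share one c: the first, in the norm of E, will bound the coefficients in
  E'; the second, in the weight, will give convergence on each test function. (M.2)' splits off
  \<open>Wt \<xi>\<close>, so that integrals over \<xi> converge after division by
  \<open>wsum c \<xi>\<close>.\<close>

lemma dominated_pairings:
  assumes f: "f \<in> GSdual b M A" and conv: "\<And>\<phi>. \<phi> \<in> GSsp b M A \<Longrightarrow> conv b M A f \<phi> \<in> Edual b M A E nE"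
    and \<eta>: "\<eta> \<in> GSsp b M A"
  shows "\<exists>c. (\<forall>p. 0 \<le> c p) \<and> c 0 = 1 \<and> bq b (\<lambda>L. 0 < L \<longrightarrow> (\<exists>B. \<forall>p. c p * M p * L ^ p \<le> B)) \<and>
    (\<forall>t\<ge>0. summable (\<lambda>p. c p * t ^ p)) \<and>
    bq b (\<lambda>q. 0 < q \<longrightarrow> (\<exists>C\<ge>0. \<forall>\<xi>::real^'n. (\<forall>\<psi>\<in>GSsp b M A. norm (f (Kop (mo \<xi> \<eta>) \<psi>)) \<le> C * wsum c \<xi> * Wt \<xi> * N \<psi>) \<and>
      (\<forall>h\<in>GSsp b M A. \<forall>P. wb A q h P \<longrightarrow> norm (f (Kop (mo \<xi> \<eta>) h)) \<le> C * wsum c \<xi> * Wt \<xi> * P)))"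
proof -
  define Q where "Q q \<xi> \<kappa> \<longleftrightarrow> (\<forall>\<psi>\<in>GSsp b M A. norm (f (Kop (mo \<xi> \<eta>) \<psi>)) \<le> \<kappa> * Wt \<xi> * N \<psi>) \<and>
      (\<forall>h\<in>GSsp b M A. \<forall>P. wb A q h P \<longrightarrow> norm (f (Kop (mo \<xi> \<eta>) h)) \<le> \<kappa> * Wt \<xi> * P)" for q \<xi> \<kappa>
  let ?H = "absorb_const M (2 * CARD('n))"
  have H1: "1 \<le> ?H" by (rule absorb_const(1)[OF wsM M2M])
  have main: "\<exists>C. \<forall>\<xi>. Q (?H * q) \<xi> (C * eo M (?H * q * norm \<xi>))"
    if q: "0 < q" and C1: "C1 \<ge> 0" "\<And>\<xi> \<psi>. \<psi> \<in> GSsp b M A \<Longrightarrow> norm (f (Kop (mo \<xi> \<eta>) \<psi>)) \<le> C1 * eo M (q * norm \<xi>) * N \<psi>"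
      and C2: "C2 \<ge> 0" "\<And>\<xi> h P. h \<in> GSsp b M A \<Longrightarrow> wb A q h P \<Longrightarrow> norm (f (Kop (mo \<xi> \<eta>) h)) \<le> C2 * eo M (q * norm \<xi>) * P"
    for q C1 C2
  proof -
    obtain C where C: "C > 0" "\<And>x::real^'n. eo M (q * norm x) \<le> C * Wt x * eo M (?H * q * norm x)"
      using eo_Wt[OF wsM M2M q, where 'n='n] by blast
    have "Q (?H * q) \<xi> ((max C1 C2 * C) * eo M (?H * q * norm \<xi>))" for \<xi>
      unfolding Q_def
    proof (intro conjI ballI allI impI)
      have e: "K * eo M (q * norm \<xi>) \<le> (max C1 C2 * C) * eo M (?H * q * norm \<xi>) * Wt \<xi>" if "0 \<le> K" "K \<le> max C1 C2" for K
      proof -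
        have "K * eo M (q * norm \<xi>) \<le> max C1 C2 * (C * Wt \<xi> * eo M (?H * q * norm \<xi>))"
          using that C1(1) by (intro mult_mono C) auto
        then show ?thesis by (simp add: mult_ac)
      qed
      fix \<psi> :: "'n tfun" assume \<psi>: "\<psi> \<in> GSsp b M A"
      show "norm (f (Kop (mo \<xi> \<eta>) \<psi>)) \<le> (max C1 C2 * C) * eo M (?H * q * norm \<xi>) * Wt \<xi> * N \<psi>"
        by (rule order_trans[OF C1(2)[OF \<psi>]]) (intro mult_right_mono e N_nonneg \<psi>, use C1 in auto)
    next
      have e: "K * eo M (q * norm \<xi>) \<le> (max C1 C2 * C) * eo M (?H * q * norm \<xi>) * Wt \<xi>" if "0 \<le> K" "K \<le> max C1 C2" for K
      proof -
        have "K * eo M (q * norm \<xi>) \<le> max C1 C2 * (C * Wt \<xi> * eo M (?H * q * norm \<xi>))"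
          using that C1(1) by (intro mult_mono C) auto
        then show ?thesis by (simp add: mult_ac)
      qed
      fix h :: "'n tfun" and P assume h: "h \<in> GSsp b M A" and w: "wb A (?H * q) h P"
      have "wb A q h P" by (rule wb_mono[OF wsA w]) (use q H1 in auto)
      from C2(2)[OF h this] show "norm (f (Kop (mo \<xi> \<eta>) h)) \<le> (max C1 C2 * C) * eo M (?H * q * norm \<xi>) * Wt \<xi> * P"
        by (rule order_trans) (intro mult_right_mono e wb_nonneg[OF w], use C2 in auto)
    qed
    then show ?thesis by blast
  qed
  have growth: "bq b (\<lambda>q. 0 < q \<longrightarrow> (\<exists>C. \<forall>\<xi>. Q q \<xi> (C * eo M (q * norm \<xi>))))"
  proof (cases b)
    case True
    obtain q1 C1 where q1: "0 < q1" "C1 \<ge> 0" "\<And>\<xi> \<psi>. \<psi> \<in> GSsp b M A \<Longrightarrow> norm (f (Kop (mo \<xi> \<eta>) \<psi>)) \<le> C1 * eo M (q1 * norm \<xi>) * N \<psi>"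
      using conv_mo_growth[OF f conv \<eta>] unfolding bq_def if_P[OF True] by blast
    obtain q2 C2 where q2: "0 < q2" "C2 \<ge> 0" "\<And>\<xi> h P. h \<in> GSsp b M A \<Longrightarrow> wb A q2 h P \<Longrightarrow> norm (f (Kop (mo \<xi> \<eta>) h)) \<le> C2 * eo M (q2 * norm \<xi>) * P"
      using functional_mo_growth[OF f \<eta>] unfolding bq_def if_P[OF True] by blast
    let ?q = "max q1 q2"
    have up: "eo M (q' * norm \<xi>) \<le> eo M (?q * norm \<xi>)" if "0 < q'" "q' \<le> ?q" for q' and \<xi> :: "real^'n"
      using that by (intro eo_mono[OF wsM] mult_right_mono) auto
    have "\<exists>C. \<forall>\<xi>. Q (?H * ?q) \<xi> (C * eo M (?H * ?q * norm \<xi>))"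
    proof (rule main)
      show "0 < ?q" using q1 by simp
      show "norm (f (Kop (mo \<xi> \<eta>) \<psi>)) \<le> C1 * eo M (?q * norm \<xi>) * N \<psi>" if "\<psi> \<in> GSsp b M A" for \<xi> \<psi>
        by (rule order_trans[OF q1(3)[OF that]]) (intro mult_right_mono mult_left_mono up N_nonneg that, use q1 in auto)
      show "norm (f (Kop (mo \<xi> \<eta>) h)) \<le> C2 * eo M (?q * norm \<xi>) * P" if h: "h \<in> GSsp b M A" and w: "wb A ?q h P" for \<xi> h P
      proof -
        have "wb A q2 h P" by (rule wb_mono[OF wsA w]) (use q2 in auto)
        from q2(3)[OF h this] show ?thesis
          by (rule order_trans) (intro mult_right_mono mult_left_mono up wb_nonneg[OF w], use q2 in auto)
      qed
    qed (use q1 q2 in auto)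
    moreover have "0 < ?H * ?q" using H1 q1 by simp
    ultimately show ?thesis unfolding bq_def if_P[OF True] by blast
  next
    case False
    have "\<exists>C. \<forall>\<xi>. Q q \<xi> (C * eo M (q * norm \<xi>))" if q: "0 < q" for q
    proof -
      have q': "0 < q / ?H" using q H1 by simp
      obtain C1 where C1: "C1 \<ge> 0" "\<And>\<xi> \<psi>. \<psi> \<in> GSsp b M A \<Longrightarrow> norm (f (Kop (mo \<xi> \<eta>) \<psi>)) \<le> C1 * eo M ((q / ?H) * norm \<xi>) * N \<psi>"
        using conv_mo_growth[OF f conv \<eta>] q' unfolding bq_def if_not_P[OF False] by blast
      obtain C2 where C2: "C2 \<ge> 0" "\<And>\<xi> h P. h \<in> GSsp b M A \<Longrightarrow> wb A (q / ?H) h P \<Longrightarrow> norm (f (Kop (mo \<xi> \<eta>) h)) \<le> C2 * eo M ((q / ?H) * norm \<xi>) * P"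
        using functional_mo_growth[OF f \<eta>, unfolded bq_def if_not_P[OF False], rule_format, OF q' q'] by metis
      have e: "?H * (q / ?H) = q" using H1 by simp
      show ?thesis using main[OF q' C1 C2] unfolding e by blast
    qed
    then show ?thesis unfolding bq_def if_not_P[OF False] by blast
  qed
  have mono: "Q q' \<xi> \<kappa>'" if "0 < q" "q \<le> q'" "\<kappa> \<le> \<kappa>'" "Q q \<xi> \<kappa>" for q q' \<xi> \<kappa> \<kappa>'
    unfolding Q_def
  proof (intro conjI ballI allI impI)
    fix \<psi> :: "'n tfun" assume \<psi>: "\<psi> \<in> GSsp b M A"
    then have "norm (f (Kop (mo \<xi> \<eta>) \<psi>)) \<le> \<kappa> * Wt \<xi> * N \<psi>" using that(4) by (simp add: Q_def)
    also have "\<dots> \<le> \<kappa>' * Wt \<xi> * N \<psi>" using that(3) by (intro mult_right_mono N_nonneg \<psi>) auto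
    finally show "norm (f (Kop (mo \<xi> \<eta>) \<psi>)) \<le> \<kappa>' * Wt \<xi> * N \<psi>" .
  next
    fix h :: "'n tfun" and P assume h: "h \<in> GSsp b M A" and w: "wb A q' h P"
    have "wb A q h P" by (rule wb_mono[OF wsA w]) (use that in auto)
    then have "norm (f (Kop (mo \<xi> \<eta>) h)) \<le> \<kappa> * Wt \<xi> * P" using that(4) h by (simp add: Q_def)
    also have "\<dots> \<le> \<kappa>' * Wt \<xi> * P" using that(3) by (intro mult_right_mono wb_nonneg[OF w]) auto
    finally show "norm (f (Kop (mo \<xi> \<eta>) h)) \<le> \<kappa>' * Wt \<xi> * P" .
  qed
  show ?thesis using dominating_series[of Q, OF mono growth] unfolding Q_def .
qed

end

lemma wsum_ge_1:
  assumes "\<And>p. 0 \<le> c p" "c 0 = 1" "\<And>t. 0 \<le> t \<Longrightarrow> summable (\<lambda>p. c p * t ^ p)"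
  shows "1 \<le> wsum c (\<xi> :: real^'n::finite)"
proof -
  have *: "1 \<le> (\<Sum>p. c p * \<bar>\<xi> $ i\<bar> ^ p)" for i
    using sum_le_suminf[OF assms(3)[of "\<bar>\<xi> $ i\<bar>"], of "{0}"] assms by simp
  have "(\<Sum>p. c p * \<bar>\<xi> $ undefined\<bar> ^ p) \<le> wsum c \<xi>"
    unfolding wsum_def by (rule member_le_sum) (use * order_trans[OF zero_le_one] in auto)
  with *[of undefined] show ?thesis by linarith
qed

lemma bqI: "(\<And>l. 0 < l \<Longrightarrow> P l) \<Longrightarrow> bq b P"
  unfolding bq_def by (auto intro: exI[of _ 1])

lemma wsum_measurable [measurable]: "(wsum c :: real^'n::finite \<Rightarrow> real) \<in> borel_measurable borel"
proof -
  have [measurable]: "(\<lambda>\<xi>::real^'n. \<xi> $ i) \<in> borel_measurable borel" for i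
    by (intro borel_measurable_continuous_onI continuous_intros)
  show ?thesis unfolding wsum_def[abs_def] by measurable
qed

lemma has_sum_finite_sum:
  fixes g :: "'b \<Rightarrow> 'a \<Rightarrow> complex"
  assumes "finite Z" "\<And>i. i \<in> Z \<Longrightarrow> (g i has_sum s i) S"
  shows "((\<lambda>x. \<Sum>i\<in>Z. g i x) has_sum (\<Sum>i\<in>Z. s i)) S"
  using assms by (induction Z rule: finite_induct) (auto intro: has_sum_add)

text \<open>Extends a series along one axis by zeros, so that d one-parameter series can be added up
  as one series over all multi-indices.\<close>

lemma has_sum_axis:
  fixes g :: "('n::finite \<Rightarrow> nat) \<Rightarrow> complex"
  assumes "((\<lambda>r. g (\<lambda>k. if k = i then r else 0)) has_sum s) UNIV"
  shows "((\<lambda>\<alpha>. if \<forall>k. k \<noteq> i \<longrightarrow> \<alpha> k = 0 then g \<alpha> else 0) has_sum s) UNIV"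
proof -
  let ?h = "\<lambda>r k. if k = i then r else (0::nat)"
  have "inj ?h" by (rule injI) (metis (mono_tags))
  then have "(g has_sum s) (range ?h)" using assms by (simp add: has_sum_reindex o_def)
  moreover have "\<alpha> \<in> range ?h" if "\<forall>k. k \<noteq> i \<longrightarrow> \<alpha> k = 0" for \<alpha>
    using that by (intro range_eqI[of _ _ "\<alpha> i"]) auto
  ultimately show ?thesis by (subst has_sum_cong_neutral[where T="range ?h" and g=g]) auto
qed

lemma integrable_Wt_bound:
  fixes g :: "real^'n::finite \<Rightarrow> complex"
  assumes "g \<in> borel_measurable borel" "\<And>\<xi>. norm (g \<xi>) \<le> C * Wt \<xi>"
  shows "integrable lborel g" and "norm (LINT \<xi>|lborel. g \<xi>) \<le> C * (LINT \<xi>|lborel. Wt (\<xi> :: real^'n))"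
proof -
  have W: "integrable lborel (\<lambda>\<xi>. C * Wt (\<xi> :: real^'n))" by (intro integrable_mult_right integrable_Wt)
  show g: "integrable lborel g"
    by (rule Bochner_Integration.integrable_bound[OF W]) (use assms order_trans[OF assms(2) abs_ge_self] in auto)
  have "norm (LINT \<xi>|lborel. g \<xi>) \<le> (LINT \<xi>|lborel. norm (g \<xi>))" by (rule integral_norm_bound)
  also have "\<dots> \<le> (LINT \<xi>|lborel. C * Wt (\<xi> :: real^'n))" by (rule integral_mono[OF integrable_norm[OF g] W assms(2)])
  finally show "norm (LINT \<xi>|lborel. g \<xi>) \<le> C * (LINT \<xi>|lborel. Wt (\<xi> :: real^'n))" by simp
qed

text \<open>M_j M_r \<le> M_0 M_(r+j) splits the bound on c (r + j) between both indices. Each index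
  gains 1/2 from 1 / pi and 1/2 from l1, l2 \<le> L / 2. The power of 1 / pi is what remains of (1 /
  (2 pi))^(r+j) after a binomial coefficient of size at most 2^(r+j).\<close>

lemma (in gs_weights) coefficient_bound:
  assumes c: "\<And>p. 0 \<le> c p" "\<And>p. c p * M p * L ^ p \<le> B" and l: "0 \<le> l1" "2 * l1 \<le> L" "0 \<le> l2" "2 * l2 \<le> L"
  shows "c (r + j) * (1 / pi) ^ (r + j) * ((l1 ^ j * M j) * (l2 ^ r * M r)) \<le> B * M 0 * (1/4) ^ r * (1/4) ^ j"
proof -
  have pi: "1 / pi \<le> 1 / 2" using pi_ge_two by (simp add: field_simps)
  have L: "l1 \<le> L / 2" "l2 \<le> L / 2" "0 \<le> L" using l by auto
  have "c (r + j) * (1 / pi) ^ (r + j) * ((l1 ^ j * M j) * (l2 ^ r * M r))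
      \<le> c (r + j) * (1 / 2) ^ (r + j) * (((L / 2) ^ j * M j) * ((L / 2) ^ r * M r))"
    using pi L l c(1) by (intro mult_mono power_mono mult_nonneg_nonneg) auto
  also have "\<dots> = c (r + j) * L ^ (r + j) * (1/4) ^ r * (1/4) ^ j * (M j * M r)"
  proof -
    have "(1/4::real) ^ k = (1/2) ^ k * (1/2) ^ k" for k by (simp flip: power_mult_distrib)
    moreover have "(L / 2) ^ k = L ^ k * (1/2) ^ k" for k by (simp add: power_divide power_one_over)
    ultimately show ?thesis by (simp only: power_add mult_ac)
  qed
  also have "\<dots> \<le> c (r + j) * L ^ (r + j) * (1/4) ^ r * (1/4) ^ j * (M 0 * M (r + j))"
    using cond_M1_supermult[OF wsM M1, of j r] c(1) L by (intro mult_left_mono) (auto simp: add.commute)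
  also have "\<dots> = (c (r + j) * M (r + j) * L ^ (r + j)) * (M 0 * (1/4) ^ r * (1/4) ^ j)" by (simp only: mult_ac)
  also have "\<dots> \<le> B * (M 0 * (1/4) ^ r * (1/4) ^ j)" by (intro mult_right_mono c(2)) auto
  finally show ?thesis by (simp only: mult_ac)
qed

section \<open>The series attached to a pair of windows\<close>

locale windowed = tmib b M A E nE for b M A and E :: "'n::finite udist set" and nE +
  fixes f :: "'n udist" and \<eta>1 \<eta>2 :: "'n tfun" and c :: "nat \<Rightarrow> real"
  assumes f: "f \<in> GSdual b M A" and \<eta>1: "\<eta>1 \<in> GSsp b M A" and \<eta>2: "\<eta>2 \<in> GSsp b M A"
    and normalized: "Kop (\<lambda>x. \<eta>1 (- x)) \<eta>2 0 = 1"
    and c_nonneg: "\<And>p. 0 \<le> c p" and c_0: "c 0 = 1"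
    and c_growth: "bq b (\<lambda>L. 0 < L \<longrightarrow> (\<exists>B. \<forall>p. c p * M p * L ^ p \<le> B))"
    and c_summable: "\<And>t. 0 \<le> t \<Longrightarrow> summable (\<lambda>p. c p * t ^ p)"
    and dominated: "bq b (\<lambda>q. 0 < q \<longrightarrow> (\<exists>C\<ge>0. \<forall>\<xi>::real^'n.
      (\<forall>\<psi>\<in>GSsp b M A. norm (f (Kop (mo \<xi> \<eta>1) \<psi>)) \<le> C * wsum c \<xi> * Wt \<xi> * N \<psi>) \<and>
      (\<forall>h\<in>GSsp b M A. \<forall>P. wb A q h P \<longrightarrow> norm (f (Kop (mo \<xi> \<eta>1) h)) \<le> C * wsum c \<xi> * Wt \<xi> * P)))"
begin

text \<open>The factor \<open>(sgn \<xi>\<^sub>i \<i> / 2\<pi>)\<^sup>p\<close> turns \<open>(- 2\<pi> \<i> \<xi>\<^sub>i)\<^sup>p\<close>, the result of \<open>p\<close> integrations by parts, into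
  \<open>\<bar>\<xi>\<^sub>i\<bar>\<^sup>p\<close>; weighted with \<open>c p / wsum c \<xi>\<close> these powers sum to \<open>1\<close> over \<open>i\<close> and \<open>p\<close>. The index
  \<open>r\<close> counts the derivatives left on the test function, \<open>j\<close> those absorbed by the window.\<close>
definition coef :: "'n \<Rightarrow> nat \<Rightarrow> real^'n \<Rightarrow> complex" where
  "coef i p \<xi> = complex_of_real (sgn (\<xi> $ i) ^ p * c p / wsum c \<xi>) * (\<i> / (2 * pi)) ^ p"

definition pairing :: "'n \<Rightarrow> nat \<Rightarrow> 'n tfun \<Rightarrow> real^'n \<Rightarrow> complex" where
  "pairing i j \<psi> \<xi> = f (Kop (mo \<xi> \<eta>1) (Kop (mo \<xi> (Dlist (replicate j i) \<eta>2)) \<psi>))"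

definition V :: "'n \<Rightarrow> nat \<Rightarrow> nat \<Rightarrow> 'n tfun \<Rightarrow> real^'n \<Rightarrow> complex" where
  "V i r j \<psi> \<xi> = coef i (r + j) \<xi> * of_nat ((r + j) choose j) * pairing i j \<psi> \<xi>"

definition J :: "'n \<Rightarrow> nat \<Rightarrow> nat \<Rightarrow> 'n tfun \<Rightarrow> complex" where
  "J i r j \<psi> = (LINT \<xi>|lborel. V i r j \<psi> \<xi>)"

text \<open>All terms that leave r derivatives on the test function; the sign cancels the (-1)^r
  introduced by \<open>dder\<close>.\<close>

definition F :: "'n \<Rightarrow> nat \<Rightarrow> 'n tfun \<Rightarrow> complex" where
  "F i r \<psi> = (-1) ^ r * (\<Sum>\<^sub>\<infinity>j. J i r j \<psi>)"

lemma wsum_ge: "1 \<le> wsum c (\<xi> :: real^'n)" by (rule wsum_ge_1[OF c_nonneg c_0 c_summable])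

lemma wsum_pos: "0 < wsum c (\<xi> :: real^'n)" using wsum_ge[of \<xi>] by linarith

lemma V_measurable: "V i r j \<psi> \<in> borel_measurable borel" if \<psi>: "\<psi> \<in> GSsp b M A"
proof -
  have "continuous_on UNIV (pairing i j \<psi>)"
    unfolding pairing_def Kop_mo_Kop_mo[OF \<eta>1 GSsp_Dlist[OF \<eta>2] \<psi>]
    by (intro functional_Kop_mo_continuous f GSsp_Kop GSsp_reflect \<eta>1 GSsp_Dlist \<eta>2 \<psi>)
  then have [measurable]: "pairing i j \<psi> \<in> borel_measurable borel" by (rule borel_measurable_continuous_onI)
  have [measurable]: "(\<lambda>\<xi>::real^'n. \<xi> $ i) \<in> borel_measurable borel"
    by (intro borel_measurable_continuous_onI continuous_intros)
  show ?thesis unfolding V_def[abs_def] coef_def by measurable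
qed

lemma V_bound:
  assumes "norm (pairing i j \<psi> \<xi>) \<le> wsum c \<xi> * Wt \<xi> * X"
  shows "norm (V i r j \<psi> \<xi>) \<le> c (r + j) * (1 / pi) ^ (r + j) * X * Wt \<xi>"
proof -
  let ?p = "r + j"
  have "norm (coef i ?p \<xi>) = \<bar>sgn (\<xi> $ i)\<bar> ^ ?p * (c ?p / wsum c \<xi>) * (1 / (2 * pi)) ^ ?p"
    using c_nonneg[of ?p] wsum_pos[of \<xi>] by (simp add: coef_def norm_mult norm_power norm_divide power_abs)
  also have "\<dots> \<le> 1 * (c ?p / wsum c \<xi>) * (1 / (2 * pi)) ^ ?p"
    using c_nonneg[of ?p] wsum_pos[of \<xi>] by (intro mult_right_mono power_le_one) (auto simp: abs_sgn_eq)
  finally have 1: "norm (coef i ?p \<xi>) \<le> c ?p / wsum c \<xi> * (1 / (2 * pi)) ^ ?p" by simp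
  have 2: "real (?p choose j) \<le> 2 ^ ?p" by (rule of_nat_le_iff[THEN iffD2, of "?p choose j" "2 ^ ?p", simplified]) (rule binomial_le_pow2)
  have "norm (V i r j \<psi> \<xi>) = norm (coef i ?p \<xi>) * real (?p choose j) * norm (pairing i j \<psi> \<xi>)"
    by (simp add: V_def norm_mult)
  also have "\<dots> \<le> (c ?p / wsum c \<xi> * (1 / (2 * pi)) ^ ?p) * 2 ^ ?p * (wsum c \<xi> * Wt \<xi> * X)"
    using c_nonneg[of ?p] wsum_pos[of \<xi>] by (intro mult_mono 1 2 assms) auto
  also have "\<dots> = c ?p * ((1 / (2 * pi)) ^ ?p * 2 ^ ?p) * X * Wt \<xi>" using wsum_pos[of \<xi>] by simp
  also have "(1 / (2 * pi)) ^ ?p * 2 ^ ?p = (1 / pi) ^ ?p" by (simp flip: power_mult_distrib)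
  finally show ?thesis .
qed

text \<open>Bounded in r after multiplication by L^r M_r and geometric in j, as the dual norms of
  the coefficients require. The bound on c has to cover both L and the parameter l1 of \<eta>2. In
  the Beurling case L is given and l1 can be taken small; in the Roumieu case l1 is given and c is
  bounded at every parameter.\<close>

lemma V_bound_E:
  "bq b (\<lambda>L. 0 < L \<longrightarrow> (\<exists>K\<ge>0. \<forall>i r j \<xi>. \<forall>\<psi>\<in>GSsp b M A. L ^ r * M r * norm (V i r j \<psi> \<xi>) \<le> K * (1/4) ^ j * N \<psi> * Wt \<xi>))"
proof -
  have main: "\<exists>K\<ge>0. \<forall>i r j \<xi>. \<forall>\<psi>\<in>GSsp b M A. L ^ r * M r * norm (V i r j \<psi> \<xi>) \<le> K * (1/4) ^ j * N \<psi> * Wt \<xi>"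
    if L: "0 < L" "L \<le> L'" and B: "\<And>p. c p * M p * L' ^ p \<le> B" and l1: "0 < l1" "2 * l1 \<le> L'"
      and B1: "gb M A l1 \<eta>2 B1" and q: "0 < q" "q \<le> 1 / l1"
      and C: "C \<ge> 0" "\<And>\<eta> \<psi> Q. \<eta> \<in> GSsp b M A \<Longrightarrow> \<psi> \<in> GSsp b M A \<Longrightarrow> wb A q \<eta> Q \<Longrightarrow> N (Kop \<eta> \<psi>) \<le> C * Q * N \<psi>"
      and D: "D \<ge> 0" "\<And>\<xi> \<psi>. \<psi> \<in> GSsp b M A \<Longrightarrow> norm (f (Kop (mo \<xi> \<eta>1) \<psi>)) \<le> D * wsum c \<xi> * Wt \<xi> * N \<psi>"
    for L L' B l1 B1 q C D
  proof (intro exI[of _ "D * C * B1 * (B * M 0)"] conjI allI ballI)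
    have B10: "0 \<le> B1" by (rule gb_nonneg[OF B1])
    have B0: "0 \<le> B" using B[of 0] by (simp add: c_0 order_trans[OF Mnn])
    show "0 \<le> D * C * B1 * (B * M 0)" using D C B10 B0 by simp
    fix i r j and \<xi> :: "real^'n" and \<psi> :: "'n tfun" assume \<psi>: "\<psi> \<in> GSsp b M A"
    let ?Q = "B1 * (l1 ^ j * M j)" and ?c = "c (r + j) * (1 / pi) ^ (r + j)"
    have "wb A q (mo \<xi> (Dlist (replicate j i) \<eta>2)) ?Q"
      using wb_mono[OF wsA gb_wb[OF B1, of "replicate j i"]] q by simp
    then have "N (Kop (mo \<xi> (Dlist (replicate j i) \<eta>2)) \<psi>) \<le> C * ?Q * N \<psi>"
      by (intro C GSsp_mo GSsp_Dlist \<eta>2 \<psi>)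
    then have "D * wsum c \<xi> * Wt \<xi> * N (Kop (mo \<xi> (Dlist (replicate j i) \<eta>2)) \<psi>) \<le> D * wsum c \<xi> * Wt \<xi> * (C * ?Q * N \<psi>)"
      using D wsum_pos[of \<xi>] by (intro mult_left_mono) auto
    then have "norm (pairing i j \<psi> \<xi>) \<le> wsum c \<xi> * Wt \<xi> * (D * (C * ?Q * N \<psi>))"
      unfolding pairing_def using D(2)[OF GSsp_Kop(1)[OF GSsp_mo[OF GSsp_Dlist[OF \<eta>2]] \<psi>], of \<xi> \<xi> "replicate j i"]
      by (simp add: mult_ac)
    then have "norm (V i r j \<psi> \<xi>) \<le> ?c * (D * (C * ?Q * N \<psi>)) * Wt \<xi>" by (rule V_bound)
    then have "L ^ r * M r * norm (V i r j \<psi> \<xi>) \<le> L' ^ r * M r * (?c * (D * (C * ?Q * N \<psi>)) * Wt \<xi>)"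
      using L by (intro mult_mono power_mono) auto
    \<comment> \<open>L'^r is written as 2^r (L' / 2)^r to fit \<open>coefficient_bound\<close>,
      whose factor (1/4)^r outweighs the 2^r.\<close>
    also have "\<dots> = D * C * B1 * N \<psi> * Wt \<xi> * 2 ^ r * (?c * ((l1 ^ j * M j) * ((L' / 2) ^ r * M r)))"
      by (simp add: power_divide)
    also have "\<dots> \<le> D * C * B1 * N \<psi> * Wt \<xi> * 2 ^ r * (B * M 0 * (1/4) ^ r * (1/4) ^ j)"
      by (intro mult_left_mono coefficient_bound[OF c_nonneg B]) (use l1 L D C B10 N_nonneg[OF \<psi>] in auto)
    also have "\<dots> = D * C * B1 * (B * M 0) * (1/4) ^ j * N \<psi> * Wt \<xi> * (1/2) ^ r"
    proof -
      have "(1/2) ^ r = (2::real) ^ r * (1/4) ^ r" by (simp flip: power_mult_distrib)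
      then show ?thesis by (simp only: mult_ac)
    qed
    also have "\<dots> \<le> D * C * B1 * (B * M 0) * (1/4) ^ j * N \<psi> * Wt \<xi> * 1"
      by (intro mult_left_mono power_le_one) (use D C B10 B0 N_nonneg[OF \<psi>] in auto)
    finally show "L ^ r * M r * norm (V i r j \<psi> \<xi>) \<le> D * C * B1 * (B * M 0) * (1/4) ^ j * N \<psi> * Wt \<xi>" by simp
  qed
  obtain q0 where "0 < q0" "\<exists>C\<ge>0. \<forall>\<xi>::real^'n.
      (\<forall>\<psi>\<in>GSsp b M A. norm (f (Kop (mo \<xi> \<eta>1) \<psi>)) \<le> C * wsum c \<xi> * Wt \<xi> * N \<psi>) \<and>
      (\<forall>h\<in>GSsp b M A. \<forall>P. wb A q0 h P \<longrightarrow> norm (f (Kop (mo \<xi> \<eta>1) h)) \<le> C * wsum c \<xi> * Wt \<xi> * P)"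
    using bq_ex[OF dominated] by blast
  then obtain D where D: "D \<ge> 0" "\<And>\<xi> \<psi>. \<psi> \<in> GSsp b M A \<Longrightarrow> norm (f (Kop (mo \<xi> \<eta>1) \<psi>)) \<le> D * wsum c \<xi> * Wt \<xi> * N \<psi>"
    by blast
  show ?thesis
  proof (cases b)
    case True
    obtain L B where L: "0 < L" and B: "\<And>p. c p * M p * L ^ p \<le> B"
      using c_growth unfolding bq_def if_P[OF True] by blast
    obtain q C where q: "0 < q" and C: "C \<ge> 0" "\<And>\<eta> \<psi> Q. \<eta> \<in> GSsp b M A \<Longrightarrow> \<psi> \<in> GSsp b M A \<Longrightarrow> wb A q \<eta> Q \<Longrightarrow> N (Kop \<eta> \<psi>) \<le> C * Q * N \<psi>"
      using N_Kop_bound unfolding bq_def if_P[OF True] by blast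
    define l1 where "l1 = min (L / 2) (1 / q)"
    have l1: "0 < l1" "2 * l1 \<le> L" "q \<le> 1 / l1"
      using L q by (auto simp: l1_def min_def field_simps)
    obtain B1 where "gb M A l1 \<eta>2 B1" using \<eta>2 l1(1) unfolding GSsp_qb qb_def if_P[OF True] by blast
    from main[OF L order_refl B l1(1,2) this q l1(3) C D] L show ?thesis
      unfolding bq_def if_P[OF True] by blast
  next
    case False
    obtain l1 B1 where l1: "0 < l1" and B1: "gb M A l1 \<eta>2 B1" using GSsp_gb[OF \<eta>2] by blast
    then have q: "0 < 1 / l1" by simp
    obtain C where C: "C \<ge> 0" "\<And>\<eta> \<psi> Q. \<eta> \<in> GSsp b M A \<Longrightarrow> \<psi> \<in> GSsp b M A \<Longrightarrow> wb A (1 / l1) \<eta> Q \<Longrightarrow> N (Kop \<eta> \<psi>) \<le> C * Q * N \<psi>"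
      using N_Kop_bound[unfolded bq_def if_not_P[OF False], rule_format, OF q q] by metis
    show ?thesis unfolding bq_def if_not_P[OF False]
    proof (intro allI impI)
      fix L :: real assume L: "0 < L"
      let ?L = "max L (2 * l1)"
      have "0 < ?L" using L by simp
      from c_growth[unfolded bq_def if_not_P[OF False], rule_format, OF this this]
      obtain B where B: "\<And>p. c p * M p * ?L ^ p \<le> B" by blast
      show "\<exists>K\<ge>0. \<forall>i r j \<xi>. \<forall>\<psi>\<in>GSsp b M A. L ^ r * M r * norm (V i r j \<psi> \<xi>) \<le> K * (1/4) ^ j * N \<psi> * Wt \<xi>"
        by (rule main[OF L _ B l1 _ B1 q order_refl C D]) auto
    qed
  qed
qed

text \<open>On derivatives of a fixed test function the second estimate in \<open>dominated\<close>
  gives decay in r as well. The resulting absolute convergence in both indices justifies the later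
  exchanges of sums and integrals.\<close>

lemma V_bound_S:
  assumes \<phi>: "\<phi> \<in> GSsp b M A"
  shows "\<exists>K\<ge>0. \<forall>i r j \<xi>. norm (V i r j (Dlist (replicate r i) \<phi>) \<xi>) \<le> K * (1/4) ^ r * (1/4) ^ j * Wt \<xi>"
proof -
  let ?H = "HA CARD('n)"
  have main: "\<exists>K\<ge>0. \<forall>i r j \<xi>. norm (V i r j (Dlist (replicate r i) \<phi>) \<xi>) \<le> K * (1/4) ^ r * (1/4) ^ j * Wt \<xi>"
    if L: "0 < L" and B: "\<And>p. c p * M p * L ^ p \<le> B" and l1: "0 < l1" "2 * l1 \<le> L" and l2: "0 < l2" "2 * l2 \<le> L"
      and B1: "gb M A l1 \<eta>2 B1" and B2: "gb M A l2 \<phi> B2" and q: "0 < q" "2 * ?H * q \<le> 1 / l1" "2 * q \<le> 1 / l2"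
      and D: "D \<ge> 0" "\<And>\<xi> h P. h \<in> GSsp b M A \<Longrightarrow> wb A q h P \<Longrightarrow> norm (f (Kop (mo \<xi> \<eta>1) h)) \<le> D * wsum c \<xi> * Wt \<xi> * P"
    for L B l1 l2 B1 B2 q D
  proof -
    obtain C where C: "C > 0" "\<And>(\<psi>::'n tfun) \<eta> P Q. \<psi> \<in> borel_measurable borel \<Longrightarrow> \<eta> \<in> borel_measurable borel \<Longrightarrow> wb A (2 * q) \<psi> P \<Longrightarrow>
        wb A (2 * ?H * q) \<eta> Q \<Longrightarrow> wb A q (Kop \<eta> \<psi>) (C * P * Q)"
      using Kop_wb[OF q(1), where 'n='n] by blast
    show ?thesis
    proof (intro exI[of _ "D * C * B1 * B2 * (B * M 0)"] conjI allI)
      have nn: "0 \<le> B1" "0 \<le> B2" by (rule gb_nonneg[OF B1], rule gb_nonneg[OF B2])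
      have B0: "0 \<le> B" using B[of 0] by (simp add: c_0 order_trans[OF Mnn])
      show "0 \<le> D * C * B1 * B2 * (B * M 0)" using D C nn B0 by simp
      fix i r j and \<xi> :: "real^'n"
      let ?D1 = "mo \<xi> (Dlist (replicate j i) \<eta>2)" and ?D2 = "Dlist (replicate r i) \<phi>"
      let ?c = "c (r + j) * (1 / pi) ^ (r + j)" and ?Q = "B1 * (l1 ^ j * M j)" and ?P = "B2 * (l2 ^ r * M r)"
      have S: "?D1 \<in> GSsp b M A" "?D2 \<in> GSsp b M A" by (intro GSsp_mo GSsp_Dlist \<eta>2 \<phi>)+
      have "wb A (2 * q) ?D2 ?P" using wb_mono[OF wsA gb_wb[OF B2, of "replicate r i"]] q by simp
      moreover have "wb A (2 * ?H * q) ?D1 ?Q" using wb_mono[OF wsA gb_wb[OF B1, of "replicate j i"]] q by simp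
      ultimately have "wb A q (Kop ?D1 ?D2) (C * ?P * ?Q)" by (intro C GSsp_measurable[OF S(1)] GSsp_measurable[OF S(2)])
      from D(2)[OF GSsp_Kop(1)[OF S] this, of \<xi>]
      have "norm (pairing i j ?D2 \<xi>) \<le> wsum c \<xi> * Wt \<xi> * (D * (C * ?P * ?Q))" unfolding pairing_def by (simp only: mult_ac)
      then have "norm (V i r j ?D2 \<xi>) \<le> ?c * (D * (C * ?P * ?Q)) * Wt \<xi>" by (rule V_bound)
      also have "\<dots> = D * C * B1 * B2 * Wt \<xi> * (?c * ((l1 ^ j * M j) * (l2 ^ r * M r)))" by (simp only: mult_ac)
      also have "\<dots> \<le> D * C * B1 * B2 * Wt \<xi> * (B * M 0 * (1/4) ^ r * (1/4) ^ j)"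
        by (intro mult_left_mono coefficient_bound[OF c_nonneg B]) (use l1 l2 D C nn in auto)
      finally show "norm (V i r j ?D2 \<xi>) \<le> D * C * B1 * B2 * (B * M 0) * (1/4) ^ r * (1/4) ^ j * Wt \<xi>" by (simp only: mult_ac)
    qed
  qed
  show ?thesis
  proof (cases b)
    case True
    obtain L B where L: "0 < L" and B: "\<And>p. c p * M p * L ^ p \<le> B"
      using c_growth unfolding bq_def if_P[OF True] by blast
    obtain q D where q: "0 < q" and D: "D \<ge> 0" "\<And>\<xi> h P. h \<in> GSsp b M A \<Longrightarrow> wb A q h P \<Longrightarrow> norm (f (Kop (mo \<xi> \<eta>1) h)) \<le> D * wsum c \<xi> * Wt \<xi> * P"
      using dominated unfolding bq_def if_P[OF True] by blast
    have min_aux: "0 < min (L / 2) (1 / a)" "2 * min (L / 2) (1 / a) \<le> L" "a \<le> 1 / min (L / 2) (1 / a)" if "0 < a" for a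
      using that L by (auto simp: min_def field_simps)
    define l1 where "l1 = min (L / 2) (1 / (2 * ?H * q))"
    define l2 where "l2 = min (L / 2) (1 / (2 * q))"
    have l1: "0 < l1" "2 * l1 \<le> L" "2 * ?H * q \<le> 1 / l1" and l2: "0 < l2" "2 * l2 \<le> L" "2 * q \<le> 1 / l2"
      unfolding l1_def l2_def using min_aux[of "2 * ?H * q"] min_aux[of "2 * q"] q by auto
    obtain B1 where B1: "gb M A l1 \<eta>2 B1" using \<eta>2 l1(1) unfolding GSsp_qb qb_def if_P[OF True] by blast
    obtain B2 where B2: "gb M A l2 \<phi> B2" using \<phi> l2(1) unfolding GSsp_qb qb_def if_P[OF True] by blast
    show ?thesis by (rule main[OF L B l1(1,2) l2(1,2) B1 B2 q l1(3) l2(3) D])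
  next
    case False
    obtain l1 B1 where l1: "0 < l1" and B1: "gb M A l1 \<eta>2 B1" using GSsp_gb[OF \<eta>2] by blast
    obtain l2 B2 where l2: "0 < l2" and B2: "gb M A l2 \<phi> B2" using GSsp_gb[OF \<phi>] by blast
    define q where "q = min (1 / (2 * ?H * l1)) (1 / (2 * l2))"
    have q: "0 < q" "2 * ?H * q \<le> 1 / l1" "2 * q \<le> 1 / l2"
      using l1 l2 HA_pos[of "CARD('n)"] by (auto simp: q_def min_def field_simps)
    let ?L = "2 * max l1 l2"
    have L: "0 < ?L" using l1 by simp
    from c_growth[unfolded bq_def if_not_P[OF False], rule_format, OF L L]
    obtain B where B: "\<And>p. c p * M p * ?L ^ p \<le> B" by blast
    from dominated[unfolded bq_def if_not_P[OF False], rule_format, OF q(1) q(1)]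
    obtain D where D: "D \<ge> 0" "\<And>\<xi> h P. h \<in> GSsp b M A \<Longrightarrow> wb A q h P \<Longrightarrow> norm (f (Kop (mo \<xi> \<eta>1) h)) \<le> D * wsum c \<xi> * Wt \<xi> * P"
      by blast
    show ?thesis by (rule main[OF L B l1 _ l2 _ B1 B2 q D]) auto
  qed
qed

lemma V_integrable: "integrable lborel (V i r j \<psi>)" if \<psi>: "\<psi> \<in> GSsp b M A"
proof -
  obtain L K where L: "0 < L" and K: "\<And>\<xi>. L ^ r * M r * norm (V i r j \<psi> \<xi>) \<le> K * (1/4) ^ j * N \<psi> * Wt \<xi>"
    using bq_ex[OF V_bound_E] \<psi> by blast
  have "norm (V i r j \<psi> \<xi>) \<le> K * (1/4) ^ j * N \<psi> / (L ^ r * M r) * Wt \<xi>" for \<xi>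
    using K[of \<xi>] L by (simp add: field_simps)
  then show ?thesis by (rule integrable_Wt_bound(1)[OF V_measurable[OF \<psi>]])
qed

lemma J_bound:
  "bq b (\<lambda>L. 0 < L \<longrightarrow> (\<exists>K\<ge>0. \<forall>i r j. \<forall>\<psi>\<in>GSsp b M A. L ^ r * M r * norm (J i r j \<psi>) \<le> K * N \<psi> * (1/4) ^ j))"
proof (rule bq_mono[OF V_bound_E], rule impI)
  fix L :: real assume L: "0 < L"
    and "0 < L \<longrightarrow> (\<exists>K\<ge>0. \<forall>i r j \<xi>. \<forall>\<psi>\<in>GSsp b M A. L ^ r * M r * norm (V i r j \<psi> \<xi>) \<le> K * (1/4) ^ j * N \<psi> * Wt \<xi>)"
  then obtain K where K: "0 \<le> K" "\<And>i r j \<xi> \<psi>. \<psi> \<in> GSsp b M A \<Longrightarrow> L ^ r * M r * norm (V i r j \<psi> \<xi>) \<le> K * (1/4) ^ j * N \<psi> * Wt \<xi>"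
    by blast
  let ?W = "LINT \<xi>|lborel. Wt (\<xi> :: real^'n)"
  have W: "0 \<le> ?W" by (rule integral_nonneg_AE) auto
  have "L ^ r * M r * norm (J i r j \<psi>) \<le> (K * ?W) * N \<psi> * (1/4) ^ j" if \<psi>: "\<psi> \<in> GSsp b M A" for i r j \<psi>
  proof -
    have "norm (V i r j \<psi> \<xi>) \<le> K * (1/4) ^ j * N \<psi> / (L ^ r * M r) * Wt \<xi>" for \<xi>
      using K(2)[OF \<psi>, of r i j \<xi>] L by (simp add: field_simps)
    from integrable_Wt_bound(2)[OF V_measurable[OF \<psi>] this] show ?thesis
      using L unfolding J_def by (simp add: field_simps)
  qed
  then show "\<exists>K\<ge>0. \<forall>i r j. \<forall>\<psi>\<in>GSsp b M A. L ^ r * M r * norm (J i r j \<psi>) \<le> K * N \<psi> * (1/4) ^ j"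
    using K(1) W by (intro exI[of _ "K * ?W"]) auto
qed

lemma lin_on_J: "lin_on (GSsp b M A) (J i r j)"
proof -
  have lin: "lin_on (GSsp b M A) (\<lambda>\<psi>. f (Kop (mo \<xi> \<eta>1) (Kop (mo \<xi> (Dlist (replicate j i) \<eta>2)) \<psi>)))" for \<xi>
    by (intro lin_on_functional_Kop[where f="\<lambda>\<psi>. f (Kop (mo \<xi> \<eta>1) \<psi>)"] lin_on_functional_Kop GSdualD(2)[OF f] GSsp_mo GSsp_Dlist \<eta>1 \<eta>2)
  show ?thesis unfolding lin_on_def
  proof (intro ballI allI conjI)
    fix \<phi> \<psi> :: "'n tfun" and k assume S: "\<phi> \<in> GSsp b M A" "\<psi> \<in> GSsp b M A"
    have "V i r j (\<lambda>x. \<phi> x + \<psi> x) = (\<lambda>\<xi>. V i r j \<phi> \<xi> + V i r j \<psi> \<xi>)"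
      unfolding fun_eq_iff V_def pairing_def lin_on_add[OF lin S] by (simp add: distrib_left)
    then show "J i r j (\<lambda>x. \<phi> x + \<psi> x) = J i r j \<phi> + J i r j \<psi>"
      unfolding J_def using V_integrable[OF S(1)] V_integrable[OF S(2)] by simp
    have "V i r j (\<lambda>x. k * \<phi> x) = (\<lambda>\<xi>. k * V i r j \<phi> \<xi>)"
      unfolding fun_eq_iff V_def pairing_def lin_on_cmult[OF lin S(1)] by simp
    then show "J i r j (\<lambda>x. k * \<phi> x) = k * J i r j \<phi>" unfolding J_def by simp
  qed
qed

lemma geometric_has_sum: "0 \<le> C \<Longrightarrow> ((\<lambda>j. C * (1/4::real) ^ j) has_sum (C * (4/3))) UNIV"
  using sums_mult[OF geometric_sums[of "1/4::real"], of C] by (intro sums_nonneg_imp_has_sum) auto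

lemma J_summable: "(\<lambda>j. norm (J i r j \<psi>)) summable_on UNIV" if \<psi>: "\<psi> \<in> GSsp b M A"
proof -
  obtain L K where L: "0 < L" and K: "K \<ge> 0" "\<And>j. L ^ r * M r * norm (J i r j \<psi>) \<le> K * N \<psi> * (1/4) ^ j"
    using bq_ex[OF J_bound] \<psi> by blast
  have "norm (J i r j \<psi>) \<le> K * N \<psi> / (L ^ r * M r) * (1/4) ^ j" for j using K(2)[of j] L by (simp add: field_simps)
  then show ?thesis
    using L K(1) N_nonneg[OF \<psi>]
    by (intro summable_on_comparison_test[OF has_sum_imp_summable[OF geometric_has_sum[of "K * N \<psi> / (L ^ r * M r)"]]]) auto
qed

lemma lin_on_F: "lin_on (GSsp b M A) (F i r)"
  unfolding lin_on_def
proof (intro ballI allI conjI)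
  fix \<phi> \<psi> :: "'n tfun" and k assume S: "\<phi> \<in> GSsp b M A" "\<psi> \<in> GSsp b M A"
  show "F i r (\<lambda>x. \<phi> x + \<psi> x) = F i r \<phi> + F i r \<psi>"
    unfolding F_def lin_on_add[OF lin_on_J S]
    by (subst infsum_add) (auto intro: abs_summable_summable J_summable S simp: distrib_left)
  show "F i r (\<lambda>x. k * \<phi> x) = k * F i r \<phi>"
    unfolding F_def lin_on_cmult[OF lin_on_J S(1)] by (simp add: infsum_cmult_right')
qed

lemma F_bound:
  "bq b (\<lambda>L. 0 < L \<longrightarrow> (\<exists>K\<ge>0. \<forall>i r. \<forall>\<psi>\<in>GSsp b M A. L ^ r * M r * norm (F i r \<psi>) \<le> K * N \<psi>))"
proof (rule bq_mono[OF J_bound], rule impI)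
  fix L :: real assume L: "0 < L"
    and "0 < L \<longrightarrow> (\<exists>K\<ge>0. \<forall>i r j. \<forall>\<psi>\<in>GSsp b M A. L ^ r * M r * norm (J i r j \<psi>) \<le> K * N \<psi> * (1/4) ^ j)"
  then obtain K where K: "0 \<le> K" "\<And>i r j \<psi>. \<psi> \<in> GSsp b M A \<Longrightarrow> L ^ r * M r * norm (J i r j \<psi>) \<le> K * N \<psi> * (1/4) ^ j"
    by blast
  have "L ^ r * M r * norm (F i r \<psi>) \<le> (K * (4/3)) * N \<psi>" if \<psi>: "\<psi> \<in> GSsp b M A" for i r \<psi>
  proof -
    let ?C = "K * N \<psi> / (L ^ r * M r)"
    have "0 \<le> ?C" using K(1) L N_nonneg[OF \<psi>] by simp
    note geo = geometric_has_sum[OF this]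
    have "norm (F i r \<psi>) \<le> (\<Sum>\<^sub>\<infinity>j. norm (J i r j \<psi>))"
      unfolding F_def by (simp add: norm_mult norm_power norm_infsum_bound[OF J_summable[OF \<psi>]])
    also have "\<dots> \<le> (\<Sum>\<^sub>\<infinity>j. ?C * (1/4) ^ j)"
      by (rule infsum_mono[OF J_summable[OF \<psi>] has_sum_imp_summable[OF geo]])
        (use K(2)[OF \<psi>, of r i] L in \<open>simp add: field_simps\<close>)
    also have "\<dots> = ?C * (4/3)" by (rule infsumI[OF geo])
    finally show ?thesis using L by (simp add: field_simps)
  qed
  then show "\<exists>K\<ge>0. \<forall>i r. \<forall>\<psi>\<in>GSsp b M A. L ^ r * M r * norm (F i r \<psi>) \<le> K * N \<psi>"
    using K(1) by (intro exI[of _ "K * (4/3)"]) auto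
qed

text \<open>Summing over j with r = p - j completes the binomial expansion of p integrations by
  parts: the derivatives disappear, (- 2 pi i \<xi>_i)^p appears, and \<open>coef\<close> corrects
  it to a nonnegative weight.\<close>

lemma V_sum:
  assumes \<phi>: "\<phi> \<in> GSsp b M A"
  shows "(\<Sum>j\<le>p. V i (p - j) j (Dlist (replicate (p - j) i) \<phi>) \<xi>) =
    complex_of_real (c p * \<bar>\<xi> $ i\<bar> ^ p / wsum c \<xi>) * f (Kop (mo \<xi> (Kop (\<lambda>x. \<eta>1 (- x)) \<eta>2)) \<phi>)"
proof -
  let ?u = "\<lambda>\<psi>. f (Kop (mo \<xi> \<eta>1) \<psi>)" and ?m = "- (2 * pi * \<xi> $ i * \<i>)"
  let ?F = "\<lambda>j. Kop (mo \<xi> (Dlist (replicate j i) \<eta>2)) (Dlist (replicate (p - j) i) \<phi>)"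
  have lin: "lin_on (GSsp b M A) ?u" by (intro lin_on_functional_Kop GSdualD(2)[OF f] GSsp_mo \<eta>1)
  have "(\<Sum>j\<le>p. V i (p - j) j (Dlist (replicate (p - j) i) \<phi>) \<xi>) = coef i p \<xi> * (\<Sum>j\<le>p. of_nat (p choose j) * ?u (?F j))"
    unfolding sum_distrib_left by (rule sum.cong) (auto simp: V_def pairing_def)
  also have "(\<Sum>j\<le>p. of_nat (p choose j) * ?u (?F j)) = ?u (\<lambda>x. \<Sum>j\<le>p. of_nat (p choose j) * ?F j x)"
    by (rule lin_on_sum[OF lin, symmetric]) (auto intro: GSsp_Kop GSsp_mo GSsp_Dlist \<eta>2 \<phi>)
  also have "\<dots> = ?u (\<lambda>x. ?m ^ p * Kop (mo \<xi> \<eta>2) \<phi> x)"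
    by (simp only: Kop_mo_power[OF \<eta>2 \<phi>])
  also have "\<dots> = ?m ^ p * ?u (Kop (mo \<xi> \<eta>2) \<phi>)"
    by (rule lin_on_cmult[OF lin]) (intro GSsp_Kop GSsp_mo \<eta>2 \<phi>)
  also have "?u (Kop (mo \<xi> \<eta>2) \<phi>) = f (Kop (mo \<xi> (Kop (\<lambda>x. \<eta>1 (- x)) \<eta>2)) \<phi>)"
    by (simp only: Kop_mo_Kop_mo[OF \<eta>1 \<eta>2 \<phi>])
  also have "coef i p \<xi> * (?m ^ p * f (Kop (mo \<xi> (Kop (\<lambda>x. \<eta>1 (- x)) \<eta>2)) \<phi>))
      = (coef i p \<xi> * ?m ^ p) * f (Kop (mo \<xi> (Kop (\<lambda>x. \<eta>1 (- x)) \<eta>2)) \<phi>)" by (simp only: mult.assoc)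
  also have "coef i p \<xi> * ?m ^ p = complex_of_real (c p * \<bar>\<xi> $ i\<bar> ^ p / wsum c \<xi>)"
  proof -
    have "\<i> / (2 * pi) * ?m = complex_of_real (\<xi> $ i)" by (simp add: complex_eq_iff)
    then have "(\<i> / (2 * pi)) ^ p * ?m ^ p = complex_of_real (\<xi> $ i) ^ p" by (simp only: power_mult_distrib[symmetric])
    moreover have "complex_of_real (sgn (\<xi> $ i)) ^ p * complex_of_real (\<xi> $ i) ^ p = complex_of_real (\<bar>\<xi> $ i\<bar>) ^ p"
      by (simp add: abs_sgn mult.commute flip: power_mult_distrib of_real_mult)
    ultimately show ?thesis by (simp add: coef_def mult_ac)
  qed
  finally show ?thesis .
qed

text \<open>The weights c p |\<xi>_i|^p / wsum c \<xi> form a partition of unity over i and p.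
  Inserted into the reproducing formula they yield terms \<open>?U i p\<close> of size (1/2)^p
  \<open>Wt\<close>, small enough to integrate term by term.\<close>

lemma reproducing_series:
  assumes \<phi>: "\<phi> \<in> GSsp b M A"
  shows "f \<phi> = (\<Sum>i\<in>UNIV. \<Sum>p. \<Sum>j\<le>p. J i (p - j) j (Dlist (replicate (p - j) i) \<phi>))"
proof -
  let ?\<eta> = "Kop (\<lambda>x. \<eta>1 (- x)) \<eta>2"
  let ?G = "\<lambda>\<xi>. f (Kop (mo \<xi> ?\<eta>) \<phi>)"
  let ?V = "\<lambda>i p j. V i (p - j) j (Dlist (replicate (p - j) i) \<phi>)"
  let ?U = "\<lambda>i p \<xi>. \<Sum>j\<le>p. ?V i p j \<xi>"
  have \<eta>: "?\<eta> \<in> GSsp b M A" by (intro GSsp_Kop GSsp_reflect \<eta>1 \<eta>2)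
  have S: "Dlist (replicate k i) \<phi> \<in> GSsp b M A" for k i by (rule GSsp_Dlist[OF \<phi>])
  obtain K where K: "0 \<le> K" "\<And>i r j \<xi>. norm (V i r j (Dlist (replicate r i) \<phi>) \<xi>) \<le> K * (1/4) ^ r * (1/4) ^ j * Wt \<xi>"
    using V_bound_S[OF \<phi>] by blast
  let ?W = "LINT \<xi>|lborel. Wt (\<xi> :: real^'n)"
  have U: "norm (?U i p \<xi>) \<le> K * (1/2) ^ p * Wt \<xi>" for i p \<xi>
  proof -
    have "norm (?U i p \<xi>) \<le> (\<Sum>j\<le>p. K * (1/4) ^ p * Wt \<xi>)"
    proof (rule sum_norm_le)
      fix j assume "j \<in> {..p}"
      then have "(1/4::real) ^ (p - j) * (1/4) ^ j = (1/4) ^ p" by (simp flip: power_add)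
      then show "norm (?V i p j \<xi>) \<le> K * (1/4) ^ p * Wt \<xi>" using K(2)[of i "p - j" j \<xi>] by (simp add: mult.assoc)
    qed
    also have "\<dots> = (K * Wt \<xi>) * (real (p + 1) * (1/4) ^ p)" by simp
    also have "\<dots> \<le> (K * Wt \<xi>) * (1/2) ^ p"
    proof (rule mult_left_mono)
      \<comment> \<open>The p + 1 summands on a diagonal are absorbed by p + 1 \<le> 2^p.\<close>
      have "real (p + 1) * (1/4) ^ p \<le> 2 ^ p * (1/4) ^ p"
        by (intro mult_right_mono) (use less_exp[of p] in \<open>auto simp: of_nat_le_iff[symmetric, where 'a=real] Suc_le_eq[symmetric] simp del: of_nat_le_iff\<close>)
      also have "\<dots> = (1/2::real) ^ p" by (simp flip: power_mult_distrib)
      finally show "real (p + 1) * (1/4) ^ p \<le> (1/2) ^ p" .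
    qed (use K in simp)
    finally show ?thesis by (simp add: mult_ac)
  qed
  have Ui: "integrable lborel (?U i p)" for i p by (intro Bochner_Integration.integrable_sum V_integrable S)
  have sU: "summable (\<lambda>p. norm (?U i p \<xi>))" for i \<xi>
    by (rule summable_comparison_test'[of "\<lambda>p. K * (1/2) ^ p * Wt \<xi>"])
      (use U in \<open>auto intro!: summable_mult summable_mult2 summable_geometric\<close>)
  have sI: "summable (\<lambda>p. LINT \<xi>|lborel. norm (?U i p \<xi>))" for i
  proof (rule summable_comparison_test'[of "\<lambda>p. K * (1/2) ^ p * ?W"])
    show "summable (\<lambda>p. K * (1/2) ^ p * ?W)" by (intro summable_mult summable_mult2 summable_geometric) simp
    have "(LINT \<xi>|lborel. norm (?U i p \<xi>)) \<le> (LINT \<xi>|lborel. K * (1/2) ^ p * Wt (\<xi>::real^'n))" for p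
      by (intro integral_mono integrable_norm[OF Ui] integrable_mult_right integrable_Wt U)
    then show "norm (LINT \<xi>|lborel. norm (?U i p \<xi>)) \<le> K * (1/2) ^ p * ?W" for p by simp
  qed
  have G: "?G \<xi> = (\<Sum>i\<in>UNIV. \<Sum>p. ?U i p \<xi>)" for \<xi>
  proof -
    have "(\<Sum>p. ?U i p \<xi>) = complex_of_real (\<Sum>p. c p * \<bar>\<xi> $ i\<bar> ^ p) / wsum c \<xi> * ?G \<xi>" for i
    proof -
      have "(\<lambda>p. complex_of_real (c p * \<bar>\<xi> $ i\<bar> ^ p) * (?G \<xi> / wsum c \<xi>)) sums
          (complex_of_real (\<Sum>p. c p * \<bar>\<xi> $ i\<bar> ^ p) * (?G \<xi> / wsum c \<xi>))"
        by (intro sums_mult2 sums_of_real summable_sums c_summable) simp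
      then show ?thesis using V_sum[OF \<phi>, of i _ \<xi>] by (simp add: sums_iff)
    qed
    then have "(\<Sum>i\<in>UNIV. \<Sum>p. ?U i p \<xi>) = (\<Sum>i\<in>UNIV. complex_of_real (\<Sum>p. c p * \<bar>\<xi> $ i\<bar> ^ p)) / wsum c \<xi> * ?G \<xi>"
      by (simp add: sum_divide_distrib sum_distrib_right)
    also have "(\<Sum>i\<in>UNIV. complex_of_real (\<Sum>p. c p * \<bar>\<xi> $ i\<bar> ^ p)) = wsum c \<xi>" by (simp add: wsum_def)
    finally show ?thesis using wsum_pos[of \<xi>] by simp
  qed
  have "f \<phi> = (LINT \<xi>|lborel. ?G \<xi>)" by (rule functional_reproducing[OF f \<eta> normalized \<phi>])
  also have "\<dots> = (LINT \<xi>|lborel. (\<Sum>i\<in>UNIV. \<Sum>p. ?U i p \<xi>))" by (simp only: G)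
  also have "\<dots> = (\<Sum>i\<in>UNIV. LINT \<xi>|lborel. (\<Sum>p. ?U i p \<xi>))"
    by (rule Bochner_Integration.integral_sum) (rule integrable_suminf[OF Ui AE_I2[OF sU] sI])
  also have "\<dots> = (\<Sum>i\<in>UNIV. \<Sum>p. LINT \<xi>|lborel. ?U i p \<xi>)"
    by (simp only: integral_suminf[OF Ui AE_I2[OF sU] sI])
  also have "\<dots> = (\<Sum>i\<in>UNIV. \<Sum>p. \<Sum>j\<le>p. J i (p - j) j (Dlist (replicate (p - j) i) \<phi>))"
    unfolding J_def by (simp only: Bochner_Integration.integral_sum[OF V_integrable[OF S]])
  finally show ?thesis .
qed

lemma F_has_sum:
  assumes \<phi>: "\<phi> \<in> GSsp b M A"
  shows "((\<lambda>r. (-1) ^ r * F i r (Dlist (replicate r i) \<phi>)) has_sum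
    (\<Sum>p. \<Sum>j\<le>p. J i (p - j) j (Dlist (replicate (p - j) i) \<phi>))) UNIV"
proof -
  obtain K where K: "0 \<le> K" "\<And>i r j \<xi>. norm (V i r j (Dlist (replicate r i) \<phi>) \<xi>) \<le> K * (1/4) ^ r * (1/4) ^ j * Wt \<xi>"
    using V_bound_S[OF \<phi>] by blast
  have "norm (J i r j (Dlist (replicate r i) \<phi>)) \<le> K * (LINT \<xi>|lborel. Wt (\<xi> :: real^'n)) * (1/4) ^ r * (1/4) ^ j" for r j
    using integrable_Wt_bound(2)[OF V_measurable[OF GSsp_Dlist[OF \<phi>]] K(2), of i r j] unfolding J_def by (simp add: mult_ac)
  from triangle_has_sum[OF this] show ?thesis by (simp add: F_def flip: mult.assoc power_mult_distrib)
qed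

text \<open>A nonzero \<alpha> lies on at most one axis; \<alpha> = 0 lies on all of them and
  collects F i 0 for every i. Off the axes the coefficient vanishes.\<close>

definition rep :: "('n \<Rightarrow> nat) \<Rightarrow> 'n udist" where
  "rep \<alpha> = restr (GSsp b M A) (\<lambda>\<psi>. \<Sum>i\<in>UNIV. if \<forall>k. k \<noteq> i \<longrightarrow> \<alpha> k = 0 then F i (\<alpha> i) \<psi> else 0)"

lemma rep_has_sum:
  assumes \<phi>: "\<phi> \<in> GSsp b M A"
  shows "((\<lambda>\<alpha>. dder b M A \<alpha> (rep \<alpha>) \<phi>) has_sum f \<phi>) UNIV"
proof -
  let ?g = "\<lambda>i \<alpha>. (-1) ^ mlen \<alpha> * F i (\<alpha> i) (Dmi \<alpha> \<phi>)"
  have eq: "dder b M A \<alpha> (rep \<alpha>) \<phi> = (\<Sum>i\<in>UNIV. if \<forall>k. k \<noteq> i \<longrightarrow> \<alpha> k = 0 then ?g i \<alpha> else 0)" for \<alpha>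
    using \<phi> Dmi_GSsp[OF \<phi>, of \<alpha>] by (simp add: dder_def rep_def restr_def sum_distrib_left if_distrib cong: if_cong)
  have "((\<lambda>r. ?g i (\<lambda>k. if k = i then r else 0)) has_sum (\<Sum>p. \<Sum>j\<le>p. J i (p - j) j (Dlist (replicate (p - j) i) \<phi>))) UNIV" for i
  proof -
    have "count_list (replicate r i) k = (if k = i then r else 0)" for r k by (induction r) auto
    then have "(\<lambda>k. if k = i then r else 0) = count_list (replicate r i)" for r by (simp add: fun_eq_iff)
    then have "?g i (\<lambda>k. if k = i then r else 0) = (-1) ^ r * F i r (Dlist (replicate r i) \<phi>)" for r
      using Dlist_eq_Dmi[OF GSsp_smooth[OF \<phi>], of "replicate r i"] mlen_count_list[of "replicate r i"] by simp
    then show ?thesis using F_has_sum[OF \<phi>, of i] by simp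
  qed
  then show ?thesis
    unfolding eq reproducing_series[OF \<phi>] by (intro has_sum_finite_sum has_sum_axis) auto
qed

lemma rep_bound:
  "bq b (\<lambda>L. 0 < L \<longrightarrow> (\<exists>K\<ge>0. \<forall>\<alpha>. \<forall>\<psi>\<in>GSsp b M A. L ^ mlen \<alpha> * M (mlen \<alpha>) * norm (rep \<alpha> \<psi>) \<le> K * N \<psi>))"
proof (rule bq_mono[OF F_bound], rule impI)
  fix L :: real assume L: "0 < L" and "0 < L \<longrightarrow> (\<exists>K\<ge>0. \<forall>i r. \<forall>\<psi>\<in>GSsp b M A. L ^ r * M r * norm (F i r \<psi>) \<le> K * N \<psi>)"
  then obtain K where K: "0 \<le> K" "\<And>i r \<psi>. \<psi> \<in> GSsp b M A \<Longrightarrow> L ^ r * M r * norm (F i r \<psi>) \<le> K * N \<psi>" by blast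
  have "L ^ mlen \<alpha> * M (mlen \<alpha>) * norm (rep \<alpha> \<psi>) \<le> (real CARD('n) * K) * N \<psi>" if \<psi>: "\<psi> \<in> GSsp b M A" for \<alpha> \<psi>
  proof -
    let ?F = "\<lambda>i. if \<forall>k. k \<noteq> i \<longrightarrow> \<alpha> k = 0 then F i (\<alpha> i) \<psi> else 0"
    have "L ^ mlen \<alpha> * M (mlen \<alpha>) * norm (?F i) \<le> K * N \<psi>" for i
    proof (cases "\<forall>k. k \<noteq> i \<longrightarrow> \<alpha> k = 0")
      case True
      then have "mlen \<alpha> = \<alpha> i" unfolding mlen_def by (subst sum.remove[of _ i]) auto
      then show ?thesis using K(2)[OF \<psi>, of "\<alpha> i" i] True by simp
    qed (use K N_nonneg[OF \<psi>] in auto)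
    then have "(\<Sum>i\<in>UNIV. L ^ mlen \<alpha> * M (mlen \<alpha>) * norm (?F i)) \<le> (\<Sum>i\<in>(UNIV::'n set). K * N \<psi>)" by (rule sum_mono)
    moreover have "norm (rep \<alpha> \<psi>) \<le> (\<Sum>i\<in>UNIV. norm (?F i))" using \<psi> by (simp add: rep_def restr_def norm_sum)
    then have "L ^ mlen \<alpha> * M (mlen \<alpha>) * norm (rep \<alpha> \<psi>) \<le> (\<Sum>i\<in>UNIV. L ^ mlen \<alpha> * M (mlen \<alpha>) * norm (?F i))"
      unfolding sum_distrib_left[symmetric] using L by (intro mult_left_mono) auto
    ultimately show ?thesis by simp
  qed
  then show "\<exists>K\<ge>0. \<forall>\<alpha>. \<forall>\<psi>\<in>GSsp b M A. L ^ mlen \<alpha> * M (mlen \<alpha>) * norm (rep \<alpha> \<psi>) \<le> K * N \<psi>"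
    using K(1) by (intro exI[of _ "real CARD('n) * K"]) auto
qed

lemma rep_Edual: "rep \<alpha> \<in> Edual b M A E nE"
proof -
  obtain L K where L: "0 < L" and K: "K \<ge> 0" "\<And>\<psi>. \<psi> \<in> GSsp b M A \<Longrightarrow> L ^ mlen \<alpha> * M (mlen \<alpha>) * norm (rep \<alpha> \<psi>) \<le> K * N \<psi>"
    using bq_ex[OF rep_bound] by blast
  show ?thesis unfolding rep_def
  proof (rule EdualI)
    show "lin_on (GSsp b M A) (\<lambda>\<psi>. \<Sum>i\<in>UNIV. if \<forall>k. k \<noteq> i \<longrightarrow> \<alpha> k = 0 then F i (\<alpha> i) \<psi> else 0)"
      using lin_on_F unfolding lin_on_def
      by (auto simp: sum_distrib_left intro!: sum.cong simp flip: sum.distrib)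
    show "0 \<le> K / (L ^ mlen \<alpha> * M (mlen \<alpha>))" using K L by simp
    show "norm (\<Sum>i\<in>UNIV. if \<forall>k. k \<noteq> i \<longrightarrow> \<alpha> k = 0 then F i (\<alpha> i) \<phi> else 0) \<le> K / (L ^ mlen \<alpha> * M (mlen \<alpha>)) * N \<phi>"
      if "\<phi> \<in> GSsp b M A" for \<phi>
      using K(2)[OF that] that L by (simp add: rep_def restr_def field_simps)
  qed
qed

lemma rep_bdd: "bq b (\<lambda>l. bdd_above (range (\<lambda>\<alpha>. l ^ mlen \<alpha> * M (mlen \<alpha>) * Edual_norm b M A nE (rep \<alpha>))))"
proof -
  have main: "bdd_above (range (\<lambda>\<alpha>. L ^ mlen \<alpha> * M (mlen \<alpha>) * Edual_norm b M A nE (rep \<alpha>)))"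
    if L: "0 < L" and K: "K \<ge> 0" "\<And>\<alpha> \<psi>. \<psi> \<in> GSsp b M A \<Longrightarrow> L ^ mlen \<alpha> * M (mlen \<alpha>) * norm (rep \<alpha> \<psi>) \<le> K * N \<psi>" for L K
  proof (rule bdd_aboveI2[where M=K])
    fix \<alpha> :: "'n \<Rightarrow> nat"
    have "Edual_norm b M A nE (rep \<alpha>) \<le> K / (L ^ mlen \<alpha> * M (mlen \<alpha>))"
      by (rule Edual_norm_le) (use K L in \<open>simp_all add: field_simps\<close>)
    then show "L ^ mlen \<alpha> * M (mlen \<alpha>) * Edual_norm b M A nE (rep \<alpha>) \<le> K" using L by (simp add: field_simps)
  qed
  show ?thesis
  proof (cases b)
    case True
    show ?thesis using rep_bound main unfolding bq_def if_P[OF True] by meson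
  next
    case False
    show ?thesis using rep_bound main unfolding bq_def if_not_P[OF False] by meson
  qed
qed

end

proposition (in tmib) conv_Edual_imp_sum_representation:
  assumes f: "f \<in> GSdual b M A" and conv: "\<And>\<phi>. \<phi> \<in> GSsp b M A \<Longrightarrow> conv b M A f \<phi> \<in> Edual b M A E nE"
  shows "\<exists>fa. (\<forall>\<alpha>. fa \<alpha> \<in> Edual b M A E nE) \<and>
    (\<forall>\<phi>\<in>GSsp b M A. ((\<lambda>\<alpha>. dder b M A \<alpha> (fa \<alpha>) \<phi>) has_sum f \<phi>) UNIV) \<and>
    bq b (\<lambda>l. bdd_above (range (\<lambda>\<alpha>. l ^ mlen \<alpha> * M (mlen \<alpha>) * Edual_norm b M A nE (fa \<alpha>))))"
\<comment> \<open>Without a nonzero test function there is no window, but then f vanishes and the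
  zero family represents it.\<close>
proof (cases "\<exists>\<theta>\<in>GSsp b M A. \<theta> \<noteq> (\<lambda>x::real^'n. 0)")
  case True
  then obtain \<eta>1 \<eta>2 :: "'n tfun" where \<eta>: "\<eta>1 \<in> GSsp b M A" "\<eta>2 \<in> GSsp b M A" "Kop (\<lambda>x. \<eta>1 (- x)) \<eta>2 0 = 1"
    using window_exists by blast
  from dominated_pairings[OF f conv \<eta>(1)] obtain c where c: "\<forall>p. 0 \<le> c p" "c 0 = 1"
    "bq b (\<lambda>L. 0 < L \<longrightarrow> (\<exists>B. \<forall>p. c p * M p * L ^ p \<le> B))" "\<forall>t\<ge>0. summable (\<lambda>p. c p * t ^ p)"
    "bq b (\<lambda>q. 0 < q \<longrightarrow> (\<exists>C\<ge>0. \<forall>\<xi>::real^'n. (\<forall>\<psi>\<in>GSsp b M A. norm (f (Kop (mo \<xi> \<eta>1) \<psi>)) \<le> C * wsum c \<xi> * Wt \<xi> * N \<psi>) \<and>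
      (\<forall>h\<in>GSsp b M A. \<forall>P. wb A q h P \<longrightarrow> norm (f (Kop (mo \<xi> \<eta>1) h)) \<le> C * wsum c \<xi> * Wt \<xi> * P)))"
    by blast
  interpret windowed b M A E nE f \<eta>1 \<eta>2 c
    by unfold_locales (use f \<eta> c in simp_all)
  show ?thesis using rep_Edual rep_has_sum rep_bdd by blast
next
  case False
  let ?z = "\<lambda>_::'n tfun. 0 :: complex"
  have f0: "f \<phi> = 0" if "\<phi> \<in> GSsp b M A" for \<phi>
  proof -
    have "\<phi> = (\<lambda>x. 0 * \<phi> x)" using False that by auto
    then show ?thesis using lin_on_cmult[OF GSdualD(2)[OF f] that, of 0] by simp
  qed
  have z: "?z = restr (GSsp b M A) ?z" by (simp add: restr_def)
  have "?z \<in> Edual b M A E nE" by (subst z, rule EdualI[of _ 0]) (auto simp: lin_on_def)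
  moreover have "((\<lambda>\<alpha>. dder b M A \<alpha> ?z \<phi>) has_sum f \<phi>) UNIV" if "\<phi> \<in> GSsp b M A" for \<phi>
    using f0[OF that] by (simp add: dder_def restr_def has_sum_0)
  moreover have "bdd_above (range (\<lambda>\<alpha>::'n \<Rightarrow> nat. l ^ mlen \<alpha> * M (mlen \<alpha>) * Edual_norm b M A nE ?z))" if "0 < l" for l
  proof (rule bdd_aboveI2[where M=0])
    have "Edual_norm b M A nE ?z \<le> 0" by (rule Edual_norm_le) auto
    then show "l ^ mlen \<alpha> * M (mlen \<alpha>) * Edual_norm b M A nE ?z \<le> 0" for \<alpha> :: "'n \<Rightarrow> nat"
      using that by (intro mult_nonneg_nonpos) auto
  qed
  then have "bq b (\<lambda>l. bdd_above (range (\<lambda>\<alpha>::'n \<Rightarrow> nat. l ^ mlen \<alpha> * M (mlen \<alpha>) * Edual_norm b M A nE ?z)))"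
    by (rule bqI)
  ultimately show ?thesis by (intro exI[of _ "\<lambda>_. ?z"]) blast
qed

theorem theorem7p4:
  fixes b :: bool and M A :: "nat \<Rightarrow> real"
    and E :: "'n::finite udist set" and nE :: "'n udist \<Rightarrow> real" and f :: "'n udist"
  assumes "weight_seq M" and "weight_seq A"
    and "cond_M1 M" and "cond_M1 A" and "cond_M2' M" and "cond_M2' A"
    and "TMIB b M A E nE" and "condG b M A E nE"
    and "f \<in> GSdual b M A"
  shows "((\<forall>\<phi>\<in>GSsp b M A. conv b M A f \<phi> \<in> Edual b M A E nE) \<longleftrightarrow> f \<in> DEdual b M A E nE)
       \<and> (f \<in> DEdual b M A E nE \<longleftrightarrow>
          (\<exists>fa :: ('n \<Rightarrow> nat) \<Rightarrow> 'n udist.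
              (\<forall>\<alpha>. fa \<alpha> \<in> Edual b M A E nE) \<and>
              (\<forall>\<phi>\<in>GSsp b M A. ((\<lambda>\<alpha>. dder b M A \<alpha> (fa \<alpha>) \<phi>) has_sum f \<phi>) UNIV) \<and>
              bq b (\<lambda>l. bdd_above (range (\<lambda>\<alpha>. l ^ mlen \<alpha> * M (mlen \<alpha>) * Edual_norm b M A nE (fa \<alpha>))))))"
proof -
  interpret tmib b M A E nE by unfold_locales (use assms in auto)
  show ?thesis
    using DEdual_imp_conv_Edual conv_Edual_imp_sum_representation[OF assms(9)] sum_representation_imp_DEdual[OF assms(9)]
    by meson
qed

end
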